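(* Let $k \in \mathbb{Z}_{\geq 0}$ and $G \in S_{2k+2}(\Gamma_{0}(N))$. Then the $h$-th component of $I^{\mathrm{Sh}}_{\Delta,r}(G,\tau)$ is given by \[ I^{\mathrm{Sh}}_{\Delta,r}(G,\tau)_{h} = -\frac{\sqrt{N}}{\sqrt{|\Delta|}}\sum_{m > 0}\frac{1}{|\Delta|^{k/2}}\mathbf{t}_{\Delta,r}(G;-m,h)q^{m}. \]
   Context: Let $N\in\mathbb{Z}_{>0}$, $V$ the space of rational trace-zero $2\times2$ matrices with $Q(X)=N\det X$, and $L=\left\{\left(\begin{smallmatrix}b&-a/N\\c&-b\end{smallmatrix}\right):a,b,c\in\mathbb{Z}\right\}$ with dual $L'$; $\Gamma_0(N)$ acts by conjugation; $q=e^{2\pi i\tau}$. Let $\Delta$ be a fundamental discriminant, $r\in\mathbb{Z}$ with $\Delta\equiv r^2\pmod{4N}$, $\chi_\Delta$ the generalized genus character on $L'$ (for $\delta\leftrightarrow[a,b,Nc]$: $\left(\frac{\Delta}{n}\right)$ if $\Delta\mid b^2-4Nac$, $(b^2-4Nac)/\Delta$ is a square mod $4N$ and $\gcd(a,b,c,\Delta)=1$, $n$ coprime to $\Delta$ represented by some $[N_1a,b,N_2c]$ with $N_1N_2=N$; else $0$), and $\psi_{\Delta,r}:\mathbb{C}[L'/L]\to\mathbb{C}[L'/\Delta L]$ the intertwiner $\psi_{\Delta,r}(\mathfrak{e}_h)=\sum_{\delta:\pi(\delta)=rh,\ Q(\delta)/|\Delta|\equiv\mathrm{sgn}(\Delta)Q(h)}\chi_\Delta(\delta)\mathfrak{e}_\delta$.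 The twisted Shintani lift is $I^{\mathrm{Sh}}_{\Delta,r}(G,\tau)=\int_{\Gamma_0(N)\backslash\mathbb{H}}G(z)\overline{\Theta_{\Delta,r}(\tau,z,\varphi_{Sh,k})}y^{2k+2}d\mu(z)$, with $\Theta_{\Delta,r}(\tau,z,\varphi)=\sum_h\langle\psi_{\Delta,r}(\mathfrak{e}_h),\overline{\Theta_{L'/\Delta L}(\tau,z,\varphi)}\rangle\mathfrak{e}_h$, $\Theta_{L'/\Delta L}$ the theta function of the lattice $\Delta L$ with quadratic form $Q/|\Delta|$, and $\varphi_{Sh,k}(X,\tau,z)=v^{1/2}y^{-2k-2}Q_X^{k+1}(\bar z)e^{-2\pi vR(X,z)}e^{2\pi iQ(X)\tau/|\Delta|}$, where $Q_X(z)=N(x_3z^2-2x_2z-x_1)$ and $R(X,z)=\tfrac12p_z(X)^2-(X,X)$, $p_z(X)=-\frac{\sqrt N}{y}(x_3|z|^2-2x_2x-x_1)$. For $m<0$, the twisted trace is $\mathbf{t}_{\Delta,r}(G;m,h)=\sum_{X\in\Gamma_0(N)\backslash L_{|\Delta|m,rh}}\chi_\Delta(X)\mathcal{C}(G,X)$, where $L_{n,h}=\{X\in L+h:Q(X)=n\}$ and $\mathcal{C}(G,X)=\int_{c(X)}G(z)Q_X^k(z)dz$ is the cycle integral along the geodesic $c(X)=\Gamma_X\backslash\{z:z\perp X\}$, oriented so that $\mathcal{C}(G,X)=(-2\sqrt{|n|N}i)^ki\int G|_{2k+2}g(iy)y^kdy$ ($Q(X)=n$, $g^{-1}Xg=\sqrt{|n|/N}\,\mathrm{diag}(1,-1)$,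 integral over $(0,\infty)$ or over one period $(1,\varepsilon^2)$).
   Formalization: For |Δ|>1 the displayed kernel makes the formula false; here it is replaced by |Δ|^{-1/2}φ_{Sh,k}(X/√|Δ|), i.e. R becomes R/|Δ| and the kernel is multiplied by |Δ|^{-(k+2)/2}; the sum runs over m>0 with m ≡ -sgn(Δ)Q(h) mod 1. *)

theory Defs
  imports "HOL-Analysis.Analysis" "HOL-Computational_Algebra.Squarefree" "HOL-Number_Theory.Residues"
begin

section \<open>Upper half-plane, congruence subgroups and cusp forms\<close>

definition upper_half_plane :: "complex set" where
  "upper_half_plane = {z. Im z > 0}"

definition mat2 :: "real \<Rightarrow> real \<Rightarrow> real \<Rightarrow> real \<Rightarrow> real^2^2" where
  "mat2 a b c d = vector [vector [a, b], vector [c, d]]"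

definition Gamma0 :: "nat \<Rightarrow> (real^2^2) set" where
  "Gamma0 N = {mat2 (of_int a) (of_int b) (of_int c) (of_int d) | a b c d :: int.
                 a * d - b * c = 1 \<and> int N dvd c}"

definition moebius :: "real^2^2 \<Rightarrow> complex \<Rightarrow> complex" where
  "moebius g z = (of_real (g$1$1) * z + of_real (g$1$2)) / (of_real (g$2$1) * z + of_real (g$2$2))"

text \<open>Weight \<open>w\<close> slash operator; it is only applied to matrices of determinant one.\<close>
definition slash :: "nat \<Rightarrow> (complex \<Rightarrow> complex) \<Rightarrow> real^2^2 \<Rightarrow> complex \<Rightarrow> complex" where
  "slash w f g z = f (moebius g z) / (of_real (g$2$1) * z + of_real (g$2$2)) ^ w"

text \<open>
  Vanishing at the cusps: for every \<open>A\<close> in \<open>SL\<^sub>2(\<int>)\<close> (which is \<open>Gamma0 1\<close>), the function \<open>f|A\<close> has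
  an expansion in \<open>exp(2 pi i z / N)\<close> with only positive exponents. All cusp widths of
  \<open>Gamma0 N\<close> divide \<open>N\<close>.
\<close>
definition cusp_forms :: "nat \<Rightarrow> nat \<Rightarrow> (complex \<Rightarrow> complex) set" where
  "cusp_forms w N = {f. f holomorphic_on upper_half_plane \<and>
     (\<forall>A\<in>Gamma0 N. \<forall>z\<in>upper_half_plane. slash w f A z = f z) \<and>
     (\<forall>A\<in>Gamma0 1. \<exists>a :: nat \<Rightarrow> complex. a 0 = 0 \<and>
        (\<forall>z\<in>upper_half_plane.
           (\<lambda>n. a n * exp (2 * of_real pi * \<i> * of_nat n * z / of_nat N)) sums slash w f A z))}"

text \<open>
  A Borel fundamental domain for \<open>Gamma0 N\<close>, with translates overlapping in null sets only.
  The integral of a \<open>Gamma0 N\<close>-invariant function over the quotient of the upper half-plane is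
  its integral over any such set.
\<close>
definition fundamental_domain :: "nat \<Rightarrow> complex set \<Rightarrow> bool" where
  "fundamental_domain N F \<longleftrightarrow> F \<in> sets borel \<and> F \<subseteq> upper_half_plane \<and>
     (\<forall>z\<in>upper_half_plane. \<exists>A\<in>Gamma0 N. moebius A z \<in> F) \<and>
     (\<forall>A\<in>Gamma0 N. A \<noteq> mat 1 \<longrightarrow> A \<noteq> - mat 1 \<longrightarrow> {z\<in>F. moebius A z \<in> F} \<in> null_sets lborel)"


section \<open>The quadratic space and its lattices\<close>

definition rat_space :: "(real^2^2) set" where
  "rat_space = {X. trace X = 0 \<and> (\<forall>i j. X$i$j \<in> \<rat>)}"

definition qform :: "nat \<Rightarrow> real^2^2 \<Rightarrow> real" where
  "qform N X = real N * det X"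

definition bform :: "nat \<Rightarrow> real^2^2 \<Rightarrow> real^2^2 \<Rightarrow> real" where
  "bform N X Y = qform N (X + Y) - qform N X - qform N Y"

definition lattice :: "nat \<Rightarrow> (real^2^2) set" where
  "lattice N = {mat2 (of_int b) (- of_int a / of_nat N) (of_int c) (- of_int b) | a b c :: int. True}"

definition dual_lattice :: "nat \<Rightarrow> (real^2^2) set" where
  "dual_lattice N = {X \<in> rat_space. \<forall>Y\<in>lattice N. bform N X Y \<in> \<int>}"

definition conj_act :: "real^2^2 \<Rightarrow> real^2^2 \<Rightarrow> real^2^2" where
  "conj_act g X = g ** X ** matrix_inv g"

text \<open>Entries of \<open>X\<close> are \<open>x\<^sub>2 = X$1$1\<close>, \<open>x\<^sub>1 = X$1$2\<close>, \<open>x\<^sub>3 = X$2$1\<close>.\<close>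
definition Qpoly :: "nat \<Rightarrow> real^2^2 \<Rightarrow> complex \<Rightarrow> complex" where
  "Qpoly N X z = of_nat N * (of_real (X$2$1) * z^2 - 2 * of_real (X$1$1) * z - of_real (X$1$2))"

definition pfun :: "nat \<Rightarrow> complex \<Rightarrow> real^2^2 \<Rightarrow> real" where
  "pfun N z X = - (sqrt (real N) / Im z) * (X$2$1 * (cmod z)^2 - 2 * X$1$1 * Re z - X$1$2)"

definition Rfun :: "nat \<Rightarrow> real^2^2 \<Rightarrow> complex \<Rightarrow> real" where
  "Rfun N X z = (pfun N z X)^2 / 2 - bform N X X"


section \<open>Genus character\<close>

definition fundamental_discriminant :: "int \<Rightarrow> bool" where
  "fundamental_discriminant D \<longleftrightarrow>
     (D mod 4 = 1 \<and> squarefree D) \<or>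
     (\<exists>m. D = 4 * m \<and> (m mod 4 = 2 \<or> m mod 4 = 3) \<and> squarefree m)"

definition kronecker_prime :: "int \<Rightarrow> int \<Rightarrow> int" where
  "kronecker_prime a p =
     (if p = 2 then (if even a then 0 else if a mod 8 = 1 \<or> a mod 8 = 7 then 1 else -1)
      else Legendre a p)"

definition kronecker :: "int \<Rightarrow> int \<Rightarrow> int" where
  "kronecker a n =
     (if n = 0 then (if \<bar>a\<bar> = 1 then 1 else 0)
      else (if n < 0 \<and> a < 0 then -1 else 1) *
           (\<Prod>p\<in>prime_factors n. kronecker_prime a p ^ multiplicity p n))"

text \<open>
  A dual lattice vector has the entries \<open>b/2N, -a/N; c, -b/2N\<close> with \<open>a, b, c\<close> integers, which the
  floors below recover. The Kronecker symbol does not depend on the chosen \<open>n\<close>.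
\<close>
definition genus_character :: "nat \<Rightarrow> int \<Rightarrow> real^2^2 \<Rightarrow> int" where
  "genus_character N \<Delta> X =
     (let a = \<lfloor>- real N * X$1$2\<rfloor>; b = \<lfloor>2 * real N * X$1$1\<rfloor>; c = \<lfloor>X$2$1\<rfloor>;
          D = b^2 - 4 * int N * a * c
      in if \<Delta> dvd D \<and> (\<exists>s. [D div \<Delta> = s^2] (mod (4 * int N))) \<and> gcd a (gcd b (gcd c \<Delta>)) = 1
         then kronecker \<Delta> (SOME n. coprime n \<Delta> \<and>
                (\<exists>N1 N2 :: nat. N1 * N2 = N \<and>
                   (\<exists>x y. n = int N1 * a * x^2 + b * x * y + int N2 * c * y^2)))
         else 0)"


section \<open>Twisted Shintani theta function and lift\<close>

definition scaled_lattice :: "nat \<Rightarrow> int \<Rightarrow> (real^2^2) set" where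
  "scaled_lattice N \<Delta> = (\<lambda>X. real_of_int \<Delta> *\<^sub>R X) ` lattice N"

definition discriminant_group :: "nat \<Rightarrow> int \<Rightarrow> (real^2^2) set set" where
  "discriminant_group N \<Delta> = (\<lambda>X. (+) X ` scaled_lattice N \<Delta>) ` dual_lattice N"

text \<open>
  Elements of the group ring of \<open>L'/\<Delta>L\<close> are functions on the set of cosets. A class in \<open>L'/L\<close> is
  given by a representative \<open>h\<close>, and \<open>intertwiner N \<Delta> r h\<close> is the image of the basis vector of \<open>h\<close>.
\<close>
definition intertwiner :: "nat \<Rightarrow> int \<Rightarrow> int \<Rightarrow> real^2^2 \<Rightarrow> (real^2^2) set \<Rightarrow> complex" where
  "intertwiner N \<Delta> r h \<delta> =
     (let X = (SOME X. X \<in> \<delta>)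
      in if X - real_of_int r *\<^sub>R h \<in> lattice N \<and>
            qform N X / real_of_int \<bar>\<Delta>\<bar> - real_of_int (sgn \<Delta>) * qform N h \<in> \<int>
         then of_int (genus_character N \<Delta> X) else 0)"

definition group_ring_inner ::
  "nat \<Rightarrow> int \<Rightarrow> ((real^2^2) set \<Rightarrow> complex) \<Rightarrow> ((real^2^2) set \<Rightarrow> complex) \<Rightarrow> complex" where
  "group_ring_inner N \<Delta> f g = (\<Sum>\<delta>\<in>discriminant_group N \<Delta>. f \<delta> * cnj (g \<delta>))"

definition phi_Sh :: "nat \<Rightarrow> nat \<Rightarrow> real^2^2 \<Rightarrow> complex \<Rightarrow> complex \<Rightarrow> complex" where
  "phi_Sh N k X \<tau> z =
     of_real (sqrt (Im \<tau>)) / of_real (Im z) ^ (2 * k + 2) * Qpoly N X (cnj z) ^ (k + 1) *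
     of_real (exp (- 2 * pi * Im \<tau> * Rfun N X z)) *
     exp (2 * of_real pi * \<i> * of_real (qform N X) * \<tau>)"

text \<open>
  Kernel for the form \<open>Q/|\<Delta>|\<close>. The map \<open>X \<mapsto> X/\<surd>|\<Delta>|\<close> is an isometry from \<open>(V, Q/|\<Delta>|)\<close> to \<open>(V, Q)\<close>;
  it turns \<open>Q(X)\<close> and \<open>R(X,z)\<close> into \<open>Q(X)/|\<Delta>|\<close> and \<open>R(X,z)/|\<Delta>|\<close>, as modularity in \<open>\<tau>\<close> requires, and
  \<open>Q\<^sub>X\<close> into \<open>Q\<^sub>X/\<surd>|\<Delta>|\<close>. The constant \<open>1/\<surd>|\<Delta>|\<close> in front is a normalization: with it, the
  coefficients of the lift carry the factor \<open>\<surd>N/\<surd>|\<Delta>|\<close>, and without it the factor would be \<open>\<surd>N\<close>.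
  For \<open>\<Delta> = 1\<close> the kernel is \<open>phi_Sh\<close>.
\<close>
definition phi_Sh_twisted :: "nat \<Rightarrow> int \<Rightarrow> nat \<Rightarrow> real^2^2 \<Rightarrow> complex \<Rightarrow> complex \<Rightarrow> complex" where
  "phi_Sh_twisted N \<Delta> k X \<tau> z =
     of_real (1 / sqrt (real_of_int \<bar>\<Delta>\<bar>)) *
     phi_Sh N k ((1 / sqrt (real_of_int \<bar>\<Delta>\<bar>)) *\<^sub>R X) \<tau> z"

definition theta_lattice ::
  "nat \<Rightarrow> int \<Rightarrow> nat \<Rightarrow> complex \<Rightarrow> complex \<Rightarrow> (real^2^2) set \<Rightarrow> complex" where
  "theta_lattice N \<Delta> k \<tau> z \<delta> = (\<Sum>\<^sub>\<infinity>X\<in>\<delta>. phi_Sh_twisted N \<Delta> k X \<tau> z)"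

text \<open>The component at \<open>h\<close> of the twisted theta function.\<close>
definition theta_twisted ::
  "nat \<Rightarrow> int \<Rightarrow> int \<Rightarrow> nat \<Rightarrow> complex \<Rightarrow> complex \<Rightarrow> real^2^2 \<Rightarrow> complex" where
  "theta_twisted N \<Delta> r k \<tau> z h =
     group_ring_inner N \<Delta> (intertwiner N \<Delta> r h) (\<lambda>\<delta>. cnj (theta_lattice N \<Delta> k \<tau> z \<delta>))"

text \<open>
  The component at \<open>h\<close> of the twisted Shintani lift; the factor \<open>1/(Im z)\<^sup>2\<close> is the density of the
  invariant measure.
\<close>
definition Shintani_lift ::
  "nat \<Rightarrow> int \<Rightarrow> int \<Rightarrow> nat \<Rightarrow> complex set \<Rightarrow> (complex \<Rightarrow> complex) \<Rightarrow> complex \<Rightarrow> real^2^2 \<Rightarrow> complex" where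
  "Shintani_lift N \<Delta> r k F G \<tau> h =
     (LINT z:F|lborel. G z * cnj (theta_twisted N \<Delta> r k \<tau> z h) *
        of_real (Im z) ^ (2 * k + 2) * of_real (1 / (Im z)^2))"


section \<open>Cycle integrals and twisted traces\<close>

text \<open>
  For \<open>Q(X) < 0\<close>, the geodesic orthogonal to \<open>X\<close> is \<open>y \<mapsto> g(iy)\<close> for any \<open>g\<close> as follows, with the
  orientation of increasing \<open>y\<close>.
\<close>
definition diagonalizes :: "nat \<Rightarrow> real^2^2 \<Rightarrow> real^2^2 \<Rightarrow> bool" where
  "diagonalizes N X g \<longleftrightarrow> det g = 1 \<and>
     matrix_inv g ** X ** g =
       mat2 (sqrt (\<bar>qform N X\<bar> / real N)) 0 0 (- sqrt (\<bar>qform N X\<bar> / real N))"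

text \<open>
  The stabilizer of \<open>X\<close> modulo \<open>\<plusminus>1\<close> is conjugate under \<open>g\<close> to a discrete group of matrices
  \<open>diag(t, 1/t)\<close> with \<open>t > 0\<close>, acting by \<open>y \<mapsto> t\<^sup>2 y\<close>. It is trivial, or generated by
  \<open>diag(\<epsilon>, 1/\<epsilon>)\<close> for the least such \<open>\<epsilon> > 1\<close>.
\<close>
definition cycle_range :: "nat \<Rightarrow> real^2^2 \<Rightarrow> real set" where
  "cycle_range N g =
     (let E = {t. t > 1 \<and> g ** mat2 t 0 0 (1 / t) ** matrix_inv g \<in> Gamma0 N}
      in if E = {} then {0<..} else {1<..<(Inf E)^2})"

definition cycle_integral :: "nat \<Rightarrow> nat \<Rightarrow> (complex \<Rightarrow> complex) \<Rightarrow> real^2^2 \<Rightarrow> complex" where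
  "cycle_integral N k G X =
     (let g = (SOME g. diagonalizes N X g); c = (\<lambda>y. moebius g (\<i> * of_real y))
      in (LINT y:cycle_range N g|lborel.
            G (c y) * Qpoly N X (c y) ^ k * vector_derivative c (at y)))"

definition lattice_norm_set :: "nat \<Rightarrow> real \<Rightarrow> real^2^2 \<Rightarrow> (real^2^2) set" where
  "lattice_norm_set N n h = {X \<in> (+) h ` lattice N. qform N X = n}"

text \<open>
  The sum runs over the finitely many \<open>Gamma0 N\<close>-orbits; the summand does not depend on the
  representative of the orbit.
\<close>
definition twisted_trace ::
  "nat \<Rightarrow> int \<Rightarrow> int \<Rightarrow> nat \<Rightarrow> (complex \<Rightarrow> complex) \<Rightarrow> real \<Rightarrow> real^2^2 \<Rightarrow> complex" where
  "twisted_trace N \<Delta> r k G m h =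
     (\<Sum>\<^sub>\<infinity>C \<in> (\<lambda>X. (\<lambda>A. conj_act A X) ` Gamma0 N) `
               lattice_norm_set N (real_of_int \<bar>\<Delta>\<bar> * m) (real_of_int r *\<^sub>R h).
        let X = (SOME X. X \<in> C)
        in of_int (genus_character N \<Delta> X) * cycle_integral N k G X)"

end

theory Submission
  imports Defs "HOL-Complex_Analysis.Complex_Analysis" "HOL-Number_Theory.Number_Theory"
    "HOL-Probability.Distributions"
begin

text \<open>
  After dividing by a factor depending on \<open>Q(X)\<close> and \<open>\<tau>\<close> only, the summand of the theta function at \<open>X\<close>,
  multiplied by \<open>G\<close>, is a kernel in \<open>X\<close> and \<open>z\<close> that is invariant under the simultaneous action of
  \<open>\<Gamma>\<^sub>0(N)\<close>. Reduction theory and the decay of \<open>G\<close> at all cusps make the sum of the integrals absolutely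
  convergent, so the integral over the fundamental domain unfolds, orbit by orbit, to the integral of one
  kernel over the quotient of the half-plane by the stabilizer of \<open>X\<close>. If \<open>Q(X) > 0\<close>, this vanishes by the
  mean value property on hyperbolic circles around the zero of \<open>Q\<^sub>X\<close>. If \<open>Q(X) = 0\<close>, it vanishes because
  the integrals of \<open>G\<close> along the horocycles at a cusp do. If \<open>Q(X) < 0\<close>, move the geodesic to the imaginary
  axis and use the coordinates \<open>z = e\<^sup>s (t + i)\<close>: the integral of the holomorphic factor along a ray does
  not depend on \<open>t\<close>, hence is the cycle integral, and the remaining factor is a Gaussian in \<open>t\<close>.
\<close>

unbundle no Formal_Power_Series.fps_syntax

lemma mat2_nth [simp]:
  "mat2 a b c d $ 1 $ 1 = a" "mat2 a b c d $ 1 $ 2 = b"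
  "mat2 a b c d $ 2 $ 1 = c" "mat2 a b c d $ 2 $ 2 = d"
  by (simp_all add: mat2_def)

lemma mat2_eq_iff:
  fixes X Y :: "real^2^2"
  shows "X = Y \<longleftrightarrow> X$1$1 = Y$1$1 \<and> X$1$2 = Y$1$2 \<and> X$2$1 = Y$2$1 \<and> X$2$2 = Y$2$2"
  unfolding vec_eq_iff forall_2 by (rule conj_assoc)

lemma mat2_mult: "mat2 a b c d ** mat2 a' b' c' d' =
    mat2 (a * a' + b * c') (a * b' + b * d') (c * a' + d * c') (c * b' + d * d')"
  by (simp add: mat2_eq_iff matrix_matrix_mult_def sum_2)

lemma mult_nth2: 
  fixes X Y :: "real^2^2"
  shows "(X ** Y)$1$1 = X$1$1 * Y$1$1 + X$1$2 * Y$2$1"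
        "(X ** Y)$1$2 = X$1$1 * Y$1$2 + X$1$2 * Y$2$2"
        "(X ** Y)$2$1 = X$2$1 * Y$1$1 + X$2$2 * Y$2$1"
        "(X ** Y)$2$2 = X$2$1 * Y$1$2 + X$2$2 * Y$2$2"
  by (simp_all add: matrix_matrix_mult_def sum_2)

lemma det_mat2: "det (mat2 a b c d) = a * d - b * c"
  by (simp add: det_2)

lemma trace_2: "trace (X :: real^2^2) = X$1$1 + X$2$2"
  by (simp add: trace_def sum_2)

lemma mat_one_mat2: "mat 1 = mat2 1 0 0 1"
  by (simp add: mat2_eq_iff mat_def)

definition SL2 :: "(real^2^2) set" where
  "SL2 = {g. det g = 1}"

lemma SL2_det: "g \<in> SL2 \<Longrightarrow> g$1$1 * g$2$2 - g$1$2 * g$2$1 = 1"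
  by (simp add: SL2_def det_2)

lemma SL2_mat2: "mat2 a b c d \<in> SL2 \<longleftrightarrow> a * d - b * c = 1"
  by (simp add: SL2_def det_mat2)

lemma SL2_mult: "g \<in> SL2 \<Longrightarrow> h \<in> SL2 \<Longrightarrow> g ** h \<in> SL2"
  by (simp add: SL2_def det_mul)

lemma matrix_inv_eqI:
  fixes A B :: "real^'n^'n"
  assumes "A ** B = mat 1"
  shows "matrix_inv A = B"
proof -
  have BA: "B ** A = mat 1" using assms matrix_left_right_inverse by blast
  have "\<exists>A'. A ** A' = mat 1 \<and> A' ** A = mat 1" using assms BA by blast
  then have "A ** matrix_inv A = mat 1 \<and> matrix_inv A ** A = mat 1"
    unfolding matrix_inv_def by (rule someI_ex)
  then have "matrix_inv A = B ** A ** matrix_inv A" "B = B ** (A ** matrix_inv A)"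
    by (simp_all add: BA matrix_mul_assoc)
  then show ?thesis by (metis matrix_mul_assoc)
qed

lemma SL2_inv_eq: "g \<in> SL2 \<Longrightarrow> matrix_inv g = mat2 (g$2$2) (- g$1$2) (- g$2$1) (g$1$1)"
  by (rule matrix_inv_eqI) (use SL2_det[of g] in \<open>simp add: mat_one_mat2 mat2_eq_iff mult_nth2 algebra_simps\<close>)

lemma SL2_inv: "g \<in> SL2 \<Longrightarrow> matrix_inv g \<in> SL2"
  using SL2_det[of g] by (simp add: SL2_inv_eq SL2_mat2 algebra_simps)

lemma SL2_inv_right: "g \<in> SL2 \<Longrightarrow> g ** matrix_inv g = mat 1"
  using SL2_det[of g] by (simp add: SL2_inv_eq mat_one_mat2 mat2_eq_iff mult_nth2 algebra_simps)

lemma SL2_inv_left: "g \<in> SL2 \<Longrightarrow> matrix_inv g ** g = mat 1"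
  using SL2_inv_right matrix_left_right_inverse by blast

lemma SL2_inv_inv: "g \<in> SL2 \<Longrightarrow> matrix_inv (matrix_inv g) = g"
  by (rule matrix_inv_eqI) (rule SL2_inv_left)

lemma SL2_cancel_left: "g \<in> SL2 \<Longrightarrow> matrix_inv g ** (g ** h) = h" "g \<in> SL2 \<Longrightarrow> g ** (matrix_inv g ** h) = h"
  by (simp_all add: matrix_mul_assoc SL2_inv_left SL2_inv_right)

lemma SL2_cancel_right: "g \<in> SL2 \<Longrightarrow> h ** matrix_inv g ** g = h" "g \<in> SL2 \<Longrightarrow> h ** g ** matrix_inv g = h"
  by (simp_all add: matrix_mul_assoc[symmetric] SL2_inv_left SL2_inv_right)

lemma SL2_inv_mult: "g \<in> SL2 \<Longrightarrow> h \<in> SL2 \<Longrightarrow> matrix_inv (g ** h) = matrix_inv h ** matrix_inv g"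
  by (rule matrix_inv_eqI) (simp add: matrix_mul_assoc SL2_cancel_right SL2_inv_right)

lemma SL2_uminus: "g \<in> SL2 \<Longrightarrow> - g \<in> SL2"
  by (simp add: SL2_def det_2)

lemma uminus_mult2: "(- g) ** h = - (g ** h)" "g ** (- h) = - (g ** h)" for g h :: "real^2^2"
  by (simp_all add: mat2_eq_iff mult_nth2)

subsection \<open>The action on the upper half-plane\<close>

definition jac :: "real^2^2 \<Rightarrow> complex \<Rightarrow> complex" where
  "jac g z = of_real (g$2$1) * z + of_real (g$2$2)"

lemma jac_nz:
  assumes "g \<in> SL2" "Im z \<noteq> 0"
  shows "jac g z \<noteq> 0"
proof
  assume "jac g z = 0"
  then have "g$2$1 * Im z = 0" "g$2$1 * Re z + g$2$2 = 0"
    by (auto simp: jac_def complex_eq_iff)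
  then have "g$2$1 = 0" "g$2$2 = 0" using assms(2) by auto
  then show False using SL2_det[OF assms(1)] by simp
qed

lemma moebius_jac: "moebius g z = (of_real (g$1$1) * z + of_real (g$1$2)) / jac g z"
  by (simp add: moebius_def jac_def)

lemma Im_moebius:
  assumes "g \<in> SL2"
  shows "Im (moebius g z) = Im z / (cmod (jac g z))^2"
proof -
  have "g$1$1 * Im z * (g$2$1 * Re z + g$2$2) - (g$1$1 * Re z + g$1$2) * (g$2$1 * Im z) = Im z * (g$1$1 * g$2$2 - g$1$2 * g$2$1)"
    by (simp add: algebra_simps)
  then show ?thesis
    using SL2_det[OF assms]
    by (simp add: moebius_jac Im_divide cmod_power2) (simp add: jac_def)
qed

lemma moebius_uhp: "g \<in> SL2 \<Longrightarrow> Im z > 0 \<Longrightarrow> Im (moebius g z) > 0"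
  using jac_nz[of g z] by (simp add: Im_moebius)

lemma jac_mult:
  assumes "h \<in> SL2" "Im z \<noteq> 0"
  shows "jac (g ** h) z = jac g (moebius h z) * jac h z"
proof -
  note nz = jac_nz[OF assms]
  have "jac g (moebius h z) * jac h z = of_real (g$2$1) * (of_real (h$1$1) * z + of_real (h$1$2)) + of_real (g$2$2) * jac h z"
    using nz by (simp add: jac_def[of g] moebius_jac field_simps)
  then show ?thesis by (simp add: jac_def mult_nth2 algebra_simps)
qed

lemma moebius_mult:
  assumes "g \<in> SL2" "h \<in> SL2" "Im z > 0"
  shows "moebius (g ** h) z = moebius g (moebius h z)"
proof -
  have nz: "jac h z \<noteq> 0" using jac_nz assms by force
  have "moebius g (moebius h z) = ((of_real (g$1$1) * moebius h z + of_real (g$1$2)) * jac h z) / (jac g (moebius h z) * jac h z)"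
    using nz by (simp add: moebius_jac[of g])
  also have "(of_real (g$1$1) * moebius h z + of_real (g$1$2)) * jac h z =
      of_real (g$1$1) * (of_real (h$1$1) * z + of_real (h$1$2)) + of_real (g$1$2) * jac h z"
    using nz by (simp add: moebius_jac field_simps)
  also have "\<dots> = of_real ((g ** h)$1$1) * z + of_real ((g ** h)$1$2)"
    by (simp add: mult_nth2 jac_def algebra_simps)
  also have "jac g (moebius h z) * jac h z = jac (g ** h) z" using assms by (simp add: jac_mult)
  finally show ?thesis by (simp add: moebius_jac)
qed

lemma moebius_one [simp]: "moebius (mat 1) z = z"
  by (simp add: moebius_def mat_one_mat2)

lemma moebius_uminus: "moebius (- g) z = moebius g z"
proof -
  have "moebius (- g) z = (- (of_real (g$1$1) * z + of_real (g$1$2))) / (- (of_real (g$2$1) * z + of_real (g$2$2)))"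
    by (simp add: moebius_def)
  then show ?thesis unfolding moebius_def by (simp only: minus_divide_divide)
qed

lemma moebius_inv: "g \<in> SL2 \<Longrightarrow> Im z > 0 \<Longrightarrow> moebius (matrix_inv g) (moebius g z) = z"
  by (simp add: moebius_mult[symmetric] SL2_inv SL2_inv_left)

lemma moebius_inv': "g \<in> SL2 \<Longrightarrow> Im z > 0 \<Longrightarrow> moebius g (moebius (matrix_inv g) z) = z"
  by (simp add: moebius_mult[symmetric] SL2_inv SL2_inv_right)

lemma moebius_measurable [measurable]: "moebius g \<in> borel_measurable borel"
  unfolding moebius_def by measurable

lemma slash_jac: "slash w f g z = f (moebius g z) / jac g z ^ w"
  by (simp add: slash_def jac_def)

lemma slash_mult:
  assumes "g \<in> SL2" "h \<in> SL2" "Im z > 0"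
  shows "slash w f (g ** h) z = slash w (slash w f g) h z"
  using assms by (simp add: slash_jac moebius_mult jac_mult power_mult_distrib)

lemma moebius_holo: "g \<in> SL2 \<Longrightarrow> moebius g holomorphic_on upper_half_plane"
  unfolding moebius_jac[abs_def] jac_def
  using jac_nz[of g] by (intro holomorphic_intros) (force simp: upper_half_plane_def jac_def)

lemma slash_holo:
  assumes "g \<in> SL2" "f holomorphic_on upper_half_plane"
  shows "slash w f g holomorphic_on upper_half_plane"
proof -
  have "(f \<circ> moebius g) holomorphic_on upper_half_plane"
    using assms moebius_uhp by (intro holomorphic_on_compose_gen[OF moebius_holo assms(2)]) (auto simp: upper_half_plane_def)
  moreover have "jac g holomorphic_on upper_half_plane"
    unfolding jac_def[abs_def] by (intro holomorphic_intros)
  ultimately show ?thesis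
    unfolding slash_jac[abs_def] using jac_nz[OF assms(1)]
    by (intro holomorphic_intros) (force simp: upper_half_plane_def o_def)+
qed

subsection \<open>Congruence subgroups\<close>

lemma Gamma0_SL2: "g \<in> Gamma0 N \<Longrightarrow> g \<in> SL2"
proof -
  assume "g \<in> Gamma0 N"
  then obtain a b c d :: int where "g = mat2 (of_int a) (of_int b) (of_int c) (of_int d)" "a * d - b * c = 1"
    by (auto simp: Gamma0_def)
  moreover from this(2) have "real_of_int (a * d - b * c) = 1" by simp
  ultimately show ?thesis by (simp add: SL2_mat2)
qed

lemma Gamma0_mat2: "mat2 (of_int a) (of_int b) (of_int c) (of_int d) \<in> Gamma0 N \<longleftrightarrow> a * d - b * c = 1 \<and> int N dvd c"
  unfolding Gamma0_def by (auto simp: mat2_eq_iff)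

lemma Gamma0E:
  assumes "g \<in> Gamma0 N"
  obtains a b c d :: int where "g = mat2 (of_int a) (of_int b) (of_int c) (of_int d)" "a * d - b * c = 1" "int N dvd c"
  using assms by (auto simp: Gamma0_def)

lemma Gamma0_mult: assumes "g \<in> Gamma0 N" "h \<in> Gamma0 N" shows "g ** h \<in> Gamma0 N"
proof -
  obtain a b c d :: int where g: "g = mat2 (of_int a) (of_int b) (of_int c) (of_int d)" "a * d - b * c = 1" "int N dvd c"
    using assms by (auto elim: Gamma0E)
  obtain a' b' c' d' :: int where h: "h = mat2 (of_int a') (of_int b') (of_int c') (of_int d')" "a' * d' - b' * c' = 1" "int N dvd c'"
    using assms by (auto elim: Gamma0E)
  have "g ** h = mat2 (of_int (a * a' + b * c')) (of_int (a * b' + b * d')) (of_int (c * a' + d * c')) (of_int (c * b' + d * d'))"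
    by (simp add: g h mat2_mult)
  moreover have "(a * a' + b * c') * (c * b' + d * d') - (a * b' + b * d') * (c * a' + d * c') = (a * d - b * c) * (a' * d' - b' * c')"
    by (simp add: algebra_simps)
  ultimately show ?thesis using g h by (simp only: Gamma0_mat2) simp
qed

lemma Gamma0_inv: assumes "g \<in> Gamma0 N" shows "matrix_inv g \<in> Gamma0 N"
proof -
  obtain a b c d :: int where g: "g = mat2 (of_int a) (of_int b) (of_int c) (of_int d)" "a * d - b * c = 1" "int N dvd c"
    using assms by (auto elim: Gamma0E)
  have "matrix_inv g = mat2 (of_int d) (of_int (- b)) (of_int (- c)) (of_int a)"
    using Gamma0_SL2[OF assms] by (simp add: SL2_inv_eq g)
  then show ?thesis using g by (simp only: Gamma0_mat2) (simp add: algebra_simps)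
qed

lemma Gamma0_one: "mat 1 \<in> Gamma0 N"
  using Gamma0_mat2[of 1 0 0 1 N] by (simp add: mat_one_mat2)

lemma Gamma0_uminus: assumes "g \<in> Gamma0 N" shows "- g \<in> Gamma0 N"
proof -
  obtain a b c d :: int where g: "g = mat2 (of_int a) (of_int b) (of_int c) (of_int d)" "a * d - b * c = 1" "int N dvd c"
    using assms by (auto elim: Gamma0E)
  have "- g = mat2 (of_int (- a)) (of_int (- b)) (of_int (- c)) (of_int (- d))"
    by (simp add: g mat2_eq_iff)
  then show ?thesis using g by (simp only: Gamma0_mat2) (simp add: algebra_simps)
qed

lemma Gamma0_subset_Gamma1: "Gamma0 N \<subseteq> Gamma0 1"
  by (auto simp: Gamma0_def)

lemma countable_Gamma0: "countable (Gamma0 N)"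
proof -
  have "Gamma0 N \<subseteq> (\<lambda>(a, b, c, d). mat2 (of_int a) (of_int b) (of_int c) (of_int d)) ` (UNIV :: (int \<times> int \<times> int \<times> int) set)"
    by (force simp: Gamma0_def image_iff)
  then show ?thesis by (rule countable_subset) simp
qed

subsection \<open>Conjugation and the associated quadratic polynomials\<close>

definition traceless :: "(real^2^2) set" where
  "traceless = {X. X$2$2 = - X$1$1}"

lemma traceless_mat2: "mat2 a b c d \<in> traceless \<longleftrightarrow> d = - a"
  by (simp add: traceless_def)

lemma conj_act_mat2:
  assumes "g \<in> SL2" "X \<in> traceless"
  shows "conj_act g X = mat2
     ((g$1$1 * g$2$2 + g$1$2 * g$2$1) * X$1$1 - g$1$1 * g$2$1 * X$1$2 + g$1$2 * g$2$2 * X$2$1)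
     (- 2 * g$1$1 * g$1$2 * X$1$1 + (g$1$1)^2 * X$1$2 - (g$1$2)^2 * X$2$1)
     (2 * g$2$1 * g$2$2 * X$1$1 - (g$2$1)^2 * X$1$2 + (g$2$2)^2 * X$2$1)
     (- ((g$1$1 * g$2$2 + g$1$2 * g$2$1) * X$1$1 - g$1$1 * g$2$1 * X$1$2 + g$1$2 * g$2$2 * X$2$1))"
  using assms unfolding traceless_def
  by (simp add: conj_act_def SL2_inv_eq mat2_eq_iff mult_nth2 power2_eq_square algebra_simps)

lemma conj_act_traceless: "g \<in> SL2 \<Longrightarrow> X \<in> traceless \<Longrightarrow> conj_act g X \<in> traceless"
  by (simp add: conj_act_mat2 traceless_mat2)

lemma conj_act_mult: "g \<in> SL2 \<Longrightarrow> h \<in> SL2 \<Longrightarrow> conj_act (g ** h) X = conj_act g (conj_act h X)"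
  by (simp add: conj_act_def SL2_inv_mult matrix_mul_assoc)

lemma conj_act_one [simp]: "conj_act (mat 1) X = X"
  using matrix_inv_eqI[of "mat 1 :: real^2^2" "mat 1"] by (simp add: conj_act_def)

lemma conj_act_inv: "g \<in> SL2 \<Longrightarrow> conj_act (matrix_inv g) (conj_act g X) = X" 
  by (simp add: conj_act_mult[symmetric] SL2_inv SL2_inv_left)

lemma conj_act_inv': "g \<in> SL2 \<Longrightarrow> conj_act g (conj_act (matrix_inv g) X) = X" 
  by (simp add: conj_act_mult[symmetric] SL2_inv SL2_inv_right)

lemma conj_act_uminus: "g \<in> SL2 \<Longrightarrow> conj_act (- g) X = conj_act g X"
  by (simp add: conj_act_def SL2_inv_eq SL2_uminus mat2_eq_iff mult_nth2 algebra_simps)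

lemma conj_act_eq_iff: "g \<in> SL2 \<Longrightarrow> conj_act g X = X \<longleftrightarrow> g ** X = X ** g"
  unfolding conj_act_def using SL2_cancel_right(1)[of g "g ** X"] SL2_cancel_right(2)[of g X] by auto

lemma qform_conj: "g \<in> SL2 \<Longrightarrow> qform N (conj_act g X) = qform N X"
  using SL2_inv[of g] by (simp add: qform_def conj_act_def det_mul SL2_def)

definition bil :: "real^2^2 \<Rightarrow> complex \<Rightarrow> complex \<Rightarrow> complex" where
  "bil X z w = of_real (X$2$1) * z * w - of_real (X$1$1) * (z + w) - of_real (X$1$2)"

lemma bil_conj:
  assumes g: "g \<in> SL2" and X: "X \<in> traceless" and nz: "jac g z \<noteq> 0" "jac g w \<noteq> 0"
  shows "bil (conj_act g X) (moebius g z) (moebius g w) * (jac g z * jac g w) = bil X z w"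
proof -
  define u v where "u = of_real (g$1$1) * z + of_real (g$1$2)" and "v = of_real (g$1$1) * w + of_real (g$1$2)"
  define a b c d where "a = complex_of_real (g$1$1)" and "b = complex_of_real (g$1$2)"
     and "c = complex_of_real (g$2$1)" and "d = complex_of_real (g$2$2)"
  define x1 x2 x3 where "x1 = complex_of_real (X$1$2)" and "x2 = complex_of_real (X$1$1)" and "x3 = complex_of_real (X$2$1)"
  define p q where "p = jac g z" and "q = jac g w"
  have det: "a * d - b * c = 1" using SL2_det[OF g]
    unfolding a_def b_def c_def d_def by (metis of_real_1 of_real_diff of_real_mult)
  have id: "d * (a * z + b) - b * (c * z + d) = (a * d - b * c) * z" "a * (c * z + d) - c * (a * z + b) = a * d - b * c" for z
    by (simp_all add: algebra_simps)
  have r: "d * u - b * p = z" "d * v - b * q = w" "a * p - c * u = 1" "a * q - c * v = 1"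
    using id[of z] id[of w] unfolding det u_def v_def p_def q_def jac_def a_def[symmetric] b_def[symmetric] c_def[symmetric] d_def[symmetric]
    by simp_all
  let ?Y = "conj_act g X"
  have m: "moebius g z = u / p" "moebius g w = v / q" by (simp_all add: moebius_jac u_def v_def p_def q_def)
  have nz': "p \<noteq> 0" "q \<noteq> 0" using nz by (simp_all add: p_def q_def)
  have "bil ?Y (moebius g z) (moebius g w) * (p * q) =
     of_real (?Y$2$1) * u * v - of_real (?Y$1$1) * (u * q + v * p) - of_real (?Y$1$2) * (p * q)"
    using nz' unfolding bil_def m by (simp add: field_simps)
  also have "\<dots> = (2*c*d*x2 - c^2*x1 + d^2*x3) * u * v - ((a*d+b*c)*x2 - a*c*x1 + b*d*x3) * (u * q + v * p)
      - (-2*a*b*x2 + a^2*x1 - b^2*x3) * (p * q)"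
    unfolding conj_act_mat2[OF g X] mat2_nth
    unfolding of_real_add of_real_diff of_real_mult of_real_power of_real_minus of_real_numeral
    unfolding a_def[symmetric] b_def[symmetric] c_def[symmetric] d_def[symmetric]
      x1_def[symmetric] x2_def[symmetric] x3_def[symmetric] by (rule refl)
  also have "\<dots> = x3 * ((d * u - b * p) * (d * v - b * q))
      - x2 * ((d * u - b * p) * (a * q - c * v) + (d * v - b * q) * (a * p - c * u)) - x1 * ((a * p - c * u) * (a * q - c * v))"
    by (simp add: algebra_simps power2_eq_square)
  also have "\<dots> = bil X z w"
    unfolding r by (simp add: bil_def x1_def x2_def x3_def algebra_simps)
  finally show ?thesis by (simp add: p_def q_def)
qed

lemma Qpoly_bil: "Qpoly N X z = of_nat N * bil X z z"
  by (simp add: Qpoly_def bil_def power2_eq_square algebra_simps)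

lemma pfun_bil: "pfun N z X = - (sqrt (real N) / Im z) * Re (bil X z (cnj z))" "Im (bil X z (cnj z)) = 0"
proof -
  have "(cmod z)^2 = Re z * Re z + Im z * Im z" unfolding cmod_power2 by (simp add: power2_eq_square)
  then show "pfun N z X = - (sqrt (real N) / Im z) * Re (bil X z (cnj z))"
    unfolding pfun_def by (simp add: bil_def algebra_simps)
qed (simp add: bil_def algebra_simps)

lemma Qpoly_conj:
  assumes "g \<in> SL2" "X \<in> traceless" "Im z > 0"
  shows "Qpoly N (conj_act g X) (moebius g z) * jac g z ^ 2 = Qpoly N X z"
  using bil_conj[OF assms(1,2), of z z] jac_nz[OF assms(1), of z] assms(3)
  by (simp add: Qpoly_bil power2_eq_square)

lemma jac_cnj: "jac g (cnj z) = cnj (jac g z)"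
  by (simp add: jac_def)

lemma moebius_cnj: "moebius g (cnj z) = cnj (moebius g z)"
  by (simp add: moebius_def)

lemma pfun_conj:
  assumes "g \<in> SL2" "X \<in> traceless" "Im z > 0"
  shows "pfun N (moebius g z) (conj_act g X) = pfun N z X"
proof -
  have nz: "jac g z \<noteq> 0" using jac_nz[OF assms(1), of z] assms(3) by simp
  have "bil (conj_act g X) (moebius g z) (cnj (moebius g z)) * (jac g z * cnj (jac g z)) = bil X z (cnj z)"
    using bil_conj[OF assms(1,2), of z "cnj z"] nz by (simp add: jac_cnj moebius_cnj)
  then have "bil (conj_act g X) (moebius g z) (cnj (moebius g z)) * of_real ((cmod (jac g z))^2) = bil X z (cnj z)"
    by (simp only: complex_norm_square)
  moreover have Re_mult_of_real: "Re (w * of_real r) = Re w * r" for w r by simp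
  ultimately have "Re (bil X z (cnj z)) = Re (bil (conj_act g X) (moebius g z) (cnj (moebius g z))) * (cmod (jac g z))^2"
    by (metis Re_mult_of_real)
  then show ?thesis using nz assms(3) by (simp add: pfun_bil Im_moebius[OF assms(1)])
qed

lemma Qpoly_uhp_measurable [measurable]: "Qpoly N X \<in> borel_measurable borel"
  unfolding Qpoly_def by measurable

lemma pfun_measurable [measurable]: "(\<lambda>z. pfun N z X) \<in> borel_measurable borel"
  unfolding pfun_def by measurable

subsection \<open>The invariant measure\<close>

definition hmeas :: "complex measure" where
  "hmeas = density lborel (\<lambda>z. ennreal (indicator upper_half_plane z / (Im z)\<^sup>2))"

definition hpt :: "real \<Rightarrow> real \<Rightarrow> complex" where
  "hpt s t = Complex (exp s * t) (exp s)"

lemma uhp_borel [measurable]: "upper_half_plane \<in> sets borel"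
proof -
  have "open upper_half_plane" unfolding upper_half_plane_def by (rule open_halfspace_Im_gt)
  then show ?thesis by simp
qed

lemma Complex_measurable [measurable]:
  assumes [measurable]: "f \<in> borel_measurable M" "g \<in> borel_measurable M"
  shows "(\<lambda>x. Complex (f x) (g x)) \<in> borel_measurable M"
  unfolding Complex_eq by measurable

lemma hpt_measurable [measurable]:
  assumes [measurable]: "f \<in> borel_measurable M" "g \<in> borel_measurable M"
  shows "(\<lambda>x. hpt (f x) (g x)) \<in> borel_measurable M"
  unfolding hpt_def by measurable

lemma sets_hmeas [simp, measurable_cong]: "sets hmeas = sets borel"
  by (simp add: hmeas_def)

lemma space_hmeas [simp]: "space hmeas = UNIV"
  by (simp add: hmeas_def)

lemma hmeas_dens_measurable [measurable]:
  "(\<lambda>z. indicator upper_half_plane z / (Im z)\<^sup>2) \<in> borel_measurable (borel :: complex measure)"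
  by measurable

lemma AE_hmeas: "AE z in hmeas. Im z > 0"
  unfolding hmeas_def by (subst AE_density) (auto simp: indicator_def upper_half_plane_def)

lemma sigma_finite_hmeas: "sigma_finite_measure hmeas"
  unfolding hmeas_def by (subst sigma_finite_measure.sigma_finite_iff_density_finite[OF sigma_finite_lborel]) auto

lemma lborel_complex: "(lborel :: complex measure) = distr (lborel \<Otimes>\<^sub>M lborel) borel (\<lambda>(y, x). Complex x y)"
proof (rule lborel_eqI)
  fix l u :: complex
  assume lu: "\<And>b. b \<in> Basis \<Longrightarrow> l \<bullet> b \<le> u \<bullet> b"
  have 1: "Re l \<le> Re u" "Im l \<le> Im u" using lu[of 1] lu[of \<i>] by (auto simp: Basis_complex_def)
  have "(\<lambda>(y, x). Complex x y) -` box l u = {Im l<..<Im u} \<times> {Re l<..<Re u}"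
    by (auto simp: in_box_complex_iff)
  then have "emeasure (distr (lborel \<Otimes>\<^sub>M lborel) borel (\<lambda>(y, x). Complex x y)) (box l u) =
     emeasure (lborel \<Otimes>\<^sub>M lborel) ({Im l<..<Im u} \<times> {Re l<..<Re u})"
    by (subst emeasure_distr) (auto simp: space_pair_measure)
  also have "\<dots> = ennreal ((Im u - Im l) * (Re u - Re l))"
    using 1 by (subst lborel.emeasure_pair_measure_Times) (auto simp: ennreal_mult)
  also have "(Im u - Im l) * (Re u - Re l) = (\<Prod>b\<in>Basis. (u - l) \<bullet> b)"
    by (simp add: Basis_complex_def)
  finally show "emeasure (distr (lborel \<Otimes>\<^sub>M lborel) borel (\<lambda>(y, x). Complex x y)) (box l u) =
     ennreal (\<Prod>b\<in>Basis. (u - l) \<bullet> b)" .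
qed simp

lemma nn_integral_complex:
  fixes f :: "complex \<Rightarrow> ennreal"
  assumes [measurable]: "f \<in> borel_measurable borel"
  shows "(\<integral>\<^sup>+z. f z \<partial>lborel) = (\<integral>\<^sup>+y. \<integral>\<^sup>+x. f (Complex x y) \<partial>lborel \<partial>lborel)"
proof -
  have "(\<integral>\<^sup>+z. f z \<partial>lborel) = (\<integral>\<^sup>+p. f (case p of (y, x) \<Rightarrow> Complex x y) \<partial>(lborel \<Otimes>\<^sub>M lborel))"
    by (subst lborel_complex, subst nn_integral_distr) (auto simp: )
  also have "\<dots> = (\<integral>\<^sup>+y. \<integral>\<^sup>+x. f (Complex x y) \<partial>lborel \<partial>lborel)"
    by (subst lborel.nn_integral_fst[symmetric]) auto
  finally show ?thesis .
qed

lemma emeasure_exp_subst: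
  fixes A :: "real set"
  assumes [measurable]: "A \<in> sets borel"
  shows "emeasure lborel (A \<inter> {0<..}) = (\<integral>\<^sup>+s. ennreal (exp s) * indicator A (exp s) \<partial>lborel)"
proof -
  let ?D = "density lborel (\<lambda>s. ennreal (exp s) * indicator A (exp s))"
  have 1: "emeasure lborel (A \<inter> {exp (- real n)..exp (real n)}) = emeasure ?D {- real n..real n}" for n
  proof -
    have "(\<integral>\<^sup>+ x. ennreal (indicator A x * indicator {exp (- real n)..exp (real n)} x) \<partial>lborel) =
          (\<integral>\<^sup>+ x. ennreal (indicator A (exp x) * exp x * indicator {- real n..real n} x) \<partial>lborel)"
      by (rule nn_integral_substitution)
        (auto intro!: derivative_eq_intros continuous_intros simp: set_borel_measurable_def)
    also have "(\<integral>\<^sup>+ x. ennreal (indicator A x * indicator {exp (- real n)..exp (real n)} x) \<partial>lborel) =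
        (\<integral>\<^sup>+ x. indicator (A \<inter> {exp (- real n)..exp (real n)}) x \<partial>lborel)"
      by (intro nn_integral_cong) (auto simp: indicator_def)
    also have "(\<integral>\<^sup>+ x. ennreal (indicator A (exp x) * exp x * indicator {- real n..real n} x) \<partial>lborel) = emeasure ?D {- real n..real n}"
      by (subst emeasure_density) (auto intro!: nn_integral_cong simp: indicator_def)
    finally show ?thesis by simp
  qed
  have "(SUP n. emeasure lborel (A \<inter> {exp (- real n)..exp (real n)})) = emeasure lborel (\<Union>n. A \<inter> {exp (- real n)..exp (real n)})"
  proof (rule SUP_emeasure_incseq)
    have "A \<inter> {exp (- real m)..exp (real m)} \<subseteq> A \<inter> {exp (- real n)..exp (real n)}" if "m \<le> n" for m n
      using that by (intro Int_mono order_refl atLeastatMost_subset_iff[THEN iffD2]) simp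
    then show "incseq (\<lambda>n. A \<inter> {exp (- real n)..exp (real n)})" unfolding incseq_def by blast
  qed (simp add: image_subset_iff)
  also have "(\<Union>n. A \<inter> {exp (- real n)..exp (real n)}) = A \<inter> {0<..}"
  proof safe
    fix x :: real assume x: "x \<in> A" "x > 0"
    obtain n :: nat where "real n \<ge> \<bar>ln x\<bar>" using real_arch_simple by blast
    then have "exp (- real n) \<le> exp (ln x)" "exp (ln x) \<le> exp (real n)" by (auto simp del: exp_ln)
    then show "x \<in> (\<Union>n. A \<inter> {exp (- real n)..exp (real n)})" using x by auto
  qed (auto intro: less_le_trans[OF exp_gt_zero])
  finally have 2: "(SUP n. emeasure lborel (A \<inter> {exp (- real n)..exp (real n)})) = emeasure lborel (A \<inter> {0<..})" .
  have "(SUP n. emeasure ?D {- real n..real n}) = emeasure ?D (\<Union>n. {- real n..real n})"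
    by (rule SUP_emeasure_incseq) (auto simp: incseq_def)
  also have "(\<Union>n. {- real n..real n}) = UNIV"
  proof safe
    fix x :: real
    obtain n :: nat where "real n \<ge> \<bar>x\<bar>" using real_arch_simple by blast
    then have "x \<in> {- real n..real n}" by auto
    then show "x \<in> (\<Union>n. {- real n..real n})" by blast
  qed auto
  finally have 3: "(SUP n. emeasure ?D {- real n..real n}) = (\<integral>\<^sup>+s. ennreal (exp s) * indicator A (exp s) \<partial>lborel)"
    by (simp add: emeasure_density)
  show ?thesis using 1 2 3 by simp
qed

lemma density_exp_distr:
  "density lborel (indicator {0<..}) = distr (density lborel (\<lambda>s. ennreal (exp s))) borel (exp :: real \<Rightarrow> real)"
proof (rule measure_eqI)
  fix A :: "real set" assume "A \<in> sets (density lborel (indicator {0<..}))"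
  then have [measurable]: "A \<in> sets borel" by simp
  have "emeasure (density lborel (indicator {0<..})) A = emeasure lborel (A \<inter> {0<..})"
    by (simp add: emeasure_density Int_commute mult.commute flip: indicator_inter_arith)
  also have "\<dots> = emeasure (distr (density lborel (\<lambda>s. ennreal (exp s))) borel exp) A"
  proof -
    have "exp -` A \<in> sets borel" using measurable_sets[of exp borel borel A] by simp
    then have "emeasure (density lborel (\<lambda>s. ennreal (exp s))) (exp -` A) = (\<integral>\<^sup>+s. ennreal (exp s) * indicator A (exp s) \<partial>lborel)"
      by (simp add: emeasure_density indicator_vimage)
    then show ?thesis by (simp add: emeasure_exp_subst emeasure_distr)
  qed
  finally show "emeasure (density lborel (indicator {0<..})) A = emeasure (distr (density lborel (\<lambda>s. ennreal (exp s))) borel exp) A" .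
qed simp

lemma nn_integral_exp_subst:
  fixes f :: "real \<Rightarrow> ennreal"
  assumes [measurable]: "f \<in> borel_measurable borel"
  shows "(\<integral>\<^sup>+y. f y * indicator {0<..} y \<partial>lborel) = (\<integral>\<^sup>+s. ennreal (exp s) * f (exp s) \<partial>lborel)"
proof -
  have "(\<integral>\<^sup>+y. f y * indicator {0<..} y \<partial>lborel) = (\<integral>\<^sup>+y. f y \<partial>density lborel (indicator {0<..}))"
    by (subst nn_integral_density) (auto simp: mult.commute)
  also have "\<dots> = (\<integral>\<^sup>+s. ennreal (exp s) * f (exp s) \<partial>lborel)"
    unfolding density_exp_distr by (subst nn_integral_distr) (auto simp: nn_integral_density)
  finally show ?thesis .
qed

lemma nn_integral_hmeas:
  fixes f :: "complex \<Rightarrow> ennreal"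
  assumes [measurable]: "f \<in> borel_measurable borel"
  shows "(\<integral>\<^sup>+z. f z \<partial>hmeas) = (\<integral>\<^sup>+s. \<integral>\<^sup>+t. f (hpt s t) \<partial>lborel \<partial>lborel)"
proof -
  define g where "g y = (\<integral>\<^sup>+t. f (Complex (y * t) y) \<partial>lborel)" for y
  have [measurable]: "g \<in> borel_measurable borel" unfolding g_def by measurable
  have "(\<integral>\<^sup>+z. f z \<partial>hmeas) = (\<integral>\<^sup>+z. ennreal (indicator upper_half_plane z / (Im z)\<^sup>2) * f z \<partial>lborel)"
    unfolding hmeas_def by (rule nn_integral_density) auto
  also have "\<dots> = (\<integral>\<^sup>+y. \<integral>\<^sup>+x. ennreal (indicator upper_half_plane (Complex x y) / y\<^sup>2) * f (Complex x y) \<partial>lborel \<partial>lborel)"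
    by (subst nn_integral_complex) auto
  also have "\<dots> = (\<integral>\<^sup>+y. ennreal (1 / y) * g y * indicator {0<..} y \<partial>lborel)"
  proof (rule nn_integral_cong)
    fix y :: real
    show "(\<integral>\<^sup>+x. ennreal (indicator upper_half_plane (Complex x y) / y\<^sup>2) * f (Complex x y) \<partial>lborel) = ennreal (1 / y) * g y * indicator {0<..} y"
    proof (cases "y > 0")
      case True
      have "(\<integral>\<^sup>+x. ennreal (indicator upper_half_plane (Complex x y) / y\<^sup>2) * f (Complex x y) \<partial>lborel) =
        (\<integral>\<^sup>+x. ennreal (1 / y\<^sup>2) * f (Complex x y) \<partial>lborel)"
        using True by (simp add: upper_half_plane_def)
      also have "\<dots> = ennreal (1 / y\<^sup>2) * (\<integral>\<^sup>+x. f (Complex x y) \<partial>lborel)"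
        by (rule nn_integral_cmult) auto
      also have "(\<integral>\<^sup>+x. f (Complex x y) \<partial>lborel) = ennreal y * g y"
        using True by (subst nn_integral_real_affine[where c=y and t=0]) (auto simp: g_def)
      also have "ennreal (1 / y\<^sup>2) * (ennreal y * g y) = ennreal (1 / y) * g y"
        using True by (simp add: mult.assoc[symmetric] ennreal_mult[symmetric] power2_eq_square)
      finally show ?thesis using True by simp
    qed (auto simp: upper_half_plane_def)
  qed
  also have "\<dots> = (\<integral>\<^sup>+s. ennreal (exp s) * (ennreal (1 / exp s) * g (exp s)) \<partial>lborel)"
    by (rule nn_integral_exp_subst) measurable
  also have "\<dots> = (\<integral>\<^sup>+s. g (exp s) \<partial>lborel)"
    by (simp add: mult.assoc[symmetric] ennreal_mult[symmetric])
  finally show ?thesis by (simp add: g_def hpt_def)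
qed

lemma hmeas_distr: "hmeas = distr (lborel \<Otimes>\<^sub>M lborel) borel (\<lambda>(s, t). hpt s t)"
proof (rule measure_eqI)
  fix A assume "A \<in> sets hmeas"
  then have [measurable]: "A \<in> sets borel" by simp
  have "emeasure hmeas A = (\<integral>\<^sup>+z. indicator A z \<partial>hmeas)" by simp
  also have "\<dots> = (\<integral>\<^sup>+s. \<integral>\<^sup>+t. indicator A (hpt s t) \<partial>lborel \<partial>lborel)"
    by (rule nn_integral_hmeas) auto
  also have "\<dots> = (\<integral>\<^sup>+p. indicator A (case p of (s, t) \<Rightarrow> hpt s t) \<partial>(lborel \<Otimes>\<^sub>M lborel))"
    by (subst lborel.nn_integral_fst[symmetric]) auto
  also have "\<dots> = (\<integral>\<^sup>+z. indicator A z \<partial>distr (lborel \<Otimes>\<^sub>M lborel) borel (\<lambda>(s, t). hpt s t))"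
    by (subst nn_integral_distr) auto
  finally show "emeasure hmeas A = emeasure (distr (lborel \<Otimes>\<^sub>M lborel) borel (\<lambda>(s, t). hpt s t)) A" by simp
qed simp

lemma nn_integral_hmeas_swap:
  fixes f :: "complex \<Rightarrow> ennreal"
  assumes [measurable]: "f \<in> borel_measurable borel"
  shows "(\<integral>\<^sup>+z. f z \<partial>hmeas) = (\<integral>\<^sup>+t. \<integral>\<^sup>+s. f (hpt s t) \<partial>lborel \<partial>lborel)"
  unfolding nn_integral_hmeas[OF assms] by (rule lborel_pair.Fubini') simp

lemma hmeas_translate:
  fixes f :: "complex \<Rightarrow> ennreal"
  assumes [measurable]: "f \<in> borel_measurable borel"
  shows "(\<integral>\<^sup>+z. f (z + of_real b) \<partial>hmeas) = (\<integral>\<^sup>+z. f z \<partial>hmeas)"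
proof -
  have "(\<integral>\<^sup>+t. f (hpt s t + of_real b) \<partial>lborel) = (\<integral>\<^sup>+t. f (hpt s t) \<partial>lborel)" for s
  proof -
    have "hpt s t + of_real b = hpt s (b / exp s + 1 * t)" for t
      by (simp add: hpt_def complex_eq_iff algebra_simps)
    then show ?thesis
      using nn_integral_real_affine[of "\<lambda>t. f (hpt s t)" 1 "b / exp s"] by simp
  qed
  then show ?thesis by (simp add: nn_integral_hmeas)
qed

lemma hmeas_scale:
  fixes f :: "complex \<Rightarrow> ennreal"
  assumes [measurable]: "f \<in> borel_measurable borel" and "a > 0"
  shows "(\<integral>\<^sup>+z. f (of_real a * z) \<partial>hmeas) = (\<integral>\<^sup>+z. f z \<partial>hmeas)"
proof -
  have "of_real a * hpt s t = hpt (ln a + 1 * s) t" for s t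
    using \<open>a > 0\<close> by (simp add: hpt_def complex_eq_iff exp_add)
  then have "(\<integral>\<^sup>+z. f (of_real a * z) \<partial>hmeas) = (\<integral>\<^sup>+s. \<integral>\<^sup>+t. f (hpt (ln a + 1 * s) t) \<partial>lborel \<partial>lborel)"
    by (simp add: nn_integral_hmeas)
  also have "\<dots> = (\<integral>\<^sup>+s. \<integral>\<^sup>+t. f (hpt s t) \<partial>lborel \<partial>lborel)"
    using nn_integral_real_affine[of "\<lambda>s. \<integral>\<^sup>+t. f (hpt s t) \<partial>lborel" 1 "ln a"] by simp
  finally show ?thesis by (simp add: nn_integral_hmeas)
qed

lemma hmeas_invert:
  fixes f :: "complex \<Rightarrow> ennreal"
  assumes [measurable]: "f \<in> borel_measurable borel"
  shows "(\<integral>\<^sup>+z. f (- 1 / z) \<partial>hmeas) = (\<integral>\<^sup>+z. f z \<partial>hmeas)"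
proof -
  have "- 1 / hpt s t = hpt (- ln (1 + t\<^sup>2) + (- 1) * s) (- t)" for s t
  proof -
    have p: "1 + t\<^sup>2 > 0" by (simp add: add_pos_nonneg)
    have "hpt s t \<noteq> 0" by (simp add: hpt_def complex_eq_iff)
    moreover have "hpt (- ln (1 + t\<^sup>2) + (- 1) * s) (- t) * hpt s t = - 1"
    proof -
      have e: "exp (- ln (1 + t\<^sup>2) + (- 1) * s) * exp s = 1 / (1 + t\<^sup>2)"
        using p by (simp add: exp_minus field_simps flip: exp_add)
      have "hpt (- ln (1 + t\<^sup>2) + (- 1) * s) (- t) * hpt s t = of_real (exp (- ln (1 + t\<^sup>2) + (- 1) * s) * exp s) * of_real (- (1 + t\<^sup>2))"
        by (simp add: hpt_def complex_eq_iff power2_eq_square algebra_simps)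
      also have "\<dots> = of_real (1 / (1 + t\<^sup>2) * (- (1 + t\<^sup>2)))" unfolding e by (simp only: of_real_mult)
      also have "1 / (1 + t\<^sup>2) * (- (1 + t\<^sup>2)) = - 1" using p by (simp add: field_simps)
      finally show ?thesis by simp
    qed
    ultimately show ?thesis by (simp add: field_simps)
  qed
  then have "(\<integral>\<^sup>+z. f (- 1 / z) \<partial>hmeas) = (\<integral>\<^sup>+t. \<integral>\<^sup>+s. f (hpt (- ln (1 + t\<^sup>2) + (- 1) * s) (- t)) \<partial>lborel \<partial>lborel)"
    by (simp add: nn_integral_hmeas_swap)
  also have "\<dots> = (\<integral>\<^sup>+t. \<integral>\<^sup>+s. f (hpt s (0 + (- 1) * t)) \<partial>lborel \<partial>lborel)"
  proof (rule nn_integral_cong)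
    fix t :: real
    show "(\<integral>\<^sup>+s. f (hpt (- ln (1 + t\<^sup>2) + (- 1) * s) (- t)) \<partial>lborel) = (\<integral>\<^sup>+s. f (hpt s (0 + (- 1) * t)) \<partial>lborel)"
      using nn_integral_real_affine[of "\<lambda>s. f (hpt s (- t))" "- 1" "- ln (1 + t\<^sup>2)"] by simp
  qed
  also have "\<dots> = (\<integral>\<^sup>+t. \<integral>\<^sup>+s. f (hpt s t) \<partial>lborel \<partial>lborel)"
    using nn_integral_real_affine[of "\<lambda>t. \<integral>\<^sup>+s. f (hpt s t) \<partial>lborel" "- 1" 0] by simp
  finally show ?thesis by (simp add: nn_integral_hmeas_swap)
qed

lemma nn_integral_hmeas_moebius:
  fixes f :: "complex \<Rightarrow> ennreal"
  assumes g: "g \<in> SL2" and [measurable]: "f \<in> borel_measurable borel"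
  shows "(\<integral>\<^sup>+z. f (moebius g z) \<partial>hmeas) = (\<integral>\<^sup>+z. f z \<partial>hmeas)"
proof -
  define a b c d where "a = g$1$1" and "b = g$1$2" and "c = g$2$1" and "d = g$2$2"
  have det: "a * d - b * c = 1" using SL2_det[OF g] by (simp add: a_def b_def c_def d_def)
  have mo: "moebius g z = (of_real a * z + of_real b) / (of_real c * z + of_real d)" for z
    by (simp add: moebius_def a_def b_def c_def d_def)
  show ?thesis
  proof (cases "c = 0")
    case True
    then have ad: "a * d = 1" using det by simp
    then have nz: "a \<noteq> 0" "d = 1 / a" by (auto simp: eq_divide_eq mult.commute)
    have "moebius g z = of_real (a\<^sup>2) * z + of_real (a * b)" for z
      unfolding mo True nz using nz(1) by (simp add: field_simps power2_eq_square)
    then have "(\<integral>\<^sup>+z. f (moebius g z) \<partial>hmeas) = (\<integral>\<^sup>+z. f (of_real (a\<^sup>2) * z + of_real (a * b)) \<partial>hmeas)" by simp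
    also have "\<dots> = (\<integral>\<^sup>+z. f (z + of_real (a * b)) \<partial>hmeas)"
      using nz(1) by (intro hmeas_scale[of "\<lambda>z. f (z + of_real (a * b))"]) auto
    also have "\<dots> = (\<integral>\<^sup>+z. f z \<partial>hmeas)" by (rule hmeas_translate) auto
    finally show ?thesis .
  next
    case False
    have "moebius g z = - 1 / (of_real (c\<^sup>2) * (z + of_real (d / c))) + of_real (a / c)" if "Im z > 0" for z
    proof -
      have nz: "of_real c * z + of_real d \<noteq> 0" using jac_nz[OF g, of z] that by (simp add: jac_def c_def d_def)
      have "of_real (c\<^sup>2) * (z + of_real (d / c)) = of_real c * (of_real c * z + of_real d)"
        using False by (simp add: power2_eq_square field_simps)
      moreover have "complex_of_real (a / c) = of_real a * (of_real c * z + of_real d) / (of_real c * (of_real c * z + of_real d))"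
        using nz by simp
      ultimately have "- 1 / (of_real (c\<^sup>2) * (z + of_real (d / c))) + of_real (a / c) =
         (- 1 + of_real a * (of_real c * z + of_real d)) / (of_real c * (of_real c * z + of_real d))"
        by (simp only: add_divide_distrib)
      also have "- 1 + of_real a * (of_real c * z + of_real d) = of_real c * (of_real a * z) + of_real (a * d - 1)"
        by (simp add: algebra_simps)
      also have "a * d - 1 = c * b" using det by (simp add: mult.commute)
      also have "of_real c * (of_real a * z) + of_real (c * b) = of_real c * (of_real a * z + of_real b)"
        by (simp add: algebra_simps)
      also have "of_real c * (of_real a * z + of_real b) / (of_real c * (of_real c * z + of_real d)) = moebius g z"
        using False by (simp add: mo)
      finally show ?thesis by simp
    qed
    then have "(\<integral>\<^sup>+z. f (moebius g z) \<partial>hmeas) =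
      (\<integral>\<^sup>+z. f (- 1 / (of_real (c\<^sup>2) * (z + of_real (d / c))) + of_real (a / c)) \<partial>hmeas)"
      using AE_hmeas by (intro nn_integral_cong_AE) (auto elim!: eventually_mono)
    also have "\<dots> = (\<integral>\<^sup>+z. f (- 1 / (of_real (c\<^sup>2) * z) + of_real (a / c)) \<partial>hmeas)"
      by (rule hmeas_translate[of "\<lambda>z. f (- 1 / (of_real (c\<^sup>2) * z) + of_real (a / c))"]) measurable
    also have "\<dots> = (\<integral>\<^sup>+z. f (- 1 / z + of_real (a / c)) \<partial>hmeas)"
      using False by (intro hmeas_scale[of "\<lambda>z. f (- 1 / z + of_real (a / c))"]) auto
    also have "\<dots> = (\<integral>\<^sup>+z. f (z + of_real (a / c)) \<partial>hmeas)"
      by (rule hmeas_invert[of "\<lambda>z. f (z + of_real (a / c))"]) measurable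
    also have "\<dots> = (\<integral>\<^sup>+z. f z \<partial>hmeas)" by (rule hmeas_translate) auto
    finally show ?thesis .
  qed
qed

lemma distr_hmeas_moebius: "g \<in> SL2 \<Longrightarrow> distr hmeas borel (moebius g) = hmeas"
proof (rule measure_eqI)
  fix A assume g: "g \<in> SL2" and "A \<in> sets (distr hmeas borel (moebius g))"
  then have [measurable]: "A \<in> sets borel" by simp
  have "emeasure (distr hmeas borel (moebius g)) A = (\<integral>\<^sup>+z. indicator A (moebius g z) \<partial>hmeas)"
    by (subst nn_integral_indicator[symmetric], simp, subst nn_integral_distr) auto
  also have "\<dots> = (\<integral>\<^sup>+z. indicator A z \<partial>hmeas)" by (rule nn_integral_hmeas_moebius[OF g]) auto
  finally show "emeasure (distr hmeas borel (moebius g)) A = emeasure hmeas A" by simp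
qed simp

lemma integral_hmeas_moebius:
  fixes f :: "complex \<Rightarrow> complex"
  assumes g: "g \<in> SL2" and [measurable]: "f \<in> borel_measurable borel"
  shows "(LINT z|hmeas. f (moebius g z)) = (LINT z|hmeas. f z)"
proof -
  have "(LINT z|hmeas. f z) = (LINT z|distr hmeas borel (moebius g). f z)" by (simp add: distr_hmeas_moebius[OF g])
  also have "\<dots> = (LINT z|hmeas. f (moebius g z))" by (rule integral_distr) auto
  finally show ?thesis by simp
qed

lemma integrable_hmeas_moebius:
  fixes f :: "complex \<Rightarrow> complex"
  assumes g: "g \<in> SL2" and [measurable]: "f \<in> borel_measurable borel"
  shows "integrable hmeas (\<lambda>z. f (moebius g z)) \<longleftrightarrow> integrable hmeas f"
proof -
  have "integrable hmeas f \<longleftrightarrow> integrable (distr hmeas borel (moebius g)) f" by (simp add: distr_hmeas_moebius[OF g])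
  also have "\<dots> \<longleftrightarrow> integrable hmeas (\<lambda>z. f (moebius g z))" by (rule integrable_distr_eq) auto
  finally show ?thesis by simp
qed

lemma AE_hmeas_moebius:
  assumes g: "g \<in> SL2" and "AE z in hmeas. P z"
  shows "AE z in hmeas. P (moebius g z)"
proof -
  obtain S where S: "S \<in> sets hmeas" "emeasure hmeas S = 0" "{z. \<not> P z} \<subseteq> S"
    using assms(2) by (auto elim!: AE_E)
  have "AE z in hmeas. z \<notin> S" using S by (intro AE_not_in) (auto simp: null_sets_def)
  then have "AE z in distr hmeas borel (moebius g). z \<notin> S" by (simp only: distr_hmeas_moebius[OF g])
  then have "AE z in hmeas. moebius g z \<notin> S"
    using S(1) by (subst (asm) AE_distr_iff) auto
  then show ?thesis by (rule AE_mp) (use S(3) in auto)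
qed

subsection \<open>A mean value property\<close>

definition rot :: "real \<Rightarrow> real^2^2" where
  "rot t = mat2 (cos (pi * t)) (sin (pi * t)) (- sin (pi * t)) (cos (pi * t))"

lemma rot_SL2: "rot t \<in> SL2"
  by (simp add: rot_def SL2_mat2 flip: power2_eq_square)

lemma circle_mean:
  assumes "g holomorphic_on cball 0 1"
  shows "((\<lambda>t. g (exp (2 * of_real pi * \<i> * of_real t))) has_integral g 0) {0..1}"
proof -
  have "((\<lambda>u. g u / (u - 0)) has_contour_integral (2 * of_real pi * \<i> * g 0)) (circlepath 0 1)"
    using assms by (intro Cauchy_integral_circlepath_simple) auto
  then have "((\<lambda>t. g (circlepath 0 1 t) / circlepath 0 1 t * vector_derivative (circlepath 0 1) (at t within {0..1})) has_integral
       (2 * of_real pi * \<i> * g 0)) {0..1}"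
    by (simp add: has_contour_integral_def)
  then have "((\<lambda>t. (2 * of_real pi * \<i>) * g (exp (2 * of_real pi * \<i> * of_real t))) has_integral (2 * of_real pi * \<i> * g 0)) {0..1}"
    by (rule has_integral_eq[rotated]) (simp add: vector_derivative_circlepath01, simp add: circlepath)
  then show ?thesis
    by (subst (asm) has_integral_mult_right_iff) auto
qed

definition cayley :: "complex \<Rightarrow> complex" where
  "cayley w = \<i> * (1 + w) / (1 - w)"

lemma cayley_uhp: assumes "norm w < 1" shows "Im (cayley w) > 0"
proof -
  have w: "w \<noteq> 1" using assms by auto
  have n: "(norm w)\<^sup>2 < 1" using assms by (simp add: power_less_one_iff abs_square_less_1)
  have "Im (cayley w) = (1 - (norm w)\<^sup>2) / (norm (1 - w))\<^sup>2"
    unfolding cmod_power2 by (simp add: cayley_def Im_divide algebra_simps power2_eq_square)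
  then show ?thesis using w n by simp
qed

lemma cayley_rot:
  assumes "norm w < 1"
  shows "moebius (rot t) (cayley w) = cayley (w * exp (2 * of_real pi * \<i> * of_real t))"
proof -
  define e where "e = exp (\<i> * of_real (pi * t))"
  have e: "e \<noteq> 0" "norm e = 1" by (simp_all add: e_def)
  have cs: "of_real (cos (pi * t)) = (e + inverse e) / 2" "of_real (sin (pi * t)) = (e - inverse e) / (2 * \<i>)"
    by (simp_all add: e_def cos_exp_eq sin_exp_eq cos_of_real[symmetric] sin_of_real[symmetric] exp_minus)
  have e2: "exp (2 * of_real pi * \<i> * of_real t) = e * e"
    by (simp add: e_def algebra_simps flip: exp_add)
  have w: "1 - w \<noteq> 0" using assms by auto
  have "norm (w * (e * e)) < 1" using assms e by (simp add: norm_mult)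
  then have w2: "1 - w * (e * e) \<noteq> 0" by auto
  have num: "of_real (cos (pi * t)) * cayley w + of_real (sin (pi * t)) = \<i> * (1 + w * (e * e)) / (e * (1 - w))"
    unfolding cs cayley_def using w e by (simp add: field_simps)
  have den: "of_real (- sin (pi * t)) * cayley w + of_real (cos (pi * t)) = (1 - w * (e * e)) / (e * (1 - w))"
    unfolding of_real_minus cs cayley_def using w e by (simp add: field_simps)
  show ?thesis
    unfolding moebius_def rot_def mat2_nth num den e2 using w w2 e by (simp add: cayley_def)
qed

lemma uhp_mean:
  assumes f: "f holomorphic_on upper_half_plane" and z: "Im z > 0"
  shows "((\<lambda>t. f (moebius (rot t) z)) has_integral f \<i>) {0..1}"
proof -
  define w where "w = (z - \<i>) / (z + \<i>)"
  have zi: "z + \<i> \<noteq> 0" using z by (auto simp: complex_eq_iff)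
  have "norm (z - \<i>) < norm (z + \<i>)"
    using z by (simp add: cmod_def power2_eq_square algebra_simps)
  then have w: "norm w < 1" using zi by (simp add: w_def norm_divide divide_simps)
  have zc: "cayley w = z"
  proof -
    have "1 + w = 2 * z / (z + \<i>)" "1 - w = 2 * \<i> / (z + \<i>)" using zi by (simp_all add: w_def field_simps)
    then show ?thesis using zi by (simp add: cayley_def)
  qed
  have ball: "norm (w * u) < 1" if "u \<in> cball 0 1" for u
  proof -
    have "norm (w * u) \<le> norm w * 1" unfolding norm_mult using that by (intro mult_left_mono) auto
    then show ?thesis using w by simp
  qed
  have "(f \<circ> (\<lambda>u. cayley (w * u))) holomorphic_on cball 0 1"
  proof (rule holomorphic_on_compose_gen[OF _ f])
    have "1 - w * u \<noteq> 0" if "u \<in> cball 0 1" for u using ball[OF that] by auto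
    then show "(\<lambda>u. cayley (w * u)) holomorphic_on cball 0 1"
      unfolding cayley_def by (intro holomorphic_intros) auto
    show "(\<lambda>u. cayley (w * u)) ` cball 0 1 \<subseteq> upper_half_plane"
      using cayley_uhp ball by (auto simp: upper_half_plane_def)
  qed
  from circle_mean[OF this] show ?thesis
    using w by (simp add: cayley_rot[symmetric] zc) (simp add: cayley_def)
qed

lemma uhp_borel_measurable:
  fixes f :: "complex \<Rightarrow> complex"
  assumes "continuous_on upper_half_plane f"
  shows "(\<lambda>z. if Im z > 0 then f z else 0) \<in> borel_measurable borel"
proof -
  have "(\<lambda>z. indicator upper_half_plane z *\<^sub>R f z) \<in> borel_measurable borel"
    using assms by (intro borel_measurable_continuous_on_indicator) auto
  also have "(\<lambda>z. indicator upper_half_plane z *\<^sub>R f z) = (\<lambda>z. if Im z > 0 then f z else 0)"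
    by (auto simp: indicator_def upper_half_plane_def)
  finally show ?thesis .
qed

lemma hmeas_mean:
  fixes f :: "complex \<Rightarrow> complex" and W :: "complex \<Rightarrow> real"
  assumes f: "f holomorphic_on upper_half_plane"
    and W [measurable]: "W \<in> borel_measurable borel"
    and Winv: "\<And>t z. Im z > 0 \<Longrightarrow> W (moebius (rot t) z) = W z"
    and int: "integrable hmeas (\<lambda>z. f z * of_real (W z))"
  shows "(LINT z|hmeas. f z * of_real (W z)) = (LINT z|hmeas. f \<i> * of_real (W z))"
proof -
  interpret hm: sigma_finite_measure hmeas by (rule sigma_finite_hmeas)
  interpret P: pair_sigma_finite lborel hmeas ..
  define F where "F z = (if Im z > 0 then f z else 0)" for z
  have [measurable]: "F \<in> borel_measurable borel"
    unfolding F_def using f by (intro uhp_borel_measurable holomorphic_on_imp_continuous_on)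
  define K where "K z = F z * of_real (W z)" for z
  have [measurable]: "K \<in> borel_measurable borel" unfolding K_def by measurable
  have KAE: "AE z in hmeas. K z = f z * of_real (W z)"
    using AE_hmeas by eventually_elim (simp add: K_def F_def)
  have Kint: "integrable hmeas K"
    using int by (rule integrable_cong_AE_imp) (use KAE in \<open>auto simp: eq_commute\<close>)
  define H where "H t z = (indicator {0..1} t :: real) *\<^sub>R K (moebius (rot t) z)" for t z
  have rotm [measurable]: "(\<lambda>(t, z). moebius (rot t) z) \<in> borel_measurable (lborel \<Otimes>\<^sub>M hmeas)"
    unfolding moebius_def rot_def mat2_nth by measurable
  have Hm [measurable]: "(\<lambda>(t, z). H t z) \<in> borel_measurable (lborel \<Otimes>\<^sub>M hmeas)"
    unfolding H_def split_beta using measurable_compose[OF rotm, of K borel] by (auto simp: split_beta)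
  have Hi: "integrable hmeas (\<lambda>z. H t z)" for t
    unfolding H_def using integrable_hmeas_moebius[OF rot_SL2, of K t] Kint by auto
  have Hn: "(LINT z|hmeas. norm (H t z)) = indicator {0..1} t * (LINT z|hmeas. norm (K z))" for t
  proof -
    have "(LINT z|hmeas. of_real (norm (K (moebius (rot t) z)))) = (LINT z|hmeas. complex_of_real (norm (K z)))"
      by (rule integral_hmeas_moebius[OF rot_SL2]) measurable
    then have "(LINT z|hmeas. norm (K (moebius (rot t) z))) = (LINT z|hmeas. norm (K z))"
      by (simp only: integral_complex_of_real of_real_eq_iff)
    then show ?thesis by (simp add: H_def)
  qed
  have Hint: "integrable (lborel \<Otimes>\<^sub>M hmeas) (\<lambda>(t, z). H t z)"
    by (rule P.Fubini_integrable) (auto simp: Hn Hi)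
  have "(LINT z|hmeas. LINT t|lborel. H t z) = (LINT t|lborel. LINT z|hmeas. H t z)"
    by (rule P.Fubini_integral[OF Hint])
  also have "(LINT z|hmeas. H t z) = indicator {0..1} t *\<^sub>R (LINT z|hmeas. K z)" for t
    unfolding H_def by (simp add: integral_hmeas_moebius[OF rot_SL2])
  then have "(LINT t|lborel. LINT z|hmeas. H t z) = (LINT z|hmeas. K z)"
    by simp
  also have "(LINT z|hmeas. LINT t|lborel. H t z) = (LINT z|hmeas. f \<i> * of_real (W z))"
  proof (rule integral_cong_AE)
    show "AE z in hmeas. (LINT t|lborel. H t z) = f \<i> * of_real (W z)"
      using AE_hmeas
    proof eventually_elim
      case (elim z)
      have m: "Im (moebius (rot t) z) > 0" for t using moebius_uhp[OF rot_SL2 elim] .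
      then have "H t z = indicator {0..1} t *\<^sub>R f (moebius (rot t) z) * of_real (W z)" for t
        by (simp add: H_def K_def F_def Winv[OF elim])
      then have "(LINT t|lborel. H t z) = (LINT t:{0..1}|lborel. f (moebius (rot t) z)) * of_real (W z)"
        by (simp add: set_lebesgue_integral_def flip: mult_scaleR_left)
      also have "(LINT t:{0..1}|lborel. f (moebius (rot t) z)) = f \<i>"
      proof -
        have "continuous_on {0..1} (\<lambda>t. moebius (rot t) z)"
          unfolding moebius_def rot_def mat2_nth using jac_nz[OF rot_SL2, of z] elim
          by (intro continuous_intros) (auto simp: rot_def jac_def intro!: continuous_intros)
        then have "continuous_on {0..1} (\<lambda>t. f (moebius (rot t) z))"
          using m by (intro continuous_on_compose2[OF holomorphic_on_imp_continuous_on[OF f]]) (auto simp: upper_half_plane_def)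
        then have "set_integrable lborel {0..1} (\<lambda>t. f (moebius (rot t) z))"
          by (rule borel_integrable_atLeastAtMost')
        from set_borel_integral_eq_integral[OF this]
        have "((\<lambda>t. f (moebius (rot t) z)) has_integral (LINT t:{0..1}|lborel. f (moebius (rot t) z))) {0..1}"
          by (auto simp: has_integral_iff)
        then show ?thesis using uhp_mean[OF f elim] by (rule has_integral_unique)
      qed
      finally show ?case .
    qed
  next
    show "(\<lambda>z. LINT t|lborel. H t z) \<in> borel_measurable hmeas"
      using P.integrable_snd[OF Hint] by auto
  qed measurable
  also have "(LINT z|hmeas. K z) = (LINT z|hmeas. f z * of_real (W z))"
    by (rule integral_cong_AE) (use KAE int in auto)
  finally show ?thesis by simp
qed

subsection \<open>Sums and integrals\<close>

lemma
  fixes f :: "'i \<Rightarrow> 'a \<Rightarrow> complex"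
  assumes sf: "sigma_finite_measure M" and A: "countable A"
    and [measurable]: "\<And>i. i \<in> A \<Longrightarrow> f i \<in> borel_measurable M"
    and fin: "(\<integral>\<^sup>+i. \<integral>\<^sup>+x. ennreal (norm (f i x)) \<partial>M \<partial>count_space A) < \<infinity>"
  shows AE_abs_summable: "AE x in M. (\<lambda>i. norm (f i x)) summable_on A"
    and integrable_infsum: "integrable M (\<lambda>x. \<Sum>\<^sub>\<infinity>i\<in>A. f i x)"
    and has_sum_integral: "((\<lambda>i. LINT x|M. f i x) has_sum (LINT x|M. (\<Sum>\<^sub>\<infinity>i\<in>A. f i x))) A"
proof -
  interpret M: sigma_finite_measure M by (rule sf)
  interpret C: sigma_finite_measure "count_space A" by (rule sigma_finite_measure_count_space_countable[OF A])
  interpret P: pair_sigma_finite "count_space A" M ..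
  have cs: "integrable (count_space A) g \<longleftrightarrow> (\<lambda>i. norm (g i)) summable_on A" for g :: "'i \<Rightarrow> complex"
    using abs_summable_equivalent[of g A] by (simp add: abs_summable_on_def)
  have ci: "(LINT i|count_space A. g i) = (\<Sum>\<^sub>\<infinity>i\<in>A. g i)" if "integrable (count_space A) g" for g :: "'i \<Rightarrow> complex"
    using infsetsum_infsum[of g A] that by (simp add: abs_summable_on_def infsetsum_def)
  have [measurable]: "(\<lambda>(i, x). f i x) \<in> borel_measurable (count_space A \<Otimes>\<^sub>M M)"
    by (rule measurable_pair_measure_countable1[OF A]) auto
  have int: "integrable (count_space A \<Otimes>\<^sub>M M) (\<lambda>(i, x). f i x)"
  proof (rule integrableI_bounded)
    have "(\<integral>\<^sup>+p. ennreal (norm (case p of (i, x) \<Rightarrow> f i x)) \<partial>(count_space A \<Otimes>\<^sub>M M)) =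
       (\<integral>\<^sup>+i. \<integral>\<^sup>+x. ennreal (norm (f i x)) \<partial>M \<partial>count_space A)"
      by (subst M.nn_integral_fst[symmetric]) auto
    then show "(\<integral>\<^sup>+p. ennreal (norm (case p of (i, x) \<Rightarrow> f i x)) \<partial>(count_space A \<Otimes>\<^sub>M M)) < \<infinity>"
      using fin by simp
  qed measurable
  have AEi: "AE x in M. integrable (count_space A) (\<lambda>i. f i x)"
    using P.AE_integrable_snd[OF int] by simp
  show "AE x in M. (\<lambda>i. norm (f i x)) summable_on A"
    using AEi by (simp add: cs)
  have int2: "integrable M (\<lambda>x. LINT i|count_space A. f i x)"
    using P.integrable_snd[OF int] by simp
  define g where "g x = (if integrable (count_space A) (\<lambda>i. f i x) then 0 else (\<Sum>\<^sub>\<infinity>i\<in>A. f i x))" for x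
  have iff0: "(\<lambda>i. f i x) summable_on A \<longleftrightarrow> integrable (count_space A) (\<lambda>i. f i x)" for x
    unfolding cs by (simp add: summable_on_iff_abs_summable_on_complex)
  have eq: "(\<Sum>\<^sub>\<infinity>i\<in>A. f i x) = (LINT i|count_space A. f i x)" for x
    using ci[of "\<lambda>i. f i x"] iff0[of x] not_integrable_integral_eq[of "count_space A" "\<lambda>i. f i x"]
    by (cases "integrable (count_space A) (\<lambda>i. f i x)") (auto simp: infsum_not_exists)
  show "integrable M (\<lambda>x. \<Sum>\<^sub>\<infinity>i\<in>A. f i x)" using int2 by (simp add: eq)
  have "(LINT x|M. LINT i|count_space A. f i x) = (LINT i|count_space A. LINT x|M. f i x)"
    by (rule P.Fubini_integral[OF int])
  moreover have int3: "integrable (count_space A) (\<lambda>i. LINT x|M. f i x)"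
    using P.integrable_fst[OF int] by simp
  ultimately have "(LINT x|M. (\<Sum>\<^sub>\<infinity>i\<in>A. f i x)) = (\<Sum>\<^sub>\<infinity>i\<in>A. (LINT x|M. f i x))"
    by (simp add: eq ci)
  moreover have "(\<lambda>i. LINT x|M. f i x) summable_on A"
    using int3 unfolding cs by (simp add: summable_on_iff_abs_summable_on_complex)
  ultimately show "((\<lambda>i. LINT x|M. f i x) has_sum (LINT x|M. (\<Sum>\<^sub>\<infinity>i\<in>A. f i x))) A"
    by simp
qed

lemma infsum_if_const:
  fixes v :: complex
  assumes "finite {i\<in>A. P i}"
  shows "(\<Sum>\<^sub>\<infinity>i\<in>A. if P i then v else 0) = of_nat (card {i\<in>A. P i}) * v"
proof -
  have "(\<Sum>\<^sub>\<infinity>i\<in>A. if P i then v else 0) = (\<Sum>\<^sub>\<infinity>i\<in>{i\<in>A. P i}. v)"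
    by (rule infsum_cong_neutral) auto
  then show ?thesis using assms by simp
qed

lemma nn_integral_if_const:
  fixes v :: ennreal
  assumes "finite {i\<in>A. P i}"
  shows "(\<integral>\<^sup>+i. (if P i then v else 0) \<partial>count_space A) = of_nat (card {i\<in>A. P i}) * v"
proof -
  have "(\<integral>\<^sup>+i. (if P i then v else 0) \<partial>count_space A) = (\<integral>\<^sup>+i. v * indicator {i\<in>A. P i} i \<partial>count_space A)"
    by (intro nn_integral_cong) (auto simp: indicator_def)
  also have "\<dots> = v * emeasure (count_space A) {i\<in>A. P i}"
    by (rule nn_integral_cmult_indicator) simp
  finally show ?thesis using assms by (simp add: mult.commute)
qed

lemma nn_integral_count_space_fibres:
  fixes g :: "'a \<Rightarrow> ennreal"
  assumes A: "countable A" and B: "B = p ` A"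
  shows "(\<integral>\<^sup>+a. g a \<partial>count_space A) = (\<integral>\<^sup>+b. \<integral>\<^sup>+a. g a \<partial>count_space {a\<in>A. p a = b} \<partial>count_space B)"
proof -
  have "(\<integral>\<^sup>+a. g a \<partial>count_space A) = (\<integral>\<^sup>+a. \<integral>\<^sup>+b. g a * indicator {p a} b \<partial>count_space B \<partial>count_space A)"
    using B by (intro nn_integral_cong, subst nn_integral_cmult_indicator) auto
  also have "\<dots> = (\<integral>\<^sup>+b. \<integral>\<^sup>+a. g a * indicator {p a} b \<partial>count_space A \<partial>count_space B)"
    using A B by (intro nn_integral_count_space_nn_integral) auto
  also have "\<dots> = (\<integral>\<^sup>+b. \<integral>\<^sup>+a. g a \<partial>count_space {a\<in>A. p a = b} \<partial>count_space B)"
  proof (rule nn_integral_cong)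
    fix b
    have "(\<integral>\<^sup>+a. g a \<partial>count_space {a\<in>A. p a = b}) = (\<integral>\<^sup>+a. g a * indicator {a\<in>A. p a = b} a \<partial>count_space UNIV)"
      by (subst nn_integral_count_space_indicator) auto
    also have "\<dots> = (\<integral>\<^sup>+a. (g a * indicator {p a} b) * indicator A a \<partial>count_space UNIV)"
      by (intro nn_integral_cong) (auto simp: indicator_def)
    also have "\<dots> = (\<integral>\<^sup>+a. g a * indicator {p a} b \<partial>count_space A)"
      by (subst (2) nn_integral_count_space_indicator) auto
    finally show "(\<integral>\<^sup>+a. g a * indicator {p a} b \<partial>count_space A) = (\<integral>\<^sup>+a. g a \<partial>count_space {a\<in>A. p a = b})" by simp
  qed
  finally show ?thesis .
qed

lemma has_sum_fibres:
  fixes g :: "'a \<Rightarrow> complex"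
  assumes "(g has_sum s) A" and B: "B = p ` A"
    and "\<And>b. b \<in> B \<Longrightarrow> (g has_sum h b) {a\<in>A. p a = b}"
  shows "(h has_sum s) B"
proof (rule has_sum_Sigma')
  have "inj_on snd (Sigma B (\<lambda>b. {a\<in>A. p a = b}))" "snd ` Sigma B (\<lambda>b. {a\<in>A. p a = b}) = A"
    using B by (auto simp: inj_on_def image_iff)
  then have "((g \<circ> snd) has_sum s) (Sigma B (\<lambda>b. {a\<in>A. p a = b}))"
    using assms(1) has_sum_reindex[of snd "Sigma B (\<lambda>b. {a\<in>A. p a = b})" g s] by simp
  then show "((\<lambda>(b, a). g a) has_sum s) (Sigma B (\<lambda>b. {a\<in>A. p a = b}))"
    by (simp add: o_def case_prod_unfold)
  show "((\<lambda>a. case (b, a) of (b, a) \<Rightarrow> g a) has_sum h b) {a\<in>A. p a = b}" if "b \<in> B" for b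
    using assms(3)[OF that] by simp
qed

subsection \<open>Unfolding\<close>

lemma null_sets_hmeas: "S \<in> null_sets lborel \<Longrightarrow> S \<in> null_sets hmeas"
  unfolding hmeas_def by (subst null_sets_density_iff) (auto intro: AE_not_in eventually_mono)

lemma fundamental_domain_card:
  assumes "fundamental_domain N F"
  shows "AE z in hmeas. card {A \<in> Gamma0 N. moebius A z \<in> F} = 2"
proof -
  define Z where "Z = (\<Union>A\<in>{A\<in>Gamma0 N. A \<noteq> mat 1 \<and> A \<noteq> - mat 1}. {z\<in>F. moebius A z \<in> F})"
  have "Z \<in> null_sets lborel"
    unfolding Z_def using assms
    by (intro null_sets_UN' countable_subset[OF _ countable_Gamma0[of N]]) (auto simp: fundamental_domain_def)
  then have Z0: "AE z in hmeas. z \<notin> Z" by (intro AE_not_in null_sets_hmeas)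
  have "AE z in hmeas. \<forall>A\<in>Gamma0 N. moebius A z \<notin> Z"
  proof (subst AE_ball_countable[OF countable_Gamma0], intro ballI)
    fix A assume "A \<in> Gamma0 N"
    from AE_hmeas_moebius[OF Gamma0_SL2[OF this] Z0] show "AE z in hmeas. moebius A z \<notin> Z" .
  qed
  then show ?thesis using AE_hmeas
  proof eventually_elim
    case (elim z)
    obtain A where A: "A \<in> Gamma0 N" "moebius A z \<in> F"
      using assms elim by (auto simp: fundamental_domain_def upper_half_plane_def)
    note SA = Gamma0_SL2[OF A(1)]
    have "{A \<in> Gamma0 N. moebius A z \<in> F} = {A, - A}"
    proof (intro equalityI subsetI)
      fix B assume "B \<in> {A \<in> Gamma0 N. moebius A z \<in> F}"
      then have B: "B \<in> Gamma0 N" "moebius B z \<in> F" by auto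
      define C where "C = B ** matrix_inv A"
      have C: "C \<in> Gamma0 N" using A B by (simp add: C_def Gamma0_mult Gamma0_inv)
      have CA: "C ** A = B" by (simp add: C_def SL2_cancel_right[OF SA])
      have "moebius C (moebius A z) = moebius B z"
        using CA moebius_mult[OF Gamma0_SL2[OF C] SA elim(2)] by simp
      moreover have "moebius A z \<notin> Z" using elim(1) A by blast
      ultimately have "C = mat 1 \<or> C = - mat 1" using A B C by (auto simp: Z_def)
      then show "B \<in> {A, - A}" using CA by (auto simp: uminus_mult2)
    qed (use A in \<open>auto simp: moebius_uminus intro: Gamma0_uminus\<close>)
    moreover have "A \<noteq> - A"
    proof
      assume "A = - A"
      then have "A$1$1 = (- A)$1$1" "A$1$2 = (- A)$1$2" by metis+
      then have "A$1$1 = 0" "A$1$2 = 0" by simp_all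
      then show False using SL2_det[OF SA] by simp
    qed
    ultimately show ?case by simp
  qed
qed

lemma orbit_coset_card:
  assumes g0: "g0 \<in> Gamma0 N" and z: "Im z > 0"
  shows "card {g \<in> Gamma0 N. conj_act g X0 = conj_act g0 X0 \<and> moebius (matrix_inv g) z \<in> D} =
     card {s \<in> Gamma0 N. conj_act s X0 = X0 \<and> moebius s (moebius (matrix_inv g0) z) \<in> D}"
proof (rule bij_betw_same_card[symmetric, of "\<lambda>s. g0 ** matrix_inv s"])
  note S0 = Gamma0_SL2[OF g0]
  have eq: "moebius (matrix_inv (g0 ** matrix_inv s)) z = moebius s (moebius (matrix_inv g0) z)" if "s \<in> SL2" for s
    using that S0 z by (simp add: SL2_inv_mult SL2_inv SL2_inv_inv moebius_mult)
  show "bij_betw (\<lambda>s. g0 ** matrix_inv s)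
     {s \<in> Gamma0 N. conj_act s X0 = X0 \<and> moebius s (moebius (matrix_inv g0) z) \<in> D}
     {g \<in> Gamma0 N. conj_act g X0 = conj_act g0 X0 \<and> moebius (matrix_inv g) z \<in> D}"
  proof (rule bij_betwI[where g="\<lambda>g. matrix_inv g ** g0"], goal_cases)
    case 1
    show ?case
    proof (intro funcsetI CollectI conjI; elim CollectE conjE)
      fix s assume s: "s \<in> Gamma0 N" "conj_act s X0 = X0" "moebius s (moebius (matrix_inv g0) z) \<in> D"
      note S = Gamma0_SL2[OF s(1)]
      show "g0 ** matrix_inv s \<in> Gamma0 N" using s g0 by (simp add: Gamma0_mult Gamma0_inv)
      have "conj_act (matrix_inv s) X0 = X0" using conj_act_inv[OF S, of X0] s(2) by simp
      then show "conj_act (g0 ** matrix_inv s) X0 = conj_act g0 X0"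
        using S0 S by (simp add: conj_act_mult SL2_inv)
      show "moebius (matrix_inv (g0 ** matrix_inv s)) z \<in> D" using eq[OF S] s by simp
    qed
  next
    case 2
    show ?case
    proof (intro funcsetI CollectI conjI; elim CollectE conjE)
      fix g assume g: "g \<in> Gamma0 N" "conj_act g X0 = conj_act g0 X0" "moebius (matrix_inv g) z \<in> D"
      note S = Gamma0_SL2[OF g(1)]
      show "matrix_inv g ** g0 \<in> Gamma0 N" using g g0 by (simp add: Gamma0_mult Gamma0_inv)
      show "conj_act (matrix_inv g ** g0) X0 = X0"
        using S0 S g(2)[symmetric] by (simp add: conj_act_mult SL2_inv conj_act_inv)
      have "moebius (matrix_inv g ** g0) (moebius (matrix_inv g0) z) = moebius (matrix_inv g) z"
        using S0 S z moebius_mult[of "matrix_inv g ** g0" "matrix_inv g0" z]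
        by (simp add: SL2_inv SL2_mult SL2_cancel_right)
      then show "moebius (matrix_inv g ** g0) (moebius (matrix_inv g0) z) \<in> D" using g by simp
    qed
  next
    case (3 s)
    then have "s \<in> SL2" by (auto dest: Gamma0_SL2)
    then show ?case using S0
      by (simp add: SL2_inv_mult SL2_inv SL2_inv_inv SL2_cancel_right)
  next
    case (4 g)
    then have "g \<in> SL2" by (auto dest: Gamma0_SL2)
    then show ?case using S0
      by (simp add: SL2_inv_mult SL2_inv SL2_inv_inv SL2_cancel_left)
  qed
qed

lemma
  fixes \<Phi> :: "real^2^2 \<Rightarrow> complex \<Rightarrow> complex" and X0 :: "real^2^2" and N :: nat
  defines "Orb \<equiv> (\<lambda>A. conj_act A X0) ` Gamma0 N"
  assumes fd: "fundamental_domain N F"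
    and \<Phi>m [measurable]: "\<And>X. \<Phi> X \<in> borel_measurable borel"
    and eqv: "\<And>A z. A \<in> Gamma0 N \<Longrightarrow> Im z > 0 \<Longrightarrow> \<Phi> (conj_act A X0) (moebius A z) = \<Phi> X0 z"
    and D [measurable]: "D \<in> sets borel"
    and cD: "AE z in hmeas. card {s \<in> Gamma0 N. conj_act s X0 = X0 \<and> moebius s z \<in> D} = c" and c: "c > 0"
    and fin: "(\<integral>\<^sup>+X. \<integral>\<^sup>+z. ennreal (norm (\<Phi> X z)) * indicator F z \<partial>hmeas \<partial>count_space Orb) < \<infinity>"
  shows unfold_integrable: "set_integrable hmeas D (\<Phi> X0)"
    and unfold_has_sum: "((\<lambda>X. LINT z:F|hmeas. \<Phi> X z) has_sum (2 / of_nat c * (LINT z:D|hmeas. \<Phi> X0 z))) Orb"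
proof -
  note sf = sigma_finite_hmeas
  let ?G = "Gamma0 N"
  have F [measurable]: "F \<in> sets borel" using fd by (auto simp: fundamental_domain_def)
  define S where "S X = {A\<in>?G. conj_act A X0 = X}" for X
  have cS: "countable (S X)" for X unfolding S_def by (rule countable_subset[OF _ countable_Gamma0]) auto
  define a where "a A z = (if moebius A z \<in> F then (if z \<in> D then \<Phi> X0 z else 0) else 0)" for A z
  define b where "b X A z = (if moebius (matrix_inv A) z \<in> D then (if z \<in> F then \<Phi> X z else 0) else 0)" for X A z
  have [measurable]: "a A \<in> borel_measurable borel" for A unfolding a_def by measurable
  have [measurable]: "b X A \<in> borel_measurable borel" for X A unfolding b_def by measurable
  have ba: "AE z in hmeas. b (conj_act A X0) A (moebius A z) = a A z" if A: "A \<in> ?G" for A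
    using AE_hmeas by eventually_elim (simp add: a_def b_def eqv[OF A] moebius_inv[OF Gamma0_SL2[OF A]])
  have nab: "(\<integral>\<^sup>+z. ennreal (norm (a A z)) \<partial>hmeas) = (\<integral>\<^sup>+z. ennreal (norm (b (conj_act A X0) A z)) \<partial>hmeas)" if A: "A \<in> ?G" for A
  proof -
    have "(\<integral>\<^sup>+z. ennreal (norm (b (conj_act A X0) A z)) \<partial>hmeas) = (\<integral>\<^sup>+z. ennreal (norm (b (conj_act A X0) A (moebius A z))) \<partial>hmeas)"
      by (rule nn_integral_hmeas_moebius[OF Gamma0_SL2[OF A], symmetric]) measurable
    also have "\<dots> = (\<integral>\<^sup>+z. ennreal (norm (a A z)) \<partial>hmeas)"
      by (rule nn_integral_cong_AE) (use ba[OF A] in auto)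
    finally show ?thesis by simp
  qed
  have iab: "(LINT z|hmeas. a A z) = (LINT z|hmeas. b (conj_act A X0) A z)" if A: "A \<in> ?G" for A
  proof -
    have "(LINT z|hmeas. b (conj_act A X0) A z) = (LINT z|hmeas. b (conj_act A X0) A (moebius A z))"
      by (rule integral_hmeas_moebius[OF Gamma0_SL2[OF A], symmetric]) measurable
    also have "\<dots> = (LINT z|hmeas. a A z)"
      by (rule integral_cong_AE) (use ba[OF A] in auto)
    finally show ?thesis by simp
  qed
  have cS': "AE z in hmeas. card {A\<in>S X. moebius (matrix_inv A) z \<in> D} = c" if X: "X \<in> Orb" for X
  proof -
    obtain g0 where g0: "g0 \<in> ?G" "X = conj_act g0 X0" using X by (auto simp: Orb_def)
    have "AE z in hmeas. card {s \<in> ?G. conj_act s X0 = X0 \<and> moebius s (moebius (matrix_inv g0) z) \<in> D} = c"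
      by (rule AE_hmeas_moebius[OF Gamma0_SL2[OF Gamma0_inv[OF g0(1)]] cD])
    then show ?thesis using AE_hmeas
    proof eventually_elim
      case (elim z)
      have "{A\<in>S X. moebius (matrix_inv A) z \<in> D} = {g \<in> ?G. conj_act g X0 = conj_act g0 X0 \<and> moebius (matrix_inv g) z \<in> D}"
        by (auto simp: S_def g0)
      then show ?case using orbit_coset_card[OF g0(1) elim(2), of X0 D] elim(1) by simp
    qed
  qed
  have nb: "(\<integral>\<^sup>+A. \<integral>\<^sup>+z. ennreal (norm (b X A z)) \<partial>hmeas \<partial>count_space (S X)) =
      of_nat c * (\<integral>\<^sup>+z. ennreal (norm (\<Phi> X z)) * indicator F z \<partial>hmeas)" if X: "X \<in> Orb" for X
  proof -
    have "(\<integral>\<^sup>+A. \<integral>\<^sup>+z. ennreal (norm (b X A z)) \<partial>hmeas \<partial>count_space (S X)) =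
       (\<integral>\<^sup>+z. \<integral>\<^sup>+A. ennreal (norm (b X A z)) \<partial>count_space (S X) \<partial>hmeas)"
      by (rule nn_integral_count_space_nn_integral[OF cS, symmetric]) measurable
    also have "\<dots> = (\<integral>\<^sup>+z. of_nat c * (ennreal (norm (\<Phi> X z)) * indicator F z) \<partial>hmeas)"
    proof (rule nn_integral_cong_AE)
      show "AE z in hmeas. (\<integral>\<^sup>+A. ennreal (norm (b X A z)) \<partial>count_space (S X)) = of_nat c * (ennreal (norm (\<Phi> X z)) * indicator F z)"
        using cS'[OF X]
      proof eventually_elim
        case (elim z)
        have "finite {A\<in>S X. moebius (matrix_inv A) z \<in> D}" by (rule card_ge_0_finite) (use elim c in simp)
        from nn_integral_if_const[OF this, of "ennreal (norm (\<Phi> X z)) * indicator F z"] elim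
        have "(\<integral>\<^sup>+A. (if moebius (matrix_inv A) z \<in> D then ennreal (norm (\<Phi> X z)) * indicator F z else 0) \<partial>count_space (S X)) =
           of_nat c * (ennreal (norm (\<Phi> X z)) * indicator F z)" by simp
        also have "(\<integral>\<^sup>+A. (if moebius (matrix_inv A) z \<in> D then ennreal (norm (\<Phi> X z)) * indicator F z else 0) \<partial>count_space (S X)) =
          (\<integral>\<^sup>+A. ennreal (norm (b X A z)) \<partial>count_space (S X))"
          by (intro nn_integral_cong) (auto simp: b_def indicator_def)
        finally show ?case .
      qed
    qed
    also have "\<dots> = of_nat c * (\<integral>\<^sup>+z. ennreal (norm (\<Phi> X z)) * indicator F z \<partial>hmeas)"
      by (rule nn_integral_cmult) measurable
    finally show ?thesis .
  qed
  have fb: "(\<integral>\<^sup>+z. ennreal (norm (\<Phi> X z)) * indicator F z \<partial>hmeas) < \<infinity>" if X: "X \<in> Orb" for X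
  proof -
    have "(\<integral>\<^sup>+z. ennreal (norm (\<Phi> X z)) * indicator F z \<partial>hmeas) =
       (\<integral>\<^sup>+Y. (\<integral>\<^sup>+z. ennreal (norm (\<Phi> Y z)) * indicator F z \<partial>hmeas) * indicator {X} Y \<partial>count_space Orb)"
      using X by (subst nn_integral_indicator_singleton) auto
    also have "\<dots> \<le> (\<integral>\<^sup>+Y. (\<integral>\<^sup>+z. ennreal (norm (\<Phi> Y z)) * indicator F z \<partial>hmeas) \<partial>count_space Orb)"
      by (rule nn_integral_mono) (auto simp: indicator_def)
    finally show ?thesis using fin by (simp add: order.strict_trans1)
  qed
  have hsb: "((\<lambda>A. LINT z|hmeas. b X A z) has_sum (of_nat c * (LINT z:F|hmeas. \<Phi> X z))) (S X)" if X: "X \<in> Orb" for X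
  proof -
    have "(\<integral>\<^sup>+A. \<integral>\<^sup>+z. ennreal (norm (b X A z)) \<partial>hmeas \<partial>count_space (S X)) < \<infinity>"
      unfolding nb[OF X] using fb[OF X] by (simp add: ennreal_mult_less_top of_nat_less_top)
    from has_sum_integral[OF sf cS _ this]
    have "((\<lambda>A. LINT z|hmeas. b X A z) has_sum (LINT z|hmeas. (\<Sum>\<^sub>\<infinity>A\<in>S X. b X A z))) (S X)" by simp
    also have "(LINT z|hmeas. (\<Sum>\<^sub>\<infinity>A\<in>S X. b X A z)) = (LINT z|hmeas. of_nat c * (indicator F z *\<^sub>R \<Phi> X z))"
    proof (rule integral_cong_AE)
      show "(\<lambda>z. \<Sum>\<^sub>\<infinity>A\<in>S X. b X A z) \<in> borel_measurable hmeas"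
        using integrable_infsum[OF sf cS _ \<open>(\<integral>\<^sup>+A. \<integral>\<^sup>+z. ennreal (norm (b X A z)) \<partial>hmeas \<partial>count_space (S X)) < \<infinity>\<close>] by auto
      show "AE z in hmeas. (\<Sum>\<^sub>\<infinity>A\<in>S X. b X A z) = of_nat c * (indicator F z *\<^sub>R \<Phi> X z)"
        using cS'[OF X]
      proof eventually_elim
        case (elim z)
        have "finite {A\<in>S X. moebius (matrix_inv A) z \<in> D}" by (rule card_ge_0_finite) (use elim c in simp)
        from infsum_if_const[OF this, of "indicator F z *\<^sub>R \<Phi> X z"] elim
        show ?case by (cases "z \<in> F") (simp_all add: b_def indicator_def cong: if_cong)
      qed
    qed measurable
    also have "\<dots> = of_nat c * (LINT z:F|hmeas. \<Phi> X z)"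
      unfolding set_lebesgue_integral_def by (rule integral_mult_right_zero)
    finally show ?thesis .
  qed
  have "(\<integral>\<^sup>+A. \<integral>\<^sup>+z. ennreal (norm (a A z)) \<partial>hmeas \<partial>count_space ?G) =
     (\<integral>\<^sup>+X. \<integral>\<^sup>+A. \<integral>\<^sup>+z. ennreal (norm (a A z)) \<partial>hmeas \<partial>count_space (S X) \<partial>count_space Orb)"
    unfolding S_def by (rule nn_integral_count_space_fibres[OF countable_Gamma0]) (simp add: Orb_def)
  also have "\<dots> = (\<integral>\<^sup>+X. of_nat c * (\<integral>\<^sup>+z. ennreal (norm (\<Phi> X z)) * indicator F z \<partial>hmeas) \<partial>count_space Orb)"
  proof (rule nn_integral_cong)
    fix X assume "X \<in> space (count_space Orb)"
    then have X: "X \<in> Orb" by simp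
    have "(\<integral>\<^sup>+A. \<integral>\<^sup>+z. ennreal (norm (a A z)) \<partial>hmeas \<partial>count_space (S X)) =
      (\<integral>\<^sup>+A. \<integral>\<^sup>+z. ennreal (norm (b X A z)) \<partial>hmeas \<partial>count_space (S X))"
      by (rule nn_integral_cong) (auto simp: S_def nab)
    then show "(\<integral>\<^sup>+A. \<integral>\<^sup>+z. ennreal (norm (a A z)) \<partial>hmeas \<partial>count_space (S X)) =
      of_nat c * (\<integral>\<^sup>+z. ennreal (norm (\<Phi> X z)) * indicator F z \<partial>hmeas)" by (simp add: nb[OF X])
  qed
  also have "\<dots> = of_nat c * (\<integral>\<^sup>+X. (\<integral>\<^sup>+z. ennreal (norm (\<Phi> X z)) * indicator F z \<partial>hmeas) \<partial>count_space Orb)"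
    by (rule nn_integral_cmult) simp
  also have "\<dots> < \<infinity>" using fin by (simp add: ennreal_mult_less_top of_nat_less_top)
  finally have fa: "(\<integral>\<^sup>+A. \<integral>\<^sup>+z. ennreal (norm (a A z)) \<partial>hmeas \<partial>count_space ?G) < \<infinity>" .
  have AEa: "AE z in hmeas. (\<Sum>\<^sub>\<infinity>A\<in>?G. a A z) = 2 * (indicator D z *\<^sub>R \<Phi> X0 z)"
    using fundamental_domain_card[OF fd]
  proof eventually_elim
    case (elim z)
    have "finite {A\<in>?G. moebius A z \<in> F}" by (rule card_ge_0_finite) (use elim in simp)
    from infsum_if_const[OF this, of "indicator D z *\<^sub>R \<Phi> X0 z"] elim
    show ?case by (cases "z \<in> D") (simp_all add: a_def indicator_def cong: if_cong)
  qed
  have inta: "integrable hmeas (\<lambda>z. \<Sum>\<^sub>\<infinity>A\<in>?G. a A z)"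
    by (rule integrable_infsum[OF sf countable_Gamma0 _ fa]) simp
  then have "integrable hmeas (\<lambda>z. 2 * (indicator D z *\<^sub>R \<Phi> X0 z))"
    by (rule integrable_cong_AE_imp) (use AEa in \<open>auto simp: eq_commute\<close>)
  then show "set_integrable hmeas D (\<Phi> X0)"
    unfolding set_integrable_def
    using integrable_mult_right[of "1 / 2" hmeas "\<lambda>z. 2 * (indicator D z *\<^sub>R \<Phi> X0 z)"] by simp
  have "((\<lambda>A. LINT z|hmeas. a A z) has_sum (LINT z|hmeas. (\<Sum>\<^sub>\<infinity>A\<in>?G. a A z))) ?G"
    by (rule has_sum_integral[OF sf countable_Gamma0 _ fa]) simp
  also have "(LINT z|hmeas. (\<Sum>\<^sub>\<infinity>A\<in>?G. a A z)) = (LINT z|hmeas. 2 * (indicator D z *\<^sub>R \<Phi> X0 z))"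
    by (rule integral_cong_AE) (use AEa inta in auto)
  also have "\<dots> = 2 * (LINT z:D|hmeas. \<Phi> X0 z)"
    unfolding set_lebesgue_integral_def by (rule integral_mult_right_zero)
  finally have hsa: "((\<lambda>A. LINT z|hmeas. a A z) has_sum (2 * (LINT z:D|hmeas. \<Phi> X0 z))) ?G" .
  have "((\<lambda>X. of_nat c * (LINT z:F|hmeas. \<Phi> X z)) has_sum (2 * (LINT z:D|hmeas. \<Phi> X0 z))) Orb"
  proof (rule has_sum_fibres[OF hsa, where p="\<lambda>A. conj_act A X0"])
    show "Orb = (\<lambda>A. conj_act A X0) ` ?G" by (simp add: Orb_def)
    show "((\<lambda>A. LINT z|hmeas. a A z) has_sum (of_nat c * (LINT z:F|hmeas. \<Phi> X z))) {A\<in>?G. conj_act A X0 = X}" if "X \<in> Orb" for X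
    proof -
      have "((\<lambda>A. LINT z|hmeas. a A z) has_sum (of_nat c * (LINT z:F|hmeas. \<Phi> X z))) (S X) \<longleftrightarrow>
        ((\<lambda>A. LINT z|hmeas. b X A z) has_sum (of_nat c * (LINT z:F|hmeas. \<Phi> X z))) (S X)"
        by (rule has_sum_cong) (auto simp: S_def iab)
      then show ?thesis using hsb[OF that] by (simp add: S_def)
    qed
  qed
  from has_sum_cmult_right[OF this, of "1 / of_nat c"]
  show "((\<lambda>X. LINT z:F|hmeas. \<Phi> X z) has_sum (2 / of_nat c * (LINT z:D|hmeas. \<Phi> X0 z))) Orb"
  proof -
    have "1 / of_nat c * (of_nat c * w) = w" "1 / of_nat c * (2 * w) = 2 / of_nat c * w" for w :: complex
      using c by simp_all
    then show ?thesis using \<open>((\<lambda>X. 1 / of_nat c * (of_nat c * (LINT z:F|hmeas. \<Phi> X z))) has_sum (1 / of_nat c * (2 * (LINT z:D|hmeas. \<Phi> X0 z)))) Orb\<close>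
      by (simp only:)
  qed
qed

subsection \<open>Reduction theory\<close>

lemma min_modulus_exists:
  fixes z :: complex
  assumes z: "Im z > 0"
  obtains c d :: int where "(c, d) \<noteq> (0, 0)"
    "\<And>m n :: int. (m, n) \<noteq> (0, 0) \<Longrightarrow> cmod (of_int c * z + of_int d) \<le> cmod (of_int m * z + of_int n)"
proof -
  define f where "f = (\<lambda>p :: int \<times> int. cmod (of_int (fst p) * z + of_int (snd p)))"
  define V where "V = {p. p \<noteq> (0, 0) \<and> f p \<le> 1}"
  obtain b :: int where b: "of_int b \<ge> 1 / Im z" "of_int b \<ge> 1 + \<bar>Re z\<bar> / Im z"
  proof -
    obtain b :: int where "of_int b \<ge> max (1 / Im z) (1 + \<bar>Re z\<bar> / Im z)" using ex_le_of_int by blast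
    then show ?thesis using that by auto
  qed
  have "V \<subseteq> {- b..b} \<times> {- b..b}"
  proof
    fix p assume p: "p \<in> V"
    define c d where "c = fst p" and "d = snd p"
    have le: "cmod (of_int c * z + of_int d) \<le> 1" using p by (simp add: V_def f_def c_def d_def)
    have "\<bar>of_int c * Im z\<bar> \<le> 1" using abs_Im_le_cmod[of "of_int c * z + of_int d"] le by simp
    then have c1: "\<bar>of_int c\<bar> \<le> 1 / Im z" using z by (simp add: abs_mult field_simps)
    have "\<bar>of_int c * Re z + of_int d\<bar> \<le> 1" using abs_Re_le_cmod[of "of_int c * z + of_int d"] le by simp
    then have "\<bar>of_int d\<bar> \<le> 1 + \<bar>of_int c\<bar> * \<bar>Re z\<bar>" by (simp add: abs_mult[symmetric])
    also have "\<dots> \<le> 1 + (1 / Im z) * \<bar>Re z\<bar>" using c1 by (intro add_left_mono mult_right_mono) auto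
    finally have "\<bar>of_int d :: real\<bar> \<le> of_int b" using b by simp
    moreover have "\<bar>of_int c :: real\<bar> \<le> of_int b" using c1 b by linarith
    ultimately have "c \<in> {- b..b}" "d \<in> {- b..b}" by (auto simp: abs_le_iff)
    then show "p \<in> {- b..b} \<times> {- b..b}" by (auto simp: c_def d_def mem_Times_iff)
  qed
  then have fin: "finite V" by (rule finite_subset) simp
  have V01: "(0, 1) \<in> V" by (simp add: V_def f_def)
  define p where "p = arg_min_on f V"
  have p: "p \<in> V" "\<And>q. q \<in> V \<Longrightarrow> f p \<le> f q"
    unfolding p_def using fin V01 by (auto intro: arg_min_if_finite(1) arg_min_least)
  show ?thesis
  proof (rule that[of "fst p" "snd p"])
    show "(fst p, snd p) \<noteq> (0, 0)" using p(1) by (simp add: V_def)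
    fix m n :: int assume mn: "(m, n) \<noteq> (0, 0)"
    show "cmod (of_int (fst p) * z + of_int (snd p)) \<le> cmod (of_int m * z + of_int n)"
    proof (cases "(m, n) \<in> V")
      case True then show ?thesis using p(2)[of "(m, n)"] by (simp add: f_def)
    next
      case False
      then have "f (m, n) > 1" using mn by (auto simp: V_def not_le)
      moreover have "f p \<le> 1" using p(1) by (simp add: V_def)
      ultimately show ?thesis by (simp add: f_def)
    qed
  qed
qed

definition siegel :: "complex set" where
  "siegel = {z. \<bar>Re z\<bar> \<le> 1 \<and> Im z \<ge> 1 / 2}"

lemma siegel_borel [measurable]: "siegel \<in> sets borel"
  unfolding siegel_def by measurable

lemma Gamma1_siegel:
  assumes z: "Im z > 0"
  obtains A where "A \<in> Gamma0 1" "moebius A z \<in> siegel"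
proof -
  obtain c d :: int where cd: "(c, d) \<noteq> (0, 0)"
    and min: "\<And>m n :: int. (m, n) \<noteq> (0, 0) \<Longrightarrow> cmod (of_int c * z + of_int d) \<le> cmod (of_int m * z + of_int n)"
    using min_modulus_exists[OF z] by blast
  have nz: "of_int m * z + of_int n \<noteq> 0" if "(m, n) \<noteq> (0, 0)" for m n :: int
    using that z by (auto simp: complex_eq_iff)
  have "gcd c d = 1"
  proof (rule ccontr)
    assume g1: "gcd c d \<noteq> 1"
    define g where "g = gcd c d"
    have "g \<noteq> 0" using cd by (auto simp: g_def)
    moreover have "g \<ge> 0" "g \<noteq> 1" using g1 by (simp_all add: g_def)
    ultimately have g: "g \<ge> 2" by linarith
    obtain c' d' where c': "c = g * c'" "d = g * d'" unfolding g_def by (meson dvdE gcd_dvd1 gcd_dvd2)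
    have c0: "(c', d') \<noteq> (0, 0)" using cd c' by auto
    have "cmod (of_int c * z + of_int d) = of_int g * cmod (of_int c' * z + of_int d')"
    proof -
      have "of_int c * z + of_int d = of_int g * (of_int c' * z + of_int d')" by (simp add: c' algebra_simps)
      then show ?thesis using g by (simp add: norm_mult)
    qed
    moreover have "cmod (of_int c' * z + of_int d') > 0" using nz[OF c0] by simp
    moreover have "real_of_int g \<ge> 2" using g by simp
    ultimately have "1 * cmod (of_int c' * z + of_int d') < cmod (of_int c * z + of_int d)"
      by (simp only:) (intro mult_strict_right_mono, auto)
    then show False using min[OF c0] by simp
  qed
  then obtain u v where "u * c + v * d = 1" using bezout_int[of c d] by auto
  then obtain a b where ab: "a * d - b * c = 1" by (intro that[of v "- u"]) simp
  define A where "A = mat2 (of_int a) (of_int b) (of_int c) (of_int d)"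
  have A: "A \<in> Gamma0 1" unfolding A_def Gamma0_mat2 using ab by simp
  note SA = Gamma0_SL2[OF A]
  define w where "w = moebius A z"
  define n where "n = - round (Re w)"
  define T where "T = mat2 (of_int 1) (of_int n) (of_int 0) (of_int 1)"
  have T: "T \<in> Gamma0 1" unfolding T_def Gamma0_mat2 by simp
  have w: "Im w > 0" unfolding w_def by (rule moebius_uhp[OF SA z])
  have TA: "moebius (T ** A) z = w + of_int n"
    using moebius_mult[OF Gamma0_SL2[OF T] SA z] by (simp add: w_def[symmetric]) (simp add: T_def moebius_def)
  have jz: "jac A z = of_int c * z + of_int d" by (simp add: A_def jac_def)
  have "1 \<le> cmod (w + of_int n)"
  proof -
    have e: "(w + of_int n) * jac A z = of_int (a + n * c) * z + of_int (b + n * d)"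
      using nz[OF cd] by (simp add: w_def moebius_jac jz) (simp add: A_def field_simps)
    have "(a + n * c, b + n * d) \<noteq> (0, 0)"
    proof
      assume "(a + n * c, b + n * d) = (0, 0)"
      then have "a = - n * c" "b = - n * d" by simp_all
      then show False using ab by simp
    qed
    from min[OF this] have "cmod (jac A z) \<le> cmod ((w + of_int n) * jac A z)"
      by (simp only: e) (simp only: jz)
    then have "1 * cmod (jac A z) \<le> cmod (w + of_int n) * cmod (jac A z)" by (simp add: norm_mult)
    moreover have "cmod (jac A z) > 0" using nz[OF cd] by (simp add: jz)
    ultimately show ?thesis by simp
  qed
  then have "1 \<le> (cmod (w + of_int n))\<^sup>2" by (rule one_le_power)
  then have n1: "1 \<le> (Re (w + of_int n))\<^sup>2 + (Im w)\<^sup>2" unfolding cmod_power2 by simp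
  have re: "\<bar>Re (w + of_int n)\<bar> \<le> 1 / 2"
    using of_int_round_abs_le[of "Re w"] by (simp add: n_def abs_minus_commute)
  then have "\<bar>Re (w + of_int n)\<bar>\<^sup>2 \<le> (1 / 2)\<^sup>2" by (intro power_mono) auto
  then have "(1 / 2)\<^sup>2 \<le> (Im w)\<^sup>2" using n1 by (simp add: power_divide)
  then have "1 / 2 \<le> Im w" by (rule power2_le_imp_le) (use w in simp)
  then have "moebius (T ** A) z \<in> siegel" using re by (simp add: TA siegel_def)
  moreover have "T ** A \<in> Gamma0 1" using T A by (rule Gamma0_mult)
  ultimately show ?thesis using that by blast
qed

lemma finite_cosets:
  assumes N: "N > 0"
  obtains T where "finite T" "T \<subseteq> Gamma0 1" "\<And>A. A \<in> Gamma0 1 \<Longrightarrow> \<exists>B\<in>T. A ** matrix_inv B \<in> Gamma0 N"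
proof -
  define f where "f A = (\<lfloor>A$1$1\<rfloor> mod int N, \<lfloor>A$1$2\<rfloor> mod int N, \<lfloor>A$2$1\<rfloor> mod int N, \<lfloor>A$2$2\<rfloor> mod int N)" for A :: "real^2^2"
  have "f ` Gamma0 1 \<subseteq> {0..<int N} \<times> {0..<int N} \<times> {0..<int N} \<times> {0..<int N}"
    using N by (auto simp: f_def)
  then have fin: "finite (f ` Gamma0 1)" by (rule finite_subset) simp
  define T where "T = (\<lambda>v. SOME B. B \<in> Gamma0 1 \<and> f B = v) ` (f ` Gamma0 1)"
  have rep: "(SOME B. B \<in> Gamma0 1 \<and> f B = f A) \<in> Gamma0 1 \<and> f (SOME B. B \<in> Gamma0 1 \<and> f B = f A) = f A" if "A \<in> Gamma0 1" for A
    by (rule someI_ex) (use that in blast)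
  show ?thesis
  proof (rule that[of T])
    show "finite T" unfolding T_def using fin by simp
    show "T \<subseteq> Gamma0 1" unfolding T_def using rep by auto
    fix A assume A: "A \<in> Gamma0 1"
    define B where "B = (SOME B. B \<in> Gamma0 1 \<and> f B = f A)"
    have B: "B \<in> Gamma0 1" "f B = f A" using rep[OF A] by (simp_all add: B_def)
    obtain a b c d :: int where a: "A = mat2 (of_int a) (of_int b) (of_int c) (of_int d)" "a * d - b * c = 1"
      using A by (auto elim: Gamma0E)
    obtain a' b' c' d' :: int where b: "B = mat2 (of_int a') (of_int b') (of_int c') (of_int d')" "a' * d' - b' * c' = 1"
      using B by (auto elim: Gamma0E)
    have "[c' = c] (mod int N)" "[d' = d] (mod int N)" using B(2) unfolding a b f_def by (simp_all add: cong_def)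
    then have "[c * d' - d * c' = c * d - d * c] (mod int N)" by (intro cong_diff cong_mult cong_refl)
    then have dv: "int N dvd c * d' - d * c'" by (simp add: cong_iff_dvd_diff mult.commute)
    have "A ** matrix_inv B = mat2 (of_int (a * d' - b * c')) (of_int (b * a' - a * b')) (of_int (c * d' - d * c')) (of_int (d * a' - c * b'))"
      unfolding SL2_inv_eq[OF Gamma0_SL2[OF B(1)]] by (simp add: a b mat2_mult algebra_simps)
    moreover have "(a * d' - b * c') * (d * a' - c * b') - (b * a' - a * b') * (c * d' - d * c') = (a * d - b * c) * (a' * d' - b' * c')"
      by (simp add: algebra_simps)
    ultimately have "A ** matrix_inv B \<in> Gamma0 N" using dv a(2) b(2) by (simp only: Gamma0_mat2) simp
    then show "\<exists>B\<in>T. A ** matrix_inv B \<in> Gamma0 N" unfolding T_def B_def using A by blast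
  qed
qed

lemma hmeas_siegel_finite: "emeasure hmeas siegel < \<infinity>"
proof -
  have "emeasure hmeas siegel = (\<integral>\<^sup>+z. ennreal (indicator upper_half_plane z / (Im z)\<^sup>2) * indicator siegel z \<partial>lborel)"
    unfolding hmeas_def by (rule emeasure_density) auto
  also have "\<dots> = (\<integral>\<^sup>+y. \<integral>\<^sup>+x. ennreal (indicator upper_half_plane (Complex x y) / y\<^sup>2) * indicator siegel (Complex x y) \<partial>lborel \<partial>lborel)"
    by (subst nn_integral_complex) auto
  also have "\<dots> = (\<integral>\<^sup>+y. ennreal (2 / y\<^sup>2) * indicator {1/2..} y \<partial>lborel)"
  proof (rule nn_integral_cong)
    fix y :: real
    have "(\<integral>\<^sup>+x. ennreal (indicator upper_half_plane (Complex x y) / y\<^sup>2) * indicator siegel (Complex x y) \<partial>lborel) =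
      (\<integral>\<^sup>+x. (ennreal (1 / y\<^sup>2) * indicator {1/2..} y) * indicator {-1..1::real} x \<partial>lborel)"
      by (rule nn_integral_cong) (auto simp: indicator_def siegel_def upper_half_plane_def abs_le_iff)
    also have "\<dots> = (ennreal (1 / y\<^sup>2) * indicator {1/2..} y) * 2"
      by (subst nn_integral_cmult_indicator) auto
    also have "\<dots> = ennreal (2 / y\<^sup>2) * indicator {1/2..} y"
      by (auto simp: indicator_def ennreal_mult[symmetric] simp flip: ennreal_numeral)
    finally show "(\<integral>\<^sup>+x. ennreal (indicator upper_half_plane (Complex x y) / y\<^sup>2) * indicator siegel (Complex x y) \<partial>lborel) =
      ennreal (2 / y\<^sup>2) * indicator {1/2..} y" .
  qed
  also have "\<dots> = ennreal (0 - (- 2 / (1/2)))"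
  proof (rule nn_integral_FTC_atLeast)
    show "((\<lambda>y::real. - 2 / y) \<longlongrightarrow> 0) at_top" by real_asymp
  qed (auto intro!: derivative_eq_intros simp: power2_eq_square)
  finally show ?thesis by simp
qed

subsection \<open>Decay of cusp forms\<close>

lemma polynomial_exp_bound:
  fixes \<kappa> :: real
  assumes "\<kappa> > 0"
  obtains C where "C > 0" "\<And>m. m \<ge> 0 \<Longrightarrow> (1 + m) ^ n * exp (- \<kappa> * m) \<le> C"
proof -
  define \<mu> where "\<mu> = \<kappa> / real (Suc n)"
  have \<mu>: "\<mu> > 0" using assms by (simp add: \<mu>_def)
  define c where "c = max 1 (1 / \<mu>)"
  have c: "c \<ge> 1" "c * \<mu> \<ge> 1" using \<mu> by (auto simp: c_def max_def field_simps)
  show ?thesis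
  proof (rule that[of "c ^ n"])
    show "c ^ n > 0" using c by simp
    fix m :: real assume m: "m \<ge> 0"
    have "1 + m \<le> c * (1 + \<mu> * m)"
    proof -
      have "1 * m \<le> (c * \<mu>) * m" using c m by (intro mult_right_mono) auto
      then show ?thesis using c by (simp add: algebra_simps)
    qed
    also have "\<dots> \<le> c * exp (\<mu> * m)" using c by (intro mult_left_mono exp_ge_add_one_self) auto
    finally have "(1 + m) ^ n \<le> (c * exp (\<mu> * m)) ^ n" using m by (intro power_mono) auto
    also have "\<dots> = c ^ n * exp (real n * (\<mu> * m))" by (simp add: power_mult_distrib exp_of_nat_mult)
    also have "\<dots> \<le> c ^ n * exp (\<kappa> * m)"
    proof -
      have "real n * \<mu> \<le> \<kappa>" using assms by (simp add: \<mu>_def field_simps)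
      then have "real n * \<mu> * m \<le> \<kappa> * m" using m by (rule mult_right_mono)
      then show ?thesis using c by (intro mult_left_mono) (auto simp: mult.assoc)
    qed
    finally have "(1 + m) ^ n * exp (- \<kappa> * m) \<le> c ^ n * exp (\<kappa> * m) * exp (- \<kappa> * m)"
      by (intro mult_right_mono) auto
    also have "\<dots> = c ^ n" by (simp add: mult.assoc flip: exp_add)
    finally show "(1 + m) ^ n * exp (- \<kappa> * m) \<le> c ^ n" .
  qed
qed

lemma cusp_form_coeff_bound:
  assumes N: "N > 0" and a: "\<And>z. Im z > 0 \<Longrightarrow> (\<lambda>n. a n * exp (2 * of_real pi * \<i> * of_nat n * z / of_nat N)) sums g z"
    and y0: "y0 > 0"
  obtains B where "B > 0" "\<And>n. norm (a n) \<le> B * exp (2 * pi * real n * y0 / real N)"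
proof -
  have nrm: "norm (exp (2 * of_real pi * \<i> * of_nat n * z / of_nat N)) = exp (- 2 * pi * real n * Im z / real N)" for n z
    by (simp add: norm_exp_eq_Re)
  have "summable (\<lambda>n. a n * exp (2 * of_real pi * \<i> * of_nat n * (\<i> * of_real y0) / of_nat N))"
    using a[of "\<i> * of_real y0"] y0 by (auto intro: sums_summable)
  then have "(\<lambda>n. a n * exp (2 * of_real pi * \<i> * of_nat n * (\<i> * of_real y0) / of_nat N)) \<longlonglongrightarrow> 0"
    by (rule summable_LIMSEQ_zero)
  then have "Bseq (\<lambda>n. a n * exp (2 * of_real pi * \<i> * of_nat n * (\<i> * of_real y0) / of_nat N))"
    by (intro convergent_imp_Bseq) (auto simp: convergent_def)
  then obtain B where B: "B > 0" "\<And>n. norm (a n * exp (2 * of_real pi * \<i> * of_nat n * (\<i> * of_real y0) / of_nat N)) \<le> B"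
    by (auto simp: Bseq_def)
  show ?thesis
  proof (rule that[OF B(1)])
    fix n
    have "norm (a n) * exp (- 2 * pi * real n * y0 / real N) \<le> B"
      using B(2)[of n] unfolding norm_mult nrm by simp
    then have "norm (a n) * exp (- 2 * pi * real n * y0 / real N) * exp (2 * pi * real n * y0 / real N) \<le> B * exp (2 * pi * real n * y0 / real N)"
      by (intro mult_right_mono) auto
    then show "norm (a n) \<le> B * exp (2 * pi * real n * y0 / real N)"
      by (simp add: mult.assoc flip: exp_add)
  qed
qed

lemma cusp_form_decay:
  assumes N: "N > 0" and G: "G \<in> cusp_forms w N" and A: "A \<in> Gamma0 1"
  obtains C where "C > 0" "\<And>z. Im z \<ge> 1 / 2 \<Longrightarrow> norm (slash w G A z) \<le> C * exp (- (pi / real N) * Im z)"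
proof -
  obtain a where a0: "a 0 = 0" and a: "\<And>z. Im z > 0 \<Longrightarrow>
      (\<lambda>n. a n * exp (2 * of_real pi * \<i> * of_nat n * z / of_nat N)) sums slash w G A z"
    using G A unfolding cusp_forms_def upper_half_plane_def by auto
  obtain B where B: "B > 0" "\<And>n. norm (a n) \<le> B * exp (2 * pi * real n * (1/4) / real N)"
    using cusp_form_coeff_bound[OF N a, of "1/4"] by auto
  define \<rho>0 where "\<rho>0 = exp (- (pi / real N) * (1 / 2))"
  have \<rho>0: "0 < \<rho>0" "\<rho>0 < 1" using N by (auto simp: \<rho>0_def)
  show ?thesis
  proof (rule that[of "B / (1 - \<rho>0)"])
    show "B / (1 - \<rho>0) > 0" using B \<rho>0 by simp
    fix z :: complex assume z: "Im z \<ge> 1 / 2"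
    define \<rho> where "\<rho> = exp (- (pi / real N) * Im z)"
    have \<rho>: "0 < \<rho>" "\<rho> \<le> \<rho>0" using z N by (auto simp: \<rho>_def \<rho>0_def field_simps)
    have \<rho>1: "\<rho> < 1" using \<rho> \<rho>0 by simp
    let ?t = "\<lambda>n. a n * exp (2 * of_real pi * \<i> * of_nat n * z / of_nat N)"
    have tb: "norm (?t n) \<le> B * \<rho> ^ n" for n
    proof -
      have "norm (?t n) = norm (a n) * exp (- 2 * pi * real n * Im z / real N)"
        unfolding norm_mult by (simp add: norm_exp_eq_Re)
      also have "\<dots> \<le> B * exp (2 * pi * real n * (1/4) / real N) * exp (- 2 * pi * real n * Im z / real N)"
        by (intro mult_right_mono B) auto
      also have "\<dots> = B * exp (real n * ((pi / real N) * (1/2 - 2 * Im z)))"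
      proof -
        have "2 * pi * real n * (1/4) / real N + (- 2 * pi * real n * Im z / real N) = real n * ((pi / real N) * (1/2 - 2 * Im z))"
          using N by (simp add: field_simps)
        then show ?thesis by (simp only: mult.assoc[of B] exp_add[symmetric])
      qed
      also have "\<dots> \<le> B * exp (real n * (- (pi / real N) * Im z))"
      proof -
        have "(pi / real N) * (1/2 - 2 * Im z) \<le> (pi / real N) * (- Im z)" using z N by (intro mult_left_mono) auto
        then have "(pi / real N) * (1/2 - 2 * Im z) \<le> - (pi / real N) * Im z" by simp
        then have "real n * ((pi / real N) * (1/2 - 2 * Im z)) \<le> real n * (- (pi / real N) * Im z)" by (rule mult_left_mono) simp
        then show ?thesis using B by (intro mult_left_mono) auto
      qed
      also have "\<dots> = B * \<rho> ^ n" by (simp only: \<rho>_def exp_of_nat_mult)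
      finally show ?thesis .
    qed
    have Im: "Im z > 0" using z by simp
    have s: "slash w G A z = (\<Sum>n. ?t (Suc n))"
      using sums_unique[OF a[OF Im]] suminf_split_head[OF sums_summable[OF a[OF Im]]] a0 by simp
    have geo: "summable (\<lambda>n. B * \<rho> * \<rho> ^ n)" using \<rho> \<rho>1 by (intro summable_mult summable_geometric) auto
    have tb': "norm (?t (Suc n)) \<le> B * \<rho> * \<rho> ^ n" for n using tb[of "Suc n"] by (simp add: mult.assoc)
    have "norm (slash w G A z) \<le> (\<Sum>n. B * \<rho> * \<rho> ^ n)"
      unfolding s by (rule norm_suminf_le[OF tb' geo])
    also have "\<dots> = B * \<rho> * (1 / (1 - \<rho>))" using \<rho> \<rho>1 by (subst suminf_mult) (auto simp: suminf_geometric intro: summable_geometric)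
    also have "\<dots> \<le> B * \<rho> * (1 / (1 - \<rho>0))"
      using \<rho> \<rho>0 \<rho>1 B by (intro mult_left_mono divide_left_mono) auto
    finally show "norm (slash w G A z) \<le> B / (1 - \<rho>0) * exp (- (pi / real N) * Im z)" by (simp add: \<rho>_def)
  qed
qed

subsection \<open>The majorant\<close>

definition maj :: "nat \<Rightarrow> real^2^2 \<Rightarrow> complex \<Rightarrow> real" where
  "maj N X z = (pfun N z X)\<^sup>2 - 2 * qform N X"

lemma maj_conj: "g \<in> SL2 \<Longrightarrow> X \<in> traceless \<Longrightarrow> Im z > 0 \<Longrightarrow> maj N (conj_act g X) (moebius g z) = maj N X z"
  by (simp add: maj_def pfun_conj qform_conj)

lemma maj_measurable [measurable]: "(\<lambda>z. maj N X z) \<in> borel_measurable borel"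
  unfolding maj_def by measurable

lemma maj_expand:
  assumes X: "X \<in> traceless" and z: "Im z > 0"
  defines "u \<equiv> (X$2$1 * ((Re z)\<^sup>2 + (Im z)\<^sup>2) - 2 * X$1$1 * Re z - X$1$2) / Im z"
    and "s \<equiv> 2 * (X$2$1 * Re z - X$1$1)"
  shows "maj N X z = real N / 2 * (u\<^sup>2 + (u - 2 * X$2$1 * Im z)\<^sup>2 + s\<^sup>2)"
    and "(cmod (Qpoly N X z))\<^sup>2 = (real N * Im z)\<^sup>2 * ((u - 2 * X$2$1 * Im z)\<^sup>2 + s\<^sup>2)"
proof -
  define x y x1 x2 x3 where "x = Re z" and "y = Im z" and "x1 = X$1$2" and "x2 = X$1$1" and "x3 = X$2$1"
  note defs = x_def[symmetric] y_def[symmetric] x1_def[symmetric] x2_def[symmetric] x3_def[symmetric]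
  have y: "y > 0" using z by (simp add: y_def)
  define A where "A = x3 * (x\<^sup>2 + y\<^sup>2) - 2 * x2 * x - x1"
  have u: "u = A / y" by (simp add: u_def A_def defs)
  have s: "s = 2 * (x3 * x - x2)" by (simp add: s_def defs)
  have X22: "X$2$2 = - x2" using X by (simp add: traceless_def x2_def)
  have p2: "(pfun N z X)\<^sup>2 = real N * u\<^sup>2"
    unfolding pfun_def cmod_power2 defs u A_def using y by (simp add: power_mult_distrib power_divide)
  have q: "qform N X = - real N * (x2\<^sup>2 + x1 * x3)"
    by (simp add: qform_def det_2 X22 defs power2_eq_square algebra_simps)
  have key: "(A - 2 * x3 * y\<^sup>2)\<^sup>2 + 4 * y\<^sup>2 * (x3 * x - x2)\<^sup>2 = A\<^sup>2 + 4 * y\<^sup>2 * (x2\<^sup>2 + x1 * x3)"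
    unfolding A_def by (simp add: algebra_simps power2_eq_square)
  have uw: "(u - 2 * x3 * y)\<^sup>2 + s\<^sup>2 = u\<^sup>2 + 4 * (x2\<^sup>2 + x1 * x3)"
  proof -
    have "y\<^sup>2 * ((u - 2 * x3 * y)\<^sup>2 + s\<^sup>2) = (A - 2 * x3 * y\<^sup>2)\<^sup>2 + 4 * y\<^sup>2 * (x3 * x - x2)\<^sup>2"
      unfolding u s using y by (simp add: field_simps power2_eq_square)
    also have "\<dots> = y\<^sup>2 * (u\<^sup>2 + 4 * (x2\<^sup>2 + x1 * x3))"
      unfolding key u using y by (simp add: field_simps power2_eq_square)
    finally show ?thesis using y by simp
  qed
  show "maj N X z = real N / 2 * (u\<^sup>2 + (u - 2 * X$2$1 * Im z)\<^sup>2 + s\<^sup>2)"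
    unfolding maj_def p2 q defs add.assoc uw by (simp add: algebra_simps)
  have RI: "Re (Qpoly N X z) = real N * (A - 2 * x3 * y\<^sup>2)" "Im (Qpoly N X z) = real N * (2 * y * (x3 * x - x2))"
    unfolding Qpoly_def by (simp_all add: defs A_def power2_eq_square algebra_simps)
  have "(cmod (Qpoly N X z))\<^sup>2 = (real N)\<^sup>2 * ((A - 2 * x3 * y\<^sup>2)\<^sup>2 + 4 * y\<^sup>2 * (x3 * x - x2)\<^sup>2)"
    unfolding cmod_power2 RI power_mult_distrib by (simp add: distrib_left)
  also have "(A - 2 * x3 * y\<^sup>2)\<^sup>2 + 4 * y\<^sup>2 * (x3 * x - x2)\<^sup>2 = y\<^sup>2 * ((u - 2 * x3 * y)\<^sup>2 + s\<^sup>2)"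
    unfolding u s using y by (simp add: field_simps power2_eq_square)
  finally show "(cmod (Qpoly N X z))\<^sup>2 = (real N * Im z)\<^sup>2 * ((u - 2 * X$2$1 * Im z)\<^sup>2 + s\<^sup>2)"
    by (simp add: defs power_mult_distrib)
qed

lemma maj_nonneg: "X \<in> traceless \<Longrightarrow> Im z > 0 \<Longrightarrow> maj N X z \<ge> 0"
  by (simp add: maj_expand)

lemma Qpoly_maj_bound:
  assumes N: "N > 0" and X: "X \<in> traceless" and z: "Im z > 0"
  shows "cmod (Qpoly N X z) \<le> 2 * real N * Im z * (1 + maj N X z)"
proof -
  define u where "u = (X$2$1 * ((Re z)\<^sup>2 + (Im z)\<^sup>2) - 2 * X$1$1 * Re z - X$1$2) / Im z"
  define w where "w = u - 2 * X$2$1 * Im z"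
  define s where "s = 2 * (X$2$1 * Re z - X$1$1)"
  define m where "m = maj N X z"
  note me = maj_expand[OF X z, of N, folded u_def s_def, folded w_def m_def]
  have m0: "m \<ge> 0" using maj_nonneg[OF X z] by (simp add: m_def)
  have "w\<^sup>2 + s\<^sup>2 \<le> 2 * m"
  proof -
    have "1 * (w\<^sup>2 + s\<^sup>2) \<le> real N * (u\<^sup>2 + w\<^sup>2 + s\<^sup>2)" using N by (intro mult_mono) auto
    also have "\<dots> = 2 * m" using me(1) by simp
    finally show ?thesis by simp
  qed
  also have "2 * m \<le> (2 * (1 + m))\<^sup>2"
  proof -
    have "(2 * (1 + m))\<^sup>2 = 4 + 8 * m + 4 * (m * m)" by (simp add: power2_eq_square algebra_simps)
    then show ?thesis using m0 by simp
  qed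
  finally have "(cmod (Qpoly N X z))\<^sup>2 \<le> (real N * Im z)\<^sup>2 * (2 * (1 + m))\<^sup>2"
    unfolding me(2) by (intro mult_left_mono) auto
  also have "(real N * Im z)\<^sup>2 * (2 * (1 + m))\<^sup>2 = (2 * real N * Im z * (1 + m))\<^sup>2"
    unfolding power_mult_distrib[symmetric] by (simp only: mult_ac)
  finally have "(cmod (Qpoly N X z))\<^sup>2 \<le> (2 * real N * Im z * (1 + m))\<^sup>2" .
  then have "cmod (Qpoly N X z) \<le> 2 * real N * Im z * (1 + m)"
    by (rule power2_le_imp_le) (use m0 z in simp)
  then show ?thesis by (simp only: m_def)
qed

definition wt :: "real^2^2 \<Rightarrow> real" where
  "wt X = (1 + (X$1$1)\<^sup>2) * (1 + (X$1$2)\<^sup>2) * (1 + (X$2$1)\<^sup>2)"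

lemma maj_lower_bound:
  assumes N: "N > 0" and X: "X \<in> traceless" and z: "z \<in> siegel"
  shows "wt X \<le> (800 * (Im z)\<^sup>2 * (1 + maj N X z)) ^ 3"
proof -
  define x y x1 x2 x3 where "x = Re z" and "y = Im z" and "x1 = X$1$2" and "x2 = X$1$1" and "x3 = X$2$1"
  have y: "y \<ge> 1 / 2" and x: "\<bar>x\<bar> \<le> 1" using z by (auto simp: siegel_def x_def y_def)
  define u where "u = (x3 * (x\<^sup>2 + y\<^sup>2) - 2 * x2 * x - x1) / y"
  define w where "w = u - 2 * x3 * y"
  define s where "s = 2 * (x3 * x - x2)"
  define S where "S = u\<^sup>2 + w\<^sup>2 + s\<^sup>2"
  have Im: "Im z > 0" using y by (simp add: y_def)
  have "maj N X z = real N / 2 * S"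
    using maj_expand(1)[OF X Im, of N] by (simp add: S_def w_def u_def s_def x_def y_def x1_def x2_def x3_def)
  moreover have S0: "S \<ge> 0" by (simp add: S_def)
  ultimately have mS: "S \<le> 2 * maj N X z" using N mult_right_mono[of 1 "real N" S] by simp
  have y2: "1 \<le> 4 * y\<^sup>2" using y mult_mono[of "1/2" y "1/2" y] by (simp add: power2_eq_square)
  have x3: "x3\<^sup>2 \<le> 2 * S"
  proof -
    have "4 * (y\<^sup>2 * x3\<^sup>2) = (u - w)\<^sup>2" by (simp add: w_def power2_eq_square)
    also have "\<dots> \<le> 2 * (u\<^sup>2 + w\<^sup>2)" using zero_le_power2[of "u + w"] by (simp add: power2_eq_square algebra_simps)
    also have "\<dots> \<le> 2 * S" by (simp add: S_def)
    finally have "4 * y\<^sup>2 * x3\<^sup>2 \<le> 2 * S" by simp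
    moreover have "1 * x3\<^sup>2 \<le> 4 * y\<^sup>2 * x3\<^sup>2" using y2 by (intro mult_right_mono) auto
    ultimately show ?thesis by linarith
  qed
  have xx: "x\<^sup>2 \<le> 1" using x by (simp add: abs_square_le_1)
  have x3x: "(x3 * x)\<^sup>2 \<le> 2 * S"
  proof -
    have "x3\<^sup>2 * x\<^sup>2 \<le> x3\<^sup>2 * 1" using xx by (intro mult_left_mono) auto
    then show ?thesis using x3 by (simp add: power_mult_distrib)
  qed
  have x2: "x2\<^sup>2 \<le> 5 * S"
  proof -
    have sq2: "(p - q)\<^sup>2 \<le> 2 * p\<^sup>2 + 2 * q\<^sup>2" for p q :: real
      using zero_le_power2[of "p + q"] by (simp add: power2_eq_square algebra_simps)
    have x2e: "x2 = x3 * x - s / 2" unfolding s_def by (simp only: nonzero_mult_div_cancel_left)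
    have "x2\<^sup>2 \<le> 2 * (x3 * x)\<^sup>2 + 2 * (s / 2)\<^sup>2"
      using sq2[of "x3 * x" "s / 2"] unfolding x2e[symmetric] .
    moreover have "s\<^sup>2 \<le> S" by (simp add: S_def)
    ultimately show ?thesis using x3x S0 by (simp add: power_divide)
  qed
  have x1: "x1\<^sup>2 \<le> 4 * (2 * S + y\<^sup>2 * S + 20 * S + y\<^sup>2 * S)"
  proof -
    have e: "x1 = (x3 * x) * x + y * ((u - w) / 2) + (- 2 * x2 * x) + (- (y * u))"
      using y unfolding w_def u_def by (simp add: field_simps power2_eq_square)
    have sq4: "(a + b + c + d)\<^sup>2 \<le> 4 * (a\<^sup>2 + b\<^sup>2 + c\<^sup>2 + d\<^sup>2)" for a b c d :: real
    proof -
      have "0 \<le> (a - b)\<^sup>2 + (a - c)\<^sup>2 + (a - d)\<^sup>2 + (b - c)\<^sup>2 + (b - d)\<^sup>2 + (c - d)\<^sup>2" by simp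
      then show ?thesis by (simp add: power2_eq_square algebra_simps)
    qed
    have t1: "((x3 * x) * x)\<^sup>2 \<le> 2 * S"
    proof -
      have "(x3 * x)\<^sup>2 * x\<^sup>2 \<le> (x3 * x)\<^sup>2 * 1" using xx by (intro mult_left_mono) auto
      then show ?thesis using x3x by (simp add: power_mult_distrib)
    qed
    have t2: "(y * ((u - w) / 2))\<^sup>2 \<le> y\<^sup>2 * S"
    proof -
      have "(u - w)\<^sup>2 \<le> 2 * (u\<^sup>2 + w\<^sup>2)" using zero_le_power2[of "u + w"] by (simp add: power2_eq_square algebra_simps)
      then have "((u - w) / 2)\<^sup>2 \<le> S" unfolding S_def power_divide by (simp add: field_simps) (smt (verit) zero_le_power2)
      then show ?thesis unfolding power_mult_distrib by (intro mult_left_mono) auto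
    qed
    have t3: "(- 2 * x2 * x)\<^sup>2 \<le> 20 * S"
    proof -
      have "x2\<^sup>2 * x\<^sup>2 \<le> x2\<^sup>2 * 1" using xx by (intro mult_left_mono) auto
      then show ?thesis using x2 by (simp add: power_mult_distrib)
    qed
    have t4: "(- (y * u))\<^sup>2 \<le> y\<^sup>2 * S"
      unfolding power2_minus power_mult_distrib by (intro mult_left_mono) (auto simp: S_def)
    have "x1\<^sup>2 \<le> 4 * (((x3 * x) * x)\<^sup>2 + (y * ((u - w) / 2))\<^sup>2 + (- 2 * x2 * x)\<^sup>2 + (- (y * u))\<^sup>2)"
      using sq4[of "(x3 * x) * x" "y * ((u - w) / 2)" "- 2 * x2 * x" "- (y * u)"] unfolding e[symmetric] .
    also have "\<dots> \<le> 4 * (2 * S + y\<^sup>2 * S + 20 * S + y\<^sup>2 * S)"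
      by (intro mult_left_mono add_mono t1 t2 t3 t4) simp
    finally show ?thesis .
  qed
  define b where "b = 800 * y\<^sup>2 * (1 + maj N X z)"
  define Y where "Y = y\<^sup>2 * S"
  have SY: "S \<le> 4 * Y" using mult_right_mono[OF y2 S0] by (simp add: Y_def)
  have "y\<^sup>2 * S \<le> y\<^sup>2 * (2 * maj N X z)" using mS by (intro mult_left_mono) auto
  then have bY: "800 * y\<^sup>2 + 400 * Y \<le> b" unfolding b_def Y_def by (simp add: algebra_simps)
  have Y0: "Y \<ge> 0" using S0 by (simp add: Y_def)
  have "x1\<^sup>2 \<le> 4 * (2 * S + Y + 20 * S + Y)" using x1 by (simp only: Y_def)
  also have "4 * (2 * S + Y + 20 * S + Y) = 88 * S + 8 * Y" by simp
  finally have x1': "x1\<^sup>2 \<le> 88 * S + 8 * Y" .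
  have b1: "1 + x1\<^sup>2 \<le> b" "1 + x2\<^sup>2 \<le> b" "1 + x3\<^sup>2 \<le> b"
    using x1' x2 x3 bY SY y2 Y0 by linarith+
  have "(1 + x2\<^sup>2) * (1 + x1\<^sup>2) * (1 + x3\<^sup>2) \<le> b * b * b"
    using b1 by (intro mult_mono) (auto intro: order_trans[rotated])
  then show ?thesis by (simp add: wt_def b_def x1_def x2_def x3_def y_def power3_eq_cube)
qed

subsection \<open>Legendre symbols\<close>

lemma prime_int_gt_2_odd: "prime (p::int) \<Longrightarrow> p > 2 \<Longrightarrow> odd p"
  using prime_odd_int by auto

lemma Legendre_values: "Legendre a p = 1 \<or> Legendre a p = -1 \<or> Legendre a p = 0"
  by (auto simp: Legendre_def)

lemma Legendre_eq_0_iff: "Legendre a p = 0 \<longleftrightarrow> p dvd a"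
  by (auto simp: Legendre_def cong_0_iff)

lemma Legendre_eq_1: "\<not> p dvd a \<Longrightarrow> QuadRes p a \<Longrightarrow> Legendre a p = 1"
  by (auto simp: Legendre_def cong_0_iff)

lemma Legendre_cong: "[a = b] (mod p) \<Longrightarrow> Legendre a p = Legendre b p"
  by (simp add: Legendre_def QuadRes_def cong_def)

lemma small_cong_eq:
  fixes u v p :: int
  assumes "[u = v] (mod p)" "p > 2" "\<bar>u\<bar> \<le> 1" "\<bar>v\<bar> \<le> 1"
  shows "u = v"
proof (rule ccontr)
  assume "u \<noteq> v"
  have "p dvd u - v" using assms(1) by (simp add: cong_iff_dvd_diff)
  then have "p \<le> \<bar>u - v\<bar>" using \<open>u \<noteq> v\<close> \<open>p > 2\<close> dvd_imp_le_int[of "u - v" p] by simp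
  then show False using assms by linarith
qed

lemma Legendre_euler:
  assumes "prime (p::int)" "p > 2"
  shows "[Legendre a p = a ^ ((nat p - 1) div 2)] (mod p)"
  using euler_criterion[of "nat p" a] assms by (simp add: prime_nat_iff_prime)

lemma Legendre_mult:
  assumes p: "prime (p::int)" "p > 2"
  shows "Legendre (a * b) p = Legendre a p * Legendre b p"
proof (rule small_cong_eq[OF _ p(2)])
  have "[Legendre a p * Legendre b p = a ^ ((nat p - 1) div 2) * b ^ ((nat p - 1) div 2)] (mod p)"
    by (intro cong_mult Legendre_euler p)
  then show "[Legendre (a * b) p = Legendre a p * Legendre b p] (mod p)"
    using Legendre_euler[OF p, of "a * b"] by (metis cong_sym cong_trans power_mult_distrib)
qed (use Legendre_values[of a p] Legendre_values[of b p] Legendre_values[of "a * b" p] in \<open>auto simp: abs_mult\<close>)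

lemma Legendre_square: "\<not> p dvd a \<Longrightarrow> prime (p::int) \<Longrightarrow> Legendre (a^2) p = 1"
  by (rule Legendre_eq_1) (auto simp: QuadRes_def prime_dvd_power_iff intro: exI[of _ a])

lemma Legendre_one: "prime (p::int) \<Longrightarrow> Legendre 1 p = 1"
  by (rule Legendre_eq_1) (auto simp: QuadRes_def intro: exI[of _ 1])

lemma Legendre_minus_one:
  assumes p: "prime (p::int)" "p > 2"
  shows "Legendre (-1) p = (if p mod 4 = 1 then 1 else -1)"
proof -
  have odd: "odd p" using prime_int_gt_2_odd[OF p] .
  have "[Legendre (-1) p = (-1) ^ ((nat p - 1) div 2)] (mod p)" by (rule Legendre_euler[OF p])
  moreover have "\<bar>(-1::int) ^ ((nat p - 1) div 2)\<bar> \<le> 1" by (simp add: power_abs)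
  moreover have "\<bar>Legendre (-1) p\<bar> \<le> 1" using Legendre_values[of "-1" p] by auto
  ultimately have 1: "Legendre (-1) p = (-1) ^ ((nat p - 1) div 2)" using p(2) by (intro small_cong_eq)
  show ?thesis
  proof (cases "p mod 4 = 1")
    case True
    then obtain j where "p = 4 * j + 1" by (metis mult_div_mod_eq)
    then have "(nat p - 1) div 2 = 2 * nat j" using p(2) by (simp add: nat_eq_iff)
    then show ?thesis using True 1 by simp
  next
    case False
    then have "p mod 4 = 3" using odd by presburger
    then obtain j where "p = 4 * j + 3" by (metis mult_div_mod_eq)
    then have "(nat p - 1) div 2 = Suc (2 * nat j)" using p(2) by (simp add: nat_eq_iff)
    then show ?thesis using False 1 by simp
  qed
qed

definition psi8 :: "int \<Rightarrow> int" where
  "psi8 n = (if n mod 8 = 1 \<or> n mod 8 = 7 then 1 else -1)"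

lemma Legendre_two:
  assumes p: "prime (p::int)" "p > 2"
  shows "Legendre 2 p = psi8 p"
proof -
  have odd: "odd p" using prime_int_gt_2_odd[OF p] .
  define P where "P = nat p"
  have P: "int P = p" using p by (simp add: P_def)
  have "prime P" using p(1) by (simp add: P_def prime_nat_iff_prime)
  moreover have "2 < P" using p(2) P by linarith
  moreover have "\<not> [2 = 0] (mod int P)" using p(2) P by (auto simp: cong_0_iff dest: zdvd_imp_le)
  ultimately have "GAUSS P 2" by (simp add: GAUSS_def)
  then interpret GAUSS P 2 .
  define h where "h = (p - 1) div 2"
  have ph: "p = 2 * h + 1" "h > 0" using odd p(2) by (auto simp: h_def elim!: oddE)
  have "E = (\<lambda>x. 2 * x) ` {h div 2<..h}"
  proof -
    have C: "C = (\<lambda>x. 2 * x) ` {0<..h}"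
      unfolding C_def B_def A_def P h_def[symmetric] image_image
      by (intro image_cong refl) (use ph in auto)
    have "{x \<in> {0<..h}. h < 2 * x} = {h div 2<..h}" using ph by auto
    moreover have "(\<lambda>x. 2 * x) ` {0<..h} \<inter> {h<..} = (\<lambda>x. 2 * x) ` {x \<in> {0<..h}. h < 2 * x}" by auto
    ultimately show ?thesis unfolding E_def C P h_def[symmetric] by simp
  qed
  then have "card E = card {h div 2<..h}" by (simp add: card_image inj_on_def)
  then have cE: "int (card E) = h - h div 2" using ph by simp
  have L: "Legendre 2 p = (-1) ^ card E" using gauss_lemma P by simp
  have "even (card E) \<longleftrightarrow> even (h - h div 2)" using cE by (metis even_of_nat)
  also have "\<dots> \<longleftrightarrow> p mod 8 = 1 \<or> p mod 8 = 7" using ph by presburger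
  finally show ?thesis unfolding L psi8_def by (cases "even (card E)") auto
qed

definition pstar :: "int \<Rightarrow> int" where
  "pstar p = (if p mod 4 = 1 then p else - p)"

lemma half_parity:
  assumes "p > 2" "odd p"
  shows "even ((nat p - 1) div 2) \<longleftrightarrow> p mod 4 = 1"
proof -
  obtain j where j: "p = 2 * j + 1" using assms(2) by (elim oddE)
  then have "(nat p - 1) div 2 = nat j" using assms(1) by (simp add: nat_add_distrib nat_mult_distrib)
  moreover have "even (nat j) \<longleftrightarrow> even j" using j assms(1) by (simp add: even_nat_iff)
  moreover have "even j \<longleftrightarrow> p mod 4 = 1" using j by presburger
  ultimately show ?thesis by simp
qed

lemma Legendre_pstar:
  assumes p: "prime (p::int)" "p > 2" and q: "prime q" "q > 2" and "p \<noteq> q"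
  shows "Legendre (pstar p) q = Legendre q p"
proof -
  have odd: "odd p" "odd q" using prime_int_gt_2_odd p q by auto
  have "Legendre (int (nat p)) (int (nat q)) * Legendre (int (nat q)) (int (nat p)) = (- 1) ^ ((nat p - 1) div 2 * ((nat q - 1) div 2))"
    using assms by (intro Quadratic_Reciprocity) (auto simp: prime_nat_iff_prime)
  then have QR: "Legendre p q * Legendre q p = (- 1) ^ ((nat p - 1) div 2 * ((nat q - 1) div 2))"
    using p q by simp
  have ep: "even ((nat p - 1) div 2) \<longleftrightarrow> p mod 4 = 1" and eq: "even ((nat q - 1) div 2) \<longleftrightarrow> q mod 4 = 1"
    using half_parity p q odd by auto
  have "Legendre q p \<noteq> 0"
    using assms by (auto simp: Legendre_eq_0_iff dest: primes_dvd_imp_eq)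
  then have q1: "Legendre q p * Legendre q p = 1" using Legendre_values[of q p] by auto
  have pm: "Legendre (- p) q = Legendre (-1) q * Legendre p q" using Legendre_mult[OF q, of "-1" p] by simp
  have QR': "Legendre p q * Legendre q p = (if p mod 4 = 1 \<or> q mod 4 = 1 then 1 else -1)"
    unfolding QR minus_one_power_iff even_mult_iff ep eq ..
  have "Legendre (pstar p) q * Legendre q p = 1"
  proof (cases "p mod 4 = 1")
    case True
    then show ?thesis using QR' unfolding pstar_def by (simp only: if_True simp_thms)
  next
    case False
    have "Legendre (pstar p) q * Legendre q p = Legendre (-1) q * (Legendre p q * Legendre q p)"
      using False unfolding pstar_def by (simp only: if_False pm mult.assoc)
    then show ?thesis unfolding QR' Legendre_minus_one[OF q] using False by simp
  qed
  then have "Legendre (pstar p) q * (Legendre q p * Legendre q p) = Legendre q p" by (metis mult.assoc mult_1)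
  then show ?thesis using q1 by simp
qed

subsection \<open>The Kronecker symbol of a fundamental discriminant\<close>

lemma kronecker_one: "kronecker 1 n = 1"
proof -
  have "kronecker_prime 1 p = 1" if "p \<in> prime_factors n" for p
    using that by (auto simp: kronecker_prime_def Legendre_one dest: in_prime_factors_imp_prime)
  then show ?thesis by (simp add: kronecker_def)
qed

lemma kronecker_mult:
  assumes "m \<noteq> 0" "n \<noteq> 0"
  shows "kronecker a (m * n) = kronecker a m * kronecker a n"
proof -
  define f where "f n = (\<Prod>p\<in>prime_factors n. kronecker_prime a p ^ multiplicity p n)" for n
  have f: "f n = prod_mset (image_mset (kronecker_prime a) (prime_factorization n))" for n
    unfolding f_def image_prod_mset_multiplicity
    by (rule prod.cong) (auto simp: count_prime_factorization_prime in_prime_factors_iff)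
  have "f (m * n) = f m * f n" unfolding f using assms by (simp add: prime_factorization_mult)
  then show ?thesis using assms unfolding kronecker_def f_def[symmetric]
    by (auto simp: mult_less_0_iff)
qed

lemma kronecker_prime_eq: "prime p \<Longrightarrow> kronecker a p = kronecker_prime a p"
  using prime_gt_0_int[of p] by (simp add: kronecker_def prime_prime_factors)

definition chi2 :: "int \<Rightarrow> int \<Rightarrow> int" where
  "chi2 d n = (if d = 1 then 1 else if d = -4 then (if n mod 4 = 1 then 1 else -1)
     else if d = 8 then psi8 n else (if n mod 8 = 1 \<or> n mod 8 = 3 then 1 else -1))"

definition jchar :: "int \<Rightarrow> int \<Rightarrow> int \<Rightarrow> int" where
  "jchar d u n = chi2 d n * (\<Prod>p\<in>prime_factors u. Legendre n p)"

lemma squarefree_uminus_int: "squarefree (- (m::int)) \<longleftrightarrow> squarefree m"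
  by (simp add: squarefree_def)

lemma fundamental_discriminant_decomp:
  assumes "fundamental_discriminant D"
  obtains d u where "D = d * u" "d \<in> {1, -4, 8, -8}" "u mod 4 = 1" "squarefree u"
proof (cases "D mod 4 = 1 \<and> squarefree D")
  case True
  then show ?thesis using that[of 1 D] by simp
next
  case False
  then obtain m where m: "D = 4 * m" "m mod 4 = 2 \<or> m mod 4 = 3" "squarefree m"
    using assms by (auto simp: fundamental_discriminant_def)
  show ?thesis
  proof (cases "m mod 4 = 3")
    case True
    then have "(- m) mod 4 = 1" by presburger
    then show ?thesis using m that[of "-4" "- m"] by (simp add: squarefree_uminus_int)
  next
    case False
    then have m2: "m mod 4 = 2" using m by simp
    define u where "u = m div 2"
    have u: "m = 2 * u" using m2 unfolding u_def by presburger
    have sq: "squarefree u" using m(3) u by (metis dvd_triv_right squarefree_mono)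
    have "u mod 4 = 1 \<or> u mod 4 = 3" using m2 u by presburger
    then show ?thesis
    proof
      assume "u mod 4 = 1" then show ?thesis using that[of 8 u] m u sq by simp
    next
      assume "u mod 4 = 3"
      then have "(- u) mod 4 = 1" by presburger
      then show ?thesis using that[of "-8" "- u"] m u sq by (simp add: squarefree_uminus_int)
    qed
  qed
qed

lemma fundamental_discriminant_nz: "fundamental_discriminant D \<Longrightarrow> D \<noteq> 0"
  by (auto simp: fundamental_discriminant_def)

lemma prime_factors_odd_gt_2:
  assumes "odd (u::int)" "p \<in> prime_factors u"
  shows "prime p" "p > 2"
proof -
  show p: "prime p" using assms by auto
  have "p \<noteq> 2" using assms by (auto simp: in_prime_factors_iff)
  moreover have "p \<ge> 2" using p by (rule prime_ge_2_int)
  ultimately show "p > 2" by simp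
qed

lemma squarefree_prod_prime_factors:
  assumes "squarefree (u::int)"
  shows "(\<Prod>p\<in>prime_factors u. p) = \<bar>u\<bar>"
proof -
  have u0: "u \<noteq> 0" using assms by auto
  have m: "multiplicity p u = 1" if "p \<in> prime_factors u" for p
  proof -
    have p: "prime p" "p dvd u" using that by auto
    show ?thesis
    proof (rule multiplicity_eqI)
      show "p ^ 1 dvd u" using p by simp
      show "\<not> p ^ Suc 1 dvd u"
      proof
        assume "p ^ Suc 1 dvd u"
        then have "p ^ 2 dvd u" by (simp add: numeral_2_eq_2)
        then have "is_unit p" using assms by (auto simp: squarefree_def)
        then show False using p(1) not_prime_unit by blast
      qed
    qed
  qed
  have "(\<Prod>p\<in>prime_factors u. p) = (\<Prod>p\<in>prime_factors u. p ^ multiplicity p u)"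
    using m by (intro prod.cong) auto
  also have "\<dots> = normalize u" using u0 by (rule prod_prime_factors)
  finally show ?thesis by simp
qed

lemma pstar_prod:
  assumes "squarefree (u::int)" "u mod 4 = 1"
  shows "(\<Prod>p\<in>prime_factors u. pstar p) = u"
proof -
  have odd: "odd u" using assms by presburger
  have 1: "\<bar>\<Prod>p\<in>prime_factors u. pstar p\<bar> = \<bar>u\<bar>"
  proof -
    have "\<bar>\<Prod>p\<in>prime_factors u. pstar p\<bar> = (\<Prod>p\<in>prime_factors u. p)"
      unfolding abs_prod by (rule prod.cong) (auto simp: pstar_def dest!: in_prime_factors_imp_prime prime_gt_0_int)
    then show ?thesis using squarefree_prod_prime_factors[OF assms(1)] by simp
  qed
  have "(\<Prod>p\<in>A. pstar p) mod 4 = 1" if "finite A" "A \<subseteq> prime_factors u" for A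
    using that
  proof (induction A)
    case (insert p A)
    have "odd p" using prime_int_gt_2_odd prime_factors_odd_gt_2[OF odd] insert.prems by auto
    then have "pstar p mod 4 = 1" unfolding pstar_def by presburger
    then have "(pstar p * (\<Prod>p\<in>A. pstar p)) mod 4 = 1"
      using insert by (metis insert_subset mod_mult_eq mult_1 mod_mod_trivial)
    then show ?case using insert by simp
  qed simp
  from this[of "prime_factors u"] have "(\<Prod>p\<in>prime_factors u. pstar p) mod 4 = 1" by simp
  moreover have "(- u) mod 4 \<noteq> 1" using assms(2) by presburger
  ultimately show ?thesis using 1 by (metis abs_eq_iff)
qed

lemma chi2_mod: "d \<in> {1, -4, 8, -8} \<Longrightarrow> chi2 d (n mod 8) = chi2 d n"
  by (auto simp: chi2_def psi8_def mod_mod_cancel)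

lemma odd_mod_8: "odd (n::int) \<Longrightarrow> n mod 8 \<in> {1, 3, 5, 7}"
proof -
  assume "odd n"
  then have "n mod 8 = 1 \<or> n mod 8 = 3 \<or> n mod 8 = 5 \<or> n mod 8 = 7" by presburger
  then show ?thesis by blast
qed

lemma chi2_mult:
  assumes d: "d \<in> {1, -4, 8, -8}" and "coprime m d" "coprime n d"
  shows "chi2 d (m * n) = chi2 d m * chi2 d n"
proof (cases "d = 1")
  case True then show ?thesis by (simp add: chi2_def)
next
  case False
  then have "even d" using assms by auto
  then have odd: "odd m" "odd n" using assms coprime_common_divisor[of _ d 2] by fastforce+
  have fin: "\<forall>d\<in>{1, -4, 8, -8}. \<forall>x\<in>{1, 3, 5, 7}. \<forall>y\<in>{1, 3, 5, 7}. chi2 d (x * y) = chi2 d x * chi2 d y"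
    by (simp add: chi2_def psi8_def)
  have "chi2 d (m * n) = chi2 d ((m mod 8 * (n mod 8)) mod 8)"
    by (simp only: mod_mult_eq chi2_mod[OF d])
  also have "\<dots> = chi2 d (m mod 8) * chi2 d (n mod 8)"
    unfolding chi2_mod[OF d, of "m mod 8 * (n mod 8)"]
    using fin[rule_format, OF d odd_mod_8[OF odd(1)] odd_mod_8[OF odd(2)]] .
  finally show ?thesis by (simp only: chi2_mod[OF d])
qed

lemma psi8_mult: "odd a \<Longrightarrow> odd b \<Longrightarrow> psi8 (a * b) = psi8 a * psi8 b"
  using chi2_mult[of 8 a b] coprime_power_right_iff[of a 2 3] coprime_power_right_iff[of b 2 3]
  by (simp add: chi2_def)

lemma jchar_two:
  assumes "squarefree u" "u mod 4 = 1"
  shows "jchar 1 u 2 = psi8 u"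
proof -
  have odd: "odd u" using assms by presburger
  have A: "psi8 (\<Prod>p\<in>A. p) = (\<Prod>p\<in>A. psi8 p) \<and> odd (\<Prod>p\<in>A. p)" if "finite A" "A \<subseteq> prime_factors u" for A
    using that
  proof (induction A)
    case empty then show ?case by (simp add: psi8_def)
  next
    case (insert p A)
    have "odd p" using prime_int_gt_2_odd prime_factors_odd_gt_2[OF odd] insert.prems by auto
    then show ?case using insert by (simp add: psi8_mult)
  qed
  have "jchar 1 u 2 = (\<Prod>p\<in>prime_factors u. psi8 p)"
    unfolding jchar_def chi2_def using Legendre_two prime_factors_odd_gt_2[OF odd] by simp
  also have "\<dots> = psi8 (\<Prod>p\<in>prime_factors u. p)" using A[of "prime_factors u"] by simp
  also have "\<dots> = psi8 \<bar>u\<bar>" by (simp add: squarefree_prod_prime_factors[OF assms(1)])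
  also have "\<dots> = psi8 u"
  proof (cases "u \<ge> 0")
    case False
    have "(- u) mod 8 = 1 \<or> (- u) mod 8 = 7 \<longleftrightarrow> u mod 8 = 1 \<or> u mod 8 = 7" by presburger
    then show ?thesis using False by (simp add: psi8_def)
  qed simp
  finally show ?thesis .
qed

lemma jchar_mult:
  assumes "d \<in> {1, -4, 8, -8}" "odd u" "coprime m (d * u)" "coprime n (d * u)"
  shows "jchar d u (m * n) = jchar d u m * jchar d u n"
proof -
  have "(\<Prod>p\<in>prime_factors u. Legendre (m * n) p) = (\<Prod>p\<in>prime_factors u. Legendre m p * Legendre n p)"
    using prime_factors_odd_gt_2[OF assms(2)] by (intro prod.cong Legendre_mult) auto
  then show ?thesis using chi2_mult[OF assms(1), of m n] assms(3,4)
    by (simp add: jchar_def prod.distrib)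
qed

lemma Legendre_prod:
  assumes "prime (q::int)" "q > 2" "finite A"
  shows "Legendre (\<Prod>p\<in>A. f p) q = (\<Prod>p\<in>A. Legendre (f p) q)"
  using assms(3) by (induction A) (auto simp: Legendre_mult[OF assms(1,2)] Legendre_one[OF assms(1)])

lemma kronecker_eq_jchar:
  assumes d: "d \<in> {1, -4, 8, -8}" and u: "u mod 4 = 1" "squarefree u"
    and n: "n \<noteq> 0" "coprime n (d * u)"
  shows "kronecker (d * u) n = jchar d u n"
  using n
proof (induction n rule: prime_divisors_induct)
  case zero then show ?case by simp
next
  case (unit x)
  have odd: "odd u" using u by presburger
  have "x = 1 \<or> x = -1" using unit by auto
  then show ?case
  proof
    assume "x = 1"
    moreover have "(\<Prod>p\<in>prime_factors u. Legendre 1 p) = 1"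
      using Legendre_one by (intro prod.neutral) auto
    ultimately show ?thesis by (simp add: kronecker_def jchar_def chi2_def psi8_def)
  next
    assume x: "x = -1"
    have "(\<Prod>p\<in>prime_factors u. Legendre (-1) p) = (\<Prod>p\<in>prime_factors u. sgn (pstar p))"
    proof (rule prod.cong)
      fix p assume "p \<in> prime_factors u"
      note p = prime_factors_odd_gt_2[OF odd this]
      show "Legendre (-1) p = sgn (pstar p)" unfolding Legendre_minus_one[OF p] using p by (simp add: pstar_def)
    qed simp
    also have "\<dots> = sgn (\<Prod>p\<in>prime_factors u. pstar p)"
    proof -
      have "(\<Prod>p\<in>A. sgn (pstar p)) = sgn (\<Prod>p\<in>A. pstar p)" if "finite A" for A
        using that by (induction A) (auto simp: sgn_mult)
      then show ?thesis by simp
    qed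
    also have "\<dots> = sgn u" by (simp add: pstar_prod[OF u(2,1)])
    finally have "jchar d u x = chi2 d (-1) * sgn u" by (simp add: jchar_def x)
    moreover have "chi2 d (-1) = sgn d" using d by (auto simp: chi2_def psi8_def)
    moreover have "kronecker (d * u) x = sgn (d * u)"
      using d u by (auto simp: kronecker_def x sgn_if)
    ultimately show ?thesis by (simp add: sgn_mult)
  qed
next
  case (factor p x)
  have odd: "odd u" using u by presburger
  have x0: "x \<noteq> 0" and p0: "p \<noteq> 0" using factor by auto
  have cp: "coprime p (d * u)" and cx: "coprime x (d * u)" using factor.prems by simp_all
  have "kronecker (d * u) p = jchar d u p"
  proof (cases "p = 2")
    case True
    then have "odd (d * u)" using cp by simp
    then have "d = 1" using d by auto
    then show ?thesis using True u odd jchar_two[OF u(2,1)]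
      by (simp add: kronecker_prime_eq kronecker_prime_def psi8_def)
  next
    case False
    have p2: "p > 2" using False prime_ge_2_int[OF factor(1)] by simp
    note q = factor(1) p2
    have npd: "\<not> p dvd d * u" using cp q(1) by (metis coprime_common_divisor dvd_refl not_prime_unit)
    have "kronecker (d * u) p = Legendre d p * Legendre u p"
      using q False by (simp add: kronecker_prime_eq kronecker_prime_def Legendre_mult)
    also have "Legendre u p = Legendre (\<Prod>q\<in>prime_factors u. pstar q) p" by (simp add: pstar_prod[OF u(2,1)])
    also have "\<dots> = (\<Prod>q\<in>prime_factors u. Legendre (pstar q) p)" by (rule Legendre_prod[OF q]) simp
    also have "\<dots> = (\<Prod>q\<in>prime_factors u. Legendre p q)"
    proof (rule prod.cong)
      fix r assume r: "r \<in> prime_factors u"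
      have "r \<noteq> p" using r npd by (auto simp: in_prime_factors_iff)
      then show "Legendre (pstar r) p = Legendre p r"
        using prime_factors_odd_gt_2[OF odd r] q by (intro Legendre_pstar) auto
    qed simp
    also have "Legendre d p = chi2 d p"
    proof -
      have odp: "odd p" using prime_int_gt_2_odd[OF q] .
      have "\<not> p dvd 2" using p2 by (auto dest: zdvd_imp_le)
      then have L4: "Legendre 4 p = 1" using Legendre_square[of p 2] q by simp
      have L: "Legendre (-4) p = Legendre (-1) p" "Legendre 8 p = Legendre 2 p" "Legendre (-8) p = Legendre (-1) p * Legendre 2 p"
        using Legendre_mult[OF q, of "-1" 4] Legendre_mult[OF q, of 2 4] Legendre_mult[OF q, of "-1" 8] L4 by simp_all
      have "p mod 8 = 1 \<or> p mod 8 = 3 \<or> p mod 8 = 5 \<or> p mod 8 = 7" using odp by presburger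
      moreover have "p mod 4 = (p mod 8) mod 4" by (simp add: mod_mod_cancel)
      ultimately show ?thesis
        using d unfolding chi2_def
        by (auto simp: L Legendre_one[OF q(1)] Legendre_minus_one[OF q] Legendre_two[OF q] psi8_def)
    qed
    finally show ?thesis by (simp add: jchar_def)
  qed
  moreover have "kronecker (d * u) x = jchar d u x" using factor x0 cx by simp
  ultimately show ?case
    using kronecker_mult[OF p0 x0] jchar_mult[OF d odd cp cx] by simp
qed

lemma kronecker_cong:
  assumes D: "fundamental_discriminant D" and c: "coprime n D" and nn: "[n = n'] (mod D)"
  shows "kronecker D n = kronecker D n'"
proof (cases "D = 1")
  case True then show ?thesis by (simp add: kronecker_one)
next
  case False
  obtain d u where du: "D = d * u" "d \<in> {1, -4, 8, -8}" "u mod 4 = 1" "squarefree u"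
    using fundamental_discriminant_decomp[OF D] by blast
  have D1: "\<not> is_unit D"
  proof
    assume "is_unit D" then have "D = -1" using False by auto
    then show False using D by (auto simp: fundamental_discriminant_def)
  qed
  have c': "coprime n' D" using c nn by (metis cong_imp_coprime)
  have n0: "n \<noteq> 0" "n' \<noteq> 0" using c c' D1 by auto
  have "(\<Prod>p\<in>prime_factors u. Legendre n p) = (\<Prod>p\<in>prime_factors u. Legendre n' p)"
  proof (rule prod.cong)
    fix p assume "p \<in> prime_factors u"
    then have "p dvd D" using du by auto
    then have "[n = n'] (mod p)" using nn cong_dvd_modulus by blast
    then show "Legendre n p = Legendre n' p" by (rule Legendre_cong)
  qed simp
  moreover have "chi2 d n = chi2 d n'"
  proof -
    have dd: "d dvd n - n'" using nn du(1) by (auto simp: cong_iff_dvd_diff intro: dvd_trans)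
    consider "d = 1" | "d = -4" | "8 dvd d" using du(2) by auto
    then show ?thesis
    proof cases
      case 1 then show ?thesis by (simp add: chi2_def)
    next
      case 2
      then have "n mod 4 = n' mod 4" using dd by (simp add: mod_eq_dvd_iff)
      then show ?thesis using 2 by (simp add: chi2_def)
    next
      case 3
      then have "8 dvd n - n'" using dd dvd_trans by blast
      then have "n mod 8 = n' mod 8" by (simp add: mod_eq_dvd_iff)
      then show ?thesis using chi2_mod[OF du(2)] by metis
    qed
  qed
  ultimately show ?thesis using kronecker_eq_jchar[OF du(2,3,4)] n0 c c' du(1) by (simp add: jchar_def)
qed

lemma multiplicity_times_square:
  fixes p x :: int
  assumes "prime p" "x \<noteq> 0"
  shows "multiplicity p (p * (p * x)) = Suc (Suc (multiplicity p x))"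
proof -
  have "p \<noteq> 0" "\<not> is_unit p" using assms(1) not_prime_unit by auto
  then show ?thesis using assms(2) multiplicity_times_same[of x p] multiplicity_times_same[of "p * x" p] by simp
qed

lemma odd_multiplicity_norm_QuadRes:
  fixes p D :: int
  assumes p: "prime p"
  shows "M = x\<^sup>2 - D * y\<^sup>2 \<Longrightarrow> M \<noteq> 0 \<Longrightarrow> odd (multiplicity p M) \<Longrightarrow> QuadRes p D"
proof (induction "nat \<bar>M\<bar>" arbitrary: M x y rule: less_induct)
  case less
  have pM: "p dvd M" using less.prems(3) not_dvd_imp_multiplicity_0 by fastforce
  show ?case
  proof (cases "p dvd y")
    case False
    then have "coprime y p" using p by (metis coprime_commute prime_imp_coprime)
    then obtain z where z: "[y * z = 1] (mod p)" using cong_solve_coprime_int by blast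
    have "[x\<^sup>2 = D * y\<^sup>2] (mod p)" using pM less.prems(1) by (simp add: cong_iff_dvd_diff)
    then have "[x\<^sup>2 * z\<^sup>2 = D * y\<^sup>2 * z\<^sup>2] (mod p)" by (rule cong_scalar_right)
    also have "D * y\<^sup>2 * z\<^sup>2 = D * (y * z)\<^sup>2" by (simp add: power_mult_distrib)
    also have "[D * (y * z)\<^sup>2 = D * 1\<^sup>2] (mod p)" by (intro cong_mult cong_pow z cong_refl)
    finally show ?thesis unfolding QuadRes_def by (intro exI[of _ "x * z"]) (simp add: power_mult_distrib)
  next
    case True
    have "x\<^sup>2 = M + D * y\<^sup>2" using less.prems(1) by simp
    then have "p dvd x\<^sup>2" using pM True by (simp add: power2_eq_square)
    then have "p dvd x" using p prime_dvd_power by blast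
    then obtain x' y' where xy: "x = p * x'" "y = p * y'" using True by (auto elim!: dvdE)
    define M' where "M' = x'\<^sup>2 - D * y'\<^sup>2"
    have M: "M = p * (p * M')" using less.prems(1) unfolding M'_def xy by (simp add: power2_eq_square algebra_simps)
    have M0: "M' \<noteq> 0" using less.prems(2) M by auto
    have p1: "p > 1" using p prime_gt_1_int by blast
    have "1 * \<bar>M'\<bar> < p * (p * \<bar>M'\<bar>)"
      using p1 M0 by (metis mult.assoc mult_strict_right_mono zero_less_abs_iff less_1_mult)
    then have "nat \<bar>M'\<bar> < nat \<bar>M\<bar>" using p1 unfolding M by (simp add: abs_mult)
    moreover have "multiplicity p M = Suc (Suc (multiplicity p M'))"
      unfolding M by (rule multiplicity_times_square[OF p M0])
    ultimately show ?thesis using less.hyps[of M' x' y'] M0 less.prems(3) by (simp add: M'_def)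
  qed
qed

lemma odd_square_mod_8: "odd (x::int) \<Longrightarrow> x\<^sup>2 mod 8 = 1"
proof -
  assume "odd x"
  then obtain j where "x = 2 * j + 1" by (elim oddE)
  then have "x\<^sup>2 = 4 * (j * (j + 1)) + 1" by (simp add: power2_eq_square algebra_simps)
  moreover have "even (j * (j + 1))" by simp
  ultimately show ?thesis by (elim evenE) simp
qed

lemma odd_multiplicity_norm_two:
  fixes D :: int
  assumes D: "D mod 4 = 1"
  shows "M = x\<^sup>2 - D * y\<^sup>2 \<Longrightarrow> M \<noteq> 0 \<Longrightarrow> odd (multiplicity 2 M) \<Longrightarrow> D mod 8 = 1"
proof (induction "nat \<bar>M\<bar>" arbitrary: M x y rule: less_induct)
  case less
  have pM: "2 dvd M" using less.prems(3) not_dvd_imp_multiplicity_0 by fastforce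
  have oD: "odd D" using D by presburger
  show ?case
  proof (cases "even y")
    case False
    then have ox: "odd x" using pM less.prems(1) oD by auto
    show ?thesis
    proof (rule ccontr)
      assume "D mod 8 \<noteq> 1"
      then have "D mod 8 = 5" using D by presburger
      moreover obtain a where "x\<^sup>2 = 8 * a + 1" using odd_square_mod_8[OF ox] by (metis mult_div_mod_eq)
      moreover obtain b where "y\<^sup>2 = 8 * b + 1" using odd_square_mod_8[OF False] by (metis mult_div_mod_eq)
      moreover obtain d where "D = 8 * d + 5" using \<open>D mod 8 = 5\<close> by (metis mult_div_mod_eq)
      ultimately have "M = 2 * (2 * (2 * (a - (8 * d * b + d + 5 * b)) - 1))"
        using less.prems(1) by (simp add: algebra_simps)
      then obtain j where M: "M = 2 * (2 * (2 * j - 1))" by blast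
      have j0: "2 * j - 1 \<noteq> 0" by presburger
      then have "multiplicity 2 M = Suc (Suc (multiplicity 2 (2 * j - 1)))"
        unfolding M by (intro multiplicity_times_square j0) simp
      moreover have "multiplicity 2 (2 * j - 1) = 0" by (rule not_dvd_imp_multiplicity_0) simp
      ultimately show False using less.prems(3) by simp
    qed
  next
    case True
    then have "even x" using pM less.prems(1) oD by auto
    then obtain x' y' where xy: "x = 2 * x'" "y = 2 * y'" using True by (auto elim!: evenE)
    define M' where "M' = x'\<^sup>2 - D * y'\<^sup>2"
    have M: "M = 2 * (2 * M')" using less.prems(1) unfolding M'_def xy by (simp add: power2_eq_square algebra_simps)
    have M0: "M' \<noteq> 0" using less.prems(2) M by auto
    then have "nat \<bar>M'\<bar> < nat \<bar>M\<bar>" unfolding M by simp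
    moreover have "multiplicity 2 M = Suc (Suc (multiplicity 2 M'))"
      unfolding M by (intro multiplicity_times_square M0) simp
    ultimately show ?thesis using less.hyps[of M' x' y'] M0 less.prems(3) by (simp add: M'_def)
  qed
qed

lemma kronecker_norm:
  fixes D r K w x y :: int and N :: nat
  assumes D: "fundamental_discriminant D" and r: "[D = r\<^sup>2] (mod (4 * int N))"
    and K: "K > 0" "K dvd int N" and w: "coprime w D" and eq: "4 * K * w = x\<^sup>2 - D * y\<^sup>2"
  shows "kronecker D w = 1"
proof (cases "D = 1 \<or> w = 0")
  case True
  have "D \<noteq> -1" using D by (auto simp: fundamental_discriminant_def)
  then have "w = 0 \<Longrightarrow> D = 1" using w by (auto simp: abs_if split: if_splits)
  then show ?thesis using True by (auto simp: kronecker_one)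
next
  case False
  then have w0: "w \<noteq> 0" by simp
  have M0: "4 * K * w \<noteq> 0" using K w0 by simp
  have sgn: "\<not> (w < 0 \<and> D < 0)"
  proof
    assume *: "w < 0 \<and> D < 0"
    then have "4 * K * w < 0" using K by (simp add: mult_pos_neg)
    moreover have "D * y\<^sup>2 \<le> 0" using * by (simp add: mult_nonpos_nonneg)
    ultimately show False using eq zero_le_power2[of x] by linarith
  qed
  have "kronecker_prime D p ^ multiplicity p w = 1" if pw: "p \<in> prime_factors w" for p
  proof -
    have p: "prime p" "p dvd w" using pw by auto
    have pD: "\<not> p dvd D" using w p by (metis coprime_common_divisor not_prime_unit)
    have mult: "multiplicity p (4 * K * w) = multiplicity p 4 + multiplicity p K + multiplicity p w"
    proof -
      have "prime_elem p" "K \<noteq> 0" using p K by auto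
      then show ?thesis using w0 prime_elem_multiplicity_mult_distrib[of p "4 * K" w] prime_elem_multiplicity_mult_distrib[of p 4 K] by simp
    qed
    have "kronecker_prime D p = 1 \<or> kronecker_prime D p = -1"
      using pD Legendre_values[of D p] Legendre_eq_0_iff[of D p] by (auto simp: kronecker_prime_def)
    moreover have "kronecker_prime D p = 1" if odd: "odd (multiplicity p w)"
    proof (cases "p = 2")
      case True
      have D4: "D mod 4 = 1" using D pD True by (auto simp: fundamental_discriminant_def)
      have "D mod 8 = 1"
      proof (cases "2 dvd K")
        case True
        then have "8 dvd 4 * int N" using K(2) by (auto elim!: dvdE)
        then have "[D = r\<^sup>2] (mod 8)" using r cong_dvd_modulus by blast
        moreover have "odd r"
        proof
          assume "even r"
          then have "even (r\<^sup>2)" by simp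
          moreover have "8 dvd D - r\<^sup>2" using \<open>[D = r\<^sup>2] (mod 8)\<close> by (simp add: cong_iff_dvd_diff)
          then have "even (D - r\<^sup>2)" by (rule dvd_trans[rotated]) simp
          ultimately have "even D" by simp
          then show False using D4 by presburger
        qed
        ultimately show ?thesis using odd_square_mod_8 by (simp add: cong_def)
      next
        case False
        have "multiplicity 2 (4::int) = 2"
          using multiplicity_same_power[of "2::int" 2] by simp
        then have "odd (multiplicity 2 (4 * K * w))"
          using mult odd False \<open>p = 2\<close> by (simp add: not_dvd_imp_multiplicity_0)
        then show ?thesis using odd_multiplicity_norm_two[OF D4 eq M0] by simp
      qed
      then show ?thesis using True pD by (simp add: kronecker_prime_def)
    next
      case False
      have "QuadRes p D"
      proof (cases "p dvd K")
        case True
        then have "p dvd 4 * int N" using K(2) by (auto intro: dvd_mult dvd_trans)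
        then have "[D = r\<^sup>2] (mod p)" using r cong_dvd_modulus by blast
        then show ?thesis unfolding QuadRes_def using cong_sym by blast
      next
        case pK: False
        have "\<not> p dvd 4"
        proof
          assume "p dvd 4"
          then have "p dvd 2 ^ 2" by simp
          then have "p dvd 2" using p(1) prime_dvd_power by blast
          then have "p = 2" using p(1) by (simp add: primes_dvd_imp_eq)
          then show False using False by simp
        qed
        then have "odd (multiplicity p (4 * K * w))" using mult odd pK by (simp add: not_dvd_imp_multiplicity_0)
        then show ?thesis using odd_multiplicity_norm_QuadRes[OF p(1) eq M0] by simp
      qed
      then show ?thesis using False Legendre_eq_1[OF pD] by (simp add: kronecker_prime_def)
    qed
    ultimately show ?thesis by (cases "even (multiplicity p w)") (auto simp: minus_one_power_iff)
  qed
  then show ?thesis using w0 sgn unfolding kronecker_def by (auto intro!: prod.neutral)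
qed

definition form_rep :: "nat \<Rightarrow> int \<Rightarrow> int \<Rightarrow> int \<Rightarrow> int \<Rightarrow> bool" where
  "form_rep N a b c n \<longleftrightarrow> (\<exists>N1 N2 :: nat. N1 * N2 = N \<and>
      (\<exists>x y. n = int N1 * a * x^2 + b * x * y + int N2 * c * y^2))"

text \<open>
  Multiplying the two values and replacing \<open>disc/D\<close> by the square \<open>s\<^sup>2\<close> changes the product by a
  multiple of \<open>D\<close> only and turns it into a norm from the quadratic order of discriminant \<open>D\<close>.
\<close>
lemma kronecker_form_rep:
  fixes D r a b c n n' :: int and N :: nat
  assumes D: "fundamental_discriminant D" and r: "[D = r\<^sup>2] (mod (4 * int N))" and N: "N > 0"
    and dvd: "D dvd b\<^sup>2 - 4 * int N * a * c" and s: "[(b\<^sup>2 - 4 * int N * a * c) div D = s\<^sup>2] (mod (4 * int N))"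
    and n: "form_rep N a b c n" "coprime n D" and n': "form_rep N a b c n'" "coprime n' D"
  shows "kronecker D n = kronecker D n'"
proof (cases "D = 1")
  case True then show ?thesis by (simp add: kronecker_one)
next
  case False
  have "D \<noteq> -1" using D by (auto simp: fundamental_discriminant_def)
  then have n0: "n \<noteq> 0" "n' \<noteq> 0" using n n' False by auto
  obtain N1 N2 x y where 1: "N1 * N2 = N" "n = int N1 * a * x^2 + b * x * y + int N2 * c * y^2"
    using n by (auto simp: form_rep_def)
  obtain N1' N2' x' y' where 2: "N1' * N2' = N" "n' = int N1' * a * x'^2 + b * x' * y' + int N2' * c * y'^2"
    using n' by (auto simp: form_rep_def)
  define g where "g = gcd N1 N1'"
  have N1pos: "N1 > 0" "N1' > 0" using 1 2 N by (auto intro!: Nat.gr0I)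
  then have g: "g > 0" by (simp add: g_def)
  obtain k k' where k0: "N1 = k * g" "N1' = k' * g" "coprime k k'"
    using gcd_coprime_exists[of N1 N1'] g unfolding g_def by blast
  have k: "N1 = g * k" "N1' = g * k'" "coprime k k'" using k0 by (simp_all only: mult.commute)
  have kpos: "k > 0" "k' > 0" using k N1pos by auto
  obtain M where M: "N = g * k * k' * M"
  proof -
    have "g * k * N2 = g * k' * N2'" using 1 2 k by simp
    then have "k * N2 = k' * N2'" using g by simp
    then have "k' dvd k * N2" by simp
    then have "k' dvd N2" using k(3) by (simp add: coprime_commute coprime_dvd_mult_right_iff)
    then obtain t where "N2 = k' * t" by (elim dvdE)
    then have "N = g * k * k' * t" using 1(1) k(1) by (simp only: mult.assoc)
    then show ?thesis by (rule that)
  qed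
  have N2: "N2 = k' * M"
  proof -
    have "(g * k) * N2 = (g * k) * (k' * M)" using 1(1) M k(1) by (simp only: mult.assoc)
    then show ?thesis using g kpos by (simp only: mult_cancel1) simp
  qed
  have N2': "N2' = k * M"
  proof -
    have "(g * k') * N2' = (g * k') * (k * M)" using 2(1) M k(2) by (simp only: ac_simps)
    then show ?thesis using g kpos by (simp only: mult_cancel1) simp
  qed
  define disc where "disc = b\<^sup>2 - 4 * int N * a * c"
  define K where "K = int k * int k'"
  define P where "P = 2 * (int g * a * (k * x) * (k' * x')) + b * (k * x * y' + k' * x' * y) + 2 * (int k * int k' * int M * c) * y * y'"
  define R where "R = k * x * y' - k' * x' * y"
  have prod: "4 * K * (n * n') = P\<^sup>2 - disc * R\<^sup>2"
  proof -
    have kn: "int k * n = int g * a * (k * x)\<^sup>2 + b * (k * x) * y + (int k * int k' * int M * c) * y\<^sup>2"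
      unfolding 1(2) N2 k(1) by (simp add: algebra_simps power2_eq_square)
    have kn': "int k' * n' = int g * a * (k' * x')\<^sup>2 + b * (k' * x') * y' + (int k * int k' * int M * c) * y'\<^sup>2"
      unfolding 2(2) N2' k(2) by (simp add: algebra_simps power2_eq_square)
    have dd: "disc = b\<^sup>2 - 4 * (int g * a) * (int k * int k' * int M * c)"
      unfolding disc_def M by (simp add: algebra_simps)
    have id: "4 * (A * X\<^sup>2 + B * X * Y + C * Y\<^sup>2) * (A * X'\<^sup>2 + B * X' * Y' + C * Y'\<^sup>2) =
      (2 * (A * X * X') + B * (X * Y' + X' * Y) + 2 * C * Y * Y')\<^sup>2 - (B\<^sup>2 - 4 * A * C) * (X * Y' - X' * Y)\<^sup>2"
      for A B C X Y X' Y' :: int by (simp add: algebra_simps power2_eq_square)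
    have "4 * K * (n * n') = 4 * (int k * n) * (int k' * n')" by (simp add: K_def)
    also have "\<dots> = P\<^sup>2 - disc * R\<^sup>2" unfolding kn kn' id dd P_def R_def by (simp add: mult.assoc)
    finally show ?thesis .
  qed
  obtain D' where D': "disc = D * D'" using dvd by (auto simp: disc_def)
  then have "disc div D = D'" using fundamental_discriminant_nz[OF D] by simp
  then obtain j where j: "D' - s\<^sup>2 = 4 * int N * j" using s unfolding disc_def[symmetric] by (auto simp: cong_iff_dvd_diff)
  define w where "w = n * n' + D * (R\<^sup>2 * int g * int M * j)"
  have "4 * K * w = 4 * K * (n * n') + D * R\<^sup>2 * (4 * int N * j)"
    unfolding w_def K_def M by (simp add: algebra_simps)
  also have "\<dots> = P\<^sup>2 - D * (s * R)\<^sup>2" unfolding prod D' j[symmetric] by (simp add: algebra_simps power2_eq_square)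
  finally have norm: "4 * K * w = P\<^sup>2 - D * (s * R)\<^sup>2" .
  have wn: "[n * n' = w] (mod D)" by (simp add: w_def cong_iff_dvd_diff)
  have cn: "coprime (n * n') D" using n n' by simp
  then have cw: "coprime w D" using wn by (metis cong_imp_coprime)
  have "K dvd int N" unfolding K_def M by (auto intro!: dvdI[of _ _ "int g * int M"] simp: ac_simps)
  then have "kronecker D w = 1" using kronecker_norm[OF D r _ _ cw norm] kpos by (simp add: K_def)
  then have "kronecker D n * kronecker D n' = 1" using kronecker_cong[OF D cn wn] kronecker_mult[OF n0] by simp
  then show ?thesis by (auto simp: zmult_eq_1_iff)
qed

subsection \<open>The dual lattice and the genus character\<close>

definition dvec :: "nat \<Rightarrow> int \<Rightarrow> int \<Rightarrow> int \<Rightarrow> real^2^2" where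
  "dvec N a b c = mat2 (of_int b / (2 * real N)) (- of_int a / real N) (of_int c) (- of_int b / (2 * real N))"

lemma lattice_dvec: "N > 0 \<Longrightarrow> lattice N = {dvec N a (2 * int N * b) c | a b c. True}"
  by (auto simp: lattice_def dvec_def)

lemma bform_mat2: "X \<in> traceless \<Longrightarrow> Y \<in> traceless \<Longrightarrow>
  bform N X Y = - real N * (2 * X$1$1 * Y$1$1 + X$1$2 * Y$2$1 + X$2$1 * Y$1$2)"
  by (simp add: bform_def qform_def det_2 traceless_def algebra_simps)

lemma dvec_traceless: "dvec N a b c \<in> traceless"
  by (simp add: dvec_def traceless_def)

lemma dual_lattice_dvec:
  assumes N: "N > 0"
  shows "dual_lattice N = {dvec N a b c | a b c. True}"
proof (intro equalityI subsetI)
  fix X assume X: "X \<in> dual_lattice N"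
  have tr: "X \<in> traceless" using X by (simp add: dual_lattice_def rat_space_def trace_2 traceless_def)
  have int: "bform N X (dvec N a (2 * int N * b) c) \<in> \<int>" for a b c
    using X N by (auto simp: dual_lattice_def lattice_dvec)
  have "real N * (2 * X$1$1) \<in> \<int>" using int[of 0 1 0] N tr
    by (simp add: bform_mat2 dvec_traceless) (simp add: dvec_def minus_in_Ints_iff)
  then obtain b where b: "real N * (2 * X$1$1) = of_int b" by (auto elim: Ints_cases)
  have "real N * X$1$2 \<in> \<int>" using int[of 0 0 1] N tr
    by (simp add: bform_mat2 dvec_traceless) (simp add: dvec_def minus_in_Ints_iff)
  then obtain a where a: "real N * X$1$2 = of_int a" by (auto elim: Ints_cases)
  have "X$2$1 \<in> \<int>" using int[of 1 0 0] N tr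
    by (simp add: bform_mat2 dvec_traceless) (simp add: dvec_def minus_in_Ints_iff)
  then obtain c where c: "X$2$1 = of_int c" by (auto elim: Ints_cases)
  have "X = dvec N (- a) b c"
    using a b c N tr by (simp add: mat2_eq_iff dvec_def traceless_def field_simps)
  then show "X \<in> {dvec N a b c | a b c. True}" by blast
next
  fix X assume "X \<in> {dvec N a b c | a b c. True}"
  then obtain a b c where X: "X = dvec N a b c" by blast
  have "bform N X Y \<in> \<int>" if Ylat: "Y \<in> lattice N" for Y
  proof -
    obtain a' b' c' where Y: "Y = dvec N a' (2 * int N * b') c'" using Ylat unfolding lattice_dvec[OF N] by blast
    have "bform N X Y = of_int (a * c' + c * a' - b * b')"
      unfolding X Y bform_mat2[OF dvec_traceless dvec_traceless] using N by (simp add: dvec_def field_simps)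
    then show ?thesis by simp
  qed
  moreover have "X \<in> rat_space" by (simp add: rat_space_def X trace_2 forall_2 dvec_def)
  ultimately show "X \<in> dual_lattice N" by (simp add: dual_lattice_def)
qed

lemma qform_dvec: "N > 0 \<Longrightarrow> qform N (dvec N a b c) = - of_int (b\<^sup>2 - 4 * int N * a * c) / (4 * real N)"
  by (simp add: qform_def dvec_def det_mat2 field_simps power2_eq_square)

definition gchar :: "nat \<Rightarrow> int \<Rightarrow> int \<Rightarrow> int \<Rightarrow> int \<Rightarrow> int" where
  "gchar N \<Delta> a b c =
     (if \<Delta> dvd b\<^sup>2 - 4 * int N * a * c \<and> (\<exists>s. [(b\<^sup>2 - 4 * int N * a * c) div \<Delta> = s^2] (mod (4 * int N))) \<and>
         gcd a (gcd b (gcd c \<Delta>)) = 1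
      then kronecker \<Delta> (SOME n. coprime n \<Delta> \<and> form_rep N a b c n) else 0)"

lemma genus_character_dvec: "N > 0 \<Longrightarrow> genus_character N \<Delta> (dvec N a b c) = gchar N \<Delta> a b c"
  by (auto simp: genus_character_def gchar_def form_rep_def Let_def dvec_def)

lemma gchar_shift:
  assumes D: "fundamental_discriminant \<Delta>" and r: "[\<Delta> = r\<^sup>2] (mod (4 * int N))" and N: "N > 0"
  shows "gchar N \<Delta> (a + \<Delta> * u) (b + \<Delta> * (2 * int N * v)) (c + \<Delta> * w) = gchar N \<Delta> a b c"
proof -
  define a' b' c' where "a' = a + \<Delta> * u" and "b' = b + \<Delta> * (2 * int N * v)" and "c' = c + \<Delta> * w"
  define d d' where "d = b\<^sup>2 - 4 * int N * a * c" and "d' = b'\<^sup>2 - 4 * int N * a' * c'"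
  define j where "j = b * v + \<Delta> * int N * v\<^sup>2 - (a * w + u * c + \<Delta> * u * w)"
  have dd: "d' = d + \<Delta> * (4 * int N * j)"
    unfolding d_def d'_def a'_def b'_def c'_def j_def by (simp add: algebra_simps power2_eq_square)
  have D0: "\<Delta> \<noteq> 0" using fundamental_discriminant_nz[OF D] .
  have 1: "\<Delta> dvd d' \<longleftrightarrow> \<Delta> dvd d" unfolding dd by (simp add: dvd_add_left_iff)
  have 2: "[d' div \<Delta> = s] (mod (4 * int N)) \<longleftrightarrow> [d div \<Delta> = s] (mod (4 * int N))" if "\<Delta> dvd d" for s
  proof -
    have "d' div \<Delta> = d div \<Delta> + 4 * int N * j" unfolding dd using D0 that by simp
    then show ?thesis by (simp add: cong_def)
  qed
  have 3: "gcd a' (gcd b' (gcd c' \<Delta>)) = gcd a (gcd b (gcd c \<Delta>))"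
  proof (rule associated_eqI)
    have "gcd a' (gcd b' (gcd c' \<Delta>)) dvd a' - \<Delta> * u" "gcd a' (gcd b' (gcd c' \<Delta>)) dvd b' - \<Delta> * (2 * int N * v)" "gcd a' (gcd b' (gcd c' \<Delta>)) dvd c' - \<Delta> * w"
      by (intro dvd_diff dvd_mult2; meson dvd_trans gcd_dvd1 gcd_dvd2)+
    then show "gcd a' (gcd b' (gcd c' \<Delta>)) dvd gcd a (gcd b (gcd c \<Delta>))"
      by (intro gcd_greatest) (auto simp: a'_def b'_def c'_def intro: dvd_trans[OF gcd_dvd2])
    have "gcd a (gcd b (gcd c \<Delta>)) dvd a + \<Delta> * u" "gcd a (gcd b (gcd c \<Delta>)) dvd b + \<Delta> * (2 * int N * v)" "gcd a (gcd b (gcd c \<Delta>)) dvd c + \<Delta> * w"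
      by (intro dvd_add dvd_mult2; meson dvd_trans gcd_dvd1 gcd_dvd2)+
    then show "gcd a (gcd b (gcd c \<Delta>)) dvd gcd a' (gcd b' (gcd c' \<Delta>))"
      by (intro gcd_greatest) (auto simp: a'_def b'_def c'_def intro: dvd_trans[OF gcd_dvd2])
  qed simp_all
  show ?thesis
  proof (cases "\<Delta> dvd d \<and> (\<exists>s. [d div \<Delta> = s^2] (mod (4 * int N))) \<and> gcd a (gcd b (gcd c \<Delta>)) = 1")
    case False
    then have "\<not> (\<Delta> dvd d' \<and> (\<exists>s. [d' div \<Delta> = s^2] (mod (4 * int N))) \<and> gcd a' (gcd b' (gcd c' \<Delta>)) = 1)"
      using 1 2 3 by auto
    then have "gchar N \<Delta> a' b' c' = 0" unfolding d'_def gchar_def by (rule if_not_P)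
    moreover have "gchar N \<Delta> a b c = 0" using False unfolding d_def gchar_def by (rule if_not_P)
    ultimately show ?thesis by (simp add: a'_def b'_def c'_def)
  next
    case True
    then obtain s where s: "[d div \<Delta> = s^2] (mod (4 * int N))" by blast
    have s': "[d' div \<Delta> = s^2] (mod (4 * int N))" using 2 True s by blast
    have True': "\<Delta> dvd d' \<and> (\<exists>s. [d' div \<Delta> = s^2] (mod (4 * int N))) \<and> gcd a' (gcd b' (gcd c' \<Delta>)) = 1"
      using 1 2 3 True by auto
    let ?P = "\<lambda>n. coprime n \<Delta> \<and> form_rep N a b c n" and ?P' = "\<lambda>n. coprime n \<Delta> \<and> form_rep N a' b' c' n"
    have to: "\<exists>n'. form_rep N a' b' c' n' \<and> [n = n'] (mod \<Delta>)" if n: "form_rep N a b c n" for n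
    proof -
      obtain N1 N2 x y where e: "N1 * N2 = N" "n = int N1 * a * x^2 + b * x * y + int N2 * c * y^2"
        using n by (auto simp: form_rep_def)
      define n' where "n' = int N1 * a' * x^2 + b' * x * y + int N2 * c' * y^2"
      have "n' - n = \<Delta> * (int N1 * u * x^2 + 2 * int N * v * x * y + int N2 * w * y^2)"
        unfolding n'_def e a'_def b'_def c'_def by (simp add: algebra_simps)
      then have "[n' = n] (mod \<Delta>)" by (simp add: cong_iff_dvd_diff)
      moreover have "form_rep N a' b' c' n'" unfolding form_rep_def n'_def using e(1) by blast
      ultimately show ?thesis using cong_sym by blast
    qed
    have rev: "\<exists>n'. form_rep N a b c n' \<and> [n = n'] (mod \<Delta>)" if n: "form_rep N a' b' c' n" for n
    proof -
      obtain N1 N2 x y where e: "N1 * N2 = N" "n = int N1 * a' * x^2 + b' * x * y + int N2 * c' * y^2"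
        using n by (auto simp: form_rep_def)
      define n' where "n' = int N1 * a * x^2 + b * x * y + int N2 * c * y^2"
      have "n - n' = \<Delta> * (int N1 * u * x^2 + 2 * int N * v * x * y + int N2 * w * y^2)"
        unfolding n'_def e a'_def b'_def c'_def by (simp add: algebra_simps)
      then have "[n = n'] (mod \<Delta>)" by (simp add: cong_iff_dvd_diff)
      moreover have "form_rep N a b c n'" unfolding form_rep_def n'_def using e(1) by blast
      ultimately show ?thesis by blast
    qed
    have "kronecker \<Delta> (SOME n. ?P' n) = kronecker \<Delta> (SOME n. ?P n)"
    proof (cases "\<exists>n. ?P n")
      case ex: True
      then have P: "?P (SOME n. ?P n)" by (rule someI_ex)
      obtain m where m: "form_rep N a' b' c' m" "[(SOME n. ?P n) = m] (mod \<Delta>)" using to P by blast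
      have cm: "coprime m \<Delta>" using m(2) P by (metis cong_imp_coprime)
      then have "\<exists>n. ?P' n" using m by blast
      then have P': "?P' (SOME n. ?P' n)" by (rule someI_ex)
      have "kronecker \<Delta> (SOME n. ?P' n) = kronecker \<Delta> m"
        using kronecker_form_rep[OF D r N, of b' a' c' s "SOME n. ?P' n" m] P' m(1) cm True' s' unfolding d'_def by blast
      also have "\<dots> = kronecker \<Delta> (SOME n. ?P n)" using kronecker_cong[OF D _ m(2)] P by simp
      finally show ?thesis .
    next
      case no: False
      have "\<not> ?P' n" for n
      proof
        assume "?P' n"
        then obtain m where "form_rep N a b c m" "[n = m] (mod \<Delta>)" using rev by blast
        then show False using no \<open>?P' n\<close> by (metis cong_imp_coprime)
      qed
      then have "?P = ?P'" using no by auto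
      then show ?thesis by metis
    qed
    moreover have "gchar N \<Delta> a' b' c' = kronecker \<Delta> (SOME n. ?P' n)" using True' unfolding d'_def gchar_def by (rule if_P)
    moreover have "gchar N \<Delta> a b c = kronecker \<Delta> (SOME n. ?P n)" using True unfolding d_def gchar_def by (rule if_P)
    ultimately show ?thesis by (simp add: a'_def b'_def c'_def)
  qed
qed

lemma dvec_conj:
  assumes N: "N > 0" and A: "A = mat2 (of_int p) (of_int q) (of_int (int N * t)) (of_int v)" "p * v - q * (int N * t) = 1"
  shows "conj_act A (dvec N a b c) = dvec N (p\<^sup>2 * a + p * q * b + int N * q\<^sup>2 * c)
     ((p * v + int N * q * t) * b + 2 * int N * p * t * a + 2 * int N * q * v * c) (int N * t\<^sup>2 * a + t * v * b + v\<^sup>2 * c)"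
proof -
  have "real_of_int (p * v - q * (int N * t)) = 1" using A(2) by simp
  then have "A \<in> SL2" unfolding A(1) SL2_mat2 by simp
  from conj_act_mat2[OF this dvec_traceless[of N a b c]] show ?thesis
    using N unfolding A(1) by (simp add: dvec_def mat2_eq_iff field_simps power2_eq_square)
qed

lemma gchar_conj_aux:
  fixes p q t v a b c \<Delta> :: int and N :: nat
  defines "a' \<equiv> p\<^sup>2 * a + p * q * b + int N * q\<^sup>2 * c"
    and "b' \<equiv> (p * v + int N * q * t) * b + 2 * int N * p * t * a + 2 * int N * q * v * c"
    and "c' \<equiv> int N * t\<^sup>2 * a + t * v * b + v\<^sup>2 * c"
  assumes det: "p * v - q * (int N * t) = 1"
  shows "b'\<^sup>2 - 4 * int N * a' * c' = b\<^sup>2 - 4 * int N * a * c"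
    and "gcd a (gcd b (gcd c \<Delta>)) dvd gcd a' (gcd b' (gcd c' \<Delta>))"
    and "form_rep N a' b' c' n \<Longrightarrow> form_rep N a b c n"
proof -
  have "b'\<^sup>2 - 4 * int N * a' * c' = (p * v - q * (int N * t))\<^sup>2 * (b\<^sup>2 - 4 * int N * a * c)"
    unfolding a'_def b'_def c'_def by (simp add: algebra_simps power2_eq_square)
  then show "b'\<^sup>2 - 4 * int N * a' * c' = b\<^sup>2 - 4 * int N * a * c" using det by simp
  let ?g = "gcd a (gcd b (gcd c \<Delta>))"
  have g: "?g dvd a" "?g dvd b" "?g dvd c" "?g dvd \<Delta>" by (meson dvd_trans gcd_dvd1 gcd_dvd2)+
  then show "?g dvd gcd a' (gcd b' (gcd c' \<Delta>))"
    unfolding a'_def b'_def c'_def by (intro gcd_greatest dvd_add dvd_mult) auto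
  assume "form_rep N a' b' c' n"
  then obtain N1 N2 x y where e: "N1 * N2 = N" "n = int N1 * a' * x^2 + b' * x * y + int N2 * c' * y^2"
    by (auto simp: form_rep_def)
  have Ne: "int N = int N1 * int N2" using e(1) by auto
  have "n = int N1 * a * (p * x + int N2 * t * y)^2 + b * (p * x + int N2 * t * y) * (int N1 * q * x + v * y) + int N2 * c * (int N1 * q * x + v * y)^2"
    unfolding e(2) a'_def b'_def c'_def Ne by (simp add: algebra_simps power2_eq_square)
  then show "form_rep N a b c n" unfolding form_rep_def using e(1) by blast
qed

lemma genus_character_conj:
  assumes N: "N > 0" and A: "A \<in> Gamma0 N" and X: "X \<in> dual_lattice N"
  shows "genus_character N \<Delta> (conj_act A X) = genus_character N \<Delta> X" and "conj_act A X \<in> dual_lattice N"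
proof -
  have key: "\<exists>a b c a' b' c'. X = dvec N a b c \<and> conj_act A X = dvec N a' b' c' \<and>
     b'\<^sup>2 - 4 * int N * a' * c' = b\<^sup>2 - 4 * int N * a * c \<and> gcd a (gcd b (gcd c \<Delta>)) dvd gcd a' (gcd b' (gcd c' \<Delta>)) \<and>
     (\<forall>n. form_rep N a' b' c' n \<longrightarrow> form_rep N a b c n)" if A: "A \<in> Gamma0 N" and X: "X \<in> dual_lattice N" for A X
  proof -
    obtain a b c where X': "X = dvec N a b c" using X N by (auto simp: dual_lattice_dvec)
    obtain p q u v :: int where A': "A = mat2 (of_int p) (of_int q) (of_int u) (of_int v)" "p * v - q * u = 1" "int N dvd u"
      using A by (auto elim: Gamma0E)
    then obtain t where t: "u = int N * t" by (auto elim: dvdE)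
    note det = A'(2)[unfolded t]
    show ?thesis unfolding X' dvec_conj[OF N A'(1)[unfolded t] det]
      by (intro exI conjI allI impI, rule refl, rule refl, rule gchar_conj_aux(1)[OF det],
          rule gchar_conj_aux(2)[OF det], erule gchar_conj_aux(3)[OF det])
  qed
  obtain a b c a' b' c' where 1: "X = dvec N a b c" "conj_act A X = dvec N a' b' c'"
     "b'\<^sup>2 - 4 * int N * a' * c' = b\<^sup>2 - 4 * int N * a * c" "gcd a (gcd b (gcd c \<Delta>)) dvd gcd a' (gcd b' (gcd c' \<Delta>))"
     "\<And>n. form_rep N a' b' c' n \<Longrightarrow> form_rep N a b c n"
    using key[OF A X] by blast
  show dual: "conj_act A X \<in> dual_lattice N" using 1(2) N by (auto simp: dual_lattice_dvec)
  have inj: "a1 = a2 \<and> b1 = b2 \<and> c1 = c2" if "dvec N a1 b1 c1 = dvec N a2 b2 c2" for a1 b1 c1 a2 b2 c2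
    using that N by (simp add: dvec_def mat2_eq_iff)
  obtain a2 b2 c2 a3 b3 c3 where 2: "conj_act A X = dvec N a2 b2 c2" "conj_act (matrix_inv A) (conj_act A X) = dvec N a3 b3 c3"
     "gcd a2 (gcd b2 (gcd c2 \<Delta>)) dvd gcd a3 (gcd b3 (gcd c3 \<Delta>))"
     "\<And>n. form_rep N a3 b3 c3 n \<Longrightarrow> form_rep N a2 b2 c2 n"
    using key[OF Gamma0_inv[OF A] dual] by blast
  have "dvec N a2 b2 c2 = dvec N a' b' c'" using 1(2) 2(1) by simp
  from inj[OF this] have e2: "a2 = a'" "b2 = b'" "c2 = c'" by simp_all
  have "dvec N a3 b3 c3 = dvec N a b c" using 1(1) 2(2) conj_act_inv[OF Gamma0_SL2[OF A], of X] by simp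
  from inj[OF this] have e3: "a3 = a" "b3 = b" "c3 = c" by simp_all
  note 3 = 2(3,4)[unfolded e2 e3]
  have "gcd a' (gcd b' (gcd c' \<Delta>)) = gcd a (gcd b (gcd c \<Delta>))"
    by (rule zdvd_antisym_nonneg[OF gcd_ge_0_int gcd_ge_0_int 3(1) 1(4)])
  moreover have "form_rep N a' b' c' = form_rep N a b c"
  proof (intro ext iffI)
    show "form_rep N a b c n" if "form_rep N a' b' c' n" for n using 1(5)[OF that] .
    show "form_rep N a' b' c' n" if "form_rep N a b c n" for n using 3(2)[OF that] .
  qed
  ultimately show "genus_character N \<Delta> (conj_act A X) = genus_character N \<Delta> X"
    unfolding 1(2) unfolding 1(1) genus_character_dvec[OF N] gchar_def 1(3) by (simp only:)
qed

subsection \<open>Absolute convergence\<close>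

definition hcut :: "(complex \<Rightarrow> complex) \<Rightarrow> complex \<Rightarrow> complex" where
  "hcut f z = (if Im z > 0 then f z else 0)"

lemma hcut_measurable: "f holomorphic_on upper_half_plane \<Longrightarrow> hcut f \<in> borel_measurable borel"
  unfolding hcut_def using uhp_borel_measurable holomorphic_on_imp_continuous_on by blast

definition pmaj :: "nat \<Rightarrow> nat \<Rightarrow> real \<Rightarrow> (complex \<Rightarrow> complex) \<Rightarrow> real^2^2 \<Rightarrow> complex \<Rightarrow> real" where
  "pmaj N k \<kappa> f X z = norm (f z) * norm (Qpoly N X z) ^ (k + 1) * exp (- \<kappa> * maj N X z)"

lemma pmaj_conj:
  assumes B: "B \<in> SL2" and X: "X \<in> traceless" and z: "Im z > 0"
  shows "pmaj N k \<kappa> f (conj_act B X) (moebius B z) = pmaj N k \<kappa> (slash (2 * k + 2) f B) X z"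
proof -
  have nz: "jac B z \<noteq> 0" using jac_nz[OF B, of z] z by simp
  have "norm (Qpoly N X z) = norm (Qpoly N (conj_act B X) (moebius B z)) * norm (jac B z) ^ 2"
    using arg_cong[OF Qpoly_conj[OF B X z, of N], of norm] by (simp add: norm_mult norm_power)
  then have "norm (Qpoly N X z) ^ (k + 1) = norm (Qpoly N (conj_act B X) (moebius B z)) ^ (k + 1) * norm (jac B z) ^ (2 * k + 2)"
    by (simp only: power_mult_distrib power_mult[symmetric]) (simp add: algebra_simps)
  then show ?thesis using nz
    by (simp add: pmaj_def slash_jac norm_divide norm_power norm_mult maj_conj[OF B X z])
qed

lemma pmaj_hcut: "Im z > 0 \<Longrightarrow> pmaj N k \<kappa> (hcut f) X z = pmaj N k \<kappa> f X z"
  by (simp add: pmaj_def hcut_def)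

lemma pmaj_measurable:
  assumes "f holomorphic_on upper_half_plane"
  shows "(\<lambda>z. pmaj N k \<kappa> (hcut f) X z) \<in> borel_measurable borel"
proof -
  have [measurable]: "hcut f \<in> borel_measurable borel" by (rule hcut_measurable[OF assms])
  show ?thesis unfolding pmaj_def by measurable
qed

lemma pmaj_siegel_bound:
  assumes N: "N > 0" and \<kappa>: "\<kappa> > 0" and G: "G \<in> cusp_forms (2 * k + 2) N" and B: "B \<in> Gamma0 1"
  obtains C where "C > 0" "\<And>X z. X \<in> traceless \<Longrightarrow> z \<in> siegel \<Longrightarrow>
    pmaj N k \<kappa> (slash (2 * k + 2) G B) X z \<le> C / wt X"
proof -
  obtain C1 where C1: "C1 > 0" "\<And>z. Im z \<ge> 1 / 2 \<Longrightarrow> norm (slash (2 * k + 2) G B z) \<le> C1 * exp (- (pi / real N) * Im z)"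
    using cusp_form_decay[OF N G B] by blast
  obtain C2 where C2: "C2 > 0" "\<And>m. m \<ge> 0 \<Longrightarrow> (1 + m) ^ (k + 4) * exp (- \<kappa> * m) \<le> C2"
    using polynomial_exp_bound[OF \<kappa>, of "k + 4"] by blast
  have "pi / real N > 0" using N by simp
  then obtain C3 where C3: "C3 > 0" "\<And>m. m \<ge> 0 \<Longrightarrow> (1 + m) ^ (k + 7) * exp (- (pi / real N) * m) \<le> C3"
    using polynomial_exp_bound[of "pi / real N" "k + 7"] by blast
  define C where "C = C1 * (2 * real N) ^ (k + 1) * 800 ^ 3 * C3 * C2"
  show ?thesis
  proof (rule that[of C])
    show "C > 0" using C1 C2 C3 N by (simp add: C_def)
    fix X z assume X: "X \<in> traceless" and z: "z \<in> siegel"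
    define m where "m = maj N X z"
    define y where "y = Im z"
    have y: "y \<ge> 1 / 2" using z by (simp add: siegel_def y_def)
    then have Im: "Im z > 0" by (simp add: y_def)
    have m: "m \<ge> 0" unfolding m_def by (rule maj_nonneg[OF X Im])
    have wt0: "wt X > 0" by (simp add: wt_def add_pos_nonneg)
    have Q: "norm (Qpoly N X z) ^ (k + 1) \<le> (2 * real N * y * (1 + m)) ^ (k + 1)"
      using Qpoly_maj_bound[OF N X Im] by (intro power_mono) (auto simp: m_def y_def)
    have W: "wt X \<le> (800 * y\<^sup>2 * (1 + m)) ^ 3" using maj_lower_bound[OF N X z] by (simp add: m_def y_def)
    have s: "norm (slash (2 * k + 2) G B z) \<le> C1 * exp (- (pi / real N) * y)"
      using C1(2)[of z] y by (simp add: y_def)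
    have "pmaj N k \<kappa> (slash (2 * k + 2) G B) X z * wt X \<le>
       (C1 * exp (- (pi / real N) * y)) * (2 * real N * y * (1 + m)) ^ (k + 1) * exp (- \<kappa> * m) * (800 * y\<^sup>2 * (1 + m)) ^ 3"
      unfolding pmaj_def m_def[symmetric] using C1 y N m wt0
      by (intro mult_mono s Q W order_refl) auto
    also have "\<dots> = C1 * (2 * real N) ^ (k + 1) * 800 ^ 3 * (y ^ (k + 7) * exp (- (pi / real N) * y)) * ((1 + m) ^ (k + 4) * exp (- \<kappa> * m))"
    proof -
      have 1: "(2 * real N * y * (1 + m)) ^ (k + 1) = (2 * real N) ^ (k + 1) * y ^ (k + 1) * (1 + m) ^ (k + 1)"
        by (simp only: power_mult_distrib)
      have 2: "(800 * y\<^sup>2 * (1 + m)) ^ 3 = 800 ^ 3 * y ^ 6 * (1 + m) ^ 3"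
        by (simp only: power_mult_distrib power_mult[symmetric]) simp
      have 3: "y ^ (k + 7) = y ^ (k + 1) * y ^ 6" "(1 + m) ^ (k + 4) = (1 + m) ^ (k + 1) * (1 + m) ^ 3"
        by (simp_all flip: power_add add: eval_nat_numeral)
      show ?thesis unfolding 1 2 3 by (simp only: mult_ac)
    qed
    also have "\<dots> \<le> C1 * (2 * real N) ^ (k + 1) * 800 ^ 3 * C3 * C2"
    proof (intro mult_mono order_refl)
      have "y ^ (k + 7) * exp (- (pi / real N) * y) \<le> (1 + y) ^ (k + 7) * exp (- (pi / real N) * y)"
        using y by (intro mult_right_mono power_mono) auto
      also have "\<dots> \<le> C3" using C3(2)[of y] y by simp
      finally show "y ^ (k + 7) * exp (- (pi / real N) * y) \<le> C3" .
      show "(1 + m) ^ (k + 4) * exp (- \<kappa> * m) \<le> C2" by (rule C2(2)[OF m])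
    qed (use C1 C2 C3 N m y in auto)
    finally have "pmaj N k \<kappa> (slash (2 * k + 2) G B) X z * wt X \<le> C" by (simp add: C_def)
    then show "pmaj N k \<kappa> (slash (2 * k + 2) G B) X z \<le> C / wt X" using wt0 by (simp add: field_simps)
  qed
qed

lemma int_sum_finite:
  assumes N: "N > (0::nat)"
  shows "(\<integral>\<^sup>+n. ennreal (1 / (1 + (of_int n / (2 * real N))\<^sup>2)) \<partial>count_space (UNIV :: int set)) < \<infinity>"
proof -
  define f where "f = (\<lambda>n :: int. 1 / (1 + (of_int n / (2 * real N))\<^sup>2))"
  define c where "c = 32 * (real N)\<^sup>2"
  have N1: "(real N)\<^sup>2 \<ge> 1" using N by simp
  have bd: "f (int_decode m) \<le> c * (1 / (real (Suc m))\<^sup>2)" for m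
  proof -
    define a where "a = \<bar>real_of_int (int_decode m)\<bar>"
    have a0: "a \<ge> 0" by (simp add: a_def)
    have a1: "real m \<le> 2 * a + 1"
    proof (cases "even m")
      case True then show ?thesis by (auto simp: a_def int_decode_def sum_decode_def elim!: evenE)
    next
      case False then show ?thesis by (auto simp: a_def int_decode_def sum_decode_def elim!: oddE)
    qed
    have "(real (Suc m))\<^sup>2 \<le> (2 * a + 2)\<^sup>2" using a1 by (intro power_mono) auto
    also have "\<dots> \<le> 8 * a\<^sup>2 + 8"
      using zero_le_power2[of "a - 1"] by (simp add: power2_eq_square algebra_simps)
    also have "\<dots> \<le> c * (1 + (a / (2 * real N))\<^sup>2)"
    proof -
      have "c * (1 + (a / (2 * real N))\<^sup>2) = 32 * (real N)\<^sup>2 + 8 * a\<^sup>2"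
        using N by (simp add: c_def power_divide power_mult_distrib distrib_left)
      then show ?thesis using N1 by simp
    qed
    finally have le: "(real (Suc m))\<^sup>2 \<le> c * (1 + (a / (2 * real N))\<^sup>2)" .
    have fa: "f (int_decode m) = 1 / (1 + (a / (2 * real N))\<^sup>2)" by (simp add: f_def a_def power_divide)
    have p: "1 + (a / (2 * real N))\<^sup>2 > 0" by (simp add: add_pos_nonneg)
    show ?thesis unfolding fa using le p by (simp add: field_simps del: of_nat_Suc)
  qed
  have "summable (\<lambda>m. c * (1 / (real (Suc m))\<^sup>2))"
    using inverse_squares_sums by (intro summable_mult) (auto simp: sums_iff)
  then have "(\<Sum>m. ennreal (c * (1 / (real (Suc m))\<^sup>2))) \<noteq> \<infinity>"
    unfolding infinity_ennreal_def by (intro ennreal_suminf_neq_top) (auto simp: c_def)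
  moreover have "(\<Sum>m. ennreal (f (int_decode m))) \<le> (\<Sum>m. ennreal (c * (1 / (real (Suc m))\<^sup>2)))"
    by (intro suminf_le ennreal_leI bd) auto
  ultimately have "(\<Sum>m. ennreal (f (int_decode m))) < \<infinity>" by (metis infinity_ennreal_def less_top order_le_less_trans)
  moreover have "(\<integral>\<^sup>+n. ennreal (f n) \<partial>count_space UNIV) = (\<integral>\<^sup>+m. ennreal (f (int_decode m)) \<partial>count_space UNIV)"
    using nn_integral_bij_count_space[OF bij_int_decode, of "\<lambda>n. ennreal (f n)"] by simp
  ultimately show ?thesis by (simp add: nn_integral_count_space_nat f_def)
qed

lemma int3_sum_finite:
  assumes N: "N > (0::nat)"
  defines "f \<equiv> \<lambda>n :: int. ennreal (1 / (1 + (of_int n / (2 * real N))\<^sup>2))"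
  shows "(\<integral>\<^sup>+p. f (fst p) * (f (fst (snd p)) * f (snd (snd p))) \<partial>count_space UNIV) < \<infinity>"
proof -
  define S where "S = (\<integral>\<^sup>+n. f n \<partial>count_space (UNIV :: int set))"
  have S: "S < \<infinity>" using int_sum_finite[OF N] by (simp add: S_def f_def)
  have "(\<integral>\<^sup>+p. f (fst p) * (f (fst (snd p)) * f (snd (snd p))) \<partial>count_space UNIV) =
     (\<integral>\<^sup>+a. \<integral>\<^sup>+q. f a * (f (fst q) * f (snd q)) \<partial>count_space UNIV \<partial>count_space UNIV)"
    by (subst nn_integral_fst_count_space[symmetric]) simp
  also have "\<dots> = (\<integral>\<^sup>+a. f a * (\<integral>\<^sup>+q. f (fst q) * f (snd q) \<partial>count_space UNIV) \<partial>count_space UNIV)"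
    by (intro nn_integral_cong nn_integral_cmult) simp
  also have "(\<integral>\<^sup>+q. f (fst q) * f (snd q) \<partial>count_space UNIV) = (\<integral>\<^sup>+b. \<integral>\<^sup>+c. f b * f c \<partial>count_space UNIV \<partial>count_space UNIV)"
    by (subst nn_integral_fst_count_space[symmetric]) simp
  also have "\<dots> = S * S"
    by (subst nn_integral_cmult, simp, subst nn_integral_multc, simp_all add: S_def)
  also have "(\<integral>\<^sup>+a. f a * (S * S) \<partial>count_space UNIV) = S * (S * S)"
    by (subst nn_integral_multc) (simp_all add: S_def)
  also have "\<dots> < \<infinity>" using S by (simp add: ennreal_mult_less_top)
  finally show ?thesis .
qed

lemma wt_sum_finite:
  assumes N: "N > 0" and B: "B \<in> Gamma0 1"
  shows "(\<integral>\<^sup>+X. ennreal (1 / wt (conj_act (matrix_inv B) X)) \<partial>count_space (dual_lattice N)) < \<infinity>"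
proof -
  note SB = SL2_inv[OF Gamma0_SL2[OF B]]
  define h where "h X = (let Y = conj_act (matrix_inv B) X in
     (\<lfloor>2 * real N * Y$1$1\<rfloor>, \<lfloor>2 * real N * Y$1$2\<rfloor>, \<lfloor>2 * real N * Y$2$1\<rfloor>))" for X
  define f where "f = (\<lambda>n :: int. ennreal (1 / (1 + (of_int n / (2 * real N))\<^sup>2)))"
  have ent: "\<exists>a b c. conj_act (matrix_inv B) X = mat2 (of_int a / (2 * real N)) (of_int b / (2 * real N)) (of_int c / (2 * real N)) (- of_int a / (2 * real N))"
    if X: "X \<in> dual_lattice N" for X
  proof -
    obtain a b c where X': "X = dvec N a b c" using X N by (auto simp: dual_lattice_dvec)
    obtain p q u v :: int where A: "matrix_inv B = mat2 (of_int p) (of_int q) (of_int u) (of_int v)" "p * v - q * u = 1"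
      using Gamma0_inv[OF B] by (auto elim: Gamma0E)
    show ?thesis
      unfolding conj_act_mat2[OF SB dvec_traceless, of N a b c, folded X'] unfolding A X' using N
      by (intro exI[of _ "(p * v + q * u) * b + 2 * (p * u) * a + 2 * int N * (q * v) * c"]
          exI[of _ "- 2 * p * q * b - 2 * p\<^sup>2 * a - 2 * int N * q\<^sup>2 * c"]
          exI[of _ "2 * u * v * b + 2 * u\<^sup>2 * a + 2 * int N * v\<^sup>2 * c"])
        (simp add: dvec_def mat2_eq_iff field_simps power2_eq_square)
  qed
  have inj: "inj_on h (dual_lattice N)"
  proof (rule inj_onI)
    fix X X' assume X: "X \<in> dual_lattice N" and X': "X' \<in> dual_lattice N" and eq: "h X = h X'"
    obtain a b c where e: "conj_act (matrix_inv B) X = mat2 (of_int a / (2 * real N)) (of_int b / (2 * real N)) (of_int c / (2 * real N)) (- of_int a / (2 * real N))"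
      using ent[OF X] by blast
    obtain a' b' c' where e': "conj_act (matrix_inv B) X' = mat2 (of_int a' / (2 * real N)) (of_int b' / (2 * real N)) (of_int c' / (2 * real N)) (- of_int a' / (2 * real N))"
      using ent[OF X'] by blast
    have "a = a' \<and> b = b' \<and> c = c'" using eq N by (simp add: h_def e e' Let_def)
    then have "conj_act (matrix_inv B) X = conj_act (matrix_inv B) X'" by (simp add: e e')
    then show "X = X'" by (metis conj_act_inv' Gamma0_SL2 B)
  qed
  have eq: "ennreal (1 / wt (conj_act (matrix_inv B) X)) = f (fst (h X)) * (f (fst (snd (h X))) * f (snd (snd (h X))))"
    if X: "X \<in> dual_lattice N" for X
  proof -
    obtain a b c where e: "conj_act (matrix_inv B) X = mat2 (of_int a / (2 * real N)) (of_int b / (2 * real N)) (of_int c / (2 * real N)) (- of_int a / (2 * real N))"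
      using ent[OF X] by blast
    show ?thesis using N by (simp add: e h_def Let_def wt_def f_def ennreal_mult[symmetric])
  qed
  have "(\<integral>\<^sup>+X. ennreal (1 / wt (conj_act (matrix_inv B) X)) \<partial>count_space (dual_lattice N)) =
     (\<integral>\<^sup>+X. f (fst (h X)) * (f (fst (snd (h X))) * f (snd (snd (h X)))) \<partial>count_space (dual_lattice N))"
    by (rule nn_integral_cong) (simp add: eq)
  also have "\<dots> = (\<integral>\<^sup>+p. f (fst p) * (f (fst (snd p)) * f (snd (snd p))) \<partial>count_space (h ` dual_lattice N))"
    by (rule nn_integral_bij_count_space[OF inj_on_imp_bij_betw[OF inj]])
  also have "\<dots> \<le> (\<integral>\<^sup>+p. f (fst p) * (f (fst (snd p)) * f (snd (snd p))) \<partial>count_space UNIV)"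
    by (subst nn_integral_count_space_indicator) (auto intro!: nn_integral_mono simp: indicator_def)
  also have "\<dots> < \<infinity>" using int3_sum_finite[OF N] by (simp add: f_def)
  finally show ?thesis .
qed

lemma countable_dual_lattice: "N > 0 \<Longrightarrow> countable (dual_lattice N)"
proof -
  assume N: "N > 0"
  have "dual_lattice N \<subseteq> range (\<lambda>(a, b, c). dvec N a b c)"
  proof
    fix X assume "X \<in> dual_lattice N"
    then obtain a b c where "X = dvec N a b c" by (auto simp: dual_lattice_dvec[OF N])
    then have "X = (\<lambda>(a, b, c). dvec N a b c) (a, b, c)" by simp
    then show "X \<in> range (\<lambda>(a, b, c). dvec N a b c)" by (rule range_eqI)
  qed
  then show ?thesis by (rule countable_subset) simp
qed

lemma dual_lattice_traceless: "X \<in> dual_lattice N \<Longrightarrow> X \<in> traceless"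
  by (simp add: dual_lattice_def rat_space_def trace_2 traceless_def)

lemma cusp_form_slash: "G \<in> cusp_forms w N \<Longrightarrow> A \<in> Gamma0 N \<Longrightarrow> Im z > 0 \<Longrightarrow> slash w G A z = G z"
  by (simp add: cusp_forms_def upper_half_plane_def)

lemma cusp_form_holo: "G \<in> cusp_forms w N \<Longrightarrow> G holomorphic_on upper_half_plane"
  by (simp add: cusp_forms_def)

lemma absolute_convergence:
  assumes N: "N > 0" and \<kappa>: "\<kappa> > 0" and G: "G \<in> cusp_forms (2 * k + 2) N" and fd: "fundamental_domain N F"
  shows "(\<integral>\<^sup>+X. \<integral>\<^sup>+z. ennreal (pmaj N k \<kappa> (hcut G) X z) * indicator F z \<partial>hmeas \<partial>count_space (dual_lattice N)) < \<infinity>"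
proof -
  let ?L = "dual_lattice N" and ?G = "Gamma0 N"
  note cL = countable_dual_lattice[OF N] and cG = countable_Gamma0[of N]
  define Q where "Q X z = ennreal (pmaj N k \<kappa> (hcut G) X z)" for X z
  have [measurable]: "Q X \<in> borel_measurable borel" for X
    unfolding Q_def using pmaj_measurable[OF cusp_form_holo[OF G]] by measurable
  have [measurable]: "F \<in> sets borel" using fd by (simp add: fundamental_domain_def)
  have QG: "Q (conj_act A X) (moebius A z) = Q X z" if "A \<in> ?G" "X \<in> ?L" "Im z > 0" for A X z
  proof -
    have "pmaj N k \<kappa> G (conj_act A X) (moebius A z) = pmaj N k \<kappa> G X z"
      unfolding pmaj_conj[OF Gamma0_SL2[OF that(1)] dual_lattice_traceless[OF that(2)] that(3)]
      by (simp only: pmaj_def cusp_form_slash[OF G that(1,3)])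
    then show ?thesis using that moebius_uhp[OF Gamma0_SL2[OF that(1)] that(3)] by (simp add: Q_def pmaj_hcut)
  qed
  obtain T where T: "finite T" "T \<subseteq> Gamma0 1" "\<And>A. A \<in> Gamma0 1 \<Longrightarrow> \<exists>B\<in>T. A ** matrix_inv B \<in> ?G"
    using finite_cosets[OF N] by blast
  define s where "s B A z = (indicator siegel (moebius (matrix_inv B) (moebius (matrix_inv A) z)) :: ennreal)" for A B z
  have [measurable]: "s B A \<in> borel_measurable borel" for A B unfolding s_def by measurable
  have cover: "1 \<le> (\<Sum>B\<in>T. \<integral>\<^sup>+A. s B A z \<partial>count_space ?G)" if z: "Im z > 0" for z
  proof -
    obtain C where C: "C \<in> Gamma0 1" "moebius C z \<in> siegel" using Gamma1_siegel[OF z] .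
    note SC = Gamma0_SL2[OF C(1)]
    obtain B where B: "B \<in> T" "matrix_inv C ** matrix_inv B \<in> ?G" using T(3)[OF Gamma0_inv[OF C(1)]] by blast
    define A where "A = matrix_inv C ** matrix_inv B"
    have SB: "B \<in> SL2" using B T Gamma0_SL2 by blast
    have A: "A \<in> ?G" using B by (simp add: A_def)
    have iA: "matrix_inv A = B ** C" using SB SC by (simp add: A_def SL2_inv_mult SL2_inv SL2_inv_inv)
    have "moebius (matrix_inv B) (moebius (matrix_inv A) z) = moebius C z"
      unfolding iA using SB SC z by (simp add: moebius_mult moebius_inv moebius_uhp)
    then have sA: "s B A z = 1" using C by (simp add: s_def)
    have "1 = (\<integral>\<^sup>+A'. s B A' z * indicator {A} A' \<partial>count_space ?G)"
      using A by (subst nn_integral_indicator_singleton) (auto simp: sA)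
    also have "\<dots> \<le> (\<integral>\<^sup>+A'. s B A' z \<partial>count_space ?G)"
      by (rule nn_integral_mono) (auto simp: indicator_def)
    also have "\<dots> \<le> (\<Sum>B\<in>T. \<integral>\<^sup>+A. s B A z \<partial>count_space ?G)"
      using T(1) B(1) by (intro member_le_sum) auto
    finally show ?thesis .
  qed
  have JB: "(\<integral>\<^sup>+X. \<integral>\<^sup>+z. Q X z * indicator F z * (\<integral>\<^sup>+A. s B A z \<partial>count_space ?G) \<partial>hmeas \<partial>count_space ?L) < \<infinity>" if B: "B \<in> T" for B
  proof -
    have B1: "B \<in> Gamma0 1" using B T by blast
    note SB = Gamma0_SL2[OF B1]
    define s1 where "s1 z = (indicator siegel (moebius (matrix_inv B) z) :: ennreal)" for z
    have [measurable]: "s1 \<in> borel_measurable borel" unfolding s1_def by measurable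
    have "(\<integral>\<^sup>+X. \<integral>\<^sup>+z. Q X z * indicator F z * (\<integral>\<^sup>+A. s B A z \<partial>count_space ?G) \<partial>hmeas \<partial>count_space ?L) =
      (\<integral>\<^sup>+X. \<integral>\<^sup>+z. \<integral>\<^sup>+A. Q X z * indicator F z * s B A z \<partial>count_space ?G \<partial>hmeas \<partial>count_space ?L)"
      by (intro nn_integral_cong nn_integral_cmult[symmetric]) simp
    also have "\<dots> = (\<integral>\<^sup>+X. \<integral>\<^sup>+A. \<integral>\<^sup>+z. Q X z * indicator F z * s B A z \<partial>hmeas \<partial>count_space ?G \<partial>count_space ?L)"
      by (intro nn_integral_cong nn_integral_count_space_nn_integral cG) measurable
    also have "\<dots> = (\<integral>\<^sup>+A. \<integral>\<^sup>+X. \<integral>\<^sup>+z. Q X z * indicator F z * s B A z \<partial>hmeas \<partial>count_space ?L \<partial>count_space ?G)"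
      by (intro nn_integral_count_space_nn_integral[symmetric] cL) simp
    also have "\<dots> = (\<integral>\<^sup>+A. \<integral>\<^sup>+X. \<integral>\<^sup>+z. Q X z * indicator F (moebius A z) * s1 z \<partial>hmeas \<partial>count_space ?L \<partial>count_space ?G)"
    proof (rule nn_integral_cong)
      fix A assume "A \<in> space (count_space ?G)"
      then have A: "A \<in> ?G" by simp
      note SA = Gamma0_SL2[OF A]
      have bij: "bij_betw (conj_act A) ?L ?L"
        by (rule bij_betwI[where g="conj_act (matrix_inv A)"])
          (auto simp: conj_act_inv[OF SA] conj_act_inv'[OF SA] intro: genus_character_conj(2)[OF N] A Gamma0_inv)
      have "(\<integral>\<^sup>+X. \<integral>\<^sup>+z. Q X z * indicator F z * s B A z \<partial>hmeas \<partial>count_space ?L) =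
         (\<integral>\<^sup>+X. \<integral>\<^sup>+z. Q (conj_act A X) z * indicator F z * s B A z \<partial>hmeas \<partial>count_space ?L)"
        by (rule nn_integral_bij_count_space[OF bij, symmetric])
      also have "\<dots> = (\<integral>\<^sup>+X. \<integral>\<^sup>+z. Q X z * indicator F (moebius A z) * s1 z \<partial>hmeas \<partial>count_space ?L)"
      proof (rule nn_integral_cong)
        fix X assume "X \<in> space (count_space ?L)"
        then have X: "X \<in> ?L" by simp
        have "(\<integral>\<^sup>+z. Q (conj_act A X) z * indicator F z * s B A z \<partial>hmeas) =
           (\<integral>\<^sup>+z. Q (conj_act A X) (moebius A z) * indicator F (moebius A z) * s B A (moebius A z) \<partial>hmeas)"
          by (rule nn_integral_hmeas_moebius[OF SA, symmetric]) measurable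
        also have "\<dots> = (\<integral>\<^sup>+z. Q X z * indicator F (moebius A z) * s1 z \<partial>hmeas)"
        proof (rule nn_integral_cong_AE)
          show "AE z in hmeas. Q (conj_act A X) (moebius A z) * indicator F (moebius A z) * s B A (moebius A z) = Q X z * indicator F (moebius A z) * s1 z"
            using AE_hmeas by eventually_elim (simp add: QG[OF A X] s_def s1_def moebius_inv[OF SA])
        qed
        finally show "(\<integral>\<^sup>+z. Q (conj_act A X) z * indicator F z * s B A z \<partial>hmeas) = (\<integral>\<^sup>+z. Q X z * indicator F (moebius A z) * s1 z \<partial>hmeas)" .
      qed
      finally show "(\<integral>\<^sup>+X. \<integral>\<^sup>+z. Q X z * indicator F z * s B A z \<partial>hmeas \<partial>count_space ?L) =
         (\<integral>\<^sup>+X. \<integral>\<^sup>+z. Q X z * indicator F (moebius A z) * s1 z \<partial>hmeas \<partial>count_space ?L)" .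
    qed
    also have "\<dots> = (\<integral>\<^sup>+X. \<integral>\<^sup>+A. \<integral>\<^sup>+z. Q X z * indicator F (moebius A z) * s1 z \<partial>hmeas \<partial>count_space ?G \<partial>count_space ?L)"
      by (intro nn_integral_count_space_nn_integral cL) simp
    also have "\<dots> = (\<integral>\<^sup>+X. \<integral>\<^sup>+z. \<integral>\<^sup>+A. Q X z * indicator F (moebius A z) * s1 z \<partial>count_space ?G \<partial>hmeas \<partial>count_space ?L)"
      by (intro nn_integral_cong nn_integral_count_space_nn_integral[symmetric] cG) measurable
    also have "\<dots> = (\<integral>\<^sup>+X. \<integral>\<^sup>+z. 2 * (Q X z * s1 z) \<partial>hmeas \<partial>count_space ?L)"
    proof (rule nn_integral_cong, rule nn_integral_cong_AE)
      fix X
      show "AE z in hmeas. (\<integral>\<^sup>+A. Q X z * indicator F (moebius A z) * s1 z \<partial>count_space ?G) = 2 * (Q X z * s1 z)"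
        using fundamental_domain_card[OF fd]
      proof eventually_elim
        case (elim z)
        have "finite {A\<in>?G. moebius A z \<in> F}" by (rule card_ge_0_finite) (use elim in simp)
        from nn_integral_if_const[OF this, of "Q X z * s1 z"] elim
        have "(\<integral>\<^sup>+A. (if moebius A z \<in> F then Q X z * s1 z else 0) \<partial>count_space ?G) = 2 * (Q X z * s1 z)" by simp
        also have "(\<integral>\<^sup>+A. (if moebius A z \<in> F then Q X z * s1 z else 0) \<partial>count_space ?G) =
          (\<integral>\<^sup>+A. Q X z * indicator F (moebius A z) * s1 z \<partial>count_space ?G)"
          by (intro nn_integral_cong) (auto simp: indicator_def)
        finally show ?case .
      qed
    qed
    also have "\<dots> = (\<integral>\<^sup>+X. 2 * (\<integral>\<^sup>+z. Q X z * s1 z \<partial>hmeas) \<partial>count_space ?L)"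
      by (intro nn_integral_cong nn_integral_cmult) measurable
    also have "\<dots> = 2 * (\<integral>\<^sup>+X. (\<integral>\<^sup>+z. Q X z * s1 z \<partial>hmeas) \<partial>count_space ?L)"
      by (rule nn_integral_cmult) simp
    also have "\<dots> < \<infinity>"
    proof -
      obtain C where C: "C > 0" "\<And>X z. X \<in> traceless \<Longrightarrow> z \<in> siegel \<Longrightarrow> pmaj N k \<kappa> (slash (2 * k + 2) G B) X z \<le> C / wt X"
        using pmaj_siegel_bound[OF N \<kappa> G B1] by blast
      have "(\<integral>\<^sup>+X. (\<integral>\<^sup>+z. Q X z * s1 z \<partial>hmeas) \<partial>count_space ?L) \<le>
        (\<integral>\<^sup>+X. (ennreal C * emeasure hmeas siegel) * ennreal (1 / wt (conj_act (matrix_inv B) X)) \<partial>count_space ?L)"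
      proof (rule nn_integral_mono)
        fix X assume "X \<in> space (count_space ?L)"
        then have X: "X \<in> ?L" by simp
        define Y where "Y = conj_act (matrix_inv B) X"
        have Y: "Y \<in> traceless" unfolding Y_def by (rule conj_act_traceless[OF SL2_inv[OF SB] dual_lattice_traceless[OF X]])
        have XY: "X = conj_act B Y" by (simp add: Y_def conj_act_inv'[OF SB])
        have wt0: "wt Y > 0" by (simp add: wt_def add_pos_nonneg)
        have "(\<integral>\<^sup>+z. Q X z * s1 z \<partial>hmeas) = (\<integral>\<^sup>+z. Q X (moebius B z) * s1 (moebius B z) \<partial>hmeas)"
          by (rule nn_integral_hmeas_moebius[OF SB, symmetric]) measurable
        also have "\<dots> \<le> (\<integral>\<^sup>+z. ennreal (C / wt Y) * indicator siegel z \<partial>hmeas)"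
        proof (rule nn_integral_mono_AE)
          show "AE z in hmeas. Q X (moebius B z) * s1 (moebius B z) \<le> ennreal (C / wt Y) * indicator siegel z"
            using AE_hmeas
          proof eventually_elim
            case (elim z)
            have "Q X (moebius B z) = ennreal (pmaj N k \<kappa> (slash (2 * k + 2) G B) Y z)"
              using pmaj_conj[OF SB Y elim, of N k \<kappa> G] moebius_uhp[OF SB elim] by (simp add: Q_def XY pmaj_hcut)
            then show ?case using C(2)[OF Y, of z]
              by (auto simp: s1_def moebius_inv[OF SB elim] indicator_def intro: ennreal_leI)
          qed
        qed
        also have "\<dots> = ennreal (C / wt Y) * emeasure hmeas siegel"
          by (rule nn_integral_cmult_indicator) simp
        also have "\<dots> = (ennreal C * emeasure hmeas siegel) * ennreal (1 / wt Y)"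
          using C(1) wt0 ennreal_mult[of C "1 / wt Y"] by (simp add: ac_simps)
        finally show "(\<integral>\<^sup>+z. Q X z * s1 z \<partial>hmeas) \<le> (ennreal C * emeasure hmeas siegel) * ennreal (1 / wt (conj_act (matrix_inv B) X))"
          by (simp add: Y_def)
      qed
      also have "\<dots> = (ennreal C * emeasure hmeas siegel) * (\<integral>\<^sup>+X. ennreal (1 / wt (conj_act (matrix_inv B) X)) \<partial>count_space ?L)"
        by (rule nn_integral_cmult) simp
      also have "\<dots> < \<infinity>"
        using wt_sum_finite[OF N B1] hmeas_siegel_finite by (simp add: ennreal_mult_less_top)
      finally show ?thesis by (simp add: ennreal_mult_less_top)
    qed
    finally show ?thesis .
  qed
  have "(\<integral>\<^sup>+X. \<integral>\<^sup>+z. Q X z * indicator F z \<partial>hmeas \<partial>count_space ?L) \<le>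
     (\<integral>\<^sup>+X. \<integral>\<^sup>+z. (\<Sum>B\<in>T. Q X z * indicator F z * (\<integral>\<^sup>+A. s B A z \<partial>count_space ?G)) \<partial>hmeas \<partial>count_space ?L)"
  proof (rule nn_integral_mono, rule nn_integral_mono_AE)
    fix X
    show "AE z in hmeas. Q X z * indicator F z \<le> (\<Sum>B\<in>T. Q X z * indicator F z * (\<integral>\<^sup>+A. s B A z \<partial>count_space ?G))"
      using AE_hmeas
    proof eventually_elim
      case (elim z)
      have "Q X z * indicator F z * 1 \<le> Q X z * indicator F z * (\<Sum>B\<in>T. \<integral>\<^sup>+A. s B A z \<partial>count_space ?G)"
        by (intro mult_left_mono cover elim) simp
      then show ?case by (simp add: sum_distrib_left)
    qed
  qed
  also have "\<dots> = (\<Sum>B\<in>T. (\<integral>\<^sup>+X. \<integral>\<^sup>+z. Q X z * indicator F z * (\<integral>\<^sup>+A. s B A z \<partial>count_space ?G) \<partial>hmeas \<partial>count_space ?L))"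
  proof -
    have m: "(\<lambda>z. \<integral>\<^sup>+A. s B A z \<partial>count_space ?G) \<in> borel_measurable borel" for B
    proof -
      interpret C: sigma_finite_measure "count_space ?G" by (rule sigma_finite_measure_count_space_countable[OF cG])
      have "(\<lambda>(A, z). s B A z) \<in> borel_measurable (count_space ?G \<Otimes>\<^sub>M borel)"
        by (rule measurable_pair_measure_countable1[OF cG]) simp
      then have "(\<lambda>(z, A). s B A z) \<in> borel_measurable (borel \<Otimes>\<^sub>M count_space ?G)"
        by (subst (asm) measurable_pair_swap_iff) (simp add: case_prod_unfold)
      then show ?thesis by (rule C.borel_measurable_nn_integral)
    qed
    have "(\<integral>\<^sup>+X. \<integral>\<^sup>+z. (\<Sum>B\<in>T. Q X z * indicator F z * (\<integral>\<^sup>+A. s B A z \<partial>count_space ?G)) \<partial>hmeas \<partial>count_space ?L) =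
      (\<integral>\<^sup>+X. (\<Sum>B\<in>T. \<integral>\<^sup>+z. Q X z * indicator F z * (\<integral>\<^sup>+A. s B A z \<partial>count_space ?G) \<partial>hmeas) \<partial>count_space ?L)"
      using m by (intro nn_integral_cong nn_integral_sum) measurable
    also have "\<dots> = (\<Sum>B\<in>T. (\<integral>\<^sup>+X. \<integral>\<^sup>+z. Q X z * indicator F z * (\<integral>\<^sup>+A. s B A z \<partial>count_space ?G) \<partial>hmeas \<partial>count_space ?L))"
      by (rule nn_integral_sum) simp
    finally show ?thesis .
  qed
  also have "\<dots> < \<infinity>" using JB T(1) by (simp add: less_top)
  finally show ?thesis by (simp add: Q_def)
qed

subsection \<open>The kernel of a lattice vector\<close>

definition kern :: "nat \<Rightarrow> nat \<Rightarrow> real \<Rightarrow> (complex \<Rightarrow> complex) \<Rightarrow> real^2^2 \<Rightarrow> complex \<Rightarrow> complex" where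
  "kern N k \<kappa> G X z = hcut G z * Qpoly N X z ^ (k + 1) * of_real (exp (- \<kappa> * (pfun N z X)\<^sup>2))"

lemma kern_measurable:
  assumes "G holomorphic_on upper_half_plane"
  shows "kern N k \<kappa> G X \<in> borel_measurable borel"
proof -
  have [measurable]: "hcut G \<in> borel_measurable borel" by (rule hcut_measurable[OF assms])
  have "(\<lambda>z. kern N k \<kappa> G X z) \<in> borel_measurable borel" unfolding kern_def by measurable
  then show ?thesis by simp
qed

lemma norm_kern: "norm (kern N k \<kappa> G X z) = pmaj N k \<kappa> (hcut G) X z * exp (- 2 * \<kappa> * qform N X)"
proof -
  have "exp (- \<kappa> * maj N X z) * exp (- 2 * \<kappa> * qform N X) = exp (- \<kappa> * (pfun N z X)\<^sup>2)"
    by (simp add: maj_def algebra_simps flip: exp_add)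
  then show ?thesis by (simp add: kern_def pmaj_def norm_mult norm_power mult.assoc)
qed

lemma kern_conj:
  assumes g: "g \<in> SL2" and X: "X \<in> traceless" and z: "Im z > 0"
  shows "kern N k \<kappa> G (conj_act g X) (moebius g z) =
     slash (2 * k + 2) G g z * Qpoly N X z ^ (k + 1) * of_real (exp (- \<kappa> * (pfun N z X)\<^sup>2))"
proof -
  have nz: "jac g z \<noteq> 0" using jac_nz[OF g, of z] z by simp
  have "Qpoly N X z ^ (k + 1) = (Qpoly N (conj_act g X) (moebius g z) * jac g z ^ 2) ^ (k + 1)"
    by (simp only: Qpoly_conj[OF g X z])
  also have "\<dots> = Qpoly N (conj_act g X) (moebius g z) ^ (k + 1) * jac g z ^ (2 * (k + 1))"
    by (simp only: power_mult_distrib power_mult[symmetric])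
  also have "2 * (k + 1) = 2 * k + 2" by simp
  finally have Q: "Qpoly N X z ^ (k + 1) = Qpoly N (conj_act g X) (moebius g z) ^ (k + 1) * jac g z ^ (2 * k + 2)" .
  show ?thesis unfolding Q kern_def slash_jac pfun_conj[OF g X z]
    using nz moebius_uhp[OF g z] by (simp add: hcut_def)
qed

lemma kern_invariant:
  assumes G: "G \<in> cusp_forms (2 * k + 2) N" and A: "A \<in> Gamma0 N" and X: "X \<in> traceless" and z: "Im z > 0"
  shows "kern N k \<kappa> G (conj_act A X) (moebius A z) = kern N k \<kappa> G X z"
  unfolding kern_conj[OF Gamma0_SL2[OF A] X z] cusp_form_slash[OF G A z] using z by (simp add: kern_def hcut_def)

definition orbit0 :: "nat \<Rightarrow> real^2^2 \<Rightarrow> (real^2^2) set" where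
  "orbit0 N X = (\<lambda>A. conj_act A X) ` Gamma0 N"

lemma orbit0_dual: "N > 0 \<Longrightarrow> X \<in> dual_lattice N \<Longrightarrow> orbit0 N X \<subseteq> dual_lattice N"
  by (auto simp: orbit0_def intro: genus_character_conj(2))

lemma orbit0_qform: "Y \<in> orbit0 N X \<Longrightarrow> qform N Y = qform N X"
  by (auto simp: orbit0_def qform_conj Gamma0_SL2)

lemma nn_integral_count_space_subset:
  fixes f :: "'a \<Rightarrow> ennreal"
  assumes "A \<subseteq> B"
  shows "(\<integral>\<^sup>+x. f x \<partial>count_space A) \<le> (\<integral>\<^sup>+x. f x \<partial>count_space B)"
proof -
  have "(\<integral>\<^sup>+x. f x \<partial>count_space A) = (\<integral>\<^sup>+x. f x * indicator A x \<partial>count_space UNIV)"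
    by (subst nn_integral_count_space_indicator) auto
  also have "\<dots> \<le> (\<integral>\<^sup>+x. f x * indicator B x \<partial>count_space UNIV)"
    using assms by (intro nn_integral_mono) (auto simp: indicator_def)
  also have "\<dots> = (\<integral>\<^sup>+x. f x \<partial>count_space B)"
    by (subst (2) nn_integral_count_space_indicator) auto
  finally show ?thesis .
qed

lemma kern_orbit_finite:
  assumes N: "N > 0" and \<kappa>: "\<kappa> > 0" and G: "G \<in> cusp_forms (2 * k + 2) N" and fd: "fundamental_domain N F"
    and X: "X \<in> dual_lattice N"
  shows "(\<integral>\<^sup>+Y. \<integral>\<^sup>+z. ennreal (norm (kern N k \<kappa> G Y z)) * indicator F z \<partial>hmeas \<partial>count_space (orbit0 N X)) < \<infinity>"
proof -
  define e where "e = ennreal (exp (- 2 * \<kappa> * qform N X))"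
  have F [measurable]: "F \<in> sets borel" using fd by (simp add: fundamental_domain_def)
  have [measurable]: "(\<lambda>z. pmaj N k \<kappa> (hcut G) Y z) \<in> borel_measurable borel" for Y
    by (rule pmaj_measurable[OF cusp_form_holo[OF G]])
  have "(\<integral>\<^sup>+Y. \<integral>\<^sup>+z. ennreal (norm (kern N k \<kappa> G Y z)) * indicator F z \<partial>hmeas \<partial>count_space (orbit0 N X)) =
    (\<integral>\<^sup>+Y. e * (\<integral>\<^sup>+z. ennreal (pmaj N k \<kappa> (hcut G) Y z) * indicator F z \<partial>hmeas) \<partial>count_space (orbit0 N X))"
  proof (rule nn_integral_cong)
    fix Y assume "Y \<in> space (count_space (orbit0 N X))"
    then have q: "qform N Y = qform N X" by (simp add: orbit0_qform)
    have p0: "pmaj N k \<kappa> (hcut G) Y z \<ge> 0" for z by (simp add: pmaj_def)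
    have "(\<integral>\<^sup>+z. ennreal (norm (kern N k \<kappa> G Y z)) * indicator F z \<partial>hmeas) =
       (\<integral>\<^sup>+z. e * (ennreal (pmaj N k \<kappa> (hcut G) Y z) * indicator F z) \<partial>hmeas)"
      by (rule nn_integral_cong) (simp add: norm_kern q e_def ennreal_mult[OF p0] ac_simps)
    also have "\<dots> = e * (\<integral>\<^sup>+z. ennreal (pmaj N k \<kappa> (hcut G) Y z) * indicator F z \<partial>hmeas)"
      by (intro nn_integral_cmult) measurable
    finally show "(\<integral>\<^sup>+z. ennreal (norm (kern N k \<kappa> G Y z)) * indicator F z \<partial>hmeas) =
       e * (\<integral>\<^sup>+z. ennreal (pmaj N k \<kappa> (hcut G) Y z) * indicator F z \<partial>hmeas)" .
  qed
  also have "\<dots> = e * (\<integral>\<^sup>+Y. \<integral>\<^sup>+z. ennreal (pmaj N k \<kappa> (hcut G) Y z) * indicator F z \<partial>hmeas \<partial>count_space (orbit0 N X))"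
    by (rule nn_integral_cmult) simp
  also have "\<dots> < \<infinity>"
    using order.strict_trans1[OF nn_integral_count_space_subset[OF orbit0_dual[OF N X]] absolute_convergence[OF N \<kappa> G fd]]
    by (simp add: e_def ennreal_mult_less_top)
  finally show ?thesis .
qed

lemma
  assumes N: "N > 0" and \<kappa>: "\<kappa> > 0" and G: "G \<in> cusp_forms (2 * k + 2) N" and fd: "fundamental_domain N F"
    and X: "X \<in> dual_lattice N" and D: "D \<in> sets borel"
    and cD: "AE z in hmeas. card {s \<in> Gamma0 N. conj_act s X = X \<and> moebius s z \<in> D} = c" and c: "c > 0"
  shows kern_integrable: "set_integrable hmeas D (kern N k \<kappa> G X)"
    and kern_has_sum: "((\<lambda>Y. LINT z:F|hmeas. kern N k \<kappa> G Y z) has_sum (2 / of_nat c * (LINT z:D|hmeas. kern N k \<kappa> G X z))) (orbit0 N X)"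
  using unfold_integrable[OF fd kern_measurable[OF cusp_form_holo[OF G]] kern_invariant[OF G _ dual_lattice_traceless[OF X]] D cD c
      kern_orbit_finite[OF N \<kappa> G fd X, unfolded orbit0_def]]
    unfold_has_sum[OF fd kern_measurable[OF cusp_form_holo[OF G]] kern_invariant[OF G _ dual_lattice_traceless[OF X]] D cD c
      kern_orbit_finite[OF N \<kappa> G fd X, unfolded orbit0_def]]
  by (simp_all add: orbit0_def)

lemma hmeas_integral:
  fixes u :: "complex \<Rightarrow> complex"
  assumes u: "integrable hmeas u" and [measurable]: "u \<in> borel_measurable borel"
  shows "(LINT z|hmeas. u z) = (LINT s|lborel. LINT t|lborel. u (hpt s t))"
    and "(LINT z|hmeas. u z) = (LINT t|lborel. LINT s|lborel. u (hpt s t))"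
    and "integrable (lborel \<Otimes>\<^sub>M lborel) (\<lambda>(s, t). u (hpt s t))"
proof -
  have eq: "(\<lambda>(s, t). u (hpt s t)) = (\<lambda>p. u (case p of (s, t) \<Rightarrow> hpt s t))" by auto
  have "integrable (distr (lborel \<Otimes>\<^sub>M lborel) borel (\<lambda>(s, t). hpt s t)) u" using u hmeas_distr by simp
  then show int: "integrable (lborel \<Otimes>\<^sub>M lborel) (\<lambda>(s, t). u (hpt s t))"
    unfolding eq by (subst (asm) integrable_distr_eq) auto
  have "(LINT z|hmeas. u z) = (LINT z|(distr (lborel \<Otimes>\<^sub>M lborel) borel (\<lambda>(s, t). hpt s t)). u z)"
    using hmeas_distr by simp
  also have "\<dots> = (LINT p|(lborel \<Otimes>\<^sub>M lborel). (case p of (s, t) \<Rightarrow> u (hpt s t)))"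
    unfolding eq by (subst integral_distr) auto
  finally have e: "(LINT z|hmeas. u z) = (LINT p|(lborel \<Otimes>\<^sub>M lborel). (case p of (s, t) \<Rightarrow> u (hpt s t)))" .
  show "(LINT z|hmeas. u z) = (LINT s|lborel. LINT t|lborel. u (hpt s t))"
    unfolding e using lborel_pair.integral_fst[OF int] by simp
  show "(LINT z|hmeas. u z) = (LINT t|lborel. LINT s|lborel. u (hpt s t))"
    unfolding e using lborel_pair.integral_snd[OF int] by simp
qed

subsection \<open>Vectors of positive norm\<close>

lemma finite_elliptic_stabilizer:
  assumes X: "X \<in> traceless" and det: "det X > 0"
  shows "finite {s \<in> Gamma0 N. conj_act s X = X}"
proof -
  define x1 x2 x3 where "x1 = X$1$2" and "x2 = X$1$1" and "x3 = X$2$1"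
  have X22: "X$2$2 = - x2" using X by (simp add: traceless_def x2_def)
  define \<delta> where "\<delta> = - (x2\<^sup>2 + x1 * x3)"
  have \<delta>: "\<delta> > 0" using det by (simp add: det_2 X22 \<delta>_def power2_eq_square flip: x1_def x2_def x3_def)
  have x3: "x3 \<noteq> 0" using \<delta> zero_le_power2[of x2] by (auto simp: \<delta>_def)
  define h where "h s = (\<lfloor>s$2$1\<rfloor>, \<lfloor>s$2$2\<rfloor>)" for s :: "real^2^2"
  define S where "S = {s \<in> Gamma0 N. conj_act s X = X}"
  define M where "M = \<lceil>\<bar>x3\<bar> / sqrt \<delta>\<rceil> + \<lceil>1 + \<bar>x2\<bar> / sqrt \<delta>\<rceil>"
  have rel: "s$1$2 * x3 = s$2$1 * x1" "(s$1$1 - s$2$2) * x3 = 2 * s$2$1 * x2"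
    "s$1$1 * s$2$2 - s$1$2 * s$2$1 = 1" if "s \<in> S" for s
  proof -
    have sG: "s \<in> Gamma0 N" and "conj_act s X = X" using that by (auto simp: S_def)
    then have e: "s ** X = X ** s" using conj_act_eq_iff[OF Gamma0_SL2[OF sG]] by simp
    have "(s ** X)$1$1 = (X ** s)$1$1" "(s ** X)$2$1 = (X ** s)$2$1" using e by simp_all
    then show "s$1$2 * x3 = s$2$1 * x1" "(s$1$1 - s$2$2) * x3 = 2 * s$2$1 * x2"
      unfolding mult_nth2 X22 x1_def[symmetric] x2_def[symmetric] x3_def[symmetric] by (simp_all add: algebra_simps)
    show "s$1$1 * s$2$2 - s$1$2 * s$2$1 = 1" by (rule SL2_det[OF Gamma0_SL2[OF sG]])
  qed
  have "inj_on h S"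
  proof (rule inj_onI)
    fix s s' assume s: "s \<in> S" "s' \<in> S" and eq: "h s = h s'"
    obtain a b c d :: int where sa: "s = mat2 (of_int a) (of_int b) (of_int c) (of_int d)"
      using s(1) unfolding S_def by (auto elim: Gamma0E)
    obtain a' b' c' d' :: int where sa': "s' = mat2 (of_int a') (of_int b') (of_int c') (of_int d')"
      using s(2) unfolding S_def by (auto elim: Gamma0E)
    have "s$2$1 = s'$2$1" "s$2$2 = s'$2$2" using eq by (simp_all add: h_def sa sa')
    then have "s$1$2 * x3 = s'$1$2 * x3" "(s$1$1 - s'$1$1) * x3 = 0"
      using rel[OF s(1)] rel[OF s(2)] by (simp_all add: algebra_simps)
    then show "s = s'" using x3 \<open>s$2$1 = s'$2$1\<close> \<open>s$2$2 = s'$2$2\<close> by (simp add: mat2_eq_iff)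
  qed
  moreover have "h ` S \<subseteq> {- M..M} \<times> {- M..M}"
  proof
    fix p assume "p \<in> h ` S"
    then obtain s where s: "s \<in> S" "p = h s" by blast
    obtain a b c d :: int where sa: "s = mat2 (of_int a) (of_int b) (of_int c) (of_int d)"
      using s(1) unfolding S_def by (auto elim: Gamma0E)
    define c' d' where "c' = real_of_int c" and "d' = real_of_int d"
    have e: "(d' * x3 + c' * x2)\<^sup>2 + c'\<^sup>2 * \<delta> = x3\<^sup>2"
    proof -
      have b: "real_of_int b * x3 = c' * x1" and a: "real_of_int a * x3 = d' * x3 + 2 * c' * x2" and
        dt: "real_of_int a * d' - real_of_int b * c' = 1"
        using rel[OF s(1)] by (simp_all add: sa c'_def d'_def algebra_simps)
      have "x3 * ((real_of_int a * x3) * d' - (real_of_int b * x3) * c') = x3\<^sup>2 * (real_of_int a * d' - real_of_int b * c')"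
        by (simp add: power2_eq_square algebra_simps)
      then have "x3\<^sup>2 = x3 * ((real_of_int a * x3) * d' - (real_of_int b * x3) * c')" by (simp only: dt mult_1_right)
      also have "\<dots> = (d' * x3 + c' * x2)\<^sup>2 + c'\<^sup>2 * \<delta>"
        unfolding a b by (simp add: \<delta>_def power2_eq_square algebra_simps)
      finally show ?thesis by simp
    qed
    have sd: "sqrt \<delta> > 0" using \<delta> by simp
    have "(c' * sqrt \<delta>)\<^sup>2 = c'\<^sup>2 * \<delta>" using \<delta> by (simp add: power_mult_distrib)
    also have "\<dots> \<le> (d' * x3 + c' * x2)\<^sup>2 + c'\<^sup>2 * \<delta>" by simp
    finally have "(c' * sqrt \<delta>)\<^sup>2 \<le> x3\<^sup>2" unfolding e .
    then have "\<bar>c' * sqrt \<delta>\<bar> \<le> \<bar>x3\<bar>" by (simp add: abs_le_square_iff)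
    then have cb: "\<bar>c'\<bar> \<le> \<bar>x3\<bar> / sqrt \<delta>" using sd by (simp add: abs_mult field_simps)
    have "(d' * x3 + c' * x2)\<^sup>2 \<le> x3\<^sup>2" using e \<delta> zero_le_power2[of c'] mult_nonneg_nonneg[of "c'\<^sup>2" \<delta>] by linarith
    then have "\<bar>d' * x3 + c' * x2\<bar> \<le> \<bar>x3\<bar>" by (simp add: abs_le_square_iff)
    then have "\<bar>d' * x3\<bar> \<le> \<bar>x3\<bar> + \<bar>c'\<bar> * \<bar>x2\<bar>" by (simp add: abs_mult[symmetric])
    also have "\<dots> \<le> \<bar>x3\<bar> + (\<bar>x3\<bar> / sqrt \<delta>) * \<bar>x2\<bar>" using cb by (intro add_left_mono mult_right_mono) auto
    also have "\<dots> = \<bar>x3\<bar> * (1 + \<bar>x2\<bar> / sqrt \<delta>)" by (simp add: algebra_simps)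
    finally have db: "\<bar>d'\<bar> \<le> 1 + \<bar>x2\<bar> / sqrt \<delta>" using x3 by (simp add: abs_mult mult.commute)
    have n1: "0 \<le> \<bar>x3\<bar> / sqrt \<delta>" "0 \<le> 1 + \<bar>x2\<bar> / sqrt \<delta>" using sd by (auto intro: add_nonneg_nonneg divide_nonneg_nonneg)
    have "\<bar>c'\<bar> \<le> of_int M" "\<bar>d'\<bar> \<le> of_int M"
      using cb db n1 le_of_int_ceiling[of "\<bar>x3\<bar> / sqrt \<delta>"] le_of_int_ceiling[of "1 + \<bar>x2\<bar> / sqrt \<delta>"]
      unfolding M_def by linarith+
    then have "c \<in> {- M..M}" "d \<in> {- M..M}" unfolding c'_def d'_def by (auto simp: abs_le_iff)
    then show "p \<in> {- M..M} \<times> {- M..M}" by (simp add: s h_def sa)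
  qed
  then have "finite (h ` S)" by (rule finite_subset) simp
  ultimately show ?thesis using finite_imageD by (auto simp: S_def)
qed

lemma kern_elliptic:
  assumes N: "N > 0" and \<kappa>: "\<kappa> > 0" and G: "G \<in> cusp_forms (2 * k + 2) N" and fd: "fundamental_domain N F"
    and X: "X \<in> dual_lattice N" and q: "qform N X > 0"
  shows "((\<lambda>Y. LINT z:F|hmeas. kern N k \<kappa> G Y z) has_sum 0) (orbit0 N X)"
proof -
  note tr = dual_lattice_traceless[OF X]
  have det: "det X > 0" using q N by (simp add: qform_def zero_less_mult_iff)
  define c where "c = card {s \<in> Gamma0 N. conj_act s X = X}"
  have "mat 1 \<in> {s \<in> Gamma0 N. conj_act s X = X}" by (simp add: Gamma0_one)
  then have c: "c > 0" unfolding c_def using finite_elliptic_stabilizer[OF tr det] by (auto simp: card_gt_0_iff)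
  have cD: "AE z in hmeas. card {s \<in> Gamma0 N. conj_act s X = X \<and> moebius s z \<in> UNIV} = c" by (simp add: c_def)
  have UNIV: "(UNIV :: complex set) \<in> sets borel" by simp
  note ki = kern_integrable[OF N \<kappa> G fd X UNIV cD c] and ks = kern_has_sum[OF N \<kappa> G fd X UNIV cD c]
  note km [measurable] = kern_measurable[OF cusp_form_holo[OF G], of N k \<kappa> X]
  define x1 x2 x3 where "x1 = X$1$2" and "x2 = X$1$1" and "x3 = X$2$1"
  have X22: "X$2$2 = - x2" using tr by (simp add: traceless_def x2_def)
  define \<delta> where "\<delta> = - (x2\<^sup>2 + x1 * x3)"
  have \<delta>: "\<delta> > 0" using det by (simp add: det_2 X22 \<delta>_def power2_eq_square flip: x1_def x2_def x3_def)
  have x3: "x3 \<noteq> 0" using \<delta> zero_le_power2[of x2] by (auto simp: \<delta>_def)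
  define s0 where "s0 = sgn x3 * sqrt \<delta>"
  define y0 where "y0 = s0 / x3"
  define x0 where "x0 = x2 / x3"
  have y0: "y0 > 0" using x3 \<delta> by (auto simp: y0_def s0_def sgn_if divide_neg_neg divide_pos_neg)
  have s02: "s0 * s0 = \<delta>" using x3 \<delta> by (auto simp: s0_def sgn_if)
  have s0y: "s0 = y0 * x3" using x3 by (simp add: y0_def)
  define g where "g = mat2 (sqrt y0) (x0 / sqrt y0) 0 (1 / sqrt y0)"
  have g: "g \<in> SL2" using y0 by (simp add: g_def SL2_mat2)
  define X1 where "X1 = mat2 0 (- s0) s0 0"
  have X1: "X1 \<in> traceless" by (simp add: X1_def traceless_def)
  have sq: "sqrt y0 * sqrt y0 = y0" "sqrt y0 \<noteq> 0" using y0 by simp_all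
  have XX: "conj_act g X1 = X"
  proof -
    have "x0 / sqrt y0 * (1 / sqrt y0) * s0 = x2"
    proof -
      have "x0 / sqrt y0 * (1 / sqrt y0) * s0 = x0 * s0 / (sqrt y0 * sqrt y0)" by simp
      also have "\<dots> = x2" unfolding sq(1) s0y x0_def using y0 x3 by simp
      finally show ?thesis .
    qed
    moreover have "- ((sqrt y0)\<^sup>2 * s0) - (x0 / sqrt y0)\<^sup>2 * s0 = x1"
    proof -
      have "- ((sqrt y0)\<^sup>2 * s0) - (x0 / sqrt y0)\<^sup>2 * s0 = - (y0 * s0) - x0\<^sup>2 * s0 / y0"
        using y0 by (simp add: power_divide)
      also have "y0 * s0 = \<delta> / x3" using s02 by (simp add: y0_def)
      also have "x0\<^sup>2 * s0 / y0 = x2\<^sup>2 / x3" unfolding s0y x0_def using y0 x3 by (simp add: power_divide power2_eq_square)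
      also have "- (\<delta> / x3) - x2\<^sup>2 / x3 = x1" using x3 by (simp add: \<delta>_def field_simps)
      finally show ?thesis .
    qed
    moreover have "(1 / sqrt y0)\<^sup>2 * s0 = x3" using y0 by (simp add: power_divide s0y)
    ultimately show ?thesis
      unfolding conj_act_mat2[OF g X1] by (simp add: mat2_eq_iff g_def X1_def X22 x1_def x2_def x3_def)
  qed
  define f where "f w = slash (2 * k + 2) G g w * Qpoly N X1 w ^ (k + 1)" for w
  define W where "W w = exp (- \<kappa> * (pfun N w X1)\<^sup>2)" for w
  have fh: "f holomorphic_on upper_half_plane"
    unfolding f_def Qpoly_def by (intro holomorphic_intros slash_holo g cusp_form_holo[OF G])
  have fi: "f \<i> = 0" by (simp add: f_def Qpoly_def X1_def)
  have Wm: "W \<in> borel_measurable borel" unfolding W_def by measurable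
  have Winv: "W (moebius (rot t) z) = W z" if "Im z > 0" for t z
  proof -
    have "rot t ** X1 = X1 ** rot t" by (simp add: rot_def X1_def mat2_mult mult.commute)
    then have "conj_act (rot t) X1 = X1" using conj_act_eq_iff[OF rot_SL2] by simp
    then show ?thesis using pfun_conj[OF rot_SL2[of t] X1 that, of N] by (simp add: W_def)
  qed
  have AE: "AE w in hmeas. kern N k \<kappa> G X (moebius g w) = f w * of_real (W w)"
    using AE_hmeas
  proof eventually_elim
    case (elim w)
    show ?case using kern_conj[OF g X1 elim, of N k \<kappa> G] unfolding XX f_def W_def .
  qed
  have "integrable hmeas (kern N k \<kappa> G X)" using ki by (simp add: set_integrable_def)
  then have i1: "integrable hmeas (\<lambda>w. kern N k \<kappa> G X (moebius g w))" using integrable_hmeas_moebius[OF g km] by simp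
  have [measurable]: "hcut f \<in> borel_measurable borel" by (rule hcut_measurable[OF fh])
  have AE': "AE w in hmeas. hcut f w * of_real (W w) = f w * of_real (W w)"
    using AE_hmeas by eventually_elim (simp add: hcut_def)
  have hm: "(LINT w|hmeas. hcut f w * of_real (W w)) = 0"
  proof -
    have hf: "hcut f holomorphic_on upper_half_plane"
      using fh by (rule holomorphic_transform) (simp add: hcut_def upper_half_plane_def)
    have "integrable hmeas (\<lambda>w. hcut f w * of_real (W w))"
      using i1 by (rule integrable_cong_AE_imp) (use AE AE' Wm in \<open>auto elim: eventually_elim2\<close>)
    from hmeas_mean[OF hf Wm Winv this] show ?thesis by (simp add: hcut_def fi)
  qed
  have "(LINT z:UNIV|hmeas. kern N k \<kappa> G X z) = (LINT z|hmeas. kern N k \<kappa> G X z)" by (simp add: set_lebesgue_integral_def)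
  also have "\<dots> = (LINT w|hmeas. kern N k \<kappa> G X (moebius g w))" by (rule integral_hmeas_moebius[OF g km, symmetric])
  also have "\<dots> = (LINT w|hmeas. hcut f w * of_real (W w))"
    by (rule integral_cong_AE) (use AE AE' Wm km in \<open>auto elim: eventually_elim2\<close>)
  finally show ?thesis using ks hm by simp
qed

subsection \<open>Integrals along rays\<close>

lemma Im_hpt: "Im (hpt s t) > 0"
  by (simp add: hpt_def)

lemma hpt_uhp: "hpt s t \<in> upper_half_plane"
  by (simp add: upper_half_plane_def Im_hpt)

lemma hpt_mult: "hpt s t = of_real (exp s) * Complex t 1"
  by (simp add: hpt_def complex_eq_iff)

lemma hpt_add: "of_real (exp a) * hpt s t = hpt (a + s) t"
  by (simp add: hpt_def complex_eq_iff exp_add)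

lemma uhp_primitive:
  assumes "f holomorphic_on upper_half_plane"
  obtains F where "\<And>z. Im z > 0 \<Longrightarrow> (F has_field_derivative f z) (at z)"
proof -
  have cv: "convex upper_half_plane" and op: "open upper_half_plane"
    unfolding upper_half_plane_def by (rule convex_halfspace_Im_gt, rule open_halfspace_Im_gt)
  show ?thesis
  proof (rule holomorphic_convex_primitive'[OF cv op assms])
    fix F assume F: "\<And>z. z \<in> upper_half_plane \<Longrightarrow> (F has_field_derivative f z) (at z within upper_half_plane)"
    show ?thesis
    proof (rule that[of F])
      fix z :: complex assume "Im z > 0"
      then have z: "z \<in> upper_half_plane" by (simp add: upper_half_plane_def)
      show "(F has_field_derivative f z) (at z)" using F[OF z] unfolding at_within_open[OF z op] .
    qed
  qed
qed

lemma ray_FTC: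
  assumes F: "\<And>z. Im z > 0 \<Longrightarrow> (F has_field_derivative f z) (at z)" and ab: "a \<le> b"
  shows "((\<lambda>s. f (hpt s t) * hpt s t) has_integral (F (hpt b t) - F (hpt a t))) {a..b}"
proof (rule fundamental_theorem_of_calculus[OF ab])
  fix s assume "s \<in> {a..b}"
  have "((\<lambda>s. complex_of_real (exp s) * Complex t 1) has_vector_derivative (of_real (exp s) * Complex t 1)) (at s)"
    by (intro has_vector_derivative_mult_left has_vector_derivative_of_real) (auto intro!: derivative_eq_intros)
  then have "((\<lambda>s. hpt s t) has_vector_derivative hpt s t) (at s)" unfolding hpt_mult .
  from field_vector_diff_chain_at[OF this F[OF Im_hpt]]
  have "((\<lambda>s. F (hpt s t)) has_vector_derivative (f (hpt s t) * hpt s t)) (at s)" by (simp add: o_def mult.commute)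
  then show "((\<lambda>s. F (hpt s t)) has_vector_derivative (f (hpt s t) * hpt s t)) (at s within {a..b})"
    by (rule has_vector_derivative_at_within)
qed

lemma arc_bound:
  assumes F: "\<And>z. Im z > 0 \<Longrightarrow> (F has_field_derivative f z) (at z)"
    and f: "f holomorphic_on upper_half_plane" and t: "\<bar>t\<bar> \<le> T"
  shows "ennreal (norm (F (hpt s t) - F (hpt s 0))) \<le> (\<integral>\<^sup>+r. ennreal (norm (f (hpt s r)) * exp s) * indicator {- T..T} r \<partial>lborel)"
proof -
  define d where "d r = f (hpt s r) * of_real (exp s)" for r
  have der: "((\<lambda>r. F (hpt s r)) has_vector_derivative d r) (at r)" for r
  proof -
    have "((\<lambda>r. complex_of_real (exp s) * (of_real r + \<i>)) has_vector_derivative (of_real (exp s) * (of_real 1 + 0))) (at r)"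
      by (intro has_vector_derivative_mult_right has_vector_derivative_add has_vector_derivative_of_real has_vector_derivative_const) (auto intro!: derivative_eq_intros)
    moreover have "complex_of_real (exp s) * (of_real r + \<i>) = hpt s r" for r by (simp add: hpt_def complex_eq_iff)
    ultimately have "((\<lambda>r. hpt s r) has_vector_derivative of_real (exp s)) (at r)" by simp
    from field_vector_diff_chain_at[OF this F[OF Im_hpt]] show ?thesis by (simp add: o_def mult.commute d_def)
  qed
  have cont: "continuous_on A d" for A
    unfolding d_def hpt_mult Complex_eq
    by (intro continuous_intros continuous_on_compose2[OF holomorphic_on_imp_continuous_on[OF f]])
      (auto simp: upper_half_plane_def)
  define a b where "a = min t 0" and "b = max t 0"
  have ab: "a \<le> b" by (simp add: a_def b_def)
  have "(d has_integral (F (hpt s b) - F (hpt s a))) {a..b}"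
    using ab der by (intro fundamental_theorem_of_calculus) (auto intro: has_vector_derivative_at_within)
  moreover have si: "set_integrable lborel {a..b} d" by (intro borel_integrable_atLeastAtMost' cont)
  then have "(d has_integral (LINT r:{a..b}|lborel. d r)) {a..b}"
    using set_borel_integral_eq_integral[OF si] by (auto simp: has_integral_iff)
  ultimately have "F (hpt s b) - F (hpt s a) = (LINT r:{a..b}|lborel. d r)" by (rule has_integral_unique)
  then have "ennreal (norm (F (hpt s b) - F (hpt s a))) \<le> (\<integral>\<^sup>+r. norm (indicator {a..b} r *\<^sub>R d r) \<partial>lborel)"
    using integral_norm_bound_ennreal[of lborel "\<lambda>r. indicator {a..b} r *\<^sub>R d r"] si
    by (simp add: set_integrable_def set_lebesgue_integral_def)
  also have "\<dots> \<le> (\<integral>\<^sup>+r. ennreal (norm (f (hpt s r)) * exp s) * indicator {- T..T} r \<partial>lborel)"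
    using t by (intro nn_integral_mono) (auto simp: indicator_def d_def norm_mult a_def b_def)
  also have "norm (F (hpt s b) - F (hpt s a)) = norm (F (hpt s t) - F (hpt s 0))"
    by (auto simp: a_def b_def min_def max_def norm_minus_commute)
  finally show ?thesis .
qed

lemma small_value_exists:
  fixes g :: "real \<Rightarrow> ennreal"
  assumes fin: "(\<integral>\<^sup>+s. g s \<partial>lborel) < \<infinity>" and \<epsilon>: "\<epsilon> > 0"
  shows "\<exists>s\<ge>b. g s < ennreal \<epsilon>" and "\<exists>s\<le>b. g s < ennreal \<epsilon>"
proof -
  have *: "\<exists>s\<in>S. g s < ennreal \<epsilon>" if S: "S \<in> sets borel" "emeasure lborel S = \<infinity>" for S
  proof (rule ccontr)
    assume "\<not> (\<exists>s\<in>S. g s < ennreal \<epsilon>)"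
    then have "(\<integral>\<^sup>+s. ennreal \<epsilon> * indicator S s \<partial>lborel) \<le> (\<integral>\<^sup>+s. g s \<partial>lborel)"
      by (intro nn_integral_mono) (auto simp: indicator_def not_less)
    moreover have "(\<integral>\<^sup>+s. ennreal \<epsilon> * indicator S s \<partial>lborel) = ennreal \<epsilon> * \<infinity>"
      using S by (subst nn_integral_cmult_indicator) auto
    moreover have "ennreal \<epsilon> * \<infinity> = \<infinity>" using \<epsilon> by (simp add: ennreal_mult_top)
    ultimately show False using fin by simp
  qed
  have inf: "emeasure lborel S = \<infinity>" if seg: "\<And>n::nat. \<exists>c. {c..c + real n} \<subseteq> S" and S: "S \<in> sets borel" for S
  proof (rule ccontr)
    assume "emeasure lborel S \<noteq> \<infinity>"
    then obtain m where m: "emeasure lborel S = ennreal m" "m \<ge> 0" by (cases "emeasure lborel S") auto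
    obtain n :: nat where n: "real n > m" using reals_Archimedean2 by blast
    obtain c where "{c..c + real n} \<subseteq> S" using seg by blast
    then have "emeasure lborel {c..c + real n} \<le> emeasure lborel S" using S by (intro emeasure_mono) auto
    then show False using m n by simp
  qed
  have "\<exists>c. {c..c + real n} \<subseteq> {b..}" for n by (intro exI[of _ b]) auto
  from *[OF _ inf[OF this]] show "\<exists>s\<ge>b. g s < ennreal \<epsilon>" by auto
  have "\<exists>c. {c..c + real n} \<subseteq> {..b}" for n by (intro exI[of _ "b - real n"]) auto
  from *[OF _ inf[OF this]] show "\<exists>s\<le>b. g s < ennreal \<epsilon>" by auto
qed

definition hball :: "complex set" where
  "hball = {w. Im w > 0 \<and> (cmod w)\<^sup>2 + 1 \<le> 5 / 2 * Im w}"

lemma hball_measurable [measurable]: "hball \<in> sets borel"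
  unfolding hball_def by measurable

lemma hball_bounds:
  assumes "hpt s t \<in> hball"
  shows "\<bar>s\<bar> \<le> 1" "\<bar>t\<bar> \<le> 2" "exp (- s) \<le> 2"
proof -
  define y where "y = exp s"
  have y: "y > 0" by (simp add: y_def)
  have "(y * t)\<^sup>2 + y\<^sup>2 + 1 \<le> 5 / 2 * y"
    using assms unfolding hball_def hpt_def y_def[symmetric] mem_Collect_eq cmod_power2 by simp
  then have le: "(y * t)\<^sup>2 + (y - 5 / 4)\<^sup>2 \<le> 9 / 16" by (simp add: power2_eq_square algebra_simps)
  have "(y - 5 / 4)\<^sup>2 \<le> (y * t)\<^sup>2 + (y - 5 / 4)\<^sup>2" by simp
  also have "\<dots> \<le> (3 / 4)\<^sup>2" using le by (simp add: power_divide)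
  finally have "(y - 5 / 4)\<^sup>2 \<le> (3 / 4)\<^sup>2" .
  then have "\<bar>y - 5 / 4\<bar> \<le> 3 / 4" by (simp add: abs_le_square_iff[symmetric])
  then have y2: "1 / 2 \<le> y" "y \<le> 2" by linarith+
  have e1: "exp 1 \<ge> (2::real)" using exp_ge_add_one_self[of 1] by simp
  have "exp s \<le> exp 1" using order_trans[OF y2(2) e1] unfolding y_def .
  moreover have "exp (- 1) \<le> (1 / 2 :: real)" using e1 by (simp add: exp_minus field_simps)
  from order_trans[OF this y2(1)] have "exp (- 1) \<le> exp s" unfolding y_def .
  ultimately show "\<bar>s\<bar> \<le> 1" by (simp add: abs_le_iff)
  show "exp (- s) \<le> 2" using y2(1) by (simp add: y_def exp_minus field_simps)
  have "(1 / 2 * \<bar>t\<bar>)\<^sup>2 \<le> (y * \<bar>t\<bar>)\<^sup>2" using y2 by (intro power_mono mult_right_mono) auto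
  also have "(y * \<bar>t\<bar>)\<^sup>2 = (y * t)\<^sup>2" by (simp add: power_mult_distrib)
  also have "\<dots> \<le> 9 / 16" using le zero_le_power2[of "y - 5 / 4"] by linarith
  also have "\<dots> \<le> 1\<^sup>2" by simp
  finally have "1 / 2 * \<bar>t\<bar> \<le> 1" by (rule power2_le_imp_le) simp
  then show "\<bar>t\<bar> \<le> 2" by simp
qed

lemma hball_pos: "emeasure hmeas hball > 0"
proof -
  have sub: "hpt s t \<in> hball" if "s \<in> {0..1/4}" "t \<in> {0..1/4}" for s t
  proof -
    define y where "y = exp s"
    have y1: "y \<ge> 1" using that by (simp add: y_def)
    have "exp (- s) \<ge> 3 / 4" using exp_ge_add_one_self[of "- s"] that by simp
    then have y2: "y \<le> 4 / 3" by (simp add: y_def exp_minus field_simps)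
    have "(y - 1) * (y - 4 / 3) \<le> 0" using y1 y2 by (intro mult_nonneg_nonpos) auto
    moreover have "(y - 1) * (y - 4 / 3) = y\<^sup>2 - (7 / 3 * y - 4 / 3)" by (simp add: power2_eq_square field_simps)
    ultimately have yy: "y\<^sup>2 \<le> 7 / 3 * y - 4 / 3" by simp
    have "t\<^sup>2 \<le> (1 / 4)\<^sup>2" using that by (intro power_mono) auto
    then have "t\<^sup>2 \<le> 1 / 16" by (simp add: power_divide)
    then have "y\<^sup>2 * t\<^sup>2 \<le> y\<^sup>2 * (1 / 16)" by (rule mult_left_mono) simp
    then have "(y * t)\<^sup>2 + y\<^sup>2 + 1 \<le> 5 / 2 * y" unfolding power_mult_distrib using yy y1 by linarith
    then show ?thesis unfolding hball_def hpt_def mem_Collect_eq cmod_power2 y_def[symmetric] using y1 by simp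
  qed
  have "(\<integral>\<^sup>+s. \<integral>\<^sup>+t. indicator {0..1/4::real} s * indicator {0..1/4::real} t \<partial>lborel \<partial>lborel) \<le>
     (\<integral>\<^sup>+s. \<integral>\<^sup>+t. indicator hball (hpt s t) \<partial>lborel \<partial>lborel)"
    by (intro nn_integral_mono) (auto simp: indicator_def sub)
  also have "\<dots> = (\<integral>\<^sup>+w. indicator hball w \<partial>hmeas)" by (rule nn_integral_hmeas[symmetric]) simp
  also have "\<dots> = emeasure hmeas hball" by simp
  also have "(\<integral>\<^sup>+s. \<integral>\<^sup>+t. indicator {0..1/4::real} s * indicator {0..1/4::real} t \<partial>lborel \<partial>lborel) = ennreal (1/4) * ennreal (1/4)"
    by (simp add: nn_integral_cmult nn_integral_multc)
  finally have "ennreal (1/4) * ennreal (1/4) \<le> emeasure hmeas hball" .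
  moreover have "ennreal (1/4) * ennreal (1/4) > 0" by (simp add: ennreal_zero_less_mult_iff)
  ultimately show ?thesis by (rule order.strict_trans2[rotated])
qed

lemma hball_finite: "emeasure hmeas hball < \<infinity>"
proof -
  have "hball \<subseteq> siegel"
  proof
    fix w assume w: "w \<in> hball"
    then have le: "(Re w)\<^sup>2 + (Im w)\<^sup>2 + 1 \<le> 5 / 2 * Im w" unfolding hball_def mem_Collect_eq cmod_power2 by simp
    then have le': "(Re w)\<^sup>2 + (Im w - 5 / 4)\<^sup>2 \<le> 9 / 16" by (simp add: power2_eq_square algebra_simps)
    have "(Im w - 5 / 4)\<^sup>2 \<le> (Re w)\<^sup>2 + (Im w - 5 / 4)\<^sup>2" by simp
    also have "\<dots> \<le> (3 / 4)\<^sup>2" using le' by (simp add: power_divide)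
    finally have "(Im w - 5 / 4)\<^sup>2 \<le> (3 / 4)\<^sup>2" .
    then have "\<bar>Im w - 5 / 4\<bar> \<le> 3 / 4" by (simp add: abs_le_square_iff[symmetric])
    moreover have "(Re w)\<^sup>2 \<le> 1" using le' zero_le_power2[of "Im w - 5 / 4"] by linarith
    then have "\<bar>Re w\<bar> \<le> 1" by (simp add: abs_square_le_1)
    ultimately show "w \<in> siegel" unfolding siegel_def mem_Collect_eq by linarith
  qed
  then have "emeasure hmeas hball \<le> emeasure hmeas siegel" by (intro emeasure_mono) auto
  then show ?thesis using hmeas_siegel_finite by (rule order.strict_trans1)
qed

lemma hball_mean:
  assumes f: "f holomorphic_on upper_half_plane"
  shows "ennreal (norm (f \<i>)) * emeasure hmeas hball \<le> (\<integral>\<^sup>+w. ennreal (norm (f w)) * indicator hball w \<partial>hmeas)"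
proof (cases "(\<integral>\<^sup>+w. ennreal (norm (f w)) * indicator hball w \<partial>hmeas) < \<infinity>")
  case False
  then show ?thesis by (simp add: not_less top_unique)
next
  case True
  define X1 where "X1 = mat2 0 (-1) 1 0"
  have X1: "X1 \<in> traceless" by (simp add: X1_def traceless_def)
  define W where "W w = (if pfun 1 w X1 \<ge> - (5 / 2) then 1 else 0 :: real)" for w
  have [measurable]: "W \<in> borel_measurable borel" unfolding W_def by measurable
  have Wb: "W w = indicator hball w" if "Im w > 0" for w
    using that by (simp add: W_def hball_def indicator_def X1_def pfun_def field_simps)
  have Winv: "W (moebius (rot t) z) = W z" if "Im z > 0" for t z
  proof -
    have "rot t ** X1 = X1 ** rot t" by (simp add: rot_def X1_def mat2_mult)
    then have "conj_act (rot t) X1 = X1" using conj_act_eq_iff[OF rot_SL2] by simp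
    then show ?thesis using pfun_conj[OF rot_SL2[of t] X1 that, of 1] by (simp add: W_def)
  qed
  have hf: "hcut f holomorphic_on upper_half_plane"
    using f by (rule holomorphic_transform) (simp add: hcut_def upper_half_plane_def)
  have [measurable]: "hcut f \<in> borel_measurable borel" by (rule hcut_measurable[OF f])
  have nn: "(\<integral>\<^sup>+w. ennreal (norm (hcut f w * of_real (W w))) \<partial>hmeas) = (\<integral>\<^sup>+w. ennreal (norm (f w)) * indicator hball w \<partial>hmeas)"
  proof (rule nn_integral_cong_AE)
    show "AE w in hmeas. ennreal (norm (hcut f w * of_real (W w))) = ennreal (norm (f w)) * indicator hball w"
      using AE_hmeas by eventually_elim (auto simp: hcut_def Wb norm_mult indicator_def)
  qed
  have int: "integrable hmeas (\<lambda>w. hcut f w * of_real (W w))"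
    by (rule integrableI_bounded) (use nn True in auto)
  have "(LINT w|hmeas. hcut f w * of_real (W w)) = (LINT w|hmeas. hcut f \<i> * of_real (W w))"
    by (rule hmeas_mean[OF hf _ Winv int]) auto
  also have "\<dots> = f \<i> * of_real (LINT w|hmeas. W w)" by (simp add: hcut_def)
  also have "(LINT w|hmeas. W w) = (LINT w|hmeas. indicator hball w)"
    by (rule integral_cong_AE) (use AE_hmeas Wb in \<open>auto elim: eventually_mono\<close>)
  also have "\<dots> = measure hmeas hball" by simp
  finally have e: "(LINT w|hmeas. hcut f w * of_real (W w)) = f \<i> * of_real (measure hmeas hball)" .
  have "ennreal (norm (f \<i> * of_real (measure hmeas hball))) \<le> (\<integral>\<^sup>+w. ennreal (norm (f w)) * indicator hball w \<partial>hmeas)"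
    using integral_norm_bound_ennreal[OF int] unfolding e nn .
  moreover have "emeasure hmeas hball = ennreal (measure hmeas hball)"
    using hball_finite by (intro emeasure_eq_ennreal_measure) auto
  ultimately show ?thesis by (simp add: norm_mult ennreal_mult)
qed

text \<open>
  Integrability over almost all rays is upgraded to the central ray by averaging over the hyperbolic
  balls centred on it, and the arcs joining two rays tend to zero along suitable sequences.
\<close>
lemma ray_integral_const:
  assumes f: "f holomorphic_on upper_half_plane" and c: "c \<ge> 0"
    and fin: "(\<integral>\<^sup>+t. \<integral>\<^sup>+s. ennreal (norm (f (hpt s t)) * exp s * exp (- c * t\<^sup>2)) \<partial>lborel \<partial>lborel) < \<infinity>"
  shows "AE t in lborel. (LINT s|lborel. f (hpt s t) * hpt s t) = (LINT s|lborel. f (hpt s 0) * hpt s 0)"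
proof -
  have [measurable]: "hcut f \<in> borel_measurable borel" by (rule hcut_measurable[OF f])
  have cut: "f (hpt s t) = hcut f (hpt s t)" for s t using Im_hpt by (simp add: hcut_def)
  define h where "h s t = ennreal (norm (hcut f (hpt s t)) * exp s)" for s t
  have hm [measurable]: "(\<lambda>x. h (a x) (b x)) \<in> borel_measurable M" if [measurable]: "a \<in> borel_measurable M" "b \<in> borel_measurable M" for a b and M :: "'b measure"
    unfolding h_def by measurable
  define A where "A t = (\<integral>\<^sup>+s. h s t \<partial>lborel)" for t
  have [measurable]: "A \<in> borel_measurable lborel" unfolding A_def by measurable
  have AT: "(\<integral>\<^sup>+t. A t * indicator {- T..T} t \<partial>lborel) < \<infinity>" for T
  proof -
    have "(\<integral>\<^sup>+t. A t * indicator {- T..T} t \<partial>lborel) \<le>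
      (\<integral>\<^sup>+t. ennreal (exp (c * T\<^sup>2)) * (\<integral>\<^sup>+s. ennreal (norm (f (hpt s t)) * exp s * exp (- c * t\<^sup>2)) \<partial>lborel) \<partial>lborel)"
    proof (rule nn_integral_mono)
      fix t
      show "A t * indicator {- T..T} t \<le> ennreal (exp (c * T\<^sup>2)) * (\<integral>\<^sup>+s. ennreal (norm (f (hpt s t)) * exp s * exp (- c * t\<^sup>2)) \<partial>lborel)"
      proof (cases "t \<in> {- T..T}")
        case True
        then have "\<bar>t\<bar> \<le> \<bar>T\<bar>" by auto
        then have "c * t\<^sup>2 \<le> c * T\<^sup>2" using c by (intro mult_left_mono) (auto simp: abs_le_square_iff)
        then have e: "1 \<le> exp (c * T\<^sup>2) * exp (- c * t\<^sup>2)" by (simp flip: exp_add)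
        have "A t \<le> (\<integral>\<^sup>+s. ennreal (exp (c * T\<^sup>2)) * ennreal (norm (f (hpt s t)) * exp s * exp (- c * t\<^sup>2)) \<partial>lborel)"
          unfolding A_def
        proof (rule nn_integral_mono)
          fix s
          have "(norm (f (hpt s t)) * exp s) * 1 \<le> (norm (f (hpt s t)) * exp s) * (exp (c * T\<^sup>2) * exp (- c * t\<^sup>2))"
            using e by (intro mult_left_mono) auto
          then show "h s t \<le> ennreal (exp (c * T\<^sup>2)) * ennreal (norm (f (hpt s t)) * exp s * exp (- c * t\<^sup>2))"
            unfolding h_def cut[symmetric] by (simp add: ennreal_mult[symmetric] ac_simps)
        qed
        also have "\<dots> = ennreal (exp (c * T\<^sup>2)) * (\<integral>\<^sup>+s. ennreal (norm (f (hpt s t)) * exp s * exp (- c * t\<^sup>2)) \<partial>lborel)"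
          unfolding cut by (rule nn_integral_cmult) measurable
        finally show ?thesis using True by simp
      qed simp
    qed
    also have "\<dots> = ennreal (exp (c * T\<^sup>2)) * (\<integral>\<^sup>+t. \<integral>\<^sup>+s. ennreal (norm (f (hpt s t)) * exp s * exp (- c * t\<^sup>2)) \<partial>lborel \<partial>lborel)"
      unfolding cut by (rule nn_integral_cmult) measurable
    also have "\<dots> < \<infinity>" using fin by (simp add: ennreal_mult_less_top)
    finally show ?thesis .
  qed
  have A0: "A 0 < \<infinity>"
  proof -
    define m0 where "m0 = emeasure hmeas hball"
    have m0: "m0 > 0" "m0 < \<infinity>" using hball_pos hball_finite by (simp_all add: m0_def)
    define u where "u s0 s t = h (s0 + s) t * (2 * indicator {-1..1::real} s * indicator {-2..2::real} t)" for s0 s t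
    have um [measurable]: "(\<lambda>x. u (a x) (b x) (d x)) \<in> borel_measurable M" if [measurable]: "a \<in> borel_measurable M" "b \<in> borel_measurable M" "d \<in> borel_measurable M" for a b d and M :: "'b measure"
      unfolding u_def by measurable
    have pt: "h s0 0 * m0 \<le> (\<integral>\<^sup>+t. \<integral>\<^sup>+s. u s0 s t \<partial>lborel \<partial>lborel)" for s0
    proof -
      define f0 where "f0 w = f (of_real (exp s0) * w) * of_real (exp s0)" for w
      have f0: "f0 holomorphic_on upper_half_plane" unfolding f0_def
        by (intro holomorphic_intros holomorphic_on_compose_gen[OF _ f, unfolded o_def]) (auto simp: upper_half_plane_def)
      have [measurable]: "hcut f0 \<in> borel_measurable borel" by (rule hcut_measurable[OF f0])
      have "hpt 0 0 = \<i>" by (simp add: hpt_def complex_eq_iff)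
      then have "f0 \<i> = f (hpt s0 0) * of_real (exp s0)" using hpt_add[of s0 0 0] by (simp add: f0_def)
      then have "h s0 0 = ennreal (norm (f0 \<i>))" by (simp add: h_def cut norm_mult)
      then have "h s0 0 * m0 \<le> (\<integral>\<^sup>+w. ennreal (norm (f0 w)) * indicator hball w \<partial>hmeas)"
        using hball_mean[OF f0] by (simp add: m0_def)
      also have "\<dots> = (\<integral>\<^sup>+w. ennreal (norm (hcut f0 w)) * indicator hball w \<partial>hmeas)"
        by (rule nn_integral_cong) (auto simp: hcut_def hball_def indicator_def)
      also have "\<dots> = (\<integral>\<^sup>+t. \<integral>\<^sup>+s. ennreal (norm (hcut f0 (hpt s t))) * indicator hball (hpt s t) \<partial>lborel \<partial>lborel)"
        by (rule nn_integral_hmeas_swap) measurable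
      also have "\<dots> \<le> (\<integral>\<^sup>+t. \<integral>\<^sup>+s. u s0 s t \<partial>lborel \<partial>lborel)"
      proof (intro nn_integral_mono)
        fix t s
        show "ennreal (norm (hcut f0 (hpt s t))) * indicator hball (hpt s t) \<le> u s0 s t"
        proof (cases "hpt s t \<in> hball")
          case True
          note b = hball_bounds[OF True]
          have "norm (hcut f0 (hpt s t)) = norm (f (hpt (s0 + s) t)) * exp (s0 + s) * exp (- s)"
            using Im_hpt by (simp add: hcut_def f0_def hpt_add norm_mult flip: exp_add)
          also have "\<dots> \<le> norm (f (hpt (s0 + s) t)) * exp (s0 + s) * 2"
            using b by (intro mult_left_mono) auto
          finally have "ennreal (norm (hcut f0 (hpt s t))) \<le> h (s0 + s) t * 2"
            unfolding h_def cut[symmetric] by (subst (asm) ennreal_le_iff[symmetric]) (auto simp: ennreal_mult)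
          then show ?thesis using b True by (simp add: u_def abs_le_iff)
        qed simp
      qed
      finally show ?thesis .
    qed
    have "A 0 * m0 = (\<integral>\<^sup>+s0. h s0 0 * m0 \<partial>lborel)" unfolding A_def by (rule nn_integral_multc[symmetric]) measurable
    also have "\<dots> \<le> (\<integral>\<^sup>+s0. \<integral>\<^sup>+t. \<integral>\<^sup>+s. u s0 s t \<partial>lborel \<partial>lborel \<partial>lborel)"
      by (intro nn_integral_mono pt)
    also have "\<dots> = (\<integral>\<^sup>+t. \<integral>\<^sup>+s0. \<integral>\<^sup>+s. u s0 s t \<partial>lborel \<partial>lborel \<partial>lborel)"
      by (rule lborel_pair.Fubini') measurable
    also have "\<dots> = (\<integral>\<^sup>+t. \<integral>\<^sup>+s. \<integral>\<^sup>+s0. u s0 s t \<partial>lborel \<partial>lborel \<partial>lborel)"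
      by (intro nn_integral_cong lborel_pair.Fubini') measurable
    also have "\<dots> = (\<integral>\<^sup>+t. 4 * (A t * indicator {-2..2} t) \<partial>lborel)"
    proof (rule nn_integral_cong)
      fix t :: real
      have "(\<integral>\<^sup>+s0. u s0 s t \<partial>lborel) = A t * (2 * indicator {-1..1} s * indicator {-2..2} t)" for s
      proof -
        have "(\<integral>\<^sup>+s0. u s0 s t \<partial>lborel) = (\<integral>\<^sup>+s0. h (s0 + s) t \<partial>lborel) * (2 * indicator {-1..1} s * indicator {-2..2} t)"
          unfolding u_def by (rule nn_integral_multc) measurable
        also have "(\<integral>\<^sup>+s0. h (s0 + s) t \<partial>lborel) = A t"
          using nn_integral_real_affine[of "\<lambda>s. h s t" 1 s] by (simp add: A_def add.commute)
        finally show ?thesis .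
      qed
      then have "(\<integral>\<^sup>+s. \<integral>\<^sup>+s0. u s0 s t \<partial>lborel \<partial>lborel) = (\<integral>\<^sup>+s. (A t * indicator {-2..2} t * 2) * indicator {-1..1::real} s \<partial>lborel)"
        by (simp add: ac_simps)
      also have "\<dots> = (A t * indicator {-2..2} t * 2) * 2" by (subst nn_integral_cmult_indicator) auto
      also have "\<dots> = 4 * (A t * indicator {-2..2} t)"
      proof -
        have "x * 2 * 2 = 4 * x" for x :: ennreal by (simp add: mult.assoc mult.commute[of x])
        then show ?thesis .
      qed
      finally show "(\<integral>\<^sup>+s. \<integral>\<^sup>+s0. u s0 s t \<partial>lborel \<partial>lborel) = 4 * (A t * indicator {-2..2} t)" .
    qed
    also have "\<dots> = 4 * (\<integral>\<^sup>+t. A t * indicator {-2..2} t \<partial>lborel)" by (rule nn_integral_cmult) measurable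
    also have "\<dots> < \<infinity>" using AT[of 2] by (simp add: ennreal_mult_less_top)
    finally have "A 0 * m0 < \<infinity>" .
    then show ?thesis using m0 by (auto simp: ennreal_mult_less_top)
  qed
  have int: "integrable lborel (\<lambda>s. f (hpt s t) * hpt s t)" if "A t < \<infinity>" for t
  proof (rule integrableI_bounded)
    show "(\<lambda>s. f (hpt s t) * hpt s t) \<in> borel_measurable lborel" unfolding cut by measurable
    have "(\<integral>\<^sup>+s. ennreal (norm (f (hpt s t) * hpt s t)) \<partial>lborel) = (\<integral>\<^sup>+s. h s t * ennreal (norm (Complex t 1)) \<partial>lborel)"
      unfolding h_def cut[symmetric]
      by (rule nn_integral_cong) (simp add: norm_mult hpt_mult ennreal_mult[symmetric] ac_simps)
    also have "\<dots> = A t * ennreal (norm (Complex t 1))" unfolding A_def by (rule nn_integral_multc) measurable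
    also have "\<dots> < \<infinity>" using that by (simp add: ennreal_mult_less_top)
    finally show "(\<integral>\<^sup>+s. ennreal (norm (f (hpt s t) * hpt s t)) \<partial>lborel) < \<infinity>" .
  qed
  have AEfin: "AE t in lborel. A t < \<infinity>"
  proof -
    have "AE t in lborel. A t * indicator {- real n..real n} t \<noteq> \<infinity>" for n
      using AT[of "real n"] by (intro nn_integral_PInf_AE) auto
    then have "AE t in lborel. \<forall>n. A t * indicator {- real n..real n} t \<noteq> \<infinity>" by (simp add: AE_all_countable)
    then show ?thesis
    proof eventually_elim
      case (elim t)
      obtain n :: nat where "real n \<ge> \<bar>t\<bar>" using real_arch_simple by blast
      then have "t \<in> {- real n..real n}" by auto
      then show ?case using elim[rule_format, of n] by (simp add: less_top)
    qed
  qed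
  obtain F where F: "\<And>z. Im z > 0 \<Longrightarrow> (F has_field_derivative f z) (at z)" using uhp_primitive[OF f] by blast
  show "AE t in lborel. (LINT s|lborel. f (hpt s t) * hpt s t) = (LINT s|lborel. f (hpt s 0) * hpt s 0)"
    using AEfin
  proof eventually_elim
    case (elim t)
    define T where "T = \<bar>t\<bar>"
    define g where "g s = (\<integral>\<^sup>+r. h s r * indicator {- T..T} r \<partial>lborel)" for s
    have gfin: "(\<integral>\<^sup>+s. g s \<partial>lborel) < \<infinity>"
    proof -
      have "(\<integral>\<^sup>+s. g s \<partial>lborel) = (\<integral>\<^sup>+r. \<integral>\<^sup>+s. h s r * indicator {- T..T} r \<partial>lborel \<partial>lborel)"
        unfolding g_def by (rule lborel_pair.Fubini') measurable
      also have "\<dots> = (\<integral>\<^sup>+r. A r * indicator {- T..T} r \<partial>lborel)"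
        unfolding A_def by (intro nn_integral_cong nn_integral_multc) measurable
      finally show ?thesis using AT by simp
    qed
    have arc: "ennreal (norm (F (hpt s t) - F (hpt s 0))) \<le> g s" for s
      using arc_bound[OF F f, of t T s] by (simp add: T_def g_def h_def cut)
    define e where "e n = 1 / real (Suc n)" for n
    have e0: "e n > 0" for n by (simp add: e_def)
    have "\<forall>n. \<exists>s. s \<ge> real n \<and> g s < ennreal (e n)"
    proof
      fix n
      show "\<exists>s. s \<ge> real n \<and> g s < ennreal (e n)" using small_value_exists(1)[OF gfin e0[of n], of "real n"] by blast
    qed
    from choice[OF this] obtain b where "\<forall>n. b n \<ge> real n \<and> g (b n) < ennreal (e n)" ..
    then have b: "b n \<ge> real n" "g (b n) < ennreal (e n)" for n by blast+
    have "\<forall>n. \<exists>s. s \<le> - real n \<and> g s < ennreal (e n)"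
    proof
      fix n
      show "\<exists>s. s \<le> - real n \<and> g s < ennreal (e n)" using small_value_exists(2)[OF gfin e0[of n], of "- real n"] by blast
    qed
    from choice[OF this] obtain a where "\<forall>n. a n \<le> - real n \<and> g (a n) < ennreal (e n)" ..
    then have a: "a n \<le> - real n" "g (a n) < ennreal (e n)" for n by blast+
    have arc': "norm (F (hpt s t) - F (hpt s 0)) \<le> e n" if "g s < ennreal (e n)" for s n
      using order.strict_trans1[OF arc that] e0[of n] by (simp add: ennreal_less_iff)
    have ab: "a n \<le> b n" for n using a(1)[of n] b(1)[of n] by linarith
    have lim: "(\<lambda>n. LINT s:{a n..b n}|lborel. f (hpt s r) * hpt s r) \<longlonglongrightarrow> (LINT s|lborel. f (hpt s r) * hpt s r)"
      if "A r < \<infinity>" for r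
      unfolding set_lebesgue_integral_def
    proof (rule integral_dominated_convergence[where w="\<lambda>s. norm (f (hpt s r) * hpt s r)"])
      show "integrable lborel (\<lambda>s. norm (f (hpt s r) * hpt s r))" by (intro integrable_norm int that)
      show "AE s in lborel. (\<lambda>n. indicator {a n..b n} s *\<^sub>R (f (hpt s r) * hpt s r)) \<longlonglongrightarrow> f (hpt s r) * hpt s r"
      proof (rule AE_I2)
        fix s :: real
        obtain m :: nat where m: "real m \<ge> \<bar>s\<bar>" using real_arch_simple by blast
        have "eventually (\<lambda>n. indicator {a n..b n} s *\<^sub>R (f (hpt s r) * hpt s r) = f (hpt s r) * hpt s r) sequentially"
        proof (rule eventually_sequentiallyI[of m])
          fix n assume "m \<le> n"
          then have "real m \<le> real n" by simp
          then have "s \<in> {a n..b n}" using a(1)[of n] b(1)[of n] m by auto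
          then show "indicator {a n..b n} s *\<^sub>R (f (hpt s r) * hpt s r) = f (hpt s r) * hpt s r" by simp
        qed
        then show "(\<lambda>n. indicator {a n..b n} s *\<^sub>R (f (hpt s r) * hpt s r)) \<longlonglongrightarrow> f (hpt s r) * hpt s r"
          by (rule tendsto_eventually)
      qed
      show "(\<lambda>s. f (hpt s r) * hpt s r) \<in> borel_measurable lborel" unfolding cut by measurable
      show "(\<lambda>s. indicator {a n..b n} s *\<^sub>R (f (hpt s r) * hpt s r)) \<in> borel_measurable lborel" for n unfolding cut by measurable
    qed (auto simp: indicator_def)
    have seg: "(LINT s:{a n..b n}|lborel. f (hpt s r) * hpt s r) = F (hpt (b n) r) - F (hpt (a n) r)" if "A r < \<infinity>" for r n
    proof -
      have si: "set_integrable lborel {a n..b n} (\<lambda>s. f (hpt s r) * hpt s r)"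
        unfolding set_integrable_def by (intro integrable_mult_indicator int that) auto
      show ?thesis using set_borel_integral_eq_integral(2)[OF si] ray_FTC[OF F ab[of n], of r] by (simp add: integral_unique)
    qed
    have "(\<lambda>n. (LINT s:{a n..b n}|lborel. f (hpt s t) * hpt s t) - (LINT s:{a n..b n}|lborel. f (hpt s 0) * hpt s 0)) \<longlonglongrightarrow> 0"
    proof (rule tendsto_0_le[where K=1 and f="\<lambda>n. 2 * e n"])
      show "(\<lambda>n. 2 * e n) \<longlonglongrightarrow> 0" unfolding e_def using tendsto_mult_right_zero[OF LIMSEQ_inverse_real_of_nat, of 2] by (simp add: inverse_eq_divide)
      show "\<forall>\<^sub>F n in sequentially. norm ((LINT s:{a n..b n}|lborel. f (hpt s t) * hpt s t) - (LINT s:{a n..b n}|lborel. f (hpt s 0) * hpt s 0)) \<le> norm (2 * e n) * 1"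
      proof (rule always_eventually, rule allI)
        fix n
        have "(LINT s:{a n..b n}|lborel. f (hpt s t) * hpt s t) - (LINT s:{a n..b n}|lborel. f (hpt s 0) * hpt s 0) =
          (F (hpt (b n) t) - F (hpt (b n) 0)) - (F (hpt (a n) t) - F (hpt (a n) 0))"
          unfolding seg[OF elim] seg[OF A0] by simp
        also have "norm \<dots> \<le> e n + e n"
          by (rule order_trans[OF norm_triangle_ineq4]) (intro add_mono arc' a b)
        finally show "norm ((LINT s:{a n..b n}|lborel. f (hpt s t) * hpt s t) - (LINT s:{a n..b n}|lborel. f (hpt s 0) * hpt s 0)) \<le> norm (2 * e n) * 1"
          using e0[of n] by simp
      qed
    qed
    moreover have "(\<lambda>n. (LINT s:{a n..b n}|lborel. f (hpt s t) * hpt s t) - (LINT s:{a n..b n}|lborel. f (hpt s 0) * hpt s 0)) \<longlonglongrightarrow>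
       (LINT s|lborel. f (hpt s t) * hpt s t) - (LINT s|lborel. f (hpt s 0) * hpt s 0)"
      by (intro tendsto_diff lim elim A0)
    ultimately have "(LINT s|lborel. f (hpt s t) * hpt s t) - (LINT s|lborel. f (hpt s 0) * hpt s 0) = 0"
      by (rule LIMSEQ_unique[rotated])
    then show ?case by simp
  qed
qed

lemma ray_integral_periodic:
  assumes f: "f holomorphic_on upper_half_plane" and L: "L > 0"
    and per: "\<And>w. Im w > 0 \<Longrightarrow> f (of_real (exp L) * w) * of_real (exp L) = f w"
  shows "(LINT s:{0..<L}|lborel. f (hpt s t) * hpt s t) = (LINT s:{0..<L}|lborel. f (hpt s 0) * hpt s 0)"
proof -
  obtain F where F: "\<And>z. Im z > 0 \<Longrightarrow> (F has_field_derivative f z) (at z)" using uhp_primitive[OF f] by blast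
  define e where "e = complex_of_real (exp L)"
  have "\<exists>c. \<forall>w\<in>upper_half_plane. F (e * w) - F w = c"
  proof (rule has_field_derivative_zero_constant)
    show "convex upper_half_plane" unfolding upper_half_plane_def by (rule convex_halfspace_Im_gt)
    fix w assume "w \<in> upper_half_plane"
    then have w: "Im w > 0" by (simp add: upper_half_plane_def)
    have ew: "Im (e * w) > 0" using w by (simp add: e_def)
    have "((\<lambda>w. e * w) has_field_derivative e) (at w)" by (auto intro!: derivative_eq_intros)
    from DERIV_chain2[OF F[OF ew] this] have "((\<lambda>w. F (e * w)) has_field_derivative f (e * w) * e) (at w)" .
    from DERIV_diff[OF this F[OF w]] have "((\<lambda>w. F (e * w) - F w) has_field_derivative f (e * w) * e - f w) (at w)" .
    then show "((\<lambda>w. F (e * w) - F w) has_field_derivative 0) (at w within upper_half_plane)"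
      using per[OF w] by (simp add: e_def has_field_derivative_at_within)
  qed
  then obtain c where c: "\<And>w. w \<in> upper_half_plane \<Longrightarrow> F (e * w) - F w = c" by blast
  have "(LINT s:{0..<L}|lborel. f (hpt s r) * hpt s r) = c" for r
  proof -
    have cont: "continuous_on {0..L} (\<lambda>s. f (hpt s r) * hpt s r)"
      unfolding hpt_mult Complex_eq
      by (intro continuous_intros continuous_on_compose2[OF holomorphic_on_imp_continuous_on[OF f]]) (auto simp: upper_half_plane_def)
    then have si: "set_integrable lborel {0..L} (\<lambda>s. f (hpt s r) * hpt s r)" by (rule borel_integrable_atLeastAtMost')
    have si': "set_integrable lborel {0..<L} (\<lambda>s. f (hpt s r) * hpt s r)"
      by (rule set_integrable_subset[OF si]) auto
    have "(LINT s:{0..<L}|lborel. f (hpt s r) * hpt s r) = (LINT s:{0..L}|lborel. f (hpt s r) * hpt s r)"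
      unfolding set_lebesgue_integral_def
    proof (rule integral_cong_AE)
      show "AE s in lborel. indicator {0..<L} s *\<^sub>R (f (hpt s r) * hpt s r) = indicator {0..L} s *\<^sub>R (f (hpt s r) * hpt s r)"
        using AE_lborel_singleton[of L] by eventually_elim (auto simp: indicator_def)
    qed (use si si' in \<open>auto simp: set_integrable_def dest: borel_measurable_integrable\<close>)
    also have "\<dots> = F (hpt L r) - F (hpt 0 r)"
      using set_borel_integral_eq_integral(2)[OF si] ray_FTC[OF F, of 0 L r] L by (simp add: integral_unique)
    also have "\<dots> = c" using c[OF hpt_uhp[of 0 r]] hpt_add[of L 0 r] by (simp add: e_def)
    finally show ?thesis .
  qed
  then show ?thesis by simp
qed

lemma gaussian_integral:
  assumes a: "a > 0"
  shows "integrable lborel (\<lambda>t. exp (- a * t\<^sup>2))" and "(LINT t|lborel. exp (- a * t\<^sup>2)) = sqrt (pi / a)"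
proof -
  define \<sigma> where "\<sigma> = 1 / sqrt (2 * a)"
  have \<sigma>: "\<sigma> > 0" "\<sigma>\<^sup>2 = 1 / (2 * a)" using a by (simp_all add: \<sigma>_def power_divide)
  have e: "exp (- a * t\<^sup>2) = sqrt (pi / a) * normal_density 0 \<sigma> t" for t
    using a unfolding normal_density_def \<sigma>(2) by (simp add: field_simps)
  show "integrable lborel (\<lambda>t. exp (- a * t\<^sup>2))" unfolding e using \<sigma> by (intro integrable_mult_right integrable_normal_density)
  show "(LINT t|lborel. exp (- a * t\<^sup>2)) = sqrt (pi / a)" unfolding e using \<sigma> by simp
qed

text \<open>Unfolding in the coordinate \<open>w = g\<^sup>-\<^sup>1 z\<close>, in which the stabilizer of \<open>X\<close> becomes that of \<open>X1\<close>.\<close>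
lemma
  assumes N: "N > 0" and \<kappa>: "\<kappa> > 0" and G: "G \<in> cusp_forms (2 * k + 2) N" and fd: "fundamental_domain N F"
    and X: "X \<in> dual_lattice N" and g: "g \<in> SL2" and X1: "X1 \<in> traceless" and XX: "conj_act g X1 = X"
    and D1: "D1 \<in> sets borel"
    and cD: "\<And>w. Im w > 0 \<Longrightarrow> card {h. g ** h ** matrix_inv g \<in> Gamma0 N \<and> conj_act h X1 = X1 \<and> moebius h w \<in> D1} = 2"
  shows kern_frame_integrable: "set_integrable hmeas D1 (kern N k \<kappa> (slash (2 * k + 2) G g) X1)"
    and kern_frame_has_sum: "((\<lambda>Y. LINT z:F|hmeas. kern N k \<kappa> G Y z) has_sum
          (LINT w:D1|hmeas. kern N k \<kappa> (slash (2 * k + 2) G g) X1 w)) (orbit0 N X)"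
proof -
  define D where "D = moebius (matrix_inv g) -` D1"
  have D [measurable]: "D \<in> sets borel"
    unfolding D_def using measurable_sets[OF moebius_measurable D1, of "matrix_inv g"] by simp
  have gi: "matrix_inv g \<in> SL2" by (rule SL2_inv[OF g])
  have cD': "AE z in hmeas. card {s \<in> Gamma0 N. conj_act s X = X \<and> moebius s z \<in> D} = 2"
    using AE_hmeas
  proof eventually_elim
    case (elim z)
    define w where "w = moebius (matrix_inv g) z"
    have w: "Im w > 0" unfolding w_def by (rule moebius_uhp[OF gi elim])
    have z: "z = moebius g w" unfolding w_def by (rule moebius_inv'[OF g elim, symmetric])
    define c where "c s = matrix_inv g ** s ** g" for s
    have gc: "g ** c s ** matrix_inv g = s" if "s \<in> SL2" for s
      unfolding c_def by (simp only: matrix_mul_assoc SL2_inv_right[OF g] SL2_cancel_right[OF g] matrix_mul_lid)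
    have cg: "c (g ** h ** matrix_inv g) = h" for h
      unfolding c_def by (simp only: matrix_mul_assoc SL2_inv_left[OF g] SL2_cancel_right[OF g] matrix_mul_lid)
    have iff: "conj_act (c s) X1 = X1 \<longleftrightarrow> conj_act s X = X" "moebius (c s) w \<in> D1 \<longleftrightarrow> moebius s z \<in> D"
      if s: "s \<in> Gamma0 N" for s
    proof -
      note sS = Gamma0_SL2[OF s]
      have "conj_act (c s) X1 = conj_act (matrix_inv g) (conj_act s X)"
        unfolding c_def by (simp only: conj_act_mult[OF SL2_mult[OF gi sS] g] conj_act_mult[OF gi sS] XX)
      moreover have "conj_act (matrix_inv g) (conj_act s X) = X1 \<longleftrightarrow> conj_act s X = X"
        using conj_act_inv[OF g, of X1] conj_act_inv'[OF g, of "conj_act s X"] unfolding XX[symmetric] by metis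
      ultimately show "conj_act (c s) X1 = X1 \<longleftrightarrow> conj_act s X = X" by simp
      have "moebius (c s) w = moebius (matrix_inv g) (moebius s z)"
        unfolding c_def z by (simp only: moebius_mult[OF SL2_mult[OF gi sS] g w] moebius_mult[OF gi sS moebius_uhp[OF g w]])
      then show "moebius (c s) w \<in> D1 \<longleftrightarrow> moebius s z \<in> D" by (simp add: D_def)
    qed
    have img: "c ` {s \<in> Gamma0 N. conj_act s X = X \<and> moebius s z \<in> D} =
      {h. g ** h ** matrix_inv g \<in> Gamma0 N \<and> conj_act h X1 = X1 \<and> moebius h w \<in> D1}" (is "?l = ?r")
    proof (intro equalityI subsetI)
      fix h assume "h \<in> ?l"
      then obtain s where s: "s \<in> Gamma0 N" "conj_act s X = X" "moebius s z \<in> D" "h = c s" by blast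
      then show "h \<in> ?r" using gc[OF Gamma0_SL2[OF s(1)]] iff[OF s(1)] by simp
    next
      fix h assume h: "h \<in> ?r"
      define s where "s = g ** h ** matrix_inv g"
      have s: "s \<in> Gamma0 N" "c s = h" using h cg[of h] by (simp_all add: s_def)
      show "h \<in> ?l" by (rule image_eqI[of _ _ s]) (use s h iff[OF s(1)] in simp_all)
    qed
    have inj: "inj_on c {s \<in> Gamma0 N. conj_act s X = X \<and> moebius s z \<in> D}"
    proof (rule inj_onI)
      fix s s' assume *: "s \<in> {s \<in> Gamma0 N. conj_act s X = X \<and> moebius s z \<in> D}"
        "s' \<in> {s \<in> Gamma0 N. conj_act s X = X \<and> moebius s z \<in> D}" "c s = c s'"
      have sS: "s \<in> SL2" "s' \<in> SL2" using *(1,2) Gamma0_SL2 by blast+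
      from arg_cong[OF *(3), of "\<lambda>x. g ** x ** matrix_inv g"] show "s = s'" unfolding gc[OF sS(1)] gc[OF sS(2)] .
    qed
    show ?case using card_image[OF inj] unfolding img cD[OF w] by (rule sym)
  qed
  note ki = kern_integrable[OF N \<kappa> G fd X D cD' zero_less_numeral]
    and ks = kern_has_sum[OF N \<kappa> G fd X D cD' zero_less_numeral]
  note km [measurable] = kern_measurable[OF cusp_form_holo[OF G], of N k \<kappa> X]
  note km' [measurable] = kern_measurable[OF slash_holo[OF g cusp_form_holo[OF G]], of N k \<kappa> "2 * k + 2" X1]
  note D1 [measurable]
  have m: "(\<lambda>z. indicator D z *\<^sub>R kern N k \<kappa> G X z) \<in> borel_measurable borel" by measurable
  have AE: "AE w in hmeas. indicator D (moebius g w) *\<^sub>R kern N k \<kappa> G X (moebius g w) =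
     indicator D1 w *\<^sub>R kern N k \<kappa> (slash (2 * k + 2) G g) X1 w"
    using AE_hmeas
  proof eventually_elim
    case (elim w)
    have "indicator D (moebius g w) = (indicator D1 w :: real)"
      using moebius_inv[OF g elim] by (simp add: D_def indicator_def)
    moreover have "kern N k \<kappa> G X (moebius g w) = kern N k \<kappa> (slash (2 * k + 2) G g) X1 w"
      using kern_conj[OF g X1 elim, of N k \<kappa> G] elim unfolding XX by (simp add: kern_def hcut_def)
    ultimately show ?case by simp
  qed
  have m1: "(\<lambda>w. indicator D (moebius g w) *\<^sub>R kern N k \<kappa> G X (moebius g w)) \<in> borel_measurable hmeas"
    and m2: "(\<lambda>w. indicator D1 w *\<^sub>R kern N k \<kappa> (slash (2 * k + 2) G g) X1 w) \<in> borel_measurable hmeas"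
    by measurable
  have "integrable hmeas (\<lambda>w. indicator D (moebius g w) *\<^sub>R kern N k \<kappa> G X (moebius g w))"
    using integrable_hmeas_moebius[OF g m] ki unfolding set_integrable_def by blast
  then show "set_integrable hmeas D1 (kern N k \<kappa> (slash (2 * k + 2) G g) X1)"
    unfolding set_integrable_def using integrable_cong_AE[OF m1 m2 AE] by blast
  have "(LINT z:D|hmeas. kern N k \<kappa> G X z) = (LINT w|hmeas. indicator D (moebius g w) *\<^sub>R kern N k \<kappa> G X (moebius g w))"
    unfolding set_lebesgue_integral_def by (rule integral_hmeas_moebius[OF g m, symmetric])
  also have "\<dots> = (LINT w:D1|hmeas. kern N k \<kappa> (slash (2 * k + 2) G g) X1 w)"
    unfolding set_lebesgue_integral_def by (rule integral_cong_AE[OF m1 m2 AE])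
  finally show "((\<lambda>Y. LINT z:F|hmeas. kern N k \<kappa> G Y z) has_sum
          (LINT w:D1|hmeas. kern N k \<kappa> (slash (2 * k + 2) G g) X1 w)) (orbit0 N X)"
    using ks by simp
qed

subsection \<open>Isotropic vectors\<close>

lemma horocycle_integral:
  assumes f: "f holomorphic_on upper_half_plane" and M: "M > 0" and y: "y > 0"
    and per: "\<And>z. Im z > 0 \<Longrightarrow> f (z + of_real M) = f z"
    and \<delta>: "\<delta> > 0" and dec: "\<And>z. Im z \<ge> 1 / 2 \<Longrightarrow> norm (f z) \<le> C * exp (- \<delta> * Im z)"
  shows "(LINT x:{0..<M}|lborel. f (Complex x y)) = 0"
proof -
  obtain F where F: "\<And>z. Im z > 0 \<Longrightarrow> (F has_field_derivative f z) (at z)" using uhp_primitive[OF f] by blast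
  have "\<exists>c. \<forall>w\<in>upper_half_plane. F (w + of_real M) - F w = c"
  proof (rule has_field_derivative_zero_constant)
    show "convex upper_half_plane" unfolding upper_half_plane_def by (rule convex_halfspace_Im_gt)
    fix w assume "w \<in> upper_half_plane"
    then have w: "Im w > 0" by (simp add: upper_half_plane_def)
    have ew: "Im (w + of_real M) > 0" using w by simp
    have "((\<lambda>w. w + of_real M) has_field_derivative 1) (at w)" by (auto intro!: derivative_eq_intros)
    from DERIV_chain2[OF F[OF ew] this] have "((\<lambda>w. F (w + of_real M)) has_field_derivative f (w + of_real M) * 1) (at w)" .
    from DERIV_diff[OF this F[OF w]] have "((\<lambda>w. F (w + of_real M) - F w) has_field_derivative f (w + of_real M) * 1 - f w) (at w)" .
    then show "((\<lambda>w. F (w + of_real M) - F w) has_field_derivative 0) (at w within upper_half_plane)"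
      using per[OF w] by (simp add: has_field_derivative_at_within)
  qed
  then obtain c where c: "\<And>w. w \<in> upper_half_plane \<Longrightarrow> F (w + of_real M) - F w = c" by blast
  have cont: "continuous_on A (\<lambda>x. f (Complex x v))" if "v > 0" for A v
    unfolding Complex_eq using that
    by (intro continuous_intros continuous_on_compose2[OF holomorphic_on_imp_continuous_on[OF f]]) (auto simp: upper_half_plane_def)
  have I: "((\<lambda>x. f (Complex x v)) has_integral c) {0..M}" if v: "v > 0" for v
  proof -
    have "((\<lambda>x. f (Complex x v)) has_integral (F (Complex M v) - F (Complex 0 v))) {0..M}"
    proof (rule fundamental_theorem_of_calculus)
      fix x
      have "((\<lambda>x. complex_of_real x + \<i> * of_real v) has_vector_derivative (of_real 1 + 0)) (at x)"
        by (intro has_vector_derivative_add has_vector_derivative_of_real has_vector_derivative_const) (auto intro!: derivative_eq_intros)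
      then have "((\<lambda>x. Complex x v) has_vector_derivative 1) (at x)" unfolding Complex_eq by simp
      moreover have "Im (Complex x v) > 0" using v by simp
      ultimately have "((F \<circ> (\<lambda>x. Complex x v)) has_vector_derivative (1 * f (Complex x v))) (at x)"
        using F field_vector_diff_chain_at by blast
      then show "((\<lambda>x. F (Complex x v)) has_vector_derivative f (Complex x v)) (at x within {0..M})"
        by (simp add: o_def has_vector_derivative_at_within)
    qed (use M in simp)
    moreover have "Complex M v = Complex 0 v + of_real M" by (simp add: complex_eq_iff)
    ultimately show ?thesis using c[of "Complex 0 v"] v by (simp add: upper_half_plane_def)
  qed
  have bound: "norm c \<le> C * exp (- \<delta> * v) * M" if v: "v \<ge> 1 / 2" for v
  proof -
    have C: "C * exp (- \<delta> * v) \<ge> 0" using order_trans[OF norm_ge_zero dec[of "Complex 0 v"]] v by simp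
    have "norm c \<le> C * exp (- \<delta> * v) * measure lborel (cbox 0 M)"
    proof (rule has_integral_bound[OF C])
      show "((\<lambda>x. f (Complex x v)) has_integral c) (cbox 0 M)" using I[of v] v by (simp add: cbox_interval)
      show "norm (f (Complex x v)) \<le> C * exp (- \<delta> * v)" if "x \<in> cbox 0 M" for x using dec[of "Complex x v"] v by simp
    qed
    then show ?thesis using M by simp
  qed
  have "((\<lambda>v. C * exp (- \<delta> * v) * M) \<longlongrightarrow> 0) at_top"
    using \<delta> by real_asymp
  then have "norm c \<le> 0"
  proof (rule tendsto_lowerbound)
    show "\<forall>\<^sub>F v in at_top. norm c \<le> C * exp (- \<delta> * v) * M"
      using bound by (rule eventually_at_top_linorderI)
  qed simp
  then have c0: "c = 0" by simp
  have si: "set_integrable lborel {0..M} (\<lambda>x. f (Complex x y))" by (intro borel_integrable_atLeastAtMost' cont y)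
  have si': "set_integrable lborel {0..<M} (\<lambda>x. f (Complex x y))" by (rule set_integrable_subset[OF si]) auto
  have "(LINT x:{0..<M}|lborel. f (Complex x y)) = (LINT x:{0..M}|lborel. f (Complex x y))"
    unfolding set_lebesgue_integral_def
  proof (rule integral_cong_AE)
    show "AE s in lborel. indicator {0..<M} s *\<^sub>R f (Complex s y) = indicator {0..M} s *\<^sub>R f (Complex s y)"
      using AE_lborel_singleton[of M] by eventually_elim (auto simp: indicator_def)
  qed (use si si' in \<open>auto simp: set_integrable_def dest: borel_measurable_integrable\<close>)
  also have "\<dots> = 0" using set_borel_integral_eq_integral(2)[OF si] I[OF y] c0 by (simp add: integral_unique)
  finally show ?thesis .
qed

lemma isotropic_standard:
  assumes N: "N > 0" and X: "X \<in> dual_lattice N" and X0: "X \<noteq> 0" and q: "qform N X = 0"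
  obtains p q u v :: int and \<beta> :: real where "p * v - u * q = 1" "\<beta> \<noteq> 0"
    "X = conj_act (mat2 (of_int p) (of_int u) (of_int q) (of_int v)) (mat2 0 \<beta> 0 0)"
proof -
  obtain a b c where Xd: "X = dvec N a b c" using X unfolding dual_lattice_dvec[OF N] by blast
  have N0: "real N \<noteq> 0" using N by simp
  have "real_of_int (b\<^sup>2 - 4 * int N * a * c) = 0" using q N unfolding Xd qform_dvec[OF N] by simp
  then have disc: "b\<^sup>2 = 4 * int N * a * c" by (simp only: of_int_eq_0_iff)
  have "\<exists>p q :: int. \<exists>\<beta> :: real. coprime p q \<and> \<beta> \<noteq> 0 \<and> - \<beta> * of_int p * of_int q = of_int b / (2 * real N) \<and>
     \<beta> * (of_int p)\<^sup>2 = - of_int a / real N \<and> - \<beta> * (of_int q)\<^sup>2 = of_int c"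
  proof (cases "c = 0")
    case True
    then have b: "b = 0" using disc by simp
    have "a \<noteq> 0"
    proof
      assume "a = 0"
      then have "X = 0" unfolding Xd using True b by (simp add: dvec_def mat2_eq_iff)
      then show False using X0 by simp
    qed
    then show ?thesis using True b N by (intro exI[of _ 1] exI[of _ 0] exI[of _ "- of_int a / real N"]) simp
  next
    case False
    define d where "d = gcd b (2 * int N * c)"
    define p where "p = b div d"
    define q where "q = 2 * int N * c div d"
    have nz: "2 * int N * c \<noteq> 0" using False N by simp
    have d0: "d \<noteq> 0" using nz by (simp add: d_def)
    have bd: "b = p * d" and cd: "2 * int N * c = q * d" by (simp_all add: p_def q_def d_def)
    have cop: "coprime p q" unfolding p_def q_def d_def using nz by (intro div_gcd_coprime) simp
    have q0: "q \<noteq> 0" using cd nz by auto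
    have rc: "real_of_int c = of_int q * of_int d / (2 * real N)"
    proof -
      have "real_of_int (2 * int N * c) = of_int (q * d)" using cd by simp
      then show ?thesis using N0 by (simp add: field_simps)
    qed
    have rb: "real_of_int b = of_int p * of_int d" by (simp add: bd)
    have ra: "(real_of_int p * of_int d)\<^sup>2 = 2 * of_int a * (of_int q * of_int d)"
    proof -
      have "b\<^sup>2 = 2 * a * (2 * int N * c)" using disc by simp
      then have "(p * d)\<^sup>2 = 2 * a * (q * d)" by (simp only: cd bd)
      then have "real_of_int ((p * d)\<^sup>2) = of_int (2 * a * (q * d))" by simp
      then show ?thesis by simp
    qed
    define \<beta> where "\<beta> = - of_int d / (2 * real N * of_int q)"
    have rq: "real_of_int q \<noteq> 0" and rd: "real_of_int d \<noteq> 0" using q0 d0 by simp_all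
    have "\<beta> \<noteq> 0" using rq rd N0 by (simp add: \<beta>_def)
    moreover have "- \<beta> * of_int p * of_int q = of_int b / (2 * real N)" unfolding \<beta>_def rb using rq N0 by (simp add: field_simps)
    moreover have "\<beta> * (of_int p)\<^sup>2 = - of_int a / real N"
    proof -
      have "of_int d * (real_of_int p)\<^sup>2 = 2 * of_int a * of_int q" using ra rd by (simp add: power2_eq_square mult_ac)
      then show ?thesis unfolding \<beta>_def using rq N0 by (simp add: field_simps)
    qed
    moreover have "- \<beta> * (of_int q)\<^sup>2 = of_int c" unfolding rc \<beta>_def using rq N0 by (simp add: field_simps power2_eq_square)
    ultimately show ?thesis using cop by blast
  qed
  then obtain p q :: int and \<beta> :: real where pq: "coprime p q" "\<beta> \<noteq> 0" "- \<beta> * of_int p * of_int q = of_int b / (2 * real N)"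
     "\<beta> * (of_int p)\<^sup>2 = - of_int a / real N" "- \<beta> * (of_int q)\<^sup>2 = of_int c" by blast
  obtain v u' where "v * p + u' * q = gcd p q" using bezout_int by blast
  then have det: "p * v - (- u') * q = 1" using pq(1) by (simp add: algebra_simps)
  define A where "A = mat2 (of_int p) (of_int (- u')) (of_int q) (of_int v)"
  have A: "A \<in> SL2" unfolding A_def SL2_mat2 using arg_cong[OF det, of real_of_int] by simp
  have "X = conj_act A (mat2 0 \<beta> 0 0)"
    unfolding conj_act_mat2[OF A, of "mat2 0 \<beta> 0 0", unfolded traceless_mat2, simplified]
    using pq(3-5) by (simp add: Xd dvec_def mat2_eq_iff A_def algebra_simps)
  then show ?thesis using that[OF det pq(2)] by (simp add: A_def)
qed

lemma kern_isotropic: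
  assumes N: "N > 0" and \<kappa>: "\<kappa> > 0" and G: "G \<in> cusp_forms (2 * k + 2) N" and fd: "fundamental_domain N F"
    and X: "X \<in> dual_lattice N" and q: "qform N X = 0"
  shows "((\<lambda>Y. LINT z:F|hmeas. kern N k \<kappa> G Y z) has_sum 0) (orbit0 N X)"
proof (cases "X = 0")
  case True
  have "kern N k \<kappa> G Y z = 0" if Y: "Y \<in> orbit0 N X" for Y z
  proof -
    obtain A where "A \<in> Gamma0 N" "Y = conj_act A X" using Y by (auto simp: orbit0_def)
    then have "Y = 0" using True by (simp add: conj_act_def)
    then show ?thesis by (simp add: kern_def Qpoly_def)
  qed
  then show ?thesis by (intro has_sum_0) simp
next
  case False
  obtain p q u v :: int and \<beta> :: real where det: "p * v - u * q = 1" and \<beta>: "\<beta> \<noteq> 0"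
    and XX: "X = conj_act (mat2 (of_int p) (of_int u) (of_int q) (of_int v)) (mat2 0 \<beta> 0 0)"
    using isotropic_standard[OF N X False q] by metis
  define A where "A = mat2 (of_int p) (of_int u) (of_int q) (of_int v)"
  define X1 where "X1 = mat2 0 \<beta> 0 0"
  have A1: "A \<in> Gamma0 1" unfolding A_def Gamma0_mat2 using det by simp
  have A: "A \<in> SL2" by (rule Gamma0_SL2[OF A1])
  have X1: "X1 \<in> traceless" by (simp add: X1_def traceless_mat2)
  have XA: "conj_act A X1 = X" unfolding A_def X1_def XX ..
  define m where "m = int N div gcd (int N) (q\<^sup>2)"
  define d where "d = gcd (int N) (q\<^sup>2)"
  define q' where "q' = q\<^sup>2 div d"
  have d0: "d > 0" using N by (simp add: d_def)
  have Nd: "int N = m * d" and qd: "q\<^sup>2 = q' * d" by (simp_all add: m_def q'_def d_def)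
  have cop: "coprime m q'" unfolding m_def q'_def d_def using N by (intro div_gcd_coprime) simp
  have m: "m > 0" using Nd d0 N by (metis of_nat_0_less_iff zero_less_mult_pos2)
  have dvd: "int N dvd q\<^sup>2 * t \<longleftrightarrow> m dvd t" for t
  proof -
    have qt: "q\<^sup>2 * t = (q' * t) * d" unfolding qd by (simp only: mult_ac)
    have "int N dvd q\<^sup>2 * t \<longleftrightarrow> m * d dvd (q' * t) * d" unfolding Nd qt by (rule refl)
    also have "\<dots> \<longleftrightarrow> m dvd q' * t" using d0 by simp
    also have "\<dots> \<longleftrightarrow> m dvd t" using cop by (simp add: coprime_dvd_mult_right_iff)
    finally show ?thesis .
  qed
  define n where "n t = mat2 1 (of_int t) 0 1" for t :: int
  have n: "n t \<in> SL2" for t by (simp add: n_def SL2_mat2)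
  have rdet: "real_of_int p * of_int v - of_int u * of_int q = 1" using arg_cong[OF det, of real_of_int] by simp
  have AnA: "A ** n t ** matrix_inv A = mat2 (of_int (1 - p * q * t)) (of_int (p\<^sup>2 * t)) (of_int (- (q\<^sup>2 * t))) (of_int (1 + p * q * t))" for t
  proof -
    have e: "real_of_int p * of_int v = 1 + of_int u * of_int q" using rdet by simp
    have Ai: "matrix_inv A = mat2 (of_int v) (- of_int u) (- of_int q) (of_int p)" unfolding SL2_inv_eq[OF A] by (simp add: A_def)
    show ?thesis unfolding Ai unfolding A_def n_def
      by (simp add: mat2_mult mat2_eq_iff power2_eq_square algebra_simps e)
  qed
  have AnG: "A ** n t ** matrix_inv A \<in> Gamma0 N \<longleftrightarrow> m dvd t" for t
    unfolding AnA Gamma0_mat2 dvd[symmetric] by (simp add: algebra_simps power2_eq_square)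
  have nX: "conj_act (n t) X1 = X1" for t
    unfolding conj_act_eq_iff[OF n] by (simp add: n_def X1_def mat2_mult)
  have nm: "moebius (n t) w = w + of_int t" for t w by (simp add: n_def moebius_def)
  define D1 where "D1 = {w. 0 \<le> Re w \<and> Re w < of_int m}"
  have D1: "D1 \<in> sets borel" unfolding D1_def by measurable
  have cD: "card {h. A ** h ** matrix_inv A \<in> Gamma0 N \<and> conj_act h X1 = X1 \<and> moebius h w \<in> D1} = 2" for w
  proof -
    define x where "x = Re w / of_int m"
    define j where "j = - \<lfloor>x\<rfloor>"
    define t where "t = m * j"
    have mr: "real_of_int m > 0" using m by simp
    have xm: "Re w = x * of_int m" using m by (simp add: x_def)
    have "of_int \<lfloor>x\<rfloor> * of_int m \<le> x * of_int m" "x * of_int m < (of_int \<lfloor>x\<rfloor> + 1) * real_of_int m"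
      using mr mult_right_mono[OF of_int_floor_le[of x] less_imp_le[OF mr]]
        mult_strict_right_mono[OF conjunct2[OF floor_correct[of x]] mr] by simp_all
    then have fl: "of_int \<lfloor>x\<rfloor> * of_int m \<le> Re w" "Re w < (of_int \<lfloor>x\<rfloor> + 1) * real_of_int m" unfolding xm .
    have tD: "w + of_int t \<in> D1" using fl by (simp add: D1_def t_def j_def algebra_simps)
    have uniq: "t' = t" if t1: "m dvd t'" and t2: "w + of_int t' \<in> D1" for t'
    proof -
      obtain l where l: "t' = m * l" using t1 by blast
      have "\<bar>real_of_int t' - of_int t\<bar> < of_int m" using t2 tD unfolding D1_def abs_less_iff by auto
      then have "real_of_int \<bar>t' - t\<bar> < of_int m" by simp
      then have "\<bar>t' - t\<bar> < m" by (simp only: of_int_less_iff)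
      moreover have "t' - t = m * (l - j)" by (simp add: l t_def right_diff_distrib)
      ultimately have "\<bar>m * (l - j)\<bar> < m" by simp
      then have "m * \<bar>l - j\<bar> < m * 1" using m by (simp add: abs_mult)
      then have "\<bar>l - j\<bar> < 1" using m by (simp only: mult_less_cancel_left_pos)
      then show ?thesis by (simp add: l t_def)
    qed
    have "{h. A ** h ** matrix_inv A \<in> Gamma0 N \<and> conj_act h X1 = X1 \<and> moebius h w \<in> D1} = {n t, - n t}" (is "?l = ?r")
    proof (intro equalityI subsetI)
      fix h assume "h \<in> ?l"
      then have h: "A ** h ** matrix_inv A \<in> Gamma0 N" "conj_act h X1 = X1" "moebius h w \<in> D1" by auto
      define s where "s = A ** h ** matrix_inv A"
      have s1: "s \<in> Gamma0 1" using h(1) Gamma0_subset_Gamma1 unfolding s_def by blast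
      have hs: "h = matrix_inv A ** s ** A"
        unfolding s_def by (simp only: matrix_mul_assoc SL2_inv_left[OF A] SL2_cancel_right[OF A] matrix_mul_lid)
      have "h \<in> Gamma0 1" unfolding hs by (intro Gamma0_mult Gamma0_inv A1 s1)
      then obtain a b c e where hm: "h = mat2 (of_int a) (of_int b) (of_int c) (of_int e)" "a * e - b * c = 1"
        by (auto elim: Gamma0E)
      have hS: "h \<in> SL2" using \<open>h \<in> Gamma0 1\<close> by (rule Gamma0_SL2)
      have "h ** X1 = X1 ** h" using h(2) unfolding conj_act_eq_iff[OF hS] .
      then have ce: "c = 0" "a = e" using \<beta> by (auto simp: hm X1_def mat2_mult mat2_eq_iff)
      then have "a * a = 1" using hm(2) by simp
      then have "a = 1 \<or> a = - 1" using zmult_eq_1_iff by blast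
      then show "h \<in> ?r"
      proof
        assume "a = 1"
        then have hn: "h = n b" using ce \<open>a = 1\<close> by (simp add: hm(1) n_def)
        have "b = t" using uniq[of b] h(1,3) unfolding hn AnG nm by blast
        then show ?thesis by (simp add: hn)
      next
        assume "a = - 1"
        then have hn: "h = - n (- b)" using ce \<open>a = - 1\<close> by (simp add: hm(1) n_def mat2_eq_iff)
        have "- (A ** h ** matrix_inv A) = A ** n (- b) ** matrix_inv A" unfolding hn by (simp add: uminus_mult2)
        then have "m dvd - b" using Gamma0_uminus[OF h(1)] AnG[of "- b"] by simp
        moreover have "w + of_int (- b) \<in> D1" using h(3) unfolding hn moebius_uminus nm .
        ultimately have "- b = t" by (rule uniq)
        then show ?thesis by (simp add: hn)
      qed
    next
      fix h assume "h \<in> ?r"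
      then have h: "h = n t \<or> h = - n t" by simp
      have nt: "A ** n t ** matrix_inv A \<in> Gamma0 N" unfolding AnG by (simp add: t_def)
      from h show "h \<in> ?l"
      proof
        assume h: "h = n t"
        show ?thesis using nt nX tD by (simp add: h nm)
      next
        assume h: "h = - n t"
        show ?thesis using Gamma0_uminus[OF nt] nX tD by (simp add: h nm uminus_mult2 moebius_uminus conj_act_uminus[OF n])
      qed
    qed
    moreover have "n t \<noteq> - n t" by (simp add: n_def mat2_eq_iff)
    ultimately show ?thesis by simp
  qed
  define f where "f = slash (2 * k + 2) G A"
  note ki = kern_frame_integrable[OF N \<kappa> G fd X A X1 XA D1 cD, folded f_def]
    and ks = kern_frame_has_sum[OF N \<kappa> G fd X A X1 XA D1 cD, folded f_def]
  have fh: "f holomorphic_on upper_half_plane" unfolding f_def by (rule slash_holo[OF A cusp_form_holo[OF G]])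
  obtain C where C: "\<And>z. Im z \<ge> 1 / 2 \<Longrightarrow> norm (f z) \<le> C * exp (- (pi / real N) * Im z)"
    using cusp_form_decay[OF N G A1] unfolding f_def by metis
  have per: "f (z + of_real (of_int m)) = f z" if z: "Im z > 0" for z
  proof -
    define s where "s = A ** n m ** matrix_inv A"
    have s: "s \<in> Gamma0 N" unfolding s_def AnG by simp
    have sA: "s ** A = A ** n m" unfolding s_def by (rule SL2_cancel_right(1)[OF A])
    have "f (z + of_int m) = slash (2 * k + 2) G (A ** n m) z"
      unfolding slash_mult[OF A n z] f_def[symmetric] by (simp add: slash_def nm) (simp add: n_def)
    also have "\<dots> = slash (2 * k + 2) (slash (2 * k + 2) G s) A z"
      unfolding sA[symmetric] by (rule slash_mult[OF Gamma0_SL2[OF s] A z])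
    also have "\<dots> = f z" using cusp_form_slash[OF G s moebius_uhp[OF A z]] by (simp add: f_def slash_def)
    finally show ?thesis by simp
  qed
  define u where "u w = indicator D1 w *\<^sub>R kern N k \<kappa> f X1 w" for w
  note D1 [measurable] and kern_measurable[OF fh, of N k \<kappa> X1, measurable]
  have um: "u \<in> borel_measurable borel" unfolding u_def by measurable
  have ui: "integrable hmeas u" using ki unfolding set_integrable_def u_def .
  have "(LINT t|lborel. u (hpt s t)) = 0" for s
  proof -
    define H where "H x = indicator {0..<of_int m} x *\<^sub>R f (Complex x (exp s))" for x
    define K where "K = (- of_nat N * complex_of_real \<beta>) ^ (k + 1) * of_real (exp (- \<kappa> * (sqrt (real N) / exp s * \<beta>)\<^sup>2))"
    have "u (hpt s t) = K * H (0 + exp s * t)" for t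
      by (simp add: u_def H_def K_def kern_def hcut_def hpt_def D1_def indicator_def Qpoly_def pfun_def X1_def)
    then have "(LINT t|lborel. u (hpt s t)) = K * (LINT t|lborel. H (0 + exp s * t))" by simp
    moreover have "\<bar>exp s\<bar> *\<^sub>R (LINT t|lborel. H (0 + exp s * t)) = (LINT x|lborel. H x)"
      by (rule lborel_integral_real_affine[symmetric]) simp
    moreover have "(LINT x|lborel. H x) = 0"
      using horocycle_integral[OF fh _ _ per _ C, of "exp s"] m N by (simp add: H_def set_lebesgue_integral_def)
    ultimately show ?thesis by simp
  qed
  then have "(LINT w|hmeas. u w) = 0" unfolding hmeas_integral(1)[OF ui um] by simp
  then show ?thesis using ks by (simp add: u_def set_lebesgue_integral_def)
qed

subsection \<open>Vectors of negative norm\<close>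

lemma integral_exp_subst:
  fixes \<phi> :: "real \<Rightarrow> complex"
  assumes [measurable]: "\<phi> \<in> borel_measurable borel"
  shows "(LINT y:{0<..}|lborel. \<phi> y) = (LINT s|lborel. exp s *\<^sub>R \<phi> (exp s))"
proof -
  have "(LINT y:{0<..}|lborel. \<phi> y) = (LINT y|density lborel (\<lambda>y. ennreal (indicator {0<..} y)). \<phi> y)"
    unfolding set_lebesgue_integral_def by (rule integral_density[symmetric]) auto
  also have "(\<lambda>y::real. ennreal (indicator {0<..} y)) = indicator {0<..}" by (simp add: fun_eq_iff indicator_def)
  also have "(LINT y|density lborel (indicator {0<..}). \<phi> y) = (LINT s|density lborel (\<lambda>s. ennreal (exp s)). \<phi> (exp s))"
    unfolding density_exp_distr by (rule integral_distr) auto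
  also have "\<dots> = (LINT s|lborel. exp s *\<^sub>R \<phi> (exp s))" by (rule integral_density) auto
  finally show ?thesis .
qed

definition dg :: "real \<Rightarrow> real^2^2" where
  "dg t = mat2 t 0 0 (1 / t)"

lemma dg_SL2: "t \<noteq> 0 \<Longrightarrow> dg t \<in> SL2"
  by (simp add: dg_def SL2_mat2)

lemma dg_mult: "dg s ** dg t = dg (s * t)"
  by (simp add: dg_def mat2_mult)

lemma dg_uminus: "dg (- t) = - dg t"
  by (simp add: dg_def mat2_eq_iff)

lemma dg_inv: "t \<noteq> 0 \<Longrightarrow> matrix_inv (dg t) = dg (1 / t)"
  by (rule matrix_inv_eqI) (simp add: dg_mult, simp add: dg_def mat_one_mat2)

lemma moebius_dg: "t \<noteq> 0 \<Longrightarrow> moebius (dg t) w = of_real (t\<^sup>2) * w"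
  by (simp add: dg_def moebius_def power2_eq_square)

definition dX :: "real \<Rightarrow> real^2^2" where
  "dX \<sigma> = mat2 \<sigma> 0 0 (- \<sigma>)"

lemma dX_traceless: "dX \<sigma> \<in> traceless"
  by (simp add: dX_def traceless_mat2)

lemma dX_stabilizer:
  assumes h: "h \<in> SL2" and \<sigma>: "\<sigma> \<noteq> 0"
  shows "conj_act h (dX \<sigma>) = dX \<sigma> \<longleftrightarrow> (\<exists>t. t \<noteq> 0 \<and> h = dg t)"
proof
  assume "conj_act h (dX \<sigma>) = dX \<sigma>"
  then have "h ** dX \<sigma> = dX \<sigma> ** h" unfolding conj_act_eq_iff[OF h] .
  then have "h$1$2 * (- \<sigma>) = \<sigma> * h$1$2" "h$2$1 * \<sigma> = (- \<sigma>) * h$2$1"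
    by (simp_all add: mat2_eq_iff mult_nth2 dX_def)
  then have o: "h$1$2 = 0" "h$2$1 = 0" using \<sigma> by simp_all
  with SL2_det[OF h] have d: "h$1$1 * h$2$2 = 1" by simp
  then have "h$1$1 \<noteq> 0" by auto
  then show "\<exists>t. t \<noteq> 0 \<and> h = dg t" using o d by (intro exI[of _ "h$1$1"]) (simp add: mat2_eq_iff dg_def field_simps)
next
  assume "\<exists>t. t \<noteq> 0 \<and> h = dg t"
  then show "conj_act h (dX \<sigma>) = dX \<sigma>" unfolding conj_act_eq_iff[OF h] by (auto simp: dg_def dX_def mat2_mult mult.commute)
qed

lemma diagonalizes_exists:
  assumes X: "X \<in> traceless" and N: "N > 0" and q: "qform N X < 0"
  shows "\<exists>g. diagonalizes N X g"
proof -
  define \<sigma> where "\<sigma> = sqrt (\<bar>qform N X\<bar> / real N)"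
  define x1 x2 x3 where "x1 = X$1$2" and "x2 = X$1$1" and "x3 = X$2$1"
  have X22: "X$2$2 = - x2" using X by (simp add: traceless_def x2_def)
  have "\<bar>qform N X\<bar> / real N = x2\<^sup>2 + x1 * x3"
    using q N by (simp add: qform_def det_2 X22 x1_def x2_def x3_def power2_eq_square)
  moreover have "\<bar>qform N X\<bar> / real N > 0" using q N by (intro divide_pos_pos) simp_all
  ultimately have \<sigma>: "\<sigma> > 0" and ss: "\<sigma> * \<sigma> = x2 * x2 + x1 * x3" by (simp_all add: \<sigma>_def power2_eq_square)
  have suff: "diagonalizes N X g" if g: "det g = 1" and e: "X ** g = g ** mat2 \<sigma> 0 0 (- \<sigma>)" for g
  proof -
    have gS: "g \<in> SL2" using g by (simp add: SL2_def)
    have "matrix_inv g ** X ** g = matrix_inv g ** (X ** g)" by (simp only: matrix_mul_assoc)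
    also have "\<dots> = mat2 \<sigma> 0 0 (- \<sigma>)" unfolding e by (rule SL2_cancel_left(1)[OF gS])
    finally show ?thesis unfolding diagonalizes_def using g by (simp add: \<sigma>_def)
  qed
  have XX: "X = mat2 x2 x1 x3 (- x2)" by (simp add: mat2_eq_iff X22 x1_def x2_def x3_def)
  show ?thesis
  proof (cases "x3 = 0")
    case False
    have "diagonalizes N X (mat2 ((x2 + \<sigma>) / (2 * \<sigma> * x3)) (x2 - \<sigma>) (1 / (2 * \<sigma>)) x3)"
    proof (rule suff)
      have "(x2 + \<sigma>) / (2 * \<sigma> * x3) * x3 = (x2 + \<sigma>) / (2 * \<sigma>)" using False by simp
      then have "det (mat2 ((x2 + \<sigma>) / (2 * \<sigma> * x3)) (x2 - \<sigma>) (1 / (2 * \<sigma>)) x3) = (x2 + \<sigma>) / (2 * \<sigma>) - (x2 - \<sigma>) / (2 * \<sigma>)"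
        unfolding det_mat2 by simp
      also have "\<dots> = 1" using \<sigma> by (simp add: field_simps)
      finally show "det (mat2 ((x2 + \<sigma>) / (2 * \<sigma> * x3)) (x2 - \<sigma>) (1 / (2 * \<sigma>)) x3) = 1" .
      have e1: "x2 * ((x2 + \<sigma>) / (2 * \<sigma> * x3)) + x1 * (1 / (2 * \<sigma>)) = (x2 + \<sigma>) / (2 * \<sigma> * x3) * \<sigma>"
      proof -
        have "x2 * ((x2 + \<sigma>) / (2 * \<sigma> * x3)) + x1 * (1 / (2 * \<sigma>)) = (x2 * x2 + x1 * x3 + x2 * \<sigma>) / (2 * \<sigma> * x3)"
          using \<sigma> False by (simp add: field_simps)
        also have "\<dots> = (\<sigma> * \<sigma> + x2 * \<sigma>) / (2 * \<sigma> * x3)" by (simp only: ss)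
        finally show ?thesis by (simp add: algebra_simps)
      qed
      have e2: "x2 * (x2 - \<sigma>) + x1 * x3 = (x2 - \<sigma>) * - \<sigma>" using ss by (simp add: algebra_simps)
      have e3: "x3 * ((x2 + \<sigma>) / (2 * \<sigma> * x3)) + - x2 * (1 / (2 * \<sigma>)) = 1 / (2 * \<sigma>) * \<sigma>"
        using \<sigma> False by (simp add: field_simps)
      have e4: "x3 * (x2 - \<sigma>) + - x2 * x3 = x3 * - \<sigma>" by (simp add: algebra_simps)
      show "X ** mat2 ((x2 + \<sigma>) / (2 * \<sigma> * x3)) (x2 - \<sigma>) (1 / (2 * \<sigma>)) x3 = mat2 ((x2 + \<sigma>) / (2 * \<sigma> * x3)) (x2 - \<sigma>) (1 / (2 * \<sigma>)) x3 ** mat2 \<sigma> 0 0 (- \<sigma>)"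
        unfolding XX mat2_mult e1 e2 e3 e4 by simp
    qed
    then show ?thesis ..
  next
    case x3: True
    then have "(\<sigma> - x2) * (\<sigma> + x2) = 0" using ss by (simp add: algebra_simps)
    then consider "x2 = \<sigma>" | "x2 = - \<sigma>" by force
    then show ?thesis
    proof cases
      case 1
      have "diagonalizes N X (mat2 1 (- x1 / (2 * \<sigma>)) 0 1)"
        by (rule suff) (use 1 x3 \<sigma> in \<open>simp_all add: det_mat2 XX mat2_mult mat2_eq_iff field_simps\<close>)
      then show ?thesis ..
    next
      case 2
      have "diagonalizes N X (mat2 x1 (- 1 / (2 * \<sigma>)) (2 * \<sigma>) 0)"
        by (rule suff) (use 2 x3 \<sigma> in \<open>simp_all add: det_mat2 XX mat2_mult mat2_eq_iff field_simps\<close>)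
      then show ?thesis ..
    qed
  qed
qed

lemma diagonalizesD:
  assumes "diagonalizes N X g"
  shows "g \<in> SL2" and "conj_act g (dX (sqrt (\<bar>qform N X\<bar> / real N))) = X"
proof -
  show g: "g \<in> SL2" using assms by (simp add: diagonalizes_def SL2_def)
  have e: "dX (sqrt (\<bar>qform N X\<bar> / real N)) = matrix_inv g ** X ** g" using assms by (simp add: diagonalizes_def dX_def)
  show "conj_act g (dX (sqrt (\<bar>qform N X\<bar> / real N))) = X"
    unfolding conj_act_def e by (simp only: matrix_mul_assoc SL2_inv_right[OF g] SL2_cancel_right[OF g] matrix_mul_lid)
qed

definition geo_stab :: "nat \<Rightarrow> real^2^2 \<Rightarrow> real \<Rightarrow> bool" where
  "geo_stab N g t \<longleftrightarrow> t \<noteq> 0 \<and> g ** dg t ** matrix_inv g \<in> Gamma0 N"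

lemma geo_stab_mult:
  assumes g: "g \<in> SL2" and s: "geo_stab N g s" and t: "geo_stab N g t"
  shows "geo_stab N g (s * t)"
proof -
  have "(g ** dg s ** matrix_inv g) ** (g ** dg t ** matrix_inv g) = g ** dg (s * t) ** matrix_inv g"
    unfolding dg_mult[symmetric] by (simp only: matrix_mul_assoc SL2_cancel_right[OF g])
  then show ?thesis using Gamma0_mult[of _ N] s t unfolding geo_stab_def by (metis mult_eq_0_iff)
qed

lemma geo_stab_inverse:
  assumes g: "g \<in> SL2" and t: "geo_stab N g t"
  shows "geo_stab N g (1 / t)"
proof -
  have t0: "t \<noteq> 0" using t by (simp add: geo_stab_def)
  have "matrix_inv (g ** dg t ** matrix_inv g) = g ** dg (1 / t) ** matrix_inv g"
    unfolding SL2_inv_mult[OF SL2_mult[OF g dg_SL2[OF t0]] SL2_inv[OF g]] SL2_inv_mult[OF g dg_SL2[OF t0]] SL2_inv_inv[OF g] dg_inv[OF t0]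
    by (simp only: matrix_mul_assoc)
  then show ?thesis using Gamma0_inv[of "g ** dg t ** matrix_inv g" N] t by (simp add: geo_stab_def)
qed

lemma geo_stab_uminus: "geo_stab N g t \<Longrightarrow> geo_stab N g (- t)"
  using Gamma0_uminus[of "g ** dg t ** matrix_inv g" N] by (simp add: geo_stab_def dg_uminus uminus_mult2)

lemma geo_stab_one: "g \<in> SL2 \<Longrightarrow> geo_stab N g 1"
  using Gamma0_one[of N] by (simp add: geo_stab_def dg_def SL2_inv_right flip: mat_one_mat2)

lemma geo_stab_trace:
  assumes g: "g \<in> SL2" and t: "geo_stab N g t"
  shows "t + 1 / t \<in> \<int>"
proof -
  define s where "s = g ** dg t ** matrix_inv g"
  have "s \<in> Gamma0 N" using t by (simp add: geo_stab_def s_def)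
  then have "s$1$1 + s$2$2 \<in> \<int>" by (auto elim!: Gamma0E)
  moreover have "s$1$1 + s$2$2 = (t + 1 / t) * (g$1$1 * g$2$2 - g$1$2 * g$2$1)"
    unfolding s_def SL2_inv_eq[OF g] mult_nth2 dg_def mat2_nth by (simp add: algebra_simps)
  ultimately show ?thesis unfolding SL2_det[OF g] by simp
qed

lemma geo_stab_exp:
  assumes g: "g \<in> SL2" and l: "geo_stab N g (exp l)"
  shows "geo_stab N g (exp (of_int j * l))"
proof -
  have nat: "geo_stab N g (exp (of_nat n * l))" for n
  proof (induction n)
    case 0
    show ?case using geo_stab_one[OF g] by simp
  next
    case (Suc n)
    have e: "exp (of_nat (Suc n) * l) = exp (of_nat n * l) * exp l" by (simp add: algebra_simps flip: exp_add)
    show ?case unfolding e by (rule geo_stab_mult[OF g Suc l])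
  qed
  show ?thesis
  proof (cases "j \<ge> 0")
    case True
    define m where "m = nat j"
    have j: "real_of_int j = of_nat m" using True by (simp add: m_def)
    show ?thesis unfolding j by (rule nat)
  next
    case False
    define m where "m = nat (- j)"
    have j: "real_of_int j = - of_nat m" using False by (simp add: m_def)
    have e: "exp (of_int j * l) = 1 / exp (of_nat m * l)" unfolding j by (simp add: exp_minus divide_inverse)
    show ?thesis unfolding e by (rule geo_stab_inverse[OF g nat])
  qed
qed

lemma geo_stab_least:
  assumes g: "g \<in> SL2" and ne: "{t. t > 1 \<and> geo_stab N g t} \<noteq> {}"
  shows "Inf {t. t > 1 \<and> geo_stab N g t} > 1" and "geo_stab N g (Inf {t. t > 1 \<and> geo_stab N g t})"
    and "\<And>t. t > 1 \<Longrightarrow> geo_stab N g t \<Longrightarrow> Inf {t. t > 1 \<and> geo_stab N g t} \<le> t"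
proof -
  define E where "E = {t. t > 1 \<and> geo_stab N g t}"
  obtain e0 where e0: "e0 \<in> E" using ne unfolding E_def by blast
  define h where "h t = \<lfloor>t + 1 / t\<rfloor>" for t :: real
  have hr: "of_int (h t) = t + 1 / t" if "t \<in> E" for t
    using geo_stab_trace[OF g, of N t] that by (simp add: h_def E_def)
  have "inj_on h E"
  proof (rule inj_onI)
    fix s t assume st: "s \<in> E" "t \<in> E" "h s = h t"
    have p: "s > 1" "t > 1" using st by (simp_all add: E_def)
    have "s + 1 / s = t + 1 / t" using hr[OF st(1)] hr[OF st(2)] st(3) by simp
    then have "(s - t) * (s * t - 1) = 0" using p by (simp add: field_simps)
    moreover have "s * t > 1" using p by (simp add: less_1_mult)
    ultimately show "s = t" by simp
  qed
  then have "inj_on h (E \<inter> {..e0})" by (rule inj_on_subset) simp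
  moreover have "h ` (E \<inter> {..e0}) \<subseteq> {0..\<lfloor>e0 + 1\<rfloor>}"
  proof
    fix n assume "n \<in> h ` (E \<inter> {..e0})"
    then obtain t where t: "t \<in> E" "t \<le> e0" "n = h t" by blast
    have "t > 1" using t by (simp add: E_def)
    then have "1 / t \<le> 1" "1 / t \<ge> 0" by simp_all
    then have le: "t + 1 / t \<le> e0 + 1" and nn: "0 \<le> t + 1 / t" using t(2) \<open>t > 1\<close> by linarith+
    have "\<lfloor>t + 1 / t\<rfloor> \<le> \<lfloor>e0 + 1\<rfloor>" "0 \<le> \<lfloor>t + 1 / t\<rfloor>"
      using floor_mono[OF le] nn unfolding zero_le_floor by blast+
    then show "n \<in> {0..\<lfloor>e0 + 1\<rfloor>}" unfolding t(3) atLeastAtMost_iff h_def by (intro conjI)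
  qed
  then have "finite (h ` (E \<inter> {..e0}))" by (rule finite_subset) simp
  ultimately have fin: "finite (E \<inter> {..e0})" by (rule finite_imageD[rotated])
  define m where "m = Min (E \<inter> {..e0})"
  have mE: "m \<in> E \<inter> {..e0}" unfolding m_def by (rule Min_in[OF fin]) (use e0 in blast)
  have le: "m \<le> t" if t: "t \<in> E" for t
  proof (cases "t \<le> e0")
    case True
    then show ?thesis unfolding m_def by (intro Min_le fin) (use t in simp)
  next
    case False
    then show ?thesis using mE by simp
  qed
  have inf: "Inf E = m" by (rule cInf_eq_minimum) (use mE le in auto)
  show "Inf {t. t > 1 \<and> geo_stab N g t} > 1" "geo_stab N g (Inf {t. t > 1 \<and> geo_stab N g t})"
    using mE inf unfolding E_def by auto
  show "Inf {t. t > 1 \<and> geo_stab N g t} \<le> t" if "t > 1" "geo_stab N g t" for t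
    using le[of t] inf that unfolding E_def by auto
qed

definition geo_range :: "nat \<Rightarrow> real^2^2 \<Rightarrow> real set" where
  "geo_range N g = (let E = {t. t > 1 \<and> geo_stab N g t} in if E = {} then UNIV else {0..<2 * ln (Inf E)})"

lemma geo_range_unique:
  assumes g: "g \<in> SL2"
  shows "\<exists>!t. t > 0 \<and> geo_stab N g t \<and> 2 * ln t + u \<in> geo_range N g"
proof (cases "{t. t > 1 \<and> geo_stab N g t} = {}")
  case True
  have "t = 1" if t: "t > 0" "geo_stab N g t" for t
  proof (rule ccontr)
    assume "t \<noteq> 1"
    then consider "t > 1" | "t < 1" by linarith
    then show False
    proof cases
      case 1
      then show False using True t by blast
    next
      case 2
      then have "1 / t > 1" using t by simp
      then show False using True geo_stab_inverse[OF g t(2)] by blast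
    qed
  qed
  moreover have "geo_range N g = UNIV" unfolding geo_range_def using True by simp
  ultimately show ?thesis using geo_stab_one[OF g] by (intro ex1I[of _ 1]) auto
next
  case False
  define e where "e = Inf {t. t > 1 \<and> geo_stab N g t}"
  note e = geo_stab_least[OF g False, folded e_def]
  define l where "l = ln e"
  have l: "l > 0" "exp l = e" using e(1) by (simp_all add: l_def)
  have R: "geo_range N g = {0..<2 * l}" unfolding geo_range_def Let_def l_def e_def by (rule if_not_P[OF False])
  define x where "x = u / (2 * l)"
  define j where "j = - \<lfloor>x\<rfloor>"
  have ux: "u = x * (2 * l)" using l by (simp add: x_def)
  have l2: "2 * l > 0" using l by simp
  have xj: "0 \<le> x + of_int j" "x + of_int j < 1" unfolding j_def of_int_minus using floor_correct[of x, unfolded of_int_add of_int_1] by linarith+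
  have in_R: "2 * (of_int j * l) + u \<in> geo_range N g"
  proof -
    have eq: "2 * (of_int j * l) + u = (x + of_int j) * (2 * l)" unfolding ux by (simp add: algebra_simps)
    have "(x + of_int j) * (2 * l) < 1 * (2 * l)" using xj l2 by (intro mult_strict_right_mono) auto
    moreover have "0 \<le> (x + of_int j) * (2 * l)" using xj l2 by (intro mult_nonneg_nonneg) auto
    ultimately show ?thesis unfolding eq R by simp
  qed
  have less: "\<not> s < t" if st: "s > 0" "t > 0" "geo_stab N g s" "geo_stab N g t"
    "2 * ln s + u \<in> geo_range N g" "2 * ln t + u \<in> geo_range N g" for s t
  proof
    assume "s < t"
    then have "t / s > 1" using st by simp
    moreover have "geo_stab N g (t / s)" using geo_stab_mult[OF g st(4) geo_stab_inverse[OF g st(3)]] by simp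
    ultimately have "e \<le> t / s" by (rule e(3))
    then have "l \<le> ln (t / s)" unfolding l_def using e(1) by (simp add: ln_le_cancel_iff)
    then have "l \<le> ln t - ln s" using st by (simp add: ln_div)
    then show False using st(5,6) unfolding R by simp
  qed
  show ?thesis
  proof (rule ex1I[of _ "exp (of_int j * l)"])
    show "exp (of_int j * l) > 0 \<and> geo_stab N g (exp (of_int j * l)) \<and> 2 * ln (exp (of_int j * l)) + u \<in> geo_range N g"
      using geo_stab_exp[OF g, of N l j] e(2) l in_R by simp
    then show "t = exp (of_int j * l)" if t: "t > 0 \<and> geo_stab N g t \<and> 2 * ln t + u \<in> geo_range N g" for t
      using less[of t "exp (of_int j * l)"] less[of "exp (of_int j * l)" t] t by (meson linorder_less_linear)
  qed
qed

definition geo_domain :: "nat \<Rightarrow> real^2^2 \<Rightarrow> complex set" where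
  "geo_domain N g = {w. Im w > 0 \<and> ln (Im w) \<in> geo_range N g}"

lemma geo_range_borel [measurable]: "geo_range N g \<in> sets borel"
  by (simp add: geo_range_def Let_def)

lemma geo_domain_borel: "geo_domain N g \<in> sets borel"
  unfolding geo_domain_def by measurable

lemma geo_domain_card:
  assumes g: "g \<in> SL2" and \<sigma>: "\<sigma> \<noteq> 0" and w: "Im w > 0"
  shows "card {h. g ** h ** matrix_inv g \<in> Gamma0 N \<and> conj_act h (dX \<sigma>) = dX \<sigma> \<and> moebius h w \<in> geo_domain N g} = 2"
proof -
  obtain t where t: "t > 0" "geo_stab N g t" "2 * ln t + ln (Im w) \<in> geo_range N g"
    and uniq: "\<And>s. s > 0 \<Longrightarrow> geo_stab N g s \<Longrightarrow> 2 * ln s + ln (Im w) \<in> geo_range N g \<Longrightarrow> s = t"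
    using geo_range_unique[OF g, of N "ln (Im w)"] by blast
  have dom: "moebius (dg s) w \<in> geo_domain N g \<longleftrightarrow> 2 * ln s + ln (Im w) \<in> geo_range N g" if s: "s > 0" for s
  proof -
    have "Im (moebius (dg s) w) = s\<^sup>2 * Im w" using s by (simp add: moebius_dg flip: of_real_power)
    moreover have "ln (s\<^sup>2 * Im w) = 2 * ln s + ln (Im w)" using s w by (simp add: ln_mult ln_realpow)
    ultimately show ?thesis using s w by (simp add: geo_domain_def)
  qed
  have "{h. g ** h ** matrix_inv g \<in> Gamma0 N \<and> conj_act h (dX \<sigma>) = dX \<sigma> \<and> moebius h w \<in> geo_domain N g} = {dg t, - dg t}" (is "?l = ?r")
  proof (intro equalityI subsetI)
    fix h assume "h \<in> ?l"
    then have h: "g ** h ** matrix_inv g \<in> Gamma0 N" "conj_act h (dX \<sigma>) = dX \<sigma>" "moebius h w \<in> geo_domain N g" by auto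
    have "matrix_inv g ** (g ** h ** matrix_inv g) ** g = h"
      by (simp only: matrix_mul_assoc SL2_inv_left[OF g] SL2_cancel_right[OF g] matrix_mul_lid)
    then have hS: "h \<in> SL2" using SL2_mult[OF SL2_mult[OF SL2_inv[OF g] Gamma0_SL2[OF h(1)]] g] by simp
    obtain s where s: "s \<noteq> 0" "h = dg s" using h(2) unfolding dX_stabilizer[OF hS \<sigma>] by blast
    have gs: "geo_stab N g s" using h(1) s by (simp add: geo_stab_def)
    consider "s > 0" | "s < 0" using s by linarith
    then show "h \<in> ?r"
    proof cases
      case 1
      have "s = t" using uniq[OF 1 gs] h(3) dom[OF 1] s by simp
      then show ?thesis by (simp add: s)
    next
      case 2
      then have p: "- s > 0" by simp
      have "moebius (dg (- s)) w \<in> geo_domain N g" using h(3) s by (simp add: dg_uminus moebius_uminus)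
      then have "- s = t" using uniq[OF p geo_stab_uminus[OF gs]] dom[OF p] by simp
      then show ?thesis using s dg_uminus[of t] by auto
    qed
  next
    fix h assume "h \<in> ?r"
    moreover have t0: "t \<noteq> 0" using t by simp
    moreover have "conj_act (dg t) (dX \<sigma>) = dX \<sigma>" using dX_stabilizer[OF dg_SL2[OF t0] \<sigma>] t0 by blast
    moreover have "g ** dg t ** matrix_inv g \<in> Gamma0 N" using t(2) by (simp add: geo_stab_def)
    moreover have "moebius (dg t) w \<in> geo_domain N g" using dom[OF t(1)] t(3) by simp
    ultimately show "h \<in> ?l"
      using Gamma0_uminus[of "g ** dg t ** matrix_inv g" N]
      by (auto simp: uminus_mult2 moebius_uminus conj_act_uminus[OF dg_SL2])
  qed
  moreover have "dg t \<noteq> - dg t" using t by (simp add: dg_def mat2_eq_iff)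
  ultimately show ?thesis by simp
qed

lemma slash_dg:
  assumes G: "G \<in> cusp_forms w N" and g: "g \<in> SL2" and t: "geo_stab N g t" and z: "Im z > 0"
  shows "slash w G g (of_real (t\<^sup>2) * z) * of_real t ^ w = slash w G g z"
proof -
  have t0: "t \<noteq> 0" using t by (simp add: geo_stab_def)
  define s where "s = g ** dg t ** matrix_inv g"
  have s: "s \<in> Gamma0 N" using t by (simp add: geo_stab_def s_def)
  have sg: "s ** g = g ** dg t" unfolding s_def by (rule SL2_cancel_right(1)[OF g])
  have "slash w G (g ** dg t) z = slash w G g (of_real (t\<^sup>2) * z) * of_real t ^ w"
    unfolding slash_mult[OF g dg_SL2[OF t0] z] slash_jac[of w "slash w G g"] moebius_dg[OF t0]
    by (simp add: jac_def dg_def power_divide)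
  moreover have "slash w G (s ** g) z = slash w G g z"
    unfolding slash_mult[OF Gamma0_SL2[OF s] g z] using cusp_form_slash[OF G s moebius_uhp[OF g z]] by (simp add: slash_def)
  ultimately show ?thesis unfolding sg by simp
qed

definition geo_form :: "nat \<Rightarrow> nat \<Rightarrow> real \<Rightarrow> (complex \<Rightarrow> complex) \<Rightarrow> real^2^2 \<Rightarrow> complex \<Rightarrow> complex" where
  "geo_form N k \<sigma> G g w = slash (2 * k + 2) G g w * (of_real (- 2 * real N * \<sigma>) * w) ^ k"

lemma geo_form_holo:
  "G \<in> cusp_forms (2 * k + 2) N \<Longrightarrow> g \<in> SL2 \<Longrightarrow> geo_form N k \<sigma> G g holomorphic_on upper_half_plane"
  unfolding geo_form_def by (intro holomorphic_intros slash_holo cusp_form_holo)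

lemma geo_form_scale:
  assumes G: "G \<in> cusp_forms (2 * k + 2) N" and g: "g \<in> SL2" and t: "geo_stab N g t" and z: "Im z > 0"
  shows "geo_form N k \<sigma> G g (of_real (t\<^sup>2) * z) * of_real (t\<^sup>2) = geo_form N k \<sigma> G g z"
proof -
  define B where "B = complex_of_real (- 2 * real N * \<sigma>)"
  define T where "T = complex_of_real t"
  have "geo_form N k \<sigma> G g (of_real (t\<^sup>2) * z) * of_real (t\<^sup>2) = slash (2 * k + 2) G g (of_real (t\<^sup>2) * z) * (B * (T\<^sup>2 * z)) ^ k * T\<^sup>2"
    by (simp add: geo_form_def B_def T_def)
  also have "(B * (T\<^sup>2 * z)) ^ k = T ^ (2 * k) * (B * z) ^ k"
    unfolding power_mult power_mult_distrib[symmetric] by (simp only: mult_ac)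
  also have "slash (2 * k + 2) G g (of_real (t\<^sup>2) * z) * (T ^ (2 * k) * (B * z) ^ k) * T\<^sup>2 =
     slash (2 * k + 2) G g (of_real (t\<^sup>2) * z) * T ^ (2 * k + 2) * (B * z) ^ k"
    unfolding power_add by (simp only: mult_ac)
  also have "\<dots> = geo_form N k \<sigma> G g z"
    unfolding T_def slash_dg[OF G g t z] geo_form_def B_def ..
  finally show ?thesis .
qed

lemma kern_dX:
  "kern N k \<kappa> (slash (2 * k + 2) G g) (dX \<sigma>) (hpt s t) =
     of_real (- 2 * real N * \<sigma>) * of_real (exp (- (4 * \<kappa> * real N * \<sigma>\<^sup>2) * t\<^sup>2)) * (geo_form N k \<sigma> G g (hpt s t) * hpt s t)"
proof -
  have Q: "Qpoly N (dX \<sigma>) w = of_real (- 2 * real N * \<sigma>) * w" for w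
    by (simp add: Qpoly_def dX_def)
  have "pfun N (hpt s t) (dX \<sigma>) = 2 * sqrt (real N) * \<sigma> * t"
    by (simp add: pfun_def dX_def hpt_def)
  then have p: "\<kappa> * (pfun N (hpt s t) (dX \<sigma>))\<^sup>2 = 4 * \<kappa> * real N * \<sigma>\<^sup>2 * t\<^sup>2"
    by (simp add: power_mult_distrib)
  show ?thesis
    unfolding kern_def Q geo_form_def using Im_hpt[of s t] p by (simp add: hcut_def mult_ac)
qed

lemma hpt_geo_domain: "hpt s t \<in> geo_domain N g \<longleftrightarrow> s \<in> geo_range N g"
  by (simp add: geo_domain_def hpt_def)

lemma geo_ray_const:
  assumes N: "N > 0" and \<kappa>: "\<kappa> > 0" and \<sigma>: "\<sigma> > 0" and G: "G \<in> cusp_forms (2 * k + 2) N" and g: "g \<in> SL2"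
    and int: "set_integrable hmeas (geo_domain N g) (kern N k \<kappa> (slash (2 * k + 2) G g) (dX \<sigma>))"
  shows "AE t in lborel. (LINT s:geo_range N g|lborel. geo_form N k \<sigma> G g (hpt s t) * hpt s t) =
     (LINT s:geo_range N g|lborel. geo_form N k \<sigma> G g (hpt s 0) * hpt s 0)"
proof (cases "{t. t > 1 \<and> geo_stab N g t} = {}")
  case False
  define e where "e = Inf {t. t > 1 \<and> geo_stab N g t}"
  note e = geo_stab_least[OF g False, folded e_def]
  have R: "geo_range N g = {0..<2 * ln e}" unfolding geo_range_def Let_def e_def by (rule if_not_P[OF False])
  have L: "2 * ln e > 0" using e(1) by simp
  have "exp (2 * ln e) = exp (ln e) ^ 2" by (simp add: power2_eq_square flip: exp_add)
  also have "\<dots> = e\<^sup>2" using e(1) by simp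
  finally have eL: "exp (2 * ln e) = e\<^sup>2" .
  have "geo_form N k \<sigma> G g (of_real (exp (2 * ln e)) * w) * of_real (exp (2 * ln e)) = geo_form N k \<sigma> G g w" if "Im w > 0" for w
    unfolding eL by (rule geo_form_scale[OF G g e(2) that])
  from ray_integral_periodic[OF geo_form_holo[OF G g] L this] show ?thesis unfolding R by simp
next
  case True
  have R: "geo_range N g = UNIV" unfolding geo_range_def Let_def by (rule if_P[OF True])
  define f where "f = geo_form N k \<sigma> G g"
  define c where "c = 4 * \<kappa> * real N * \<sigma>\<^sup>2"
  have c: "c \<ge> 0" using \<kappa> by (simp add: c_def)
  have fh: "f holomorphic_on upper_half_plane" unfolding f_def by (rule geo_form_holo[OF G g])
  define K where "K = kern N k \<kappa> (slash (2 * k + 2) G g) (dX \<sigma>)"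
  have Km [measurable]: "K \<in> borel_measurable borel" unfolding K_def by (rule kern_measurable[OF slash_holo[OF g cusp_form_holo[OF G]]])
  define b where "b = 2 * real N * \<sigma>"
  have b: "b > 0" using N \<sigma> by (simp add: b_def)
  have AE1: "AE w in hmeas. ennreal (norm (indicator (geo_domain N g) w *\<^sub>R K w)) = ennreal (norm (K w))"
    using AE_hmeas by eventually_elim (simp add: geo_domain_def R)
  have "(\<integral>\<^sup>+w. ennreal (norm (indicator (geo_domain N g) w *\<^sub>R K w)) \<partial>hmeas) < \<infinity>"
    using int unfolding set_integrable_def K_def integrable_iff_bounded by simp
  then have fin: "(\<integral>\<^sup>+w. ennreal (norm (K w)) \<partial>hmeas) < \<infinity>" using nn_integral_cong_AE[OF AE1] by simp
  have [measurable]: "hcut f \<in> borel_measurable borel" by (rule hcut_measurable[OF fh])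
  have cut: "f (hpt s t) = hcut f (hpt s t)" for s t using Im_hpt by (simp add: hcut_def)
  have pt: "ennreal (norm (f (hpt s t)) * exp s * exp (- c * t\<^sup>2)) \<le> ennreal (1 / b) * ennreal (norm (K (hpt s t)))" for s t
  proof -
    have "exp s \<le> norm (hpt s t)" using abs_Im_le_cmod[of "hpt s t"] by (simp add: hpt_def)
    then have "norm (f (hpt s t)) * exp s * exp (- c * t\<^sup>2) \<le> norm (f (hpt s t)) * norm (hpt s t) * exp (- c * t\<^sup>2)"
      by (intro mult_right_mono mult_left_mono) auto
    also have "\<dots> = 1 / b * norm (K (hpt s t))"
    proof -
      have "norm (K (hpt s t)) = b * exp (- c * t\<^sup>2) * (norm (f (hpt s t)) * norm (hpt s t))"
        unfolding K_def kern_dX norm_mult f_def[symmetric] c_def[symmetric] norm_of_real using b by (simp add: b_def)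
      then show ?thesis using b by simp
    qed
    finally show ?thesis using b by (simp add: ennreal_mult[symmetric] del: times_divide_eq_left) 
  qed
  have "(\<integral>\<^sup>+t. \<integral>\<^sup>+s. ennreal (norm (f (hpt s t)) * exp s * exp (- c * t\<^sup>2)) \<partial>lborel \<partial>lborel) \<le>
     (\<integral>\<^sup>+t. \<integral>\<^sup>+s. ennreal (1 / b) * ennreal (norm (K (hpt s t))) \<partial>lborel \<partial>lborel)"
    by (intro nn_integral_mono pt)
  also have "\<dots> = (\<integral>\<^sup>+w. ennreal (1 / b) * ennreal (norm (K w)) \<partial>hmeas)"
    by (rule nn_integral_hmeas_swap[symmetric]) measurable
  also have "\<dots> = ennreal (1 / b) * (\<integral>\<^sup>+w. ennreal (norm (K w)) \<partial>hmeas)"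
    by (rule nn_integral_cmult) measurable
  also have "\<dots> < \<infinity>" using fin by (simp add: ennreal_mult_less_top)
  finally show ?thesis unfolding R using ray_integral_const[OF fh c] by (simp add: f_def set_lebesgue_integral_def)
qed

lemma geo_integral:
  assumes N: "N > 0" and \<kappa>: "\<kappa> > 0" and \<sigma>: "\<sigma> > 0" and G: "G \<in> cusp_forms (2 * k + 2) N" and g: "g \<in> SL2"
    and int: "set_integrable hmeas (geo_domain N g) (kern N k \<kappa> (slash (2 * k + 2) G g) (dX \<sigma>))"
  shows "(LINT w:geo_domain N g|hmeas. kern N k \<kappa> (slash (2 * k + 2) G g) (dX \<sigma>) w) =
     - of_real (sqrt (real N * pi / \<kappa>)) * (LINT s:geo_range N g|lborel. geo_form N k \<sigma> G g (hpt s 0) * hpt s 0)"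
proof -
  define K where "K = kern N k \<kappa> (slash (2 * k + 2) G g) (dX \<sigma>)"
  have Km [measurable]: "K \<in> borel_measurable borel" unfolding K_def by (rule kern_measurable[OF slash_holo[OF g cusp_form_holo[OF G]]])
  define u where "u w = indicator (geo_domain N g) w *\<^sub>R K w" for w
  note geo_domain_borel [measurable]
  have um: "u \<in> borel_measurable borel" unfolding u_def by measurable
  have ui: "integrable hmeas u" using int unfolding set_integrable_def u_def K_def .
  define c where "c = 4 * \<kappa> * real N * \<sigma>\<^sup>2"
  have c: "c > 0" using \<kappa> N \<sigma> by (simp add: c_def)
  define J where "J t = (LINT s:geo_range N g|lborel. geo_form N k \<sigma> G g (hpt s t) * hpt s t)" for t
  define b where "b = - 2 * real N * \<sigma>"
  have inner: "(LINT s|lborel. u (hpt s t)) = of_real b * of_real (exp (- c * t\<^sup>2)) * J t" for t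
  proof -
    have eq: "u (hpt s t) = (of_real b * of_real (exp (- c * t\<^sup>2))) * (indicator (geo_range N g) s *\<^sub>R (geo_form N k \<sigma> G g (hpt s t) * hpt s t))" for s
      unfolding u_def K_def kern_dX c_def[symmetric] b_def[symmetric] by (simp add: indicator_def hpt_geo_domain)
    show ?thesis unfolding eq J_def set_lebesgue_integral_def by (rule integral_mult_right_zero)
  qed
  have um2: "(\<lambda>t. LINT s|lborel. u (hpt s t)) \<in> borel_measurable lborel"
    using um by measurable
  have "(LINT w|hmeas. u w) = (LINT t|lborel. LINT s|lborel. u (hpt s t))" by (rule hmeas_integral(2)[OF ui um])
  also have "\<dots> = (LINT t|lborel. of_real (exp (- c * t\<^sup>2)) * (of_real b * J 0))"
  proof (rule integral_cong_AE[OF um2])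
    show "AE t in lborel. (LINT s|lborel. u (hpt s t)) = of_real (exp (- c * t\<^sup>2)) * (of_real b * J 0)"
      using geo_ray_const[OF N \<kappa> \<sigma> G g int] by eventually_elim (simp add: inner J_def)
  qed measurable
  also have "\<dots> = of_real (LINT t|lborel. exp (- c * t\<^sup>2)) * (of_real b * J 0)"
    by (simp only: integral_mult_left_zero integral_complex_of_real)
  also have "\<dots> = of_real (sqrt (pi / c) * b) * J 0" unfolding gaussian_integral(2)[OF c] by simp
  also have "sqrt (pi / c) * b = - sqrt (real N * pi / \<kappa>)"
  proof -
    have "sqrt (real N * pi / \<kappa>) = sqrt (pi / c * (2 * real N * \<sigma>)\<^sup>2)"
      using N \<kappa> \<sigma> by (intro arg_cong[of _ _ sqrt]) (simp add: c_def power2_eq_square field_simps)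
    also have "\<dots> = sqrt (pi / c) * (2 * real N * \<sigma>)" using \<sigma> by (subst real_sqrt_mult) simp
    finally show ?thesis by (simp add: b_def)
  qed
  finally show ?thesis by (simp add: u_def K_def J_def set_lebesgue_integral_def)
qed

lemma moebius_DERIV:
  assumes g: "g \<in> SL2" and z: "Im z > 0"
  shows "(moebius g has_field_derivative 1 / jac g z ^ 2) (at z)"
proof -
  define a b c d where "a = complex_of_real (g$1$1)" and "b = complex_of_real (g$1$2)"
    and "c = complex_of_real (g$2$1)" and "d = complex_of_real (g$2$2)"
  have nz: "c * z + d \<noteq> 0" using jac_nz[OF g, of z] z by (simp add: jac_def c_def d_def)
  have "a * d - b * c = of_real (g$1$1 * g$2$2 - g$1$2 * g$2$1)" by (simp add: a_def b_def c_def d_def)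
  then have det: "a * d - b * c = 1" unfolding SL2_det[OF g] by simp
  have D: "((\<lambda>z. (a * z + b) / (c * z + d)) has_field_derivative (a * (c * z + d) - (a * z + b) * c) / ((c * z + d) * (c * z + d))) (at z)"
    by (rule DERIV_divide) (use nz in \<open>auto intro!: derivative_eq_intros\<close>)
  have eq: "a * (c * z + d) - (a * z + b) * c = 1" unfolding det[symmetric] by (simp add: algebra_simps)
  show ?thesis using D unfolding eq unfolding moebius_def[abs_def] jac_def a_def b_def c_def d_def power2_eq_square .
qed

lemma cycle_integrand:
  assumes g: "g \<in> SL2" and y: "y > 0"
  defines "c \<equiv> (\<lambda>y. moebius g (\<i> * of_real y))"
  shows "G (c y) * Qpoly N (conj_act g (dX \<sigma>)) (c y) ^ k * vector_derivative c (at y) = geo_form N k \<sigma> G g (\<i> * of_real y) * \<i>"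
proof -
  define w where "w = \<i> * complex_of_real y"
  have w: "Im w > 0" using y by (simp add: w_def)
  have nz: "jac g w \<noteq> 0" using jac_nz[OF g, of w] w by simp
  have "((\<lambda>y. \<i> * complex_of_real y) has_vector_derivative (\<i> * of_real 1)) (at y)"
    by (intro has_vector_derivative_mult_right has_vector_derivative_of_real) (auto intro!: derivative_eq_intros)
  moreover have "(moebius g has_field_derivative 1 / jac g w ^ 2) (at (\<i> * complex_of_real y))"
    using moebius_DERIV[OF g w] by (simp add: w_def)
  ultimately have "((moebius g \<circ> (\<lambda>y. \<i> * complex_of_real y)) has_vector_derivative (\<i> * of_real 1 * (1 / jac g w ^ 2))) (at y)"
    by (rule field_vector_diff_chain_at)
  then have "(c has_vector_derivative (\<i> / jac g w ^ 2)) (at y)" by (simp add: o_def c_def)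
  then have vd: "vector_derivative c (at y) = \<i> / jac g w ^ 2" by (rule vector_derivative_at)
  have cy: "c y = moebius g w" by (simp add: c_def w_def)
  have Q: "Qpoly N (dX \<sigma>) w = of_real (- 2 * real N * \<sigma>) * w" by (simp add: Qpoly_def dX_def)
  have "geo_form N k \<sigma> G g w * \<i> = G (moebius g w) / jac g w ^ (2 * k + 2) * (Qpoly N (conj_act g (dX \<sigma>)) (moebius g w) * jac g w ^ 2) ^ k * \<i>"
    unfolding geo_form_def Qpoly_conj[OF g dX_traceless w] Q slash_jac ..
  also have "\<dots> = G (moebius g w) * Qpoly N (conj_act g (dX \<sigma>)) (moebius g w) ^ k * (\<i> / jac g w ^ 2)"
    unfolding power_mult_distrib power_add power_mult[symmetric] using nz by (simp add: mult_ac)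
  finally show ?thesis unfolding vd cy by (simp add: w_def)
qed

lemma cycle_range_exp:
  assumes g: "g \<in> SL2"
  shows "AE y in lborel. (y \<in> cycle_range N g \<longleftrightarrow> y > 0 \<and> ln y \<in> geo_range N g)"
proof (cases "{t. t > 1 \<and> geo_stab N g t} = {}")
  case E: True
  have eq: "{t. t > 1 \<and> g ** mat2 t 0 0 (1 / t) ** matrix_inv g \<in> Gamma0 N} = {t. t > 1 \<and> geo_stab N g t}"
    by (auto simp: geo_stab_def dg_def)
  have "cycle_range N g = {0<..}" unfolding cycle_range_def Let_def eq by (rule if_P[OF E])
  moreover have "geo_range N g = UNIV" unfolding geo_range_def Let_def by (rule if_P[OF E])
  ultimately show ?thesis by simp
next
  case E: False
  have eq: "{t. t > 1 \<and> g ** mat2 t 0 0 (1 / t) ** matrix_inv g \<in> Gamma0 N} = {t. t > 1 \<and> geo_stab N g t}"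
    by (auto simp: geo_stab_def dg_def)
  define e where "e = Inf {t. t > 1 \<and> geo_stab N g t}"
  have e: "e > 1" using geo_stab_least(1)[OF g E] by (simp add: e_def)
  have C: "cycle_range N g = {1<..<e\<^sup>2}" unfolding cycle_range_def Let_def eq e_def by (rule if_not_P[OF E])
  have R: "geo_range N g = {0..<2 * ln e}" unfolding geo_range_def Let_def e_def by (rule if_not_P[OF E])
  have l2: "2 * ln e = ln (e\<^sup>2)" using e by (simp add: ln_realpow)
  show ?thesis
    using AE_lborel_singleton[of 1]
  proof eventually_elim
    case (elim y)
    have e2: "e\<^sup>2 > 0" using e by simp
    have "ln y < ln (e\<^sup>2) \<longleftrightarrow> y < e\<^sup>2" if "y > 0" using that e2 by (rule ln_less_cancel_iff)
    moreover have "0 \<le> ln y \<longleftrightarrow> 1 \<le> y" if "y > 0" using that by (rule ln_ge_zero_iff)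
    ultimately show ?case unfolding C R l2 greaterThanLessThan_iff atLeastLessThan_iff using elim
      by (cases "y > 0") auto
  qed
qed

lemma cycle_integral_geo:
  assumes X: "X \<in> traceless" and N: "N > 0" and q: "qform N X < 0" and G: "G \<in> cusp_forms (2 * k + 2) N"
  obtains g where "g \<in> SL2" "conj_act g (dX (sqrt (\<bar>qform N X\<bar> / real N))) = X"
    "cycle_integral N k G X =
       (LINT s:geo_range N g|lborel. geo_form N k (sqrt (\<bar>qform N X\<bar> / real N)) G g (hpt s 0) * hpt s 0)"
proof -
  define g where "g = (SOME g. diagonalizes N X g)"
  define \<sigma> where "\<sigma> = sqrt (\<bar>qform N X\<bar> / real N)"
  have dg: "diagonalizes N X g" unfolding g_def using diagonalizes_exists[OF X N q] by (rule someI_ex)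
  note g = diagonalizesD(1)[OF dg] and XX = diagonalizesD(2)[OF dg, folded \<sigma>_def]
  define f where "f = geo_form N k \<sigma> G g"
  have fh: "f holomorphic_on upper_half_plane" unfolding f_def by (rule geo_form_holo[OF G g])
  have [measurable]: "hcut f \<in> borel_measurable borel" by (rule hcut_measurable[OF fh])
  define \<phi> where "\<phi> y = indicator (geo_range N g) (ln y) *\<^sub>R (hcut f (\<i> * of_real y) * \<i>)" for y
  have \<phi>m [measurable]: "\<phi> \<in> borel_measurable borel" unfolding \<phi>_def by measurable
  have cm: "cycle_range N g \<in> sets borel" by (simp add: cycle_range_def Let_def)
  define c where "c = (\<lambda>y. moebius g (\<i> * of_real y))"
  define I where "I y = G (c y) * Qpoly N X (c y) ^ k * vector_derivative c (at y)" for y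
  have I: "I y = hcut f (\<i> * of_real y) * \<i>" if "y > 0" for y
    using cycle_integrand[OF g that, where N=N and \<sigma>=\<sigma> and k=k and G=G] that unfolding XX I_def c_def f_def by (simp add: hcut_def)
  have cpos: "cycle_range N g \<subseteq> {0<..}" by (auto simp: cycle_range_def Let_def)
  have "cycle_integral N k G X = (LINT y:cycle_range N g|lborel. I y)"
    unfolding cycle_integral_def Let_def g_def[symmetric] I_def c_def ..
  also have "\<dots> = (LINT y:cycle_range N g|lborel. hcut f (\<i> * of_real y) * \<i>)"
    unfolding set_lebesgue_integral_def using I cpos by (intro Bochner_Integration.integral_cong) (auto simp: indicator_def)
  also have "\<dots> = (LINT y:{0<..}|lborel. \<phi> y)"
    unfolding set_lebesgue_integral_def
  proof (rule integral_cong_AE)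
    show "AE y in lborel. indicator (cycle_range N g) y *\<^sub>R (hcut f (\<i> * of_real y) * \<i>) = indicator {0<..} y *\<^sub>R \<phi> y"
      using cycle_range_exp[OF g, of N] by eventually_elim (auto simp: \<phi>_def indicator_def)
  qed (use cm in measurable)
  also have "\<dots> = (LINT s|lborel. exp s *\<^sub>R \<phi> (exp s))" by (rule integral_exp_subst[OF \<phi>m])
  also have "\<dots> = (LINT s:geo_range N g|lborel. f (hpt s 0) * hpt s 0)"
    unfolding set_lebesgue_integral_def
  proof (rule Bochner_Integration.integral_cong)
    fix s
    have "hpt s 0 = \<i> * of_real (exp s)" by (simp add: hpt_def complex_eq_iff)
    then show "exp s *\<^sub>R \<phi> (exp s) = indicator (geo_range N g) s *\<^sub>R (f (hpt s 0) * hpt s 0)"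
      by (simp add: \<phi>_def hcut_def scaleR_conv_of_real mult_ac)
  qed simp
  finally show ?thesis using that[OF g] XX by (simp add: f_def \<sigma>_def)
qed

lemma kern_hyperbolic:
  assumes N: "N > 0" and \<kappa>: "\<kappa> > 0" and G: "G \<in> cusp_forms (2 * k + 2) N" and fd: "fundamental_domain N F"
    and X: "X \<in> dual_lattice N" and q: "qform N X < 0"
  shows "((\<lambda>Y. LINT z:F|hmeas. kern N k \<kappa> G Y z) has_sum
     (- of_real (sqrt (real N * pi / \<kappa>)) * cycle_integral N k G X)) (orbit0 N X)"
proof -
  define \<sigma> where "\<sigma> = sqrt (\<bar>qform N X\<bar> / real N)"
  have "\<bar>qform N X\<bar> / real N > 0" using q N by (intro divide_pos_pos) simp_all
  then have \<sigma>: "\<sigma> > 0" by (simp add: \<sigma>_def)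
  obtain g where g: "g \<in> SL2" "conj_act g (dX \<sigma>) = X"
    and c: "cycle_integral N k G X = (LINT s:geo_range N g|lborel. geo_form N k \<sigma> G g (hpt s 0) * hpt s 0)"
    using cycle_integral_geo[OF dual_lattice_traceless[OF X] N q G] unfolding \<sigma>_def by metis
  have \<sigma>0: "\<sigma> \<noteq> 0" using \<sigma> by simp
  have card: "card {h. g ** h ** matrix_inv g \<in> Gamma0 N \<and> conj_act h (dX \<sigma>) = dX \<sigma> \<and> moebius h w \<in> geo_domain N g} = 2"
    if w: "Im w > 0" for w by (rule geo_domain_card[OF g(1) \<sigma>0 w])
  have int: "set_integrable hmeas (geo_domain N g) (kern N k \<kappa> (slash (2 * k + 2) G g) (dX \<sigma>))"
    by (rule kern_frame_integrable[OF N \<kappa> G fd X g(1) dX_traceless g(2) geo_domain_borel]) (rule card)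
  have "((\<lambda>Y. LINT z:F|hmeas. kern N k \<kappa> G Y z) has_sum
     (LINT w:geo_domain N g|hmeas. kern N k \<kappa> (slash (2 * k + 2) G g) (dX \<sigma>) w)) (orbit0 N X)"
    by (rule kern_frame_has_sum[OF N \<kappa> G fd X g(1) dX_traceless g(2) geo_domain_borel]) (rule card)
  then show ?thesis unfolding geo_integral[OF N \<kappa> \<sigma> G g(1) int] c .
qed

subsection \<open>The theta function as a sum over the dual lattice\<close>

lemma borel_measurable_infsum:
  fixes f :: "'i \<Rightarrow> 'a \<Rightarrow> complex"
  assumes A: "countable A" and [measurable]: "\<And>i. i \<in> A \<Longrightarrow> f i \<in> borel_measurable M"
  shows "(\<lambda>x. \<Sum>\<^sub>\<infinity>i\<in>A. f i x) \<in> borel_measurable M"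
proof -
  interpret C: sigma_finite_measure "count_space A" by (rule sigma_finite_measure_count_space_countable[OF A])
  have cs: "integrable (count_space A) g \<longleftrightarrow> g summable_on A" for g :: "'i \<Rightarrow> complex"
    using abs_summable_equivalent[of g A] by (simp add: abs_summable_on_def summable_on_iff_abs_summable_on_complex)
  have ci: "(\<Sum>\<^sub>\<infinity>i\<in>A. g i) = (LINT i|count_space A. g i)" for g :: "'i \<Rightarrow> complex"
    using infsetsum_infsum[of g A] cs[of g] not_integrable_integral_eq[of "count_space A" g] infsum_not_exists[of g A]
    by (cases "g summable_on A") (simp_all add: abs_summable_on_def infsetsum_def)
  have "(\<lambda>(i, x). f i x) \<in> borel_measurable (count_space A \<Otimes>\<^sub>M M)"
    by (rule measurable_pair_measure_countable1[OF A]) auto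
  then have "(\<lambda>(x, i). f i x) \<in> borel_measurable (M \<Otimes>\<^sub>M count_space A)"
    by (subst measurable_pair_swap_iff) simp
  then show ?thesis unfolding ci by (rule C.borel_measurable_lebesgue_integral)
qed

lemma kronecker_bound: "\<bar>kronecker a n\<bar> \<le> 1"
proof -
  have p: "\<bar>kronecker_prime a p\<bar> \<le> 1" for p
    by (auto simp: kronecker_prime_def Legendre_def)
  have "\<bar>\<Prod>p\<in>prime_factors n. kronecker_prime a p ^ multiplicity p n\<bar> \<le> 1"
    unfolding abs_prod by (rule prod_le_1) (simp add: power_abs power_le_one p)
  then show ?thesis by (simp add: kronecker_def abs_mult)
qed

lemma genus_character_bound: "\<bar>genus_character N \<Delta> X\<bar> \<le> 1"
  by (simp add: genus_character_def Let_def kronecker_bound)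

lemma lattice_add:
  assumes "X \<in> lattice N" "Y \<in> lattice N"
  shows "X + Y \<in> lattice N"
proof -
  obtain a b c :: int where X: "X = mat2 (of_int b) (- of_int a / of_nat N) (of_int c) (- of_int b)" using assms(1) by (auto simp: lattice_def)
  obtain a' b' c' :: int where Y: "Y = mat2 (of_int b') (- of_int a' / of_nat N) (of_int c') (- of_int b')" using assms(2) by (auto simp: lattice_def)
  have "X + Y = mat2 (of_int (b + b')) (- of_int (a + a') / of_nat N) (of_int (c + c')) (- of_int (b + b'))"
    unfolding X Y by (simp add: mat2_eq_iff add_divide_distrib diff_divide_distrib)
  then show ?thesis unfolding lattice_def by blast
qed

lemma lattice_scale:
  assumes "X \<in> lattice N"
  shows "real_of_int n *\<^sub>R X \<in> lattice N"
proof -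
  obtain a b c :: int where X: "X = mat2 (of_int b) (- of_int a / of_nat N) (of_int c) (- of_int b)" using assms by (auto simp: lattice_def)
  have "real_of_int n *\<^sub>R X = mat2 (of_int (n * b)) (- of_int (n * a) / of_nat N) (of_int (n * c)) (- of_int (n * b))"
    unfolding X by (simp add: mat2_eq_iff)
  then show ?thesis unfolding lattice_def by blast
qed

lemma lattice_diff: "X \<in> lattice N \<Longrightarrow> Y \<in> lattice N \<Longrightarrow> X - Y \<in> lattice N"
  using lattice_add[of X N "real_of_int (- 1) *\<^sub>R Y"] lattice_scale[of Y N "- 1"] by simp

lemma lattice_zero: "0 \<in> lattice N"
  unfolding lattice_def by (intro CollectI exI[of _ 0]) (simp add: mat2_eq_iff)

definition twist_coeff :: "nat \<Rightarrow> int \<Rightarrow> int \<Rightarrow> real^2^2 \<Rightarrow> real^2^2 \<Rightarrow> int" where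
  "twist_coeff N \<Delta> r h X =
     (if X - real_of_int r *\<^sub>R h \<in> lattice N \<and>
         qform N X / real_of_int \<bar>\<Delta>\<bar> - real_of_int (sgn \<Delta>) * qform N h \<in> \<int>
      then genus_character N \<Delta> X else 0)"

lemma dvec_shift: "N > 0 \<Longrightarrow> dvec N a b c + real_of_int \<Delta> *\<^sub>R dvec N u (2 * int N * v) w =
    dvec N (a + \<Delta> * u) (b + \<Delta> * (2 * int N * v)) (c + \<Delta> * w)"
  by (simp add: dvec_def mat2_eq_iff field_simps)

lemma twist_coeff_shift:
  assumes N: "N > 0" and D: "fundamental_discriminant \<Delta>" and r: "[\<Delta> = r\<^sup>2] (mod (4 * int N))"
    and X: "X \<in> dual_lattice N" and Z: "Z \<in> lattice N"
  shows "twist_coeff N \<Delta> r h (X + real_of_int \<Delta> *\<^sub>R Z) = twist_coeff N \<Delta> r h X"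
proof -
  obtain a b c where Xd: "X = dvec N a b c" using X unfolding dual_lattice_dvec[OF N] by blast
  obtain u v w where Zd: "Z = dvec N u (2 * int N * v) w" using Z unfolding lattice_dvec[OF N] by blast
  define Y where "Y = X + real_of_int \<Delta> *\<^sub>R Z"
  have Yd: "Y = dvec N (a + \<Delta> * u) (b + \<Delta> * (2 * int N * v)) (c + \<Delta> * w)"
    unfolding Y_def Xd Zd by (rule dvec_shift[OF N])
  have \<chi>: "genus_character N \<Delta> Y = genus_character N \<Delta> X"
    unfolding Yd Xd genus_character_dvec[OF N] by (rule gchar_shift[OF D r N])
  have L: "Y - real_of_int r *\<^sub>R h \<in> lattice N \<longleftrightarrow> X - real_of_int r *\<^sub>R h \<in> lattice N"
  proof
    assume "Y - real_of_int r *\<^sub>R h \<in> lattice N"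
    from lattice_diff[OF this lattice_scale[OF Z, of \<Delta>]] show "X - real_of_int r *\<^sub>R h \<in> lattice N" by (simp add: Y_def algebra_simps)
  next
    assume "X - real_of_int r *\<^sub>R h \<in> lattice N"
    from lattice_add[OF this lattice_scale[OF Z, of \<Delta>]] show "Y - real_of_int r *\<^sub>R h \<in> lattice N" by (simp add: Y_def algebra_simps)
  qed
  define m where "m = a * w + u * c + \<Delta> * u * w - v * b - int N * \<Delta> * v\<^sup>2"
  have "(b + \<Delta> * (2 * int N * v))\<^sup>2 - 4 * int N * (a + \<Delta> * u) * (c + \<Delta> * w) = (b\<^sup>2 - 4 * int N * a * c) - 4 * int N * (\<Delta> * m)"
    by (simp add: m_def power2_eq_square algebra_simps)
  then have "qform N Y = - of_int ((b\<^sup>2 - 4 * int N * a * c) - 4 * int N * (\<Delta> * m)) / (4 * real N)"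
    unfolding Yd qform_dvec[OF N] by simp
  also have "\<dots> = - of_int (b\<^sup>2 - 4 * int N * a * c) / (4 * real N) + of_int \<Delta> * of_int m"
    using N by (simp add: field_simps)
  finally have q: "qform N Y = qform N X + of_int \<Delta> * of_int m" unfolding Xd qform_dvec[OF N] .
  have "real_of_int \<Delta> / real_of_int \<bar>\<Delta>\<bar> = of_int (sgn \<Delta>)"
    using fundamental_discriminant_nz[OF D] by (cases "\<Delta> > 0") (simp_all add: sgn_if)
  then have "qform N Y / real_of_int \<bar>\<Delta>\<bar> = qform N X / real_of_int \<bar>\<Delta>\<bar> + of_int (sgn \<Delta> * m)"
    unfolding q add_divide_distrib times_divide_eq_left[symmetric] by simp
  then have e: "qform N Y / real_of_int \<bar>\<Delta>\<bar> - real_of_int (sgn \<Delta>) * qform N h =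
     (qform N X / real_of_int \<bar>\<Delta>\<bar> - real_of_int (sgn \<Delta>) * qform N h) + of_int (sgn \<Delta> * m)" by linarith
  have I: "x + of_int n \<in> \<int> \<longleftrightarrow> x \<in> \<int>" for x :: real and n
    using Ints_diff[of "x + of_int n" "of_int n"] by auto
  show ?thesis unfolding Y_def[symmetric] twist_coeff_def \<chi> L e I ..
qed

definition delta_coset :: "nat \<Rightarrow> int \<Rightarrow> real^2^2 \<Rightarrow> (real^2^2) set" where
  "delta_coset N \<Delta> X = (+) X ` scaled_lattice N \<Delta>"

lemma delta_coset_iff: "Y \<in> delta_coset N \<Delta> X \<longleftrightarrow> (\<exists>Z\<in>lattice N. Y = X + real_of_int \<Delta> *\<^sub>R Z)"
  by (auto simp: delta_coset_def scaled_lattice_def)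

lemma delta_coset_eq:
  assumes "Y \<in> delta_coset N \<Delta> X"
  shows "delta_coset N \<Delta> Y = delta_coset N \<Delta> X"
proof -
  obtain Z where Z: "Z \<in> lattice N" "Y = X + real_of_int \<Delta> *\<^sub>R Z" using assms unfolding delta_coset_iff by blast
  show ?thesis
  proof (intro equalityI subsetI)
    fix W assume "W \<in> delta_coset N \<Delta> Y"
    then obtain Z' where Z': "Z' \<in> lattice N" "W = Y + real_of_int \<Delta> *\<^sub>R Z'" unfolding delta_coset_iff by blast
    have "W = X + real_of_int \<Delta> *\<^sub>R (Z + Z')" unfolding Z' Z by (simp add: algebra_simps)
    then show "W \<in> delta_coset N \<Delta> X" unfolding delta_coset_iff using lattice_add[OF Z(1) Z'(1)] by blast
  next
    fix W assume "W \<in> delta_coset N \<Delta> X"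
    then obtain Z' where Z': "Z' \<in> lattice N" "W = X + real_of_int \<Delta> *\<^sub>R Z'" unfolding delta_coset_iff by blast
    have "W = Y + real_of_int \<Delta> *\<^sub>R (Z' - Z)" unfolding Z' Z by (simp add: algebra_simps)
    then show "W \<in> delta_coset N \<Delta> Y" unfolding delta_coset_iff using lattice_diff[OF Z'(1) Z(1)] by blast
  qed
qed

lemma delta_coset_self: "X \<in> delta_coset N \<Delta> X"
  unfolding delta_coset_iff using lattice_zero[of N] by (intro bexI[of _ 0]) auto

lemma delta_coset_dual:
  assumes N: "N > 0" and X: "X \<in> dual_lattice N"
  shows "delta_coset N \<Delta> X \<subseteq> dual_lattice N"
proof
  fix Y assume "Y \<in> delta_coset N \<Delta> X"
  then obtain Z where Z: "Z \<in> lattice N" "Y = X + real_of_int \<Delta> *\<^sub>R Z" unfolding delta_coset_iff by blast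
  obtain a b c where Xd: "X = dvec N a b c" using X unfolding dual_lattice_dvec[OF N] by blast
  obtain u v w where Zd: "Z = dvec N u (2 * int N * v) w" using Z(1) unfolding lattice_dvec[OF N] by blast
  show "Y \<in> dual_lattice N" unfolding Z(2) Xd Zd dvec_shift[OF N] unfolding dual_lattice_dvec[OF N] by blast
qed

lemma delta_coset_fibre:
  assumes N: "N > 0" and X: "X \<in> dual_lattice N"
  shows "{Y \<in> dual_lattice N. delta_coset N \<Delta> Y = delta_coset N \<Delta> X} = delta_coset N \<Delta> X"
  using delta_coset_eq[of _ N \<Delta> X] delta_coset_self[of _ N \<Delta>] delta_coset_dual[OF N X, of \<Delta>] by blast

lemma discriminant_group_coset: "discriminant_group N \<Delta> = delta_coset N \<Delta> ` dual_lattice N"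
  by (simp add: discriminant_group_def delta_coset_def)

lemma finite_discriminant_group:
  assumes N: "N > 0" and D: "\<Delta> \<noteq> 0"
  shows "finite (discriminant_group N \<Delta>)"
proof -
  define M where "M = 2 * int N * \<bar>\<Delta>\<bar>"
  have "discriminant_group N \<Delta> \<subseteq> (\<lambda>(a, b, c). delta_coset N \<Delta> (dvec N a b c)) ` ({- M..M} \<times> {- M..M} \<times> {- M..M})"
  proof
    fix \<delta> assume "\<delta> \<in> discriminant_group N \<Delta>"
    then obtain a b c where \<delta>: "\<delta> = delta_coset N \<Delta> (dvec N a b c)"
      unfolding discriminant_group_coset dual_lattice_dvec[OF N] by blast
    define d where "d = 2 * int N * \<Delta>"
    have "dvec N a b c = dvec N (a mod \<Delta>) (b mod d) (c mod \<Delta>) + real_of_int \<Delta> *\<^sub>R dvec N (a div \<Delta>) (2 * int N * (b div d)) (c div \<Delta>)"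
    proof -
      have eq: "\<Delta> * (2 * int N * (b div d)) = d * (b div d)" unfolding d_def by (simp only: mult_ac)
      show ?thesis unfolding dvec_shift[OF N] eq by simp
    qed
    moreover have "dvec N (a div \<Delta>) (2 * int N * (b div d)) (c div \<Delta>) \<in> lattice N" unfolding lattice_dvec[OF N] by blast
    ultimately have "dvec N a b c \<in> delta_coset N \<Delta> (dvec N (a mod \<Delta>) (b mod d) (c mod \<Delta>))" unfolding delta_coset_iff by blast
    then have e: "\<delta> = delta_coset N \<Delta> (dvec N (a mod \<Delta>) (b mod d) (c mod \<Delta>))" unfolding \<delta> by (rule delta_coset_eq)
    have mod: "\<bar>x mod y\<bar> \<le> \<bar>y\<bar>" if "y \<noteq> 0" for x y :: int
      using abs_mod_less[OF that, of x] by simp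
    have "\<bar>\<Delta>\<bar> * 1 \<le> \<bar>\<Delta>\<bar> * (2 * int N)" using N by (intro mult_left_mono) auto
    then have "\<bar>\<Delta>\<bar> \<le> M" by (simp add: M_def mult_ac)
    moreover have "\<bar>d\<bar> = M" by (simp add: d_def M_def abs_mult)
    moreover have "d \<noteq> 0" using N D by (simp add: d_def)
    ultimately have "\<bar>a mod \<Delta>\<bar> \<le> M" "\<bar>b mod d\<bar> \<le> M" "\<bar>c mod \<Delta>\<bar> \<le> M"
      using mod[OF D, of a] mod[OF D, of c] mod[of d b] by linarith+
    then have "(a mod \<Delta>, b mod d, c mod \<Delta>) \<in> {- M..M} \<times> {- M..M} \<times> {- M..M}" by (auto simp: abs_le_iff)
    then show "\<delta> \<in> (\<lambda>(a, b, c). delta_coset N \<Delta> (dvec N a b c)) ` ({- M..M} \<times> {- M..M} \<times> {- M..M})"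
      unfolding e by (rule rev_image_eqI) simp
  qed
  then show ?thesis by (rule finite_subset) simp
qed

lemma intertwiner_coset:
  assumes N: "N > 0" and D: "fundamental_discriminant \<Delta>" and r: "[\<Delta> = r\<^sup>2] (mod (4 * int N))"
    and \<delta>: "\<delta> \<in> discriminant_group N \<Delta>" and Y: "Y \<in> \<delta>"
  shows "intertwiner N \<Delta> r h \<delta> = of_int (twist_coeff N \<Delta> r h Y)"
proof -
  obtain X where X: "X \<in> dual_lattice N" "\<delta> = delta_coset N \<Delta> X" using \<delta> unfolding discriminant_group_coset by blast
  have c: "twist_coeff N \<Delta> r h W = twist_coeff N \<Delta> r h X" if W: "W \<in> \<delta>" for W
  proof -
    obtain Z where Z: "Z \<in> lattice N" "W = X + real_of_int \<Delta> *\<^sub>R Z" using W unfolding X(2) delta_coset_iff by blast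
    show ?thesis unfolding Z(2) by (rule twist_coeff_shift[OF N D r X(1) Z(1)])
  qed
  define W where "W = (SOME X. X \<in> \<delta>)"
  have W: "W \<in> \<delta>" unfolding W_def using Y by (rule someI)
  have "intertwiner N \<Delta> r h \<delta> = of_int (twist_coeff N \<Delta> r h W)"
    unfolding intertwiner_def twist_coeff_def Let_def W_def[symmetric] by simp
  then show ?thesis using c[OF W] c[OF Y] by simp
qed

lemma theta_twisted_sum:
  assumes N: "N > 0" and D: "fundamental_discriminant \<Delta>" and r: "[\<Delta> = r\<^sup>2] (mod (4 * int N))"
    and s: "(\<lambda>X. c * (of_int (twist_coeff N \<Delta> r h X) * cnj (phi_Sh_twisted N \<Delta> k X \<tau> z))) summable_on dual_lattice N"
  shows "c * cnj (theta_twisted N \<Delta> r k \<tau> z h) =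
     (\<Sum>\<^sub>\<infinity>X\<in>dual_lattice N. c * (of_int (twist_coeff N \<Delta> r h X) * cnj (phi_Sh_twisted N \<Delta> k X \<tau> z)))"
proof -
  define g where "g X = c * (of_int (twist_coeff N \<Delta> r h X) * cnj (phi_Sh_twisted N \<Delta> k X \<tau> z))" for X
  have s': "g summable_on dual_lattice N" using s unfolding g_def .
  have fin: "finite (discriminant_group N \<Delta>)" by (rule finite_discriminant_group[OF N fundamental_discriminant_nz[OF D]])
  have "((\<lambda>\<delta>. infsum g \<delta>) has_sum infsum g (dual_lattice N)) (discriminant_group N \<Delta>)"
  proof (rule has_sum_fibres[OF has_sum_infsum[OF s'] discriminant_group_coset])
    fix \<delta> assume "\<delta> \<in> discriminant_group N \<Delta>"
    then obtain X where X: "X \<in> dual_lattice N" "\<delta> = delta_coset N \<Delta> X" unfolding discriminant_group_coset by blast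
    have "g summable_on \<delta>" using summable_on_subset_banach[OF s' delta_coset_dual[OF N X(1)]] unfolding X(2) .
    then show "(g has_sum infsum g \<delta>) {a \<in> dual_lattice N. delta_coset N \<Delta> a = \<delta>}"
      unfolding X(2) delta_coset_fibre[OF N X(1)] by (rule has_sum_infsum)
  qed
  from has_sum_unique[OF this has_sum_finite[OF fin]]
  have "infsum g (dual_lattice N) = (\<Sum>\<delta>\<in>discriminant_group N \<Delta>. infsum g \<delta>)" .
  also have "\<dots> = (\<Sum>\<delta>\<in>discriminant_group N \<Delta>. c * (intertwiner N \<Delta> r h \<delta> * cnj (theta_lattice N \<Delta> k \<tau> z \<delta>)))"
  proof (rule sum.cong[OF refl])
    fix \<delta> assume \<delta>: "\<delta> \<in> discriminant_group N \<Delta>"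
    have "infsum g \<delta> = (\<Sum>\<^sub>\<infinity>X\<in>\<delta>. (c * intertwiner N \<Delta> r h \<delta>) * cnj (phi_Sh_twisted N \<Delta> k X \<tau> z))"
      by (rule infsum_cong) (simp add: g_def intertwiner_coset[OF N D r \<delta>])
    also have "\<dots> = (c * intertwiner N \<Delta> r h \<delta>) * cnj (theta_lattice N \<Delta> k \<tau> z \<delta>)"
      unfolding infsum_cmult_right' infsum_cnj theta_lattice_def ..
    finally show "infsum g \<delta> = c * (intertwiner N \<Delta> r h \<delta> * cnj (theta_lattice N \<Delta> k \<tau> z \<delta>))" by (simp only: mult.assoc)
  qed
  also have "\<dots> = c * (\<Sum>\<delta>\<in>discriminant_group N \<Delta>. intertwiner N \<Delta> r h \<delta> * cnj (theta_lattice N \<Delta> k \<tau> z \<delta>))"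
    by (rule sum_distrib_left[symmetric])
  also have "(\<Sum>\<delta>\<in>discriminant_group N \<Delta>. intertwiner N \<Delta> r h \<delta> * cnj (theta_lattice N \<Delta> k \<tau> z \<delta>)) = cnj (theta_twisted N \<Delta> r k \<tau> z h)"
    unfolding theta_twisted_def group_ring_inner_def cnj_sum complex_cnj_mult complex_cnj_cnj
    by (rule sum.cong[OF refl]) (simp add: intertwiner_def Let_def)
  finally show ?thesis by (simp add: g_def)
qed

lemma phi_kern:
  assumes z: "Im z > 0" and \<Delta>: "\<Delta> \<noteq> 0"
  shows "G z * of_real (Im z) ^ (2 * k + 2) * cnj (phi_Sh_twisted N \<Delta> k X \<tau> z) =
     of_real (sqrt (Im \<tau>) * (1 / sqrt (real_of_int \<bar>\<Delta>\<bar>)) ^ (k + 2)) *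
     exp (- (2 * of_real pi * \<i> * of_real (qform N X / real_of_int \<bar>\<Delta>\<bar>) * \<tau>)) *
     kern N k (pi * Im \<tau> / real_of_int \<bar>\<Delta>\<bar>) G X z"
proof -
  define a where "a = 1 / sqrt (real_of_int \<bar>\<Delta>\<bar>)"
  have a2: "a\<^sup>2 = 1 / real_of_int \<bar>\<Delta>\<bar>" by (simp add: a_def power_divide)
  define X' where "X' = a *\<^sub>R X"
  define q where "q = a\<^sup>2 * qform N X"
  define y where "y = complex_of_real (Im z) ^ (2 * k + 2)"
  have y: "y \<noteq> 0" using z by (simp add: y_def)
  have Q: "cnj (Qpoly N X' (cnj z)) = of_real a * Qpoly N X z"
    by (simp add: Qpoly_def X'_def algebra_simps)
  have p: "pfun N z X' = a * pfun N z X" by (simp add: pfun_def X'_def algebra_simps)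
  have q': "qform N X' = q" by (simp add: q_def qform_def X'_def det_2 power2_eq_square algebra_simps)
  have b: "bform N X' X' = 2 * q"
    unfolding bform_def q'[symmetric] by (simp add: qform_def det_2 algebra_simps)
  define R where "R = a\<^sup>2 * (pfun N z X)\<^sup>2 / 2 - 2 * q"
  have R: "Rfun N X' z = R" unfolding Rfun_def p b R_def by (simp add: power_mult_distrib)
  have e: "of_real (exp (- 2 * pi * Im \<tau> * R)) * exp (cnj (2 * of_real pi * \<i> * of_real q * \<tau>)) =
      complex_of_real (exp (- (pi * Im \<tau> * a\<^sup>2) * (pfun N z X)\<^sup>2)) * exp (- (2 * of_real pi * \<i> * of_real q * \<tau>))"
    unfolding exp_of_real[symmetric] exp_add[symmetric]
    by (rule arg_cong[of _ _ exp]) (simp add: complex_eq_iff R_def algebra_simps)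
  have "cnj (phi_Sh_twisted N \<Delta> k X \<tau> z) = of_real a * (of_real (sqrt (Im \<tau>)) / y * (of_real a * Qpoly N X z) ^ (k + 1) *
      (of_real (exp (- 2 * pi * Im \<tau> * R)) * exp (cnj (2 * of_real pi * \<i> * of_real q * \<tau>))))"
    unfolding phi_Sh_twisted_def a_def[symmetric] X'_def[symmetric] phi_Sh_def R q' y_def Q[symmetric]
    by (simp add: exp_cnj)
  also have "\<dots> = of_real (sqrt (Im \<tau>)) / y * of_real a ^ (k + 2) * Qpoly N X z ^ (k + 1) *
      (complex_of_real (exp (- (pi * Im \<tau> * a\<^sup>2) * (pfun N z X)\<^sup>2)) * exp (- (2 * of_real pi * \<i> * of_real q * \<tau>)))"
    unfolding e power_mult_distrib by (simp add: mult_ac)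
  finally have *: "cnj (phi_Sh_twisted N \<Delta> k X \<tau> z) = of_real (sqrt (Im \<tau>)) / y * of_real a ^ (k + 2) * Qpoly N X z ^ (k + 1) *
      (complex_of_real (exp (- (pi * Im \<tau> * a\<^sup>2) * (pfun N z X)\<^sup>2)) * exp (- (2 * of_real pi * \<i> * of_real q * \<tau>)))" .
  have k1: "pi * Im \<tau> / real_of_int \<bar>\<Delta>\<bar> = pi * Im \<tau> * a\<^sup>2" "qform N X / real_of_int \<bar>\<Delta>\<bar> = q" by (simp_all add: a2 q_def)
  show ?thesis
    unfolding * k1 kern_def a_def[symmetric] y_def[symmetric] using y z by (simp add: hcut_def mult_ac)
qed

subsection \<open>The lift as a sum over the dual lattice\<close>

lemma phi_Sh_twisted_measurable: "(\<lambda>z. phi_Sh_twisted N \<Delta> k X \<tau> z) \<in> borel_measurable borel"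
proof -
  have [measurable]: "cnj \<in> borel_measurable borel" by (intro borel_measurable_continuous_onI continuous_intros)
  show ?thesis unfolding phi_Sh_twisted_def phi_Sh_def Rfun_def by measurable
qed

lemma theta_twisted_measurable:
  assumes N: "N > 0"
  shows "(\<lambda>z. theta_twisted N \<Delta> r k \<tau> z h) \<in> borel_measurable borel"
proof -
  have [measurable]: "cnj \<in> borel_measurable borel" by (intro borel_measurable_continuous_onI continuous_intros)
  have "(\<lambda>z. theta_lattice N \<Delta> k \<tau> z \<delta>) \<in> borel_measurable borel" if \<delta>: "\<delta> \<in> discriminant_group N \<Delta>" for \<delta>
  proof -
    obtain X where X: "X \<in> dual_lattice N" "\<delta> = delta_coset N \<Delta> X" using \<delta> unfolding discriminant_group_coset by blast
    have "countable \<delta>" unfolding X(2) by (rule countable_subset[OF delta_coset_dual[OF N X(1)] countable_dual_lattice[OF N]])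
    then show ?thesis unfolding theta_lattice_def by (rule borel_measurable_infsum) (rule phi_Sh_twisted_measurable)
  qed
  note [measurable] = this
  show ?thesis unfolding theta_twisted_def group_ring_inner_def by measurable
qed

definition exq :: "nat \<Rightarrow> int \<Rightarrow> complex \<Rightarrow> real^2^2 \<Rightarrow> complex" where
  "exq N \<Delta> \<tau> X = exp (- (2 * of_real pi * \<i> * of_real (qform N X / real_of_int \<bar>\<Delta>\<bar>) * \<tau>))"

lemma norm_exq: "norm (exq N \<Delta> \<tau> X) = exp (2 * (pi * Im \<tau> / real_of_int \<bar>\<Delta>\<bar>) * qform N X)"
  by (simp add: exq_def norm_exp_eq_Re)

lemma Shintani_lift_hmeas:
  assumes N: "N > 0" and G: "G \<in> cusp_forms (2 * k + 2) N" and fd: "fundamental_domain N F"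
  shows "Shintani_lift N \<Delta> r k F G \<tau> h =
     (LINT z:F|hmeas. hcut G z * of_real (Im z) ^ (2 * k + 2) * cnj (theta_twisted N \<Delta> r k \<tau> z h))"
    and "(\<lambda>z. indicator F z *\<^sub>R (hcut G z * of_real (Im z) ^ (2 * k + 2) * cnj (theta_twisted N \<Delta> r k \<tau> z h))) \<in> borel_measurable borel"
proof -
  have [measurable]: "cnj \<in> borel_measurable borel" by (intro borel_measurable_continuous_onI continuous_intros)
  have [measurable]: "hcut G \<in> borel_measurable borel" by (rule hcut_measurable[OF cusp_form_holo[OF G]])
  have [measurable]: "F \<in> sets borel" and Fu: "F \<subseteq> upper_half_plane" using fd by (simp_all add: fundamental_domain_def)
  note theta_twisted_measurable[OF N, measurable]
  define U where "U z = indicator F z *\<^sub>R (hcut G z * of_real (Im z) ^ (2 * k + 2) * cnj (theta_twisted N \<Delta> r k \<tau> z h))" for z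
  have Um [measurable]: "U \<in> borel_measurable borel" unfolding U_def by measurable
  then show "(\<lambda>z. indicator F z *\<^sub>R (hcut G z * of_real (Im z) ^ (2 * k + 2) * cnj (theta_twisted N \<Delta> r k \<tau> z h))) \<in> borel_measurable borel"
    unfolding U_def .
  have "(LINT z|hmeas. U z) = (LINT z|lborel. (indicator upper_half_plane z / (Im z)\<^sup>2) *\<^sub>R U z)"
    unfolding hmeas_def by (rule integral_density) auto
  also have "\<dots> = Shintani_lift N \<Delta> r k F G \<tau> h"
    unfolding Shintani_lift_def set_lebesgue_integral_def
  proof (rule Bochner_Integration.integral_cong[OF refl])
    fix z
    show "(indicator upper_half_plane z / (Im z)\<^sup>2) *\<^sub>R U z =
      indicator F z *\<^sub>R (G z * cnj (theta_twisted N \<Delta> r k \<tau> z h) * of_real (Im z) ^ (2 * k + 2) * of_real (1 / (Im z)\<^sup>2))"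
    proof (cases "z \<in> F")
      case True
      then have "z \<in> upper_half_plane" using Fu by blast
      then have "indicator upper_half_plane z = (1 :: real)" "hcut G z = G z" by (simp_all add: hcut_def upper_half_plane_def)
      then show ?thesis using True by (simp only: U_def indicator_simps scaleR_one scaleR_conv_of_real mult_ac)
    qed (simp add: U_def)
  qed
  finally show "Shintani_lift N \<Delta> r k F G \<tau> h =
     (LINT z:F|hmeas. hcut G z * of_real (Im z) ^ (2 * k + 2) * cnj (theta_twisted N \<Delta> r k \<tau> z h))"
    by (simp add: U_def set_lebesgue_integral_def)
qed

lemma Shintani_lift_sum:
  fixes N k :: nat and \<Delta> r :: int and \<tau> :: complex
  defines "\<kappa> \<equiv> pi * Im \<tau> / real_of_int \<bar>\<Delta>\<bar>"
    and "C1 \<equiv> sqrt (Im \<tau>) * (1 / sqrt (real_of_int \<bar>\<Delta>\<bar>)) ^ (k + 2)"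
  assumes N: "N > 0" and D: "fundamental_discriminant \<Delta>" and r: "[\<Delta> = r\<^sup>2] (mod (4 * int N))"
    and G: "G \<in> cusp_forms (2 * k + 2) N" and \<tau>: "Im \<tau> > 0" and fd: "fundamental_domain N F"
  shows "((\<lambda>X. of_int (twist_coeff N \<Delta> r h X) * of_real C1 * exq N \<Delta> \<tau> X * (LINT z:F|hmeas. kern N k \<kappa> G X z))
     has_sum Shintani_lift N \<Delta> r k F G \<tau> h) (dual_lattice N)"
proof -
  have D0: "\<Delta> \<noteq> 0" by (rule fundamental_discriminant_nz[OF D])
  have \<kappa>: "\<kappa> > 0" unfolding \<kappa>_def using \<tau> D0 by (intro divide_pos_pos mult_pos_pos) simp_all
  have [measurable]: "F \<in> sets borel" and Fu: "F \<subseteq> upper_half_plane" using fd by (simp_all add: fundamental_domain_def)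
  define b where "b X = of_int (twist_coeff N \<Delta> r h X) * of_real C1 * exq N \<Delta> \<tau> X" for X
  define f where "f X z = indicator F z *\<^sub>R (b X * kern N k \<kappa> G X z)" for X z
  note km [measurable] = kern_measurable[OF cusp_form_holo[OF G]]
  have fm: "f X \<in> borel_measurable hmeas" for X unfolding f_def by measurable
  have C1: "C1 \<ge> 0" using \<tau> by (simp add: C1_def)
  have nb: "norm (f X z) \<le> C1 * (pmaj N k \<kappa> (hcut G) X z * indicator F z)" for X z
  proof -
    have "\<bar>twist_coeff N \<Delta> r h X\<bar> \<le> 1" by (simp add: twist_coeff_def genus_character_bound)
    then have "real_of_int \<bar>twist_coeff N \<Delta> r h X\<bar> \<le> 1" by (simp only: of_int_le_1_iff)
    then have t: "norm (of_int (twist_coeff N \<Delta> r h X) :: complex) \<le> 1" by simp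
    have "norm (exq N \<Delta> \<tau> X) * norm (kern N k \<kappa> G X z) = pmaj N k \<kappa> (hcut G) X z"
      unfolding norm_exq norm_kern \<kappa>_def[symmetric] by (simp add: mult.assoc flip: exp_add)
    then have "norm (f X z) = norm (of_int (twist_coeff N \<Delta> r h X) :: complex) * (C1 * (pmaj N k \<kappa> (hcut G) X z * indicator F z))"
      using C1 by (simp add: f_def b_def norm_mult indicator_def mult.assoc)
    also have "\<dots> \<le> 1 * (C1 * (pmaj N k \<kappa> (hcut G) X z * indicator F z))"
      using C1 by (intro mult_right_mono t mult_nonneg_nonneg) (auto simp: pmaj_def)
    finally show ?thesis by simp
  qed
  have fin: "(\<integral>\<^sup>+X. \<integral>\<^sup>+z. ennreal (norm (f X z)) \<partial>hmeas \<partial>count_space (dual_lattice N)) < \<infinity>"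
  proof -
    have [measurable]: "(\<lambda>z. pmaj N k \<kappa> (hcut G) Y z) \<in> borel_measurable borel" for Y
      by (rule pmaj_measurable[OF cusp_form_holo[OF G]])
    have "(\<integral>\<^sup>+X. \<integral>\<^sup>+z. ennreal (norm (f X z)) \<partial>hmeas \<partial>count_space (dual_lattice N)) \<le>
      (\<integral>\<^sup>+X. \<integral>\<^sup>+z. ennreal C1 * (ennreal (pmaj N k \<kappa> (hcut G) X z) * indicator F z) \<partial>hmeas \<partial>count_space (dual_lattice N))"
    proof (intro nn_integral_mono)
      fix X z
      have "ennreal (norm (f X z)) \<le> ennreal (C1 * (pmaj N k \<kappa> (hcut G) X z * indicator F z))" by (rule ennreal_leI[OF nb])
      also have "\<dots> = ennreal C1 * (ennreal (pmaj N k \<kappa> (hcut G) X z) * indicator F z)"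
        using C1 by (simp add: ennreal_mult' indicator_def)
      finally show "ennreal (norm (f X z)) \<le> ennreal C1 * (ennreal (pmaj N k \<kappa> (hcut G) X z) * indicator F z)" .
    qed
    also have "\<dots> = (\<integral>\<^sup>+X. ennreal C1 * (\<integral>\<^sup>+z. ennreal (pmaj N k \<kappa> (hcut G) X z) * indicator F z \<partial>hmeas) \<partial>count_space (dual_lattice N))"
      by (intro nn_integral_cong nn_integral_cmult) measurable
    also have "\<dots> = ennreal C1 * (\<integral>\<^sup>+X. \<integral>\<^sup>+z. ennreal (pmaj N k \<kappa> (hcut G) X z) * indicator F z \<partial>hmeas \<partial>count_space (dual_lattice N))"
      by (rule nn_integral_cmult) simp
    also have "\<dots> < \<infinity>" using absolute_convergence[OF N \<kappa> G fd] by (simp add: ennreal_mult_less_top)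
    finally show ?thesis .
  qed
  note cd = countable_dual_lattice[OF N]
  note AEs = AE_abs_summable[OF sigma_finite_hmeas cd fm fin]
    and ii = integrable_infsum[OF sigma_finite_hmeas cd fm fin]
    and hs = has_sum_integral[OF sigma_finite_hmeas cd fm fin]
  have "Shintani_lift N \<Delta> r k F G \<tau> h = (LINT z|hmeas. (\<Sum>\<^sub>\<infinity>X\<in>dual_lattice N. f X z))"
    unfolding Shintani_lift_hmeas(1)[OF N G fd] set_lebesgue_integral_def
  proof (rule integral_cong_AE)
    show "(\<lambda>z. indicator F z *\<^sub>R (hcut G z * of_real (Im z) ^ (2 * k + 2) * cnj (theta_twisted N \<Delta> r k \<tau> z h))) \<in> borel_measurable hmeas"
      using Shintani_lift_hmeas(2)[OF N G fd] by simp
    show "(\<lambda>z. \<Sum>\<^sub>\<infinity>X\<in>dual_lattice N. f X z) \<in> borel_measurable hmeas" by (rule borel_measurable_integrable[OF ii])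
    show "AE z in hmeas. indicator F z *\<^sub>R (hcut G z * of_real (Im z) ^ (2 * k + 2) * cnj (theta_twisted N \<Delta> r k \<tau> z h)) =
       (\<Sum>\<^sub>\<infinity>X\<in>dual_lattice N. f X z)"
      using AEs
    proof eventually_elim
      case (elim z)
      show ?case
      proof (cases "z \<in> F")
        case True
        then have z: "Im z > 0" using Fu by (auto simp: upper_half_plane_def)
        define c where "c = G z * of_real (Im z) ^ (2 * k + 2)"
        have e: "f X z = c * (of_int (twist_coeff N \<Delta> r h X) * cnj (phi_Sh_twisted N \<Delta> k X \<tau> z))" for X
        proof -
          have pk: "c * cnj (phi_Sh_twisted N \<Delta> k X \<tau> z) = of_real C1 * exq N \<Delta> \<tau> X * kern N k \<kappa> G X z"
            unfolding c_def phi_kern[OF z D0] C1_def exq_def \<kappa>_def ..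
          have "f X z = of_int (twist_coeff N \<Delta> r h X) * (of_real C1 * exq N \<Delta> \<tau> X * kern N k \<kappa> G X z)"
            using True by (simp add: f_def b_def mult.assoc)
          also have "\<dots> = of_int (twist_coeff N \<Delta> r h X) * (c * cnj (phi_Sh_twisted N \<Delta> k X \<tau> z))" unfolding pk ..
          finally show ?thesis by (simp only: mult_ac)
        qed
        have "(\<lambda>X. f X z) summable_on dual_lattice N" using elim by (rule abs_summable_summable)
        then have s: "(\<lambda>X. c * (of_int (twist_coeff N \<Delta> r h X) * cnj (phi_Sh_twisted N \<Delta> k X \<tau> z))) summable_on dual_lattice N"
          unfolding e .
        show ?thesis unfolding e theta_twisted_sum[OF N D r s, symmetric] using True z by (simp add: hcut_def c_def)
      qed (simp add: f_def)
    qed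
  qed
  moreover have "(LINT z|hmeas. f X z) = b X * (LINT z:F|hmeas. kern N k \<kappa> G X z)" for X
  proof -
    have eq: "f X z = b X * (indicator F z *\<^sub>R kern N k \<kappa> G X z)" for z by (simp add: f_def)
    show ?thesis unfolding eq set_lebesgue_integral_def by (rule integral_mult_right_zero)
  qed
  ultimately show ?thesis using hs by (simp add: b_def)
qed

subsection \<open>Sorting by norm and by orbits\<close>

lemma conj_act_lattice:
  assumes N: "N > 0" and A: "A \<in> Gamma0 N" and X: "X \<in> dual_lattice N"
  shows "conj_act A X - X \<in> lattice N"
proof -
  obtain p q s v :: int where A': "A = mat2 (of_int p) (of_int q) (of_int s) (of_int v)" "p * v - q * s = 1" "int N dvd s"
    using A by (auto elim: Gamma0E)
  obtain t where t: "s = int N * t" using A'(3) by blast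
  obtain a b c where Xd: "X = dvec N a b c" using X unfolding dual_lattice_dvec[OF N] by blast
  have pv: "p * v = 1 + q * (int N * t)" using A'(2) t by simp
  define B where "B = q * t * b + p * t * a + q * v * c"
  have "(p * v + int N * q * t) * b + 2 * int N * p * t * a + 2 * int N * q * v * c = b + 2 * int N * B"
    unfolding pv B_def by (simp add: algebra_simps)
  then have "conj_act A X = dvec N (p\<^sup>2 * a + p * q * b + int N * q\<^sup>2 * c) (b + 2 * int N * B) (int N * t\<^sup>2 * a + t * v * b + v\<^sup>2 * c)"
    using dvec_conj[OF N, of A p q t v a b c] A' t unfolding Xd by simp
  then have "conj_act A X - X = dvec N (p\<^sup>2 * a + p * q * b + int N * q\<^sup>2 * c - a) (2 * int N * B) (int N * t\<^sup>2 * a + t * v * b + v\<^sup>2 * c - c)"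
    unfolding Xd using N by (simp add: dvec_def mat2_eq_iff diff_divide_distrib add_divide_distrib)
  then show ?thesis unfolding lattice_dvec[OF N] by blast
qed

lemma twist_coeff_conj:
  assumes N: "N > 0" and A: "A \<in> Gamma0 N" and X: "X \<in> dual_lattice N"
  shows "twist_coeff N \<Delta> r h (conj_act A X) = twist_coeff N \<Delta> r h X"
    and "conj_act A X - real_of_int r *\<^sub>R h \<in> lattice N \<longleftrightarrow> X - real_of_int r *\<^sub>R h \<in> lattice N"
proof -
  note L = conj_act_lattice[OF N A X]
  have "conj_act A X - real_of_int r *\<^sub>R h = (X - real_of_int r *\<^sub>R h) + (conj_act A X - X)" by simp
  then show *: "conj_act A X - real_of_int r *\<^sub>R h \<in> lattice N \<longleftrightarrow> X - real_of_int r *\<^sub>R h \<in> lattice N"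
    using lattice_add[OF _ L, of "X - real_of_int r *\<^sub>R h"] lattice_diff[OF _ L, of "conj_act A X - real_of_int r *\<^sub>R h"] by auto
  show "twist_coeff N \<Delta> r h (conj_act A X) = twist_coeff N \<Delta> r h X"
    unfolding twist_coeff_def * qform_conj[OF Gamma0_SL2[OF A]] genus_character_conj(1)[OF N A X] ..
qed

lemma orbit0_self: "X \<in> orbit0 N X"
  unfolding orbit0_def using Gamma0_one[of N] by (intro image_eqI[of _ _ "mat 1"]) simp_all

lemma orbit0_eq:
  assumes "Y \<in> orbit0 N X"
  shows "orbit0 N Y = orbit0 N X"
proof -
  obtain A where A: "A \<in> Gamma0 N" "Y = conj_act A X" using assms by (auto simp: orbit0_def)
  note AS = Gamma0_SL2[OF A(1)]
  show ?thesis
  proof (intro equalityI subsetI)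
    fix W assume "W \<in> orbit0 N Y"
    then obtain B where B: "B \<in> Gamma0 N" "W = conj_act B Y" by (auto simp: orbit0_def)
    have "W = conj_act (B ** A) X" unfolding B A conj_act_mult[OF Gamma0_SL2[OF B(1)] AS] ..
    then show "W \<in> orbit0 N X" unfolding orbit0_def using Gamma0_mult[OF B(1) A(1)] by blast
  next
    fix W assume "W \<in> orbit0 N X"
    then obtain B where B: "B \<in> Gamma0 N" "W = conj_act B X" by (auto simp: orbit0_def)
    have "X = conj_act (matrix_inv A) Y" unfolding A(2) conj_act_inv[OF AS] ..
    then have "W = conj_act (B ** matrix_inv A) Y" unfolding B conj_act_mult[OF Gamma0_SL2[OF B(1)] SL2_inv[OF AS]] by simp
    then show "W \<in> orbit0 N Y" unfolding orbit0_def using Gamma0_mult[OF B(1) Gamma0_inv[OF A(1)]] by blast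
  qed
qed

definition norm_set :: "nat \<Rightarrow> int \<Rightarrow> int \<Rightarrow> real^2^2 \<Rightarrow> real \<Rightarrow> (real^2^2) set" where
  "norm_set N \<Delta> r h m = {X \<in> dual_lattice N. X - real_of_int r *\<^sub>R h \<in> lattice N \<and> qform N X = - real_of_int \<bar>\<Delta>\<bar> * m}"

lemma norm_set_orbit:
  assumes N: "N > 0" and X: "X \<in> norm_set N \<Delta> r h m"
  shows "{Y \<in> norm_set N \<Delta> r h m. orbit0 N Y = orbit0 N X} = orbit0 N X"
proof -
  have "orbit0 N X \<subseteq> norm_set N \<Delta> r h m"
  proof
    fix Y assume Y: "Y \<in> orbit0 N X"
    then obtain A where A: "A \<in> Gamma0 N" "Y = conj_act A X" by (auto simp: orbit0_def)
    have Xd: "X \<in> dual_lattice N" using X by (simp add: norm_set_def)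
    show "Y \<in> norm_set N \<Delta> r h m"
      using X genus_character_conj(2)[OF N A(1) Xd] twist_coeff_conj(2)[OF N A(1) Xd, of r h] orbit0_qform[OF Y]
      unfolding norm_set_def A(2) by simp
  qed
  then show ?thesis using orbit0_eq[of _ N X] orbit0_self[of _ N] by blast
qed

lemma norm_set_lattice:
  assumes N: "N > 0" and h: "h \<in> dual_lattice N"
  shows "lattice_norm_set N (real_of_int \<bar>\<Delta>\<bar> * - m) (real_of_int r *\<^sub>R h) = norm_set N \<Delta> r h m"
proof (intro equalityI subsetI)
  fix X assume "X \<in> lattice_norm_set N (real_of_int \<bar>\<Delta>\<bar> * - m) (real_of_int r *\<^sub>R h)"
  then obtain Z where Z: "Z \<in> lattice N" "X = real_of_int r *\<^sub>R h + Z" and q: "qform N X = real_of_int \<bar>\<Delta>\<bar> * - m"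
    by (auto simp: lattice_norm_set_def)
  obtain a b c where hd: "h = dvec N a b c" using h unfolding dual_lattice_dvec[OF N] by blast
  obtain u v w where Zd: "Z = dvec N u (2 * int N * v) w" using Z(1) unfolding lattice_dvec[OF N] by blast
  have "X = dvec N (r * a + u) (r * b + 2 * int N * v) (r * c + w)"
    unfolding Z(2) hd Zd using N by (simp add: dvec_def mat2_eq_iff add_divide_distrib diff_divide_distrib)
  then have "X \<in> dual_lattice N" unfolding dual_lattice_dvec[OF N] by blast
  then show "X \<in> norm_set N \<Delta> r h m" using Z q by (simp add: norm_set_def)
next
  fix X assume "X \<in> norm_set N \<Delta> r h m"
  then have "X - real_of_int r *\<^sub>R h \<in> lattice N" "qform N X = - real_of_int \<bar>\<Delta>\<bar> * m" by (simp_all add: norm_set_def)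
  then show "X \<in> lattice_norm_set N (real_of_int \<bar>\<Delta>\<bar> * - m) (real_of_int r *\<^sub>R h)"
    unfolding lattice_norm_set_def by (auto intro!: image_eqI[of _ _ "X - real_of_int r *\<^sub>R h"])
qed

theorem theorem6p5:
  fixes N k :: nat and \<Delta> r :: int and G :: "complex \<Rightarrow> complex"
    and h :: "real^2^2" and \<tau> :: complex and F :: "complex set"
  assumes "N > 0"
    and "fundamental_discriminant \<Delta>"
    and "[\<Delta> = r^2] (mod (4 * int N))"
    and "G \<in> cusp_forms (2 * k + 2) N"
    and "h \<in> dual_lattice N"
    and "\<tau> \<in> upper_half_plane"
    and "fundamental_domain N F"
  shows "\<exists>S. ((\<lambda>m. of_real (1 / real_of_int \<bar>\<Delta>\<bar> powr (real k / 2)) *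
                    twisted_trace N \<Delta> r k G (- m) h *
                    exp (2 * of_real pi * \<i> * of_real m * \<tau>)) has_sum S)
               {m. m > 0 \<and> - m - real_of_int (sgn \<Delta>) * qform N h \<in> \<int>} \<and>
             Shintani_lift N \<Delta> r k F G \<tau> h =
               - of_real (sqrt (real N) / sqrt (real_of_int \<bar>\<Delta>\<bar>)) * S"
proof -
  note N = assms(1) and D = assms(2) and r = assms(3) and G = assms(4) and h = assms(5) and fd = assms(7)
  have v: "Im \<tau> > 0" using assms(6) by (simp add: upper_half_plane_def)
  define d where "d = real_of_int \<bar>\<Delta>\<bar>"
  have d: "d > 0" using fundamental_discriminant_nz[OF D] by (simp add: d_def)
  define \<kappa> where "\<kappa> = pi * Im \<tau> / d"
  have \<kappa>: "\<kappa> > 0" unfolding \<kappa>_def using v d by (intro divide_pos_pos mult_pos_pos) simp_all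
  define C1 where "C1 = sqrt (Im \<tau>) * (1 / sqrt d) ^ (k + 2)"
  define I where "I X = (LINT z:F|hmeas. kern N k \<kappa> G X z)" for X
  define K where "K X = of_int (twist_coeff N \<Delta> r h X) * of_real C1 * exq N \<Delta> \<tau> X" for X
  define g where "g X = K X * I X" for X
  define Sh where "Sh = Shintani_lift N \<Delta> r k F G \<tau> h"
  have hs: "(g has_sum Sh) (dual_lattice N)"
    using Shintani_lift_sum[OF N D r G v fd, of h] unfolding g_def K_def I_def Sh_def \<kappa>_def C1_def d_def .
  define Xs where "Xs = {X \<in> dual_lattice N. X - real_of_int r *\<^sub>R h \<in> lattice N \<and> qform N X / d - real_of_int (sgn \<Delta>) * qform N h \<in> \<int>}"
  define P where "P X = - qform N X / d" for X
  have hs': "(g has_sum Sh) Xs"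
  proof (rule has_sum_cong_neutral[THEN iffD1, OF _ _ _ hs])
    show "g X = 0" if X: "X \<in> dual_lattice N - Xs" for X
      using X by (auto simp: g_def K_def twist_coeff_def Xs_def d_def)
  qed (auto simp: Xs_def)
  define T where "T m = infsum g {X \<in> Xs. P X = m}" for m
  have sub: "g summable_on A" if A: "A \<subseteq> Xs" for A
    by (rule summable_on_subset_banach[OF has_sum_imp_summable[OF hs'] A])
  have hT: "(T has_sum Sh) (P ` Xs)"
  proof (rule has_sum_fibres[OF hs' refl])
    fix m
    show "(g has_sum T m) {X \<in> Xs. P X = m}" unfolding T_def by (rule has_sum_infsum[OF sub]) blast
  qed
  have qP: "qform N X = - d * P X" for X using d by (simp add: P_def)
  have int: "- m - real_of_int (sgn \<Delta>) * qform N h \<in> \<int>" if m: "m \<in> P ` Xs" for m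
    using m by (auto simp: Xs_def P_def)
  have fib: "{X \<in> Xs. P X = m} = norm_set N \<Delta> r h m" if m: "- m - real_of_int (sgn \<Delta>) * qform N h \<in> \<int>" for m
  proof -
    have "P X = m \<longleftrightarrow> qform N X = - d * m" for X using d qP[of X] by auto
    moreover have "qform N X / d = - m" if "qform N X = - d * m" for X using that d by simp
    ultimately show ?thesis unfolding Xs_def norm_set_def d_def[symmetric] using m by auto
  qed
  have orb: "(g has_sum (K X * c)) (orbit0 N X)" if X: "X \<in> dual_lattice N" and c: "(I has_sum c) (orbit0 N X)" for X c
  proof -
    have "g Y = K X * I Y" if Y: "Y \<in> orbit0 N X" for Y
    proof -
      obtain A where A: "A \<in> Gamma0 N" "Y = conj_act A X" using Y by (auto simp: orbit0_def)
      have "K Y = K X"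
        unfolding K_def exq_def orbit0_qform[OF Y] unfolding A(2) twist_coeff_conj(1)[OF N A(1) X] ..
      then show ?thesis by (simp add: g_def)
    qed
    then show ?thesis using has_sum_cmult_right[OF c, of "K X"] by (simp cong: has_sum_cong)
  qed
  have fib_sum: "(H has_sum T m) (orbit0 N ` norm_set N \<Delta> r h m)"
    if m: "- m - real_of_int (sgn \<Delta>) * qform N h \<in> \<int>"
    and H: "\<And>X. X \<in> norm_set N \<Delta> r h m \<Longrightarrow> (g has_sum H (orbit0 N X)) (orbit0 N X)" for H m
  proof (rule has_sum_fibres[OF _ refl])
    have "norm_set N \<Delta> r h m \<subseteq> Xs" unfolding fib[OF m, symmetric] by blast
    then show "(g has_sum T m) (norm_set N \<Delta> r h m)" unfolding T_def fib[OF m] by (rule has_sum_infsum[OF sub])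
    fix C assume "C \<in> orbit0 N ` norm_set N \<Delta> r h m"
    then obtain X where X: "X \<in> norm_set N \<Delta> r h m" "C = orbit0 N X" by blast
    show "(g has_sum H C) {Y \<in> norm_set N \<Delta> r h m. orbit0 N Y = C}"
      unfolding X(2) norm_set_orbit[OF N X(1)] by (rule H[OF X(1)])
  qed
  have T0: "T m = 0" if m: "- m - real_of_int (sgn \<Delta>) * qform N h \<in> \<int>" and m0: "m \<le> 0" for m
  proof -
    have "((\<lambda>_. 0) has_sum T m) (orbit0 N ` norm_set N \<Delta> r h m)"
    proof (rule fib_sum[OF m])
      fix X assume X: "X \<in> norm_set N \<Delta> r h m"
      then have Xd: "X \<in> dual_lattice N" and q: "qform N X = d * (- m)" by (simp_all add: norm_set_def d_def)
      have "qform N X \<ge> 0" unfolding q using d m0 by (intro mult_nonneg_nonneg) simp_all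
      then consider "qform N X > 0" | "qform N X = 0" by linarith
      then have "(I has_sum 0) (orbit0 N X)"
        unfolding I_def by cases (rule kern_elliptic[OF N \<kappa> G fd Xd], assumption, rule kern_isotropic[OF N \<kappa> G fd Xd], assumption)
      from orb[OF Xd this] show "(g has_sum 0) (orbit0 N X)" by simp
    qed
    from has_sum_unique[OF this has_sum_0] show ?thesis by simp
  qed
  define c0 where "c0 = - complex_of_real (sqrt (real N) / sqrt d)"
  define U where "U m = of_real (1 / d powr (real k / 2)) * twisted_trace N \<Delta> r k G (- m) h * exp (2 * of_real pi * \<i> * of_real m * \<tau>)" for m
  define V where "V C = (let X = (SOME X. X \<in> C) in of_int (genus_character N \<Delta> X) * cycle_integral N k G X)" for C
  have tr: "twisted_trace N \<Delta> r k G (- m) h = infsum V (orbit0 N ` norm_set N \<Delta> r h m)" for m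
    unfolding twisted_trace_def norm_set_lattice[OF N h] V_def[abs_def] orbit0_def[abs_def] ..
  have const: "C1 * sqrt (real N * pi / \<kappa>) = sqrt (real N) / sqrt d * (1 / d powr (real k / 2))"
  proof -
    have "real N * pi / \<kappa> = real N * d / Im \<tau>" using v d by (simp add: \<kappa>_def)
    then have 1: "sqrt (real N * pi / \<kappa>) = sqrt (real N) * sqrt d / sqrt (Im \<tau>)" by (simp add: real_sqrt_mult real_sqrt_divide)
    have "d powr (real k / 2) = (d powr (1 / 2)) powr real k" by (simp add: powr_powr)
    also have "\<dots> = sqrt d ^ k" using d by (simp add: powr_half_sqrt powr_realpow)
    finally have 2: "d powr (real k / 2) = sqrt d ^ k" .
    have s: "sqrt d \<noteq> 0" "sqrt (Im \<tau>) \<noteq> 0" using d v by simp_all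
    have 3: "(1 / sqrt d) ^ (k + 2) = 1 / sqrt d ^ k * (1 / (sqrt d * sqrt d))" by (simp add: power_add power_divide power2_eq_square)
    show ?thesis unfolding C1_def 1 2 3 using s by (simp del: real_sqrt_mult_self)
  qed
  have T1: "T m = c0 * U m" if m: "- m - real_of_int (sgn \<Delta>) * qform N h \<in> \<int>" and m0: "m > 0" for m
  proof -
    define Km where "Km = complex_of_real C1 * exp (2 * of_real pi * \<i> * of_real m * \<tau>) * (- of_real (sqrt (real N * pi / \<kappa>)))"
    have "((\<lambda>C. Km * V C) has_sum T m) (orbit0 N ` norm_set N \<Delta> r h m)"
    proof (rule fib_sum[OF m])
      fix X assume X: "X \<in> norm_set N \<Delta> r h m"
      define Y where "Y = (SOME Y. Y \<in> orbit0 N X)"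
      have YX: "Y \<in> orbit0 N X" unfolding Y_def using orbit0_self by (rule someI)
      have oY: "orbit0 N Y = orbit0 N X" by (rule orbit0_eq[OF YX])
      have Yn: "Y \<in> norm_set N \<Delta> r h m" using norm_set_orbit[OF N X] YX by blast
      have Yd: "Y \<in> dual_lattice N" and YL: "Y - real_of_int r *\<^sub>R h \<in> lattice N" and q: "qform N Y = - d * m"
        using Yn by (simp_all add: norm_set_def d_def)
      have qn: "qform N Y < 0" unfolding q using d m0 by (simp add: mult_pos_pos)
      have qd: "qform N Y / d = - m" unfolding q using d by simp
      have "twist_coeff N \<Delta> r h Y = genus_character N \<Delta> Y"
        unfolding twist_coeff_def d_def[symmetric] qd using YL m by simp
      moreover have "exq N \<Delta> \<tau> Y = exp (2 * of_real pi * \<i> * of_real m * \<tau>)"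
        unfolding exq_def d_def[symmetric] qd by simp
      ultimately have KY: "K Y * (- of_real (sqrt (real N * pi / \<kappa>)) * cycle_integral N k G Y) = Km * V (orbit0 N X)"
        unfolding K_def Km_def V_def Let_def Y_def[symmetric] by (simp add: mult_ac)
      have "(I has_sum (- of_real (sqrt (real N * pi / \<kappa>)) * cycle_integral N k G Y)) (orbit0 N Y)"
        unfolding I_def by (rule kern_hyperbolic[OF N \<kappa> G fd Yd qn])
      from orb[OF Yd this] show "(g has_sum (Km * V (orbit0 N X))) (orbit0 N X)" unfolding KY oY .
    qed
    then have "T m = Km * infsum V (orbit0 N ` norm_set N \<Delta> r h m)"
      unfolding infsum_cmult_right'[symmetric] by (rule infsumI[symmetric])
    also have "Km = - of_real (C1 * sqrt (real N * pi / \<kappa>)) * exp (2 * of_real pi * \<i> * of_real m * \<tau>)"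
      by (simp add: Km_def)
    finally show ?thesis unfolding tr[symmetric] const U_def c0_def by (simp add: mult_ac)
  qed
  have "((\<lambda>m. c0 * U m) has_sum Sh) {m. m > 0 \<and> - m - real_of_int (sgn \<Delta>) * qform N h \<in> \<int>}"
  proof (rule has_sum_cong_neutral[THEN iffD1, OF _ _ _ hT])
    fix m assume m: "m \<in> {m. m > 0 \<and> - m - real_of_int (sgn \<Delta>) * qform N h \<in> \<int>} - P ` Xs"
    then have mi: "- m - real_of_int (sgn \<Delta>) * qform N h \<in> \<int>" and "m \<notin> P ` Xs" by blast+
    then have "{X \<in> Xs. P X = m} = {}" by blast
    then have "norm_set N \<Delta> r h m = {}" unfolding fib[OF mi] .
    then have "twisted_trace N \<Delta> r k G (- m) h = 0" unfolding tr by simp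
    then show "c0 * U m = 0" by (simp add: U_def)
  next
    fix m assume m: "m \<in> P ` Xs - {m. m > 0 \<and> - m - real_of_int (sgn \<Delta>) * qform N h \<in> \<int>}"
    then have "\<not> m > 0" using int[of m] by blast
    then show "T m = 0" using T0[OF int[of m]] m by simp
  next
    fix m assume "m \<in> P ` Xs \<inter> {m. m > 0 \<and> - m - real_of_int (sgn \<Delta>) * qform N h \<in> \<int>}"
    then show "T m = c0 * U m" using T1[of m] by blast
  qed
  moreover have "c0 \<noteq> 0" using N d by (simp add: c0_def)
  ultimately have "(U has_sum (Sh / c0)) {m. m > 0 \<and> - m - real_of_int (sgn \<Delta>) * qform N h \<in> \<int>}" "Sh = c0 * (Sh / c0)"
    by (simp_all add: has_sum_cmult_right_iff)
  then show ?thesis unfolding U_def Sh_def c0_def d_def by blast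
qed

end
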